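(* Let $(A,\mathfrak{m})$ be a Cohen-Macaulay local ring of dimension $d\geq 1$ and let $M,N$ be maximal Cohen-Macaulay $A$-modules. Then the $A$-module $\mathrm{Ext}^1_A(M,N)/T_A(M,N)$ has finite length.
   Context: All rings are commutative Noetherian and all modules are finitely generated; $\ell(-)$ denotes length; MCM means maximal Cohen-Macaulay. For an MCM $A$-module $M$ put $$e^T_A(M)=\lim_{n\to\infty}\frac{(d-1)!}{n^{d-1}}\,\ell\left(\mathrm{Tor}^A_1(M,A/\mathfrak{m}^{n+1})\right),$$ which exists and is finite. For an exact sequence $s\colon 0\to N\to E\to M\to 0$ of MCM $A$-modules put $e^T_A(s)=e^T_A(M)+e^T_A(N)-e^T_A(E)$; this depends only on the class of $s$ in $\mathrm{Ext}^1_A(M,N)$ (elements of $\mathrm{Ext}^1_A(M,N)$ are identified with equivalence classes of extensions of $M$ by $N$). The extension $s$ is called $T$-split if $e^T_A(s)=0$, and $T_A(M,N)\subseteq \mathrm{Ext}^1_A(M,N)$ is the set of all $T$-split extensions; it is an $A$-submodule of $\mathrm{Ext}^1_A(M,N)$. *)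

theory Defs
  imports Complex_Main "HOL-Library.Extended_Nat" "HOL-Algebra.Algebra"
begin

text \<open>
  Modules are those of HOL-Algebra: \<open>Module.module R M\<close>, with submodules \<open>submodule H R M\<close>.
  The record type of modules extends that of rings; the fields \<open>mult\<close> and \<open>one\<close> of a module are
  meaningless and are left \<open>undefined\<close> in the constructions below.
\<close>


section \<open>Modules\<close>

definition mod_hom ::
    "('a, 'r) ring_scheme \<Rightarrow> ('a, 'b, 'm) module_scheme \<Rightarrow> ('a, 'c, 'n) module_scheme \<Rightarrow> ('b \<Rightarrow> 'c) set"
  where "mod_hom R M N =
    {f \<in> carrier M \<rightarrow> carrier N.
       (\<forall>x\<in>carrier M. \<forall>y\<in>carrier M. f (x \<oplus>\<^bsub>M\<^esub> y) = f x \<oplus>\<^bsub>N\<^esub> f y) \<and>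
       (\<forall>a\<in>carrier R. \<forall>x\<in>carrier M. f (a \<odot>\<^bsub>M\<^esub> x) = a \<odot>\<^bsub>N\<^esub> f x)}"

definition self_module :: "('a, 'r) ring_scheme \<Rightarrow> ('a, 'a) module"
  where "self_module R =
    \<lparr>carrier = carrier R, monoid.mult = monoid.mult R, monoid.one = monoid.one R,
     ring.zero = ring.zero R, ring.add = ring.add R, smult = monoid.mult R\<rparr>"

definition gen_submodule :: "('a, 'r) ring_scheme \<Rightarrow> ('a, 'b, 'm) module_scheme \<Rightarrow> 'b set \<Rightarrow> 'b set"
  where "gen_submodule R M S = \<Inter>{H. submodule H R M \<and> S \<subseteq> H}"

definition fin_gen :: "('a, 'r) ring_scheme \<Rightarrow> ('a, 'b, 'm) module_scheme \<Rightarrow> bool"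
  where "fin_gen R M \<longleftrightarrow> (\<exists>S\<subseteq>carrier M. finite S \<and> gen_submodule R M S = carrier M)"

definition quot_module :: "('a, 'b, 'm) module_scheme \<Rightarrow> 'b set \<Rightarrow> ('a, 'b set) module"
  where "quot_module M H =
    \<lparr>carrier = a_rcosets\<^bsub>M\<^esub> H, monoid.mult = undefined, monoid.one = undefined,
     ring.zero = H, ring.add = set_add M,
     smult = (\<lambda>a C. \<Union>x\<in>C. H +>\<^bsub>M\<^esub> (a \<odot>\<^bsub>M\<^esub> x))\<rparr>"

definition prod_module ::
    "('a, 'b, 'm) module_scheme \<Rightarrow> ('a, 'c, 'n) module_scheme \<Rightarrow> ('a, 'b \<times> 'c) module"
  where "prod_module M N =
    \<lparr>carrier = carrier M \<times> carrier N, monoid.mult = undefined, monoid.one = undefined,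
     ring.zero = (\<zero>\<^bsub>M\<^esub>, \<zero>\<^bsub>N\<^esub>),
     ring.add = (\<lambda>(x, y) (x', y'). (x \<oplus>\<^bsub>M\<^esub> x', y \<oplus>\<^bsub>N\<^esub> y')),
     smult = (\<lambda>a (x, y). (a \<odot>\<^bsub>M\<^esub> x, a \<odot>\<^bsub>N\<^esub> y))\<rparr>"

definition fibre_product ::
    "('a, 'b, 'm) module_scheme \<Rightarrow> ('b \<Rightarrow> 'd) \<Rightarrow> ('a, 'c, 'n) module_scheme \<Rightarrow> ('c \<Rightarrow> 'd) \<Rightarrow>
     ('a, 'b \<times> 'c) module"
  where "fibre_product M f N g =
    (prod_module M N)\<lparr>carrier := {(x, y). x \<in> carrier M \<and> y \<in> carrier N \<and> f x = g y}\<rparr>"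

text \<open>Length as the supremum of the lengths of strictly increasing chains of submodules.\<close>

definition mod_length :: "('a, 'r) ring_scheme \<Rightarrow> ('a, 'b, 'm) module_scheme \<Rightarrow> enat"
  where "mod_length R M =
    Sup {enat n | n. \<exists>C :: nat \<Rightarrow> 'b set.
           (\<forall>i\<le>n. submodule (C i) R M) \<and> (\<forall>i<n. C i \<subset> C (Suc i))}"

definition finite_length :: "('a, 'r) ring_scheme \<Rightarrow> ('a, 'b, 'm) module_scheme \<Rightarrow> bool"
  where "finite_length R M \<longleftrightarrow> Module.module R M \<and> mod_length R M < \<infinity>"


section \<open>Cohen-Macaulay rings and modules\<close>

definition local_ring :: "('a, 'r) ring_scheme \<Rightarrow> 'a set \<Rightarrow> bool"
  where "local_ring R \<mm> \<longleftrightarrow>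
    cring R \<and> maximalideal \<mm> R \<and> (\<forall>J. maximalideal J R \<longrightarrow> J = \<mm>)"

definition krull_dim :: "('a, 'r) ring_scheme \<Rightarrow> enat"
  where "krull_dim R =
    Sup {enat n | n. \<exists>P :: nat \<Rightarrow> 'a set.
           (\<forall>i\<le>n. primeideal (P i) R) \<and> (\<forall>i<n. P i \<subset> P (Suc i))}"

definition seq_submodule :: "('a, 'r) ring_scheme \<Rightarrow> ('a, 'b, 'm) module_scheme \<Rightarrow> 'a list \<Rightarrow> 'b set"
  where "seq_submodule R M xs = gen_submodule R M {a \<odot>\<^bsub>M\<^esub> x | a x. a \<in> set xs \<and> x \<in> carrier M}"

definition regular_sequence :: "('a, 'r) ring_scheme \<Rightarrow> ('a, 'b, 'm) module_scheme \<Rightarrow> 'a list \<Rightarrow> bool"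
  where "regular_sequence R M xs \<longleftrightarrow>
    set xs \<subseteq> carrier R \<and>
    (\<forall>i<length xs. \<forall>x\<in>carrier M.
       (xs ! i) \<odot>\<^bsub>M\<^esub> x \<in> seq_submodule R M (take i xs) \<longrightarrow> x \<in> seq_submodule R M (take i xs)) \<and>
    seq_submodule R M xs \<noteq> carrier M"

definition depth :: "('a, 'r) ring_scheme \<Rightarrow> 'a set \<Rightarrow> ('a, 'b, 'm) module_scheme \<Rightarrow> enat"
  where "depth R \<mm> M = Sup {enat (length xs) | xs. set xs \<subseteq> \<mm> \<and> regular_sequence R M xs}"

definition CM_local_ring :: "('a, 'r) ring_scheme \<Rightarrow> 'a set \<Rightarrow> bool"
  where "CM_local_ring R \<mm> \<longleftrightarrow>
    local_ring R \<mm> \<and> noetherian_ring R \<and> depth R \<mm> (self_module R) = krull_dim R"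

definition MCM :: "('a, 'r) ring_scheme \<Rightarrow> 'a set \<Rightarrow> ('a, 'b, 'm) module_scheme \<Rightarrow> bool"
  where "MCM R \<mm> M \<longleftrightarrow>
    Module.module R M \<and> fin_gen R M \<and> carrier M \<noteq> {\<zero>\<^bsub>M\<^esub>} \<and> depth R \<mm> M = krull_dim R"


section \<open>Tensor products and \<open>Tor\<^sub>1\<close>\<close>

text \<open>The free module with basis \<open>B\<close> consists of the finitely supported functions on \<open>B\<close>,
  extended by zero.\<close>

definition free_module :: "('a, 'r) ring_scheme \<Rightarrow> 'x set \<Rightarrow> ('a, 'x \<Rightarrow> 'a) module"
  where "free_module R B =
    \<lparr>carrier = {f. finite {x. f x \<noteq> \<zero>\<^bsub>R\<^esub>} \<and>
       (\<forall>x\<in>B. f x \<in> carrier R) \<and> (\<forall>x. x \<notin> B \<longrightarrow> f x = \<zero>\<^bsub>R\<^esub>)},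
     monoid.mult = undefined, monoid.one = undefined,
     ring.zero = (\<lambda>_. \<zero>\<^bsub>R\<^esub>), ring.add = (\<lambda>f g x. f x \<oplus>\<^bsub>R\<^esub> g x), smult = (\<lambda>a f x. a \<otimes>\<^bsub>R\<^esub> f x)\<rparr>"

definition basis_elt :: "('a, 'r) ring_scheme \<Rightarrow> 'x \<Rightarrow> 'x \<Rightarrow> 'a"
  where "basis_elt R x = (\<lambda>y. if y = x then \<one>\<^bsub>R\<^esub> else \<zero>\<^bsub>R\<^esub>)"

text \<open>The linear map from a free module to \<open>N\<close> given by \<open>\<phi>\<close> on the basis.\<close>

definition free_lift ::
    "('a, 'r) ring_scheme \<Rightarrow> ('a, 'b, 'm) module_scheme \<Rightarrow> ('x \<Rightarrow> 'b) \<Rightarrow> ('x \<Rightarrow> 'a) \<Rightarrow> 'b"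
  where "free_lift R N \<phi> f = (\<Oplus>\<^bsub>N\<^esub>x\<in>{x. f x \<noteq> \<zero>\<^bsub>R\<^esub>}. f x \<odot>\<^bsub>N\<^esub> \<phi> x)"

definition tensor_relations ::
    "('a, 'r) ring_scheme \<Rightarrow> ('a, 'b, 'm) module_scheme \<Rightarrow> ('a, 'c, 'n) module_scheme \<Rightarrow>
     ('b \<times> 'c \<Rightarrow> 'a) set"
  where "tensor_relations R M L =
    (let F = free_module R (carrier M \<times> carrier L); \<delta> = basis_elt R in
     gen_submodule R F
      ({\<delta> (x \<oplus>\<^bsub>M\<^esub> x', y) \<ominus>\<^bsub>F\<^esub> (\<delta> (x, y) \<oplus>\<^bsub>F\<^esub> \<delta> (x', y)) | x x' y.
          x \<in> carrier M \<and> x' \<in> carrier M \<and> y \<in> carrier L} \<union>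
       {\<delta> (x, y \<oplus>\<^bsub>L\<^esub> y') \<ominus>\<^bsub>F\<^esub> (\<delta> (x, y) \<oplus>\<^bsub>F\<^esub> \<delta> (x, y')) | x y y'.
          x \<in> carrier M \<and> y \<in> carrier L \<and> y' \<in> carrier L} \<union>
       {\<delta> (a \<odot>\<^bsub>M\<^esub> x, y) \<ominus>\<^bsub>F\<^esub> (a \<odot>\<^bsub>F\<^esub> \<delta> (x, y)) | a x y.
          a \<in> carrier R \<and> x \<in> carrier M \<and> y \<in> carrier L} \<union>
       {\<delta> (x, a \<odot>\<^bsub>L\<^esub> y) \<ominus>\<^bsub>F\<^esub> (a \<odot>\<^bsub>F\<^esub> \<delta> (x, y)) | a x y.
          a \<in> carrier R \<and> x \<in> carrier M \<and> y \<in> carrier L}))"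

definition tensor ::
    "('a, 'r) ring_scheme \<Rightarrow> ('a, 'b, 'm) module_scheme \<Rightarrow> ('a, 'c, 'n) module_scheme \<Rightarrow>
     ('a, ('b \<times> 'c \<Rightarrow> 'a) set) module"
  where "tensor R M L =
    quot_module (free_module R (carrier M \<times> carrier L)) (tensor_relations R M L)"

text \<open>The map induced by \<open>f : M \<rightarrow> M'\<close> from \<open>M \<otimes> L\<close> to \<open>M' \<otimes> L\<close>. All cosets in the union
  coincide.\<close>

definition tensor_map ::
    "('a, 'r) ring_scheme \<Rightarrow> ('a, 'd, 'm) module_scheme \<Rightarrow> ('a, 'c, 'n) module_scheme \<Rightarrow>
     ('b \<Rightarrow> 'd) \<Rightarrow> ('b \<times> 'c \<Rightarrow> 'a) set \<Rightarrow> ('d \<times> 'c \<Rightarrow> 'a) set"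
  where "tensor_map R M' L f C =
    (let F' = free_module R (carrier M' \<times> carrier L) in
     \<Union>g\<in>C. tensor_relations R M' L +>\<^bsub>F'\<^esub> free_lift R F' (\<lambda>(x, l). basis_elt R (f x, l)) g)"

text \<open>The first syzygy of \<open>M\<close> with respect to the free module on all elements of \<open>M\<close>. Iterating
  it gives the free resolution
  \<open>\<cdots> \<rightarrow> free (syz (syz M)) \<rightarrow> free (syz M) \<rightarrow> free M \<rightarrow> M \<rightarrow> 0\<close>,
  which is used to compute \<open>Tor\<^sub>1\<close>.\<close>

definition syz :: "('a, 'r) ring_scheme \<Rightarrow> ('a, 'b, 'm) module_scheme \<Rightarrow> ('a, 'b \<Rightarrow> 'a) module"
  where "syz R M =
    (let F = free_module R (carrier M) in F\<lparr>carrier := a_kernel F M (free_lift R M id)\<rparr>)"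

definition Tor1 ::
    "('a, 'r) ring_scheme \<Rightarrow> ('a, 'b, 'm) module_scheme \<Rightarrow> ('a, 'c, 'n) module_scheme \<Rightarrow>
     ('a, ((('b \<Rightarrow> 'a) \<Rightarrow> 'a) \<times> 'c \<Rightarrow> 'a) set set) module"
  where "Tor1 R M L =
    (let F0 = free_module R (carrier M);
         F1 = free_module R (carrier (syz R M));
         F2 = free_module R (carrier (syz R (syz R M)));
         d1 = tensor_map R F0 L (free_lift R F0 id);
         d2 = tensor_map R F1 L (free_lift R F1 id)
     in quot_module
          ((tensor R F1 L)\<lparr>carrier := a_kernel (tensor R F1 L) (tensor R F0 L) d1\<rparr>)
          (d2 ` carrier (tensor R F2 L)))"


section \<open>Extensions and \<open>Ext\<^sup>1\<close>\<close>

text \<open>A triple \<open>(i, E, p)\<close> stands for the sequence \<open>0 \<rightarrow> N \<rightarrow> E \<rightarrow> M \<rightarrow> 0\<close> with maps \<open>i\<close> and \<open>p\<close>.\<close>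

type_synonym ('a, 'b, 'c, 'e) extn = "('c \<Rightarrow> 'e) \<times> ('a, 'e) module \<times> ('e \<Rightarrow> 'b)"

definition extension ::
    "('a, 'r) ring_scheme \<Rightarrow> ('a, 'b, 'm) module_scheme \<Rightarrow> ('a, 'c, 'n) module_scheme \<Rightarrow>
     ('a, 'b, 'c, 'e) extn \<Rightarrow> bool"
  where "extension R M N = (\<lambda>(i, E, p).
    Module.module R E \<and> i \<in> mod_hom R N E \<and> p \<in> mod_hom R E M \<and>
    inj_on i (carrier N) \<and> i ` carrier N = a_kernel E M p \<and> p ` carrier E = carrier M)"

definition ext_equiv ::
    "('a, 'r) ring_scheme \<Rightarrow> ('a, 'c, 'n) module_scheme \<Rightarrow>
     ('a, 'b, 'c, 'e) extn \<Rightarrow> ('a, 'b, 'c, 'f) extn \<Rightarrow> bool"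
  where "ext_equiv R N = (\<lambda>(i, E, p) (i', E', p').
    \<exists>\<phi>\<in>mod_hom R E E'. bij_betw \<phi> (carrier E) (carrier E') \<and>
      (\<forall>x\<in>carrier N. \<phi> (i x) = i' x) \<and> (\<forall>y\<in>carrier E. p' (\<phi> y) = p y))"

text \<open>
  An extension of \<open>M\<close> by \<open>N\<close> has underlying set in bijection with \<open>N \<times> M\<close>, so every
  extension, whatever the type of its middle term, is equivalent to one whose middle term lives
  on the type of \<open>N \<times> M\<close>. Equivalence classes are therefore formed inside this type.
\<close>

definition ext_class ::
    "('a, 'r) ring_scheme \<Rightarrow> ('a, 'b, 'm) module_scheme \<Rightarrow> ('a, 'c, 'n) module_scheme \<Rightarrow>
     ('a, 'b, 'c, 'e) extn \<Rightarrow> ('a, 'b, 'c, 'c \<times> 'b) extn set"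
  where "ext_class R M N s = {t. extension R M N t \<and> ext_equiv R N s t}"

definition split_ext ::
    "('a, 'b, 'm) module_scheme \<Rightarrow> ('a, 'c, 'n) module_scheme \<Rightarrow> ('a, 'b, 'c, 'c \<times> 'b) extn"
  where "split_ext M N = ((\<lambda>x. (x, \<zero>\<^bsub>M\<^esub>)), prod_module N M, snd)"

text \<open>Baer sum: the quotient of the fibre product of the middle terms over \<open>M\<close> by the
  antidiagonal copy of \<open>N\<close>.\<close>

definition baer_sum ::
    "('a, 'c, 'n) module_scheme \<Rightarrow>
     ('a, 'b, 'c, 'e) extn \<Rightarrow> ('a, 'b, 'c, 'f) extn \<Rightarrow> ('a, 'b, 'c, ('e \<times> 'f) set) extn"
  where "baer_sum N = (\<lambda>(i, E, p) (i', E', p').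
    let P = fibre_product E p E' p';
        H = {(i x, \<ominus>\<^bsub>E'\<^esub> i' x) | x. x \<in> carrier N}
    in (\<lambda>x. H +>\<^bsub>P\<^esub> (i x, \<zero>\<^bsub>E'\<^esub>), quot_module P H, \<lambda>C. the_elem ((\<lambda>(y, y'). p y) ` C)))"

text \<open>Scalar multiplication by \<open>a\<close>: pullback along multiplication by \<open>a\<close> on \<open>M\<close>.\<close>

definition ext_smult ::
    "('a, 'b, 'm) module_scheme \<Rightarrow> 'a \<Rightarrow> ('a, 'b, 'c, 'e) extn \<Rightarrow> ('a, 'b, 'c, 'e \<times> 'b) extn"
  where "ext_smult M a = (\<lambda>(i, E, p).
    (\<lambda>x. (i x, \<zero>\<^bsub>M\<^esub>), fibre_product E p M (\<lambda>z. a \<odot>\<^bsub>M\<^esub> z), snd))"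

definition Ext1 ::
    "('a, 'r) ring_scheme \<Rightarrow> ('a, 'b, 'm) module_scheme \<Rightarrow> ('a, 'c, 'n) module_scheme \<Rightarrow>
     ('a, ('a, 'b, 'c, 'c \<times> 'b) extn set) module"
  where "Ext1 R M N =
    \<lparr>carrier = ext_class R M N ` {s :: ('a, 'b, 'c, 'c \<times> 'b) extn. extension R M N s},
     monoid.mult = undefined, monoid.one = undefined,
     ring.zero = ext_class R M N (split_ext M N),
     ring.add = (\<lambda>B C. \<Union>s\<in>B. \<Union>t\<in>C. ext_class R M N (baer_sum N s t)),
     smult = (\<lambda>a B. \<Union>s\<in>B. ext_class R M N (ext_smult M a s))\<rparr>"


section \<open>The invariant \<open>e\<^sup>T\<close> and \<open>T\<close>-split extensions\<close>

definition eT :: "('a, 'r) ring_scheme \<Rightarrow> 'a set \<Rightarrow> ('a, 'b, 'm) module_scheme \<Rightarrow> real"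
  where "eT R \<mm> M =
    (let d = the_enat (krull_dim R) in
     lim (\<lambda>n. fact (d - 1) / real n ^ (d - 1) *
       real (the_enat (mod_length R
         (Tor1 R M (quot_module (self_module R) (\<mm> [^]\<^bsub>ideals_set R\<^esub> (n + 1))))))))"

definition eT_ext ::
    "('a, 'r) ring_scheme \<Rightarrow> 'a set \<Rightarrow> ('a, 'b, 'm) module_scheme \<Rightarrow> ('a, 'c, 'n) module_scheme \<Rightarrow>
     ('a, 'b, 'c, 'e) extn \<Rightarrow> real"
  where "eT_ext R \<mm> M N = (\<lambda>(i, E, p). eT R \<mm> M + eT R \<mm> N - eT R \<mm> E)"

text \<open>If \<open>M\<close> and \<open>N\<close> are maximal Cohen-Macaulay, so is the middle term of any extension of
  \<open>M\<close> by \<open>N\<close>, hence this need not be required separately.\<close>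

definition T_split ::
    "('a, 'r) ring_scheme \<Rightarrow> 'a set \<Rightarrow> ('a, 'b, 'm) module_scheme \<Rightarrow> ('a, 'c, 'n) module_scheme \<Rightarrow>
     ('a, 'b, 'c, 'e) extn \<Rightarrow> bool"
  where "T_split R \<mm> M N s \<longleftrightarrow> extension R M N s \<and> eT_ext R \<mm> M N s = 0"

definition T_ext ::
    "('a, 'r) ring_scheme \<Rightarrow> 'a set \<Rightarrow> ('a, 'b, 'm) module_scheme \<Rightarrow> ('a, 'c, 'n) module_scheme \<Rightarrow>
     ('a, 'b, 'c, 'c \<times> 'b) extn set set"
  where "T_ext R \<mm> M N =
    ext_class R M N ` {s :: ('a, 'b, 'c, 'c \<times> 'b) extn. T_split R \<mm> M N s}"

end

theory Submission
  imports Defs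
begin

text \<open>
  Why the theorem holds. Write \<open>\<mm>\<^sup>n\<close> for the powers of the maximal ideal and choose presentations
  \<open>0 \<rightarrow> K \<rightarrow> F \<rightarrow> M \<rightarrow> 0\<close> and \<open>0 \<rightarrow> K' \<rightarrow> F' \<rightarrow> N \<rightarrow> 0\<close> by finite free modules. For an ideal \<open>I\<close>
  the module \<open>Tor(M, A/I)\<close> is \<open>(K \<inter> IF) / IK\<close> (\<open>mod_length_Tor1\<close>, \<open>tor_length_eq\<close>), and
  \<open>Ext(M, N)\<close> is the image of \<open>Hom(K, N)\<close> under the map that sends \<open>\<phi>\<close> to the extension obtained by
  pushing \<open>0 \<rightarrow> K \<rightarrow> F \<rightarrow> M \<rightarrow> 0\<close> out along \<open>\<phi>\<close> (\<open>Ext1_module\<close>). The middle term of that extension is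
  presented by \<open>F' \<oplus> F\<close> with an explicit kernel \<open>KE \<phi>\<close>. All computations thus take place in
  submodules of \<open>F\<close>, \<open>F'\<close>, \<open>F' \<oplus> F\<close> and \<open>Hom(K, N)\<close>, and lengths are lengths of intervals in
  lattices of submodules (\<open>ilen\<close>).

  In the long exact sequence
  \<open>Tor\<^sub>2(M, A/I) \<rightarrow> Tor(N, A/I) \<rightarrow> Tor(E, A/I) \<rightarrow> Tor(M, A/I) \<rightarrow> N/IN\<close>
  the lengths of the three Tor modules fail to be additive by exactly the lengths of the images of
  the two outer maps. The sum of these two lengths is the \<open>defect\<close> of \<open>\<phi>\<close> (\<open>defect_eq\<close>), and the
  extension is \<open>T\<close>-split if and only if the defect for \<open>I = \<mm>\<^sup>n\<close> grows more slowly than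
  \<open>n\<^sup>d\<^sup>-\<^sup>1\<close> (\<open>T_split_iff\<close>). Two properties of the defect prove the theorem. The connecting maps are
  linear in \<open>\<phi>\<close>, hence the defect is subadditive and does not increase under scalar multiplication
  (\<open>defect_add\<close>, \<open>defect_smult\<close>); this makes the \<open>T\<close>-split classes a submodule. And by the
  Artin--Rees lemma there is a fixed power \<open>\<mm>\<^sup>c\<close> that annihilates \<open>Tor(M, A/\<mm>\<^sup>n)\<close> and
  \<open>Tor(N, A/\<mm>\<^sup>n)\<close> for all large \<open>n\<close>, so that the connecting maps of every class in
  \<open>\<mm>\<^sup>c Ext(M, N)\<close> vanish for large \<open>n\<close> (\<open>defect_annihilated\<close>, \<open>power_small\<close>). Hence the quotient in
  question is a quotient of \<open>Ext(M, N) / \<mm>\<^sup>c Ext(M, N)\<close>, which has finite length because \<open>Hom(K, N)\<close>,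
  and with it \<open>Ext(M, N)\<close>, is Noetherian (\<open>acc_H\<close>, \<open>finite_length_spow\<close>).

  The comparison of the limits \<open>e\<^sup>T\<close> with the defect presupposes that these limits exist
  (\<open>torsion_limit\<close>). The modules \<open>(K \<inter> \<mm>\<^sup>nF) / \<mm>\<^sup>nK\<close> form a graded module over the Rees algebra
  that is finitely generated from some degree on, by Artin--Rees; so their lengths are eventually a
  combination of binomial coefficients in \<open>n\<close> (\<open>hilbert_serre\<close>). Its degree is at most \<open>d - 1\<close>:
  by Artin--Rees again, the lengths are bounded by a fixed number of values of the Hilbert function
  of \<open>K\<close>, and the Hilbert--Samuel function has degree at most \<open>d\<close> because \<open>\<mm>\<close> contains an ideal
  generated by \<open>d\<close> elements and containing a power of \<open>\<mm>\<close>. Such an ideal is where the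
  Cohen--Macaulay hypothesis enters: it is generated by a regular sequence of length \<open>d\<close>, and a prime
  other than \<open>\<mm>\<close> containing it would produce a chain of \<open>d + 2\<close> primes (\<open>exists_parameters\<close>).

  Both Artin--Rees and the finite generation needed for the induction of Hilbert and Serre are
  instances of one graded form of Hilbert's basis theorem, \<open>subsystem_generated\<close>, which is stated for
  sequences of submodules of a fixed module instead of graded modules.
\<close>


section \<open>Submodules and linear maps\<close>

context module
begin

lemma submoduleI':
  assumes "H \<subseteq> carrier M" "\<zero>\<^bsub>M\<^esub> \<in> H"
    and "\<And>x y. x \<in> H \<Longrightarrow> y \<in> H \<Longrightarrow> x \<oplus>\<^bsub>M\<^esub> y \<in> H"
    and "\<And>a x. a \<in> carrier R \<Longrightarrow> x \<in> H \<Longrightarrow> a \<odot>\<^bsub>M\<^esub> x \<in> H"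
  shows "submodule H R M"
proof (rule submoduleI)
  fix x assume x: "x \<in> H"
  have "(\<ominus> \<one>) \<odot>\<^bsub>M\<^esub> x = \<ominus>\<^bsub>M\<^esub> x"
    using smult_l_minus[of \<one> x] x assms(1) by auto
  then show "\<ominus>\<^bsub>M\<^esub> x \<in> H" using assms(4)[OF _ x, of "\<ominus> \<one>"] by simp
qed (use assms in auto)

lemma sub_carr: "submodule H R M \<Longrightarrow> x \<in> H \<Longrightarrow> x \<in> carrier M"
  using submoduleE(1) by blast

lemma sub_zero: "submodule H R M \<Longrightarrow> \<zero>\<^bsub>M\<^esub> \<in> H"
  using submodule.axioms(1) subgroup.one_closed by fastforce

lemma sub_add: "submodule H R M \<Longrightarrow> x \<in> H \<Longrightarrow> y \<in> H \<Longrightarrow> x \<oplus>\<^bsub>M\<^esub> y \<in> H"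
  using submoduleE(5) by blast

lemma sub_neg: "submodule H R M \<Longrightarrow> x \<in> H \<Longrightarrow> \<ominus>\<^bsub>M\<^esub> x \<in> H"
  using submoduleE(3) by blast

lemma sub_minus: "submodule H R M \<Longrightarrow> x \<in> H \<Longrightarrow> y \<in> H \<Longrightarrow> x \<ominus>\<^bsub>M\<^esub> y \<in> H"
  unfolding a_minus_def by (simp add: sub_add sub_neg)

lemma sub_smult: "submodule H R M \<Longrightarrow> a \<in> carrier R \<Longrightarrow> x \<in> H \<Longrightarrow> a \<odot>\<^bsub>M\<^esub> x \<in> H"
  using submoduleE(4) by blast

lemma sub_add_cancel:
  assumes "submodule H R M" "x \<in> carrier M" "y \<in> H" "x \<oplus>\<^bsub>M\<^esub> y \<in> H"
  shows "x \<in> H"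
proof -
  have y: "y \<in> carrier M" using assms sub_carr by auto
  have "x = (x \<oplus>\<^bsub>M\<^esub> y) \<ominus>\<^bsub>M\<^esub> y" using assms(2) y
    by (simp add: a_minus_def M.a_assoc M.r_neg)
  then show ?thesis using sub_minus[OF assms(1,4,3)] by simp
qed

lemma sub_minus_cancel:
  assumes "submodule H R M" "x \<in> carrier M" "y \<in> H" "x \<ominus>\<^bsub>M\<^esub> y \<in> H"
  shows "x \<in> H"
  using sub_add_cancel[OF assms(1,2) sub_neg[OF assms(1,3)]] assms(4)
  by (simp add: a_minus_def)

lemma minus_add_self: "x \<in> carrier M \<Longrightarrow> y \<in> carrier M \<Longrightarrow> y \<oplus>\<^bsub>M\<^esub> (x \<ominus>\<^bsub>M\<^esub> y) = x"
  by (simp add: a_minus_def M.a_lcomm M.r_neg)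

lemma add_minus_self: "x \<in> carrier M \<Longrightarrow> y \<in> carrier M \<Longrightarrow> (x \<oplus>\<^bsub>M\<^esub> y) \<ominus>\<^bsub>M\<^esub> x = y"
  by (simp add: a_minus_def M.a_comm[of x y] M.a_assoc M.r_neg)

lemma smult_minus_distr:
  "a \<in> carrier R \<Longrightarrow> x \<in> carrier M \<Longrightarrow> y \<in> carrier M \<Longrightarrow> a \<odot>\<^bsub>M\<^esub> (x \<ominus>\<^bsub>M\<^esub> y) = a \<odot>\<^bsub>M\<^esub> x \<ominus>\<^bsub>M\<^esub> a \<odot>\<^bsub>M\<^esub> y"
  by (simp add: a_minus_def smult_r_distr smult_r_minus)

lemma smult_comm:
  "a \<in> carrier R \<Longrightarrow> b \<in> carrier R \<Longrightarrow> x \<in> carrier M \<Longrightarrow> a \<odot>\<^bsub>M\<^esub> (b \<odot>\<^bsub>M\<^esub> x) = b \<odot>\<^bsub>M\<^esub> (a \<odot>\<^bsub>M\<^esub> x)"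
  by (metis smult_assoc1 R.m_comm)

lemma zero_submodule: "submodule {\<zero>\<^bsub>M\<^esub>} R M"
  by (rule submoduleI') auto

lemma Int_submodule: "submodule H R M \<Longrightarrow> submodule L R M \<Longrightarrow> submodule (H \<inter> L) R M"
  by (rule submoduleI') (auto simp: sub_carr sub_zero sub_add sub_smult)

lemma gen_submodule_submodule:
  assumes "S \<subseteq> carrier M" shows "submodule (gen_submodule R M S) R M"
proof (rule submoduleI')
  show "gen_submodule R M S \<subseteq> carrier M"
    unfolding gen_submodule_def using carrier_is_submodule assms by blast
qed (auto simp: gen_submodule_def sub_zero sub_add sub_smult)

lemma gen_submodule_least: "submodule H R M \<Longrightarrow> S \<subseteq> H \<Longrightarrow> gen_submodule R M S \<subseteq> H"
  unfolding gen_submodule_def by blast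

lemma gen_submodule_incl: "S \<subseteq> gen_submodule R M S"
  unfolding gen_submodule_def by blast

lemma gen_submodule_mono: "S \<subseteq> T \<Longrightarrow> gen_submodule R M S \<subseteq> gen_submodule R M T"
  unfolding gen_submodule_def by blast

lemma mem_sum_iff: "x \<in> H <+>\<^bsub>M\<^esub> L \<longleftrightarrow> (\<exists>h\<in>H. \<exists>l\<in>L. x = h \<oplus>\<^bsub>M\<^esub> l)"
  by (auto simp: set_add_def')

lemma sum_memI: "h \<in> H \<Longrightarrow> l \<in> L \<Longrightarrow> h \<oplus>\<^bsub>M\<^esub> l \<in> H <+>\<^bsub>M\<^esub> L"
  using mem_sum_iff by blast

lemma sum_submodule:
  assumes H: "submodule H R M" and L: "submodule L R M"
  shows "submodule (H <+>\<^bsub>M\<^esub> L) R M"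
proof (rule submoduleI')
  show "H <+>\<^bsub>M\<^esub> L \<subseteq> carrier M"
    using sub_carr[OF H] sub_carr[OF L] by (auto simp: mem_sum_iff)
  show "\<zero>\<^bsub>M\<^esub> \<in> H <+>\<^bsub>M\<^esub> L"
    using sub_zero[OF H] sub_zero[OF L] by (force simp: mem_sum_iff)
next
  fix x y assume "x \<in> H <+>\<^bsub>M\<^esub> L" "y \<in> H <+>\<^bsub>M\<^esub> L"
  then obtain h l h' l' where *: "h \<in> H" "l \<in> L" "h' \<in> H" "l' \<in> L"
    "x = h \<oplus>\<^bsub>M\<^esub> l" "y = h' \<oplus>\<^bsub>M\<^esub> l'" by (auto simp: mem_sum_iff)
  have "x \<oplus>\<^bsub>M\<^esub> y = (h \<oplus>\<^bsub>M\<^esub> h') \<oplus>\<^bsub>M\<^esub> (l \<oplus>\<^bsub>M\<^esub> l')"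
    using * sub_carr[OF H] sub_carr[OF L] by (simp add: M.a_ac)
  then show "x \<oplus>\<^bsub>M\<^esub> y \<in> H <+>\<^bsub>M\<^esub> L"
    using * by (simp only:) (intro sum_memI sub_add[OF H] sub_add[OF L])
next
  fix a x assume a: "a \<in> carrier R" and "x \<in> H <+>\<^bsub>M\<^esub> L"
  then obtain h l where *: "h \<in> H" "l \<in> L" "x = h \<oplus>\<^bsub>M\<^esub> l" by (auto simp: mem_sum_iff)
  have "a \<odot>\<^bsub>M\<^esub> x = a \<odot>\<^bsub>M\<^esub> h \<oplus>\<^bsub>M\<^esub> a \<odot>\<^bsub>M\<^esub> l"
    using * a sub_carr[OF H] sub_carr[OF L] by (simp add: smult_r_distr)
  then show "a \<odot>\<^bsub>M\<^esub> x \<in> H <+>\<^bsub>M\<^esub> L"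
    using * a by (simp only:) (intro sum_memI sub_smult[OF H] sub_smult[OF L])
qed

lemma sum_upper1: "submodule H R M \<Longrightarrow> submodule L R M \<Longrightarrow> H \<subseteq> H <+>\<^bsub>M\<^esub> L"
  using sub_zero[of L] sub_carr[of H] by (force simp: mem_sum_iff)

lemma sum_upper2: "submodule H R M \<Longrightarrow> submodule L R M \<Longrightarrow> L \<subseteq> H <+>\<^bsub>M\<^esub> L"
  using sub_zero[of H] sub_carr[of L] by (force simp: mem_sum_iff)

lemma sum_least: "submodule P R M \<Longrightarrow> H \<subseteq> P \<Longrightarrow> L \<subseteq> P \<Longrightarrow> H <+>\<^bsub>M\<^esub> L \<subseteq> P"
  using sub_add[of P] by (auto simp: mem_sum_iff subset_iff)

lemma sum_mono: "H \<subseteq> H' \<Longrightarrow> L \<subseteq> L' \<Longrightarrow> H <+>\<^bsub>M\<^esub> L \<subseteq> H' <+>\<^bsub>M\<^esub> L'"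
  unfolding set_add_def' by blast

lemma sum_absorb:
  "submodule H R M \<Longrightarrow> submodule L R M \<Longrightarrow> L \<subseteq> H \<Longrightarrow> H <+>\<^bsub>M\<^esub> L = H"
  by (intro equalityI sum_least sum_upper1) auto

text \<open>The modular law in the form used for additivity of length: within a chain, a submodule is
  determined by its trace on \<open>L\<close> together with its join with \<open>L\<close>.\<close>

lemma modular_eq:
  assumes H: "submodule H R M" and H': "submodule H' R M" and L: "submodule L R M"
    and le: "H \<subseteq> H'" and int: "H \<inter> L = H' \<inter> L" and sum: "H <+>\<^bsub>M\<^esub> L = H' <+>\<^bsub>M\<^esub> L"
  shows "H = H'"
proof
  show "H' \<subseteq> H"
  proof
    fix x assume x: "x \<in> H'"
    then have "x \<in> H <+>\<^bsub>M\<^esub> L" using sum_upper1[OF H' L] sum by blast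
    then obtain h l where hl: "h \<in> H" "l \<in> L" "x = h \<oplus>\<^bsub>M\<^esub> l" by (auto simp: mem_sum_iff)
    then have e: "x \<ominus>\<^bsub>M\<^esub> h = l"
      using sub_carr[OF H] sub_carr[OF L] by (simp add: add_minus_self)
    have "l \<in> H'" using sub_minus[OF H' x subsetD[OF le hl(1)]] e by simp
    then have "l \<in> H" using int hl by blast
    then show "x \<in> H" using hl sub_add[OF H] by simp
  qed
qed (fact le)

end

text \<open>Linearity on a submodule \<open>P\<close> of the domain. Maps out of a kernel \<open>K \<subseteq> F\<close> are treated as partial
  maps on \<open>F\<close>, so that one submodule lattice serves for \<open>F\<close> and for \<open>K\<close>.\<close>

definition linear_on ::
    "('a, 'r) ring_scheme \<Rightarrow> ('a, 'b, 'm) module_scheme \<Rightarrow> 'b set \<Rightarrow> ('a, 'c, 'n) module_scheme \<Rightarrow>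
     ('b \<Rightarrow> 'c) \<Rightarrow> bool"
  where "linear_on R M P N f \<longleftrightarrow> f \<in> P \<rightarrow> carrier N \<and>
     (\<forall>x\<in>P. \<forall>y\<in>P. f (x \<oplus>\<^bsub>M\<^esub> y) = f x \<oplus>\<^bsub>N\<^esub> f y) \<and>
     (\<forall>a\<in>carrier R. \<forall>x\<in>P. f (a \<odot>\<^bsub>M\<^esub> x) = a \<odot>\<^bsub>N\<^esub> f x)"

lemma mod_hom_iff: "f \<in> mod_hom R M N \<longleftrightarrow> linear_on R M (carrier M) N f"
  by (auto simp: mod_hom_def linear_on_def)

lemma linear_on_subset: "linear_on R M P N f \<Longrightarrow> P' \<subseteq> P \<Longrightarrow> linear_on R M P' N f"
  unfolding linear_on_def by blast

lemma linear_onD: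
  assumes "linear_on R M P N f"
  shows "x \<in> P \<Longrightarrow> f x \<in> carrier N"
    and "x \<in> P \<Longrightarrow> y \<in> P \<Longrightarrow> f (x \<oplus>\<^bsub>M\<^esub> y) = f x \<oplus>\<^bsub>N\<^esub> f y"
    and "a \<in> carrier R \<Longrightarrow> x \<in> P \<Longrightarrow> f (a \<odot>\<^bsub>M\<^esub> x) = a \<odot>\<^bsub>N\<^esub> f x"
  using assms unfolding linear_on_def by auto

lemma linear_onI:
  assumes "\<And>x. x \<in> P \<Longrightarrow> f x \<in> carrier N"
    and "\<And>x y. x \<in> P \<Longrightarrow> y \<in> P \<Longrightarrow> f (x \<oplus>\<^bsub>M\<^esub> y) = f x \<oplus>\<^bsub>N\<^esub> f y"
    and "\<And>a x. a \<in> carrier R \<Longrightarrow> x \<in> P \<Longrightarrow> f (a \<odot>\<^bsub>M\<^esub> x) = a \<odot>\<^bsub>N\<^esub> f x"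
  shows "linear_on R M P N f"
  using assms unfolding linear_on_def by auto

lemma linear_on_comp:
  assumes "linear_on R M P N f" "linear_on R N P' L g" "f ` P \<subseteq> P'"
  shows "linear_on R M P L (g \<circ> f)"
  using assms unfolding linear_on_def by (auto simp: image_subset_iff)

locale module_pair = M?: module R M + N?: module R N for R (structure) and M and N
begin

lemma lin_zero:
  assumes P: "submodule P R M" and f: "linear_on R M P N f"
  shows "f \<zero>\<^bsub>M\<^esub> = \<zero>\<^bsub>N\<^esub>"
proof -
  have z: "\<zero>\<^bsub>M\<^esub> \<in> P" by (rule M.sub_zero[OF P])
  have "f (\<zero>\<^bsub>R\<^esub> \<odot>\<^bsub>M\<^esub> \<zero>\<^bsub>M\<^esub>) = \<zero>\<^bsub>R\<^esub> \<odot>\<^bsub>N\<^esub> f \<zero>\<^bsub>M\<^esub>"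
    using linear_onD(3)[OF f _ z, of "\<zero>\<^bsub>R\<^esub>"] by simp
  then show ?thesis using linear_onD(1)[OF f z] by simp
qed

lemma lin_neg:
  assumes P: "submodule P R M" and f: "linear_on R M P N f" and x: "x \<in> P"
  shows "f (\<ominus>\<^bsub>M\<^esub> x) = \<ominus>\<^bsub>N\<^esub> f x"
proof -
  have c: "x \<in> carrier M" "f x \<in> carrier N"
    using M.sub_carr[OF P x] linear_onD(1)[OF f x] by auto
  have "f ((\<ominus>\<^bsub>R\<^esub> \<one>\<^bsub>R\<^esub>) \<odot>\<^bsub>M\<^esub> x) = (\<ominus>\<^bsub>R\<^esub> \<one>\<^bsub>R\<^esub>) \<odot>\<^bsub>N\<^esub> f x"
    using linear_onD(3)[OF f _ x] by simp
  then show ?thesis using c M.smult_l_minus[of "\<one>\<^bsub>R\<^esub>" x] N.smult_l_minus[of "\<one>\<^bsub>R\<^esub>" "f x"] by simp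
qed

lemma lin_minus:
  assumes P: "submodule P R M" and f: "linear_on R M P N f" and x: "x \<in> P" "y \<in> P"
  shows "f (x \<ominus>\<^bsub>M\<^esub> y) = f x \<ominus>\<^bsub>N\<^esub> f y"
  using lin_neg[OF P f x(2)] linear_onD(2)[OF f x(1) M.sub_neg[OF P x(2)]]
  by (simp add: a_minus_def)

lemma vimage_submodule:
  assumes P: "submodule P R M" and f: "linear_on R M P N f" and Y: "submodule Y R N"
  shows "submodule {x \<in> P. f x \<in> Y} R M"
  by (rule M.submoduleI')
     (use lin_zero[OF P f] in \<open>auto simp: linear_onD[OF f] M.sub_carr[OF P] M.sub_zero[OF P]
        M.sub_add[OF P] M.sub_smult[OF P] N.sub_zero[OF Y] N.sub_add[OF Y] N.sub_smult[OF Y]\<close>)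

lemma image_submodule:
  assumes P: "submodule P R M" and f: "linear_on R M P N f" and H: "submodule H R M" "H \<subseteq> P"
  shows "submodule (f ` H) R N"
proof (rule N.submoduleI')
  show "f ` H \<subseteq> carrier N" using linear_onD(1)[OF f] H(2) by auto
  show "\<zero>\<^bsub>N\<^esub> \<in> f ` H" using lin_zero[OF P f] M.sub_zero[OF H(1)] by force
next
  fix x y assume "x \<in> f ` H" "y \<in> f ` H"
  then obtain u v where uv: "u \<in> H" "v \<in> H" "x = f u" "y = f v" by blast
  then have "x \<oplus>\<^bsub>N\<^esub> y = f (u \<oplus>\<^bsub>M\<^esub> v)" using linear_onD(2)[OF f] H(2) by (metis subsetD)
  then show "x \<oplus>\<^bsub>N\<^esub> y \<in> f ` H" using M.sub_add[OF H(1) uv(1,2)] by blast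
next
  fix a x assume a: "a \<in> carrier R" and "x \<in> f ` H"
  then obtain u where u: "u \<in> H" "x = f u" by blast
  then have "a \<odot>\<^bsub>N\<^esub> x = f (a \<odot>\<^bsub>M\<^esub> u)" using linear_onD(3)[OF f a] H(2) by (metis subsetD)
  then show "a \<odot>\<^bsub>N\<^esub> x \<in> f ` H" using M.sub_smult[OF H(1) a u(1)] by blast
qed

end

lemma module_pairI: "module R M \<Longrightarrow> module R N \<Longrightarrow> module_pair R M N"
  unfolding module_pair_def by simp

text \<open>Quotients, the modules of extension classes and the middle terms of extensions are all
  recognised as modules in the same way: their operations are pushed forward from a known module.\<close>

lemma surjective_image_module:
  fixes R (structure)
  assumes "module R M"
    and im: "f ` carrier M = carrier Q" and zero: "f \<zero>\<^bsub>M\<^esub> = \<zero>\<^bsub>Q\<^esub>"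
    and plus: "\<And>x y. x \<in> carrier M \<Longrightarrow> y \<in> carrier M \<Longrightarrow> f x \<oplus>\<^bsub>Q\<^esub> f y = f (x \<oplus>\<^bsub>M\<^esub> y)"
    and smult: "\<And>a x. a \<in> carrier R \<Longrightarrow> x \<in> carrier M \<Longrightarrow> a \<odot>\<^bsub>Q\<^esub> f x = f (a \<odot>\<^bsub>M\<^esub> x)"
  shows "module R Q"
proof -
  interpret M: module R M by fact
  have C: "f x \<in> carrier Q" if "x \<in> carrier M" for x using that im by blast
  show ?thesis
  proof (rule moduleI, unfold im[symmetric])
    show "cring R" by (rule M.R.is_cring)
    show "abelian_group Q"
    proof (rule abelian_groupI, unfold im[symmetric] zero[symmetric])
      fix x assume "x \<in> f ` carrier M"
      then obtain u where u: "u \<in> carrier M" "x = f u" by blast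
      have "f (\<ominus>\<^bsub>M\<^esub> u) \<oplus>\<^bsub>Q\<^esub> x = f \<zero>\<^bsub>M\<^esub>"
        using u by (simp add: plus M.M.l_neg)
      then show "\<exists>y\<in>f ` carrier M. y \<oplus>\<^bsub>Q\<^esub> x = f \<zero>\<^bsub>M\<^esub>" using u(1) by auto
    qed (auto simp: plus M.M.a_ac)
  qed (auto simp: plus smult M.smult_l_distr M.smult_r_distr M.smult_assoc1)
qed

section \<open>Length and the ascending chain condition\<close>

text \<open>Length and the ascending chain condition are read off from an arbitrary family of sets. Applied
  to the interval of submodules between \<open>H\<close> and \<open>L\<close> they give the length of \<open>L/H\<close>, and whether \<open>L/H\<close> is
  Noetherian, without forming the quotient; isomorphism theorems become monotone maps between
  intervals.\<close>

definition chain_length :: "'x set set \<Rightarrow> enat"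
  where "chain_length \<L> =
    Sup {enat n | n. \<exists>C :: nat \<Rightarrow> 'x set. (\<forall>i\<le>n. C i \<in> \<L>) \<and> (\<forall>i<n. C i \<subset> C (Suc i))}"

definition acc :: "'x set set \<Rightarrow> bool"
  where "acc \<L> \<longleftrightarrow> (\<forall>C :: nat \<Rightarrow> 'x set. (\<forall>i. C i \<in> \<L> \<and> C i \<subseteq> C (Suc i)) \<longrightarrow> (\<exists>k. \<forall>i\<ge>k. C i = C k))"

text \<open>The supremum that defines a length is attained whenever it is at least a finite number, so that
  a bound from below can be traded for an actual chain.\<close>

lemma enat_le_Sup_iff:
  fixes S :: "nat set"
  assumes ne: "S \<noteq> {}" and down: "\<And>m n. n \<in> S \<Longrightarrow> m \<le> n \<Longrightarrow> m \<in> S"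
  shows "enat n \<le> Sup (enat ` S) \<longleftrightarrow> n \<in> S"
proof
  assume "n \<in> S" then show "enat n \<le> Sup (enat ` S)" by (intro Sup_upper) auto
next
  assume le: "enat n \<le> Sup (enat ` S)"
  show "n \<in> S"
  proof (rule ccontr)
    assume n: "n \<notin> S"
    then have lt: "m < n" if "m \<in> S" for m using down that by (meson not_le)
    then obtain k where k: "n = Suc k" using ne by (cases n) auto
    have "Sup (enat ` S) \<le> enat k" using lt k by (intro Sup_least) (auto simp: less_Suc_eq_le)
    then have "enat n \<le> enat k" using le order_trans by blast
    then show False using k by simp
  qed
qed

lemma enat_le_chain_length_iff:
  assumes "\<L> \<noteq> {}"
  shows "enat n \<le> chain_length \<L> \<longleftrightarrow>
    (\<exists>C :: nat \<Rightarrow> 'x set. (\<forall>i\<le>n. C i \<in> \<L>) \<and> (\<forall>i<n. C i \<subset> C (Suc i)))"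
proof -
  let ?S = "{n. \<exists>C :: nat \<Rightarrow> 'x set. (\<forall>i\<le>n. C i \<in> \<L>) \<and> (\<forall>i<n. C i \<subset> C (Suc i))}"
  have "chain_length \<L> = Sup (enat ` ?S)"
    unfolding chain_length_def by (rule arg_cong[of _ _ Sup]) auto
  moreover have "enat n \<le> Sup (enat ` ?S) \<longleftrightarrow> n \<in> ?S"
  proof (rule enat_le_Sup_iff)
    have "0 \<in> ?S" using assms by auto
    then show "?S \<noteq> {}" by blast
  next
    fix m k assume "k \<in> ?S" "m \<le> k"
    then obtain C where "\<forall>i\<le>k. C i \<in> \<L>" "\<forall>i<k. C i \<subset> C (Suc i)" by blast
    then have "(\<forall>i\<le>m. C i \<in> \<L>) \<and> (\<forall>i<m. C i \<subset> C (Suc i))" using \<open>m \<le> k\<close> by auto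
    then show "m \<in> ?S" by blast
  qed
  ultimately show ?thesis by simp
qed

lemma enat_leI: "(\<And>k. enat k \<le> a \<Longrightarrow> enat k \<le> b) \<Longrightarrow> a \<le> (b :: enat)"
proof (cases a)
  case infinity
  assume "\<And>k. enat k \<le> a \<Longrightarrow> enat k \<le> b"
  then have "enat k \<le> b" for k using infinity by simp
  then have "b = \<infinity>" by (metis enat_ord_code(3) enat_ord_simps(1) not_less_eq_eq order_refl not_infinity_eq)
  then show ?thesis by simp
qed auto

lemma enat_le_add_split:
  assumes "enat k \<le> a + b"
  obtains m n where "k = m + n" "enat m \<le> a" "enat n \<le> b"
proof (cases "enat k \<le> a")
  case True then show ?thesis using that[of k 0] by (simp add: zero_enat_def[symmetric])
next
  case False
  then obtain m where m: "a = enat m" "m \<le> k" by (cases a) auto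
  have "enat (k - m) \<le> b" using assms m by (cases b) auto
  then show ?thesis using that[of m "k - m"] m by simp
qed

text \<open>The image of a strict chain under a monotone map is only weakly increasing; deleting its
  repetitions leaves a strict chain.\<close>

lemma weak_chain_bound:
  assumes "\<And>i. i \<le> n \<Longrightarrow> C i \<in> \<L>" and "\<And>i. i < n \<Longrightarrow> C i \<subseteq> C (Suc i)"
  shows "enat (card {i. i < n \<and> C i \<noteq> C (Suc i)}) \<le> chain_length \<L>"
proof -
  have "\<exists>D :: nat \<Rightarrow> 'a set. (\<forall>i\<le>card {i. i < n \<and> C i \<noteq> C (Suc i)}. D i \<in> \<L>) \<and>
      (\<forall>i<card {i. i < n \<and> C i \<noteq> C (Suc i)}. D i \<subset> D (Suc i)) \<and>
      D (card {i. i < n \<and> C i \<noteq> C (Suc i)}) = C n"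
    using assms
  proof (induction n)
    case 0 then show ?case by (intro exI[of _ "\<lambda>_. C 0"]) auto
  next
    case (Suc n)
    let ?s = "\<lambda>n. {i. i < n \<and> C i \<noteq> C (Suc i)}"
    obtain D where D: "\<forall>i\<le>card (?s n). D i \<in> \<L>" "\<forall>i<card (?s n). D i \<subset> D (Suc i)"
        "D (card (?s n)) = C n"
    proof -
      have "\<exists>D :: nat \<Rightarrow> 'a set. (\<forall>i\<le>card (?s n). D i \<in> \<L>) \<and> (\<forall>i<card (?s n). D i \<subset> D (Suc i)) \<and>
          D (card (?s n)) = C n"
        by (rule Suc.IH) (use Suc.prems in auto)
      then show ?thesis using that by blast
    qed
    show ?case
    proof (cases "C n = C (Suc n)")
      case True
      then have "?s (Suc n) = ?s n" by (auto simp: less_Suc_eq)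
      then show ?thesis using D True by auto
    next
      case False
      then have "?s (Suc n) = insert n (?s n)" by (auto simp: less_Suc_eq)
      then have c: "card (?s (Suc n)) = Suc (card (?s n))" by simp
      have "C n \<subset> C (Suc n)" using False Suc.prems(2)[of n] by auto
      then show ?thesis unfolding c using D Suc.prems(1)[of "Suc n"]
        by (intro exI[of _ "\<lambda>i. if i \<le> card (?s n) then D i else C (Suc n)"])
           (auto simp: le_Suc_eq less_Suc_eq)
    qed
  qed
  then obtain D :: "nat \<Rightarrow> 'a set" where
    D: "\<forall>i\<le>card {i. i < n \<and> C i \<noteq> C (Suc i)}. D i \<in> \<L>"
      "\<forall>i<card {i. i < n \<and> C i \<noteq> C (Suc i)}. D i \<subset> D (Suc i)" by (elim exE conjE)
  have ne: "\<L> \<noteq> {}" using assms(1)[of n] by auto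
  show ?thesis
    by (rule enat_le_chain_length_iff[OF ne, THEN iffD2]) (intro exI[of _ D] conjI D)
qed

text \<open>If two monotone maps together separate the members of every chain, each step of a chain is
  strict in at least one of the two images, so the number of steps is bounded by the sum of the two
  lengths. Chains stabilize for the same reason (\<open>acc_pair\<close>).\<close>

lemma chain_length_pair:
  assumes f: "\<And>H. H \<in> \<L> \<Longrightarrow> f H \<in> \<L>1" "\<And>H L. H \<in> \<L> \<Longrightarrow> L \<in> \<L> \<Longrightarrow> H \<subseteq> L \<Longrightarrow> f H \<subseteq> f L"
    and g: "\<And>H. H \<in> \<L> \<Longrightarrow> g H \<in> \<L>2" "\<And>H L. H \<in> \<L> \<Longrightarrow> L \<in> \<L> \<Longrightarrow> H \<subseteq> L \<Longrightarrow> g H \<subseteq> g L"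
    and fg: "\<And>H L. H \<in> \<L> \<Longrightarrow> L \<in> \<L> \<Longrightarrow> H \<subseteq> L \<Longrightarrow> f H = f L \<Longrightarrow> g H = g L \<Longrightarrow> H = L"
  shows "chain_length \<L> \<le> chain_length \<L>1 + chain_length \<L>2"
  unfolding chain_length_def[of \<L>]
proof (rule Sup_least, clarify)
  fix n C assume C: "\<forall>i\<le>n. C i \<in> \<L>" "\<forall>i<n. C i \<subset> C (Suc i)"
  let ?a = "{i. i < n \<and> f (C i) \<noteq> f (C (Suc i))}" and ?b = "{i. i < n \<and> g (C i) \<noteq> g (C (Suc i))}"
  have "{..<n} \<subseteq> ?a \<union> ?b"
  proof
    fix i assume "i \<in> {..<n}"
    then have "C i \<in> \<L>" "C (Suc i) \<in> \<L>" "C i \<subset> C (Suc i)" using C by auto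
    then show "i \<in> ?a \<union> ?b" using fg \<open>i \<in> {..<n}\<close> by blast
  qed
  then have "card {..<n} \<le> card (?a \<union> ?b)" by (intro card_mono) auto
  also have "\<dots> \<le> card ?a + card ?b" by (rule card_Un_le)
  finally have "enat n \<le> enat (card ?a) + enat (card ?b)" by simp
  moreover have "enat (card ?a) \<le> chain_length \<L>1"
    using weak_chain_bound[of n "\<lambda>i. f (C i)" \<L>1] C f by (simp add: psubset_imp_subset)
  moreover have "enat (card ?b) \<le> chain_length \<L>2"
    using weak_chain_bound[of n "\<lambda>i. g (C i)" \<L>2] C g by (simp add: psubset_imp_subset)
  ultimately show "enat n \<le> chain_length \<L>1 + chain_length \<L>2"
    by (meson add_mono order_trans)
qed

lemma chain_length_embed:
  assumes f: "\<And>H. H \<in> \<L> \<Longrightarrow> f H \<in> \<L>1" "\<And>H L. H \<in> \<L> \<Longrightarrow> L \<in> \<L> \<Longrightarrow> H \<subseteq> L \<Longrightarrow> f H \<subseteq> f L"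
    and "\<And>H L. H \<in> \<L> \<Longrightarrow> L \<in> \<L> \<Longrightarrow> H \<subseteq> L \<Longrightarrow> f H = f L \<Longrightarrow> H = L"
  shows "chain_length \<L> \<le> chain_length \<L>1"
proof -
  have "chain_length \<L> \<le> chain_length \<L>1 + chain_length {{} :: 'a set}"
    by (rule chain_length_pair[of \<L> f \<L>1 "\<lambda>_. {}"]) (use assms in auto)
  moreover have "chain_length {{} :: 'a set} \<le> enat 0"
    unfolding chain_length_def
  proof (rule Sup_least, clarify)
    fix n C assume C: "\<forall>i\<le>n. C i \<in> {{} :: 'a set}" "\<forall>i<n. C i \<subset> C (Suc i)"
    show "enat n \<le> enat 0"
    proof (cases n)
      case (Suc m)
      then have "C 0 = {}" "C 1 = {}" "C 0 \<subset> C 1" using C by auto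
      then show ?thesis by simp
    qed simp
  qed
  ultimately show ?thesis by (simp add: zero_enat_def[symmetric])
qed

lemma acc_pair:
  assumes f: "\<And>H. H \<in> \<L> \<Longrightarrow> f H \<in> \<L>1" "\<And>H L. H \<in> \<L> \<Longrightarrow> L \<in> \<L> \<Longrightarrow> H \<subseteq> L \<Longrightarrow> f H \<subseteq> f L"
    and g: "\<And>H. H \<in> \<L> \<Longrightarrow> g H \<in> \<L>2" "\<And>H L. H \<in> \<L> \<Longrightarrow> L \<in> \<L> \<Longrightarrow> H \<subseteq> L \<Longrightarrow> g H \<subseteq> g L"
    and fg: "\<And>H L. H \<in> \<L> \<Longrightarrow> L \<in> \<L> \<Longrightarrow> H \<subseteq> L \<Longrightarrow> f H = f L \<Longrightarrow> g H = g L \<Longrightarrow> H = L"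
    and a: "acc \<L>1" "acc \<L>2"
  shows "acc \<L>"
  unfolding acc_def
proof (intro allI impI)
  fix C :: "nat \<Rightarrow> 'a set" assume C: "\<forall>i. C i \<in> \<L> \<and> C i \<subseteq> C (Suc i)"
  obtain k where k: "\<forall>i\<ge>k. f (C i) = f (C k)"
    using a(1)[unfolded acc_def, rule_format, of "\<lambda>i. f (C i)"] C f by blast
  obtain l where l: "\<forall>i\<ge>l. g (C i) = g (C l)"
    using a(2)[unfolded acc_def, rule_format, of "\<lambda>i. g (C i)"] C g by blast
  have mono: "C i \<subseteq> C j" if "i \<le> j" for i j using C that lift_Suc_mono_le[of C] by blast
  have "C i = C (max k l)" if "i \<ge> max k l" for i
  proof -
    have "f (C (max k l)) = f (C i)" "g (C (max k l)) = g (C i)"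
      using k l that by (metis max.cobounded1 max.cobounded2 order_trans)+
    then show ?thesis using fg[of "C (max k l)" "C i"] C mono[OF that] by blast
  qed
  then show "\<exists>k. \<forall>i\<ge>k. C i = C k" by blast
qed

lemma acc_embed:
  assumes "\<And>H. H \<in> \<L> \<Longrightarrow> f H \<in> \<L>1" "\<And>H L. H \<in> \<L> \<Longrightarrow> L \<in> \<L> \<Longrightarrow> H \<subseteq> L \<Longrightarrow> f H \<subseteq> f L"
    and "\<And>H L. H \<in> \<L> \<Longrightarrow> L \<in> \<L> \<Longrightarrow> H \<subseteq> L \<Longrightarrow> f H = f L \<Longrightarrow> H = L" and "acc \<L>1"
  shows "acc \<L>"
  by (rule acc_pair[of \<L> f \<L>1 f \<L>1]) (use assms in auto)

lemma acc_maximal: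
  assumes a: "acc \<L>" and "H \<in> \<L>" "Q H"
  shows "\<exists>L\<in>\<L>. Q L \<and> H \<subseteq> L \<and> (\<forall>P\<in>\<L>. Q P \<longrightarrow> L \<subseteq> P \<longrightarrow> P = L)"
proof (rule ccontr)
  assume neg: "\<not> ?thesis"
  have step: "\<exists>P. (P \<in> \<L> \<and> Q P \<and> H \<subseteq> P) \<and> L \<subset> P" if "L \<in> \<L> \<and> Q L \<and> H \<subseteq> L" for L
  proof -
    have "\<not> (\<forall>P\<in>\<L>. Q P \<longrightarrow> L \<subseteq> P \<longrightarrow> P = L)" using neg that by auto
    then obtain P where "P \<in> \<L>" "Q P" "L \<subseteq> P" "P \<noteq> L" by auto
    then show ?thesis using that by (intro exI[of _ P]) auto
  qed
  have "\<exists>C. \<forall>n. (C n \<in> \<L> \<and> Q (C n) \<and> H \<subseteq> C n) \<and> C n \<subset> C (Suc n)"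
    by (rule dependent_nat_choice[where P = "\<lambda>_ L. L \<in> \<L> \<and> Q L \<and> H \<subseteq> L" and Q = "\<lambda>_ L P. L \<subset> P"])
       (use assms(2,3) step in \<open>blast+\<close>)
  then obtain C where C: "\<And>n. C n \<in> \<L>" "\<And>n. C n \<subset> C (Suc n)" by blast
  have "\<exists>k. \<forall>i\<ge>k. C i = C k"
    by (rule a[unfolded acc_def, rule_format]) (use C in auto)
  then obtain k where k: "\<forall>i\<ge>k. C i = C k" ..
  have "C (Suc k) = C k" by (rule k[rule_format]) simp
  then show False using C(2)[of k] by simp
qed

subsection \<open>The length of a subquotient\<close>

definition subs :: "('a, 'r) ring_scheme \<Rightarrow> ('a, 'b, 'm) module_scheme \<Rightarrow> 'b set \<Rightarrow> 'b set \<Rightarrow> 'b set set"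
  where "subs R M H L = {P. submodule P R M \<and> H \<subseteq> P \<and> P \<subseteq> L}"

definition ilen :: "('a, 'r) ring_scheme \<Rightarrow> ('a, 'b, 'm) module_scheme \<Rightarrow> 'b set \<Rightarrow> 'b set \<Rightarrow> enat"
  where "ilen R M H L = chain_length (subs R M H L)"

context module
begin

lemma subs_split:
  assumes "submodule H R M" "submodule L R M" "submodule P R M" "H \<subseteq> L" "L \<subseteq> P"
  shows "\<And>U. U \<in> subs R M H P \<Longrightarrow> U \<inter> L \<in> subs R M H L"
    and "\<And>U. U \<in> subs R M H P \<Longrightarrow> U <+>\<^bsub>M\<^esub> L \<in> subs R M L P"
    and "\<And>U V. U \<in> subs R M H P \<Longrightarrow> V \<in> subs R M H P \<Longrightarrow> U \<subseteq> V \<Longrightarrow> U \<inter> L = V \<inter> L \<Longrightarrow>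
      U <+>\<^bsub>M\<^esub> L = V <+>\<^bsub>M\<^esub> L \<Longrightarrow> U = V"
proof -
  note H = assms(1) and L = assms(2) and P = assms(3) and le = assms(4,5)
  fix U assume "U \<in> subs R M H P"
  then have U: "submodule U R M" "H \<subseteq> U" "U \<subseteq> P" by (auto simp: subs_def)
  show "U \<inter> L \<in> subs R M H L" using Int_submodule[OF U(1) L] U le by (auto simp: subs_def)
  show "U <+>\<^bsub>M\<^esub> L \<in> subs R M L P"
    using sum_submodule[OF U(1) L] sum_upper2[OF U(1) L] sum_least[OF P U(3) le(2)]
    by (simp add: subs_def)
next
  fix U V assume "U \<in> subs R M H P" "V \<in> subs R M H P" and *: "U \<subseteq> V" "U \<inter> L = V \<inter> L"
      "U <+>\<^bsub>M\<^esub> L = V <+>\<^bsub>M\<^esub> L"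
  then have "submodule U R M" "submodule V R M" by (auto simp: subs_def)
  then show "U = V" using modular_eq[OF _ _ assms(2) *] by simp
qed

text \<open>One inequality concatenates chains; the other sends a chain from \<open>H\<close> to \<open>P\<close> to its traces
  on \<open>L\<close> and its joins with \<open>L\<close>, which determine it by the modular law.\<close>

theorem ilen_add:
  assumes H: "submodule H R M" and L: "submodule L R M" and P: "submodule P R M"
    and le: "H \<subseteq> L" "L \<subseteq> P"
  shows "ilen R M H P = ilen R M H L + ilen R M L P"
proof (rule antisym)
  show "ilen R M H P \<le> ilen R M H L + ilen R M L P"
    unfolding ilen_def
    by (rule chain_length_pair[OF subs_split(1)[OF assms] _ subs_split(2)[OF assms] _
          subs_split(3)[OF assms]]) (auto simp: sum_mono)
  show "ilen R M H L + ilen R M L P \<le> ilen R M H P"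
  proof (rule enat_leI)
    fix k assume "enat k \<le> ilen R M H L + ilen R M L P"
    then obtain m n where k: "k = m + n" and m: "enat m \<le> ilen R M H L" and n: "enat n \<le> ilen R M L P"
      by (rule enat_le_add_split)
    have ne: "subs R M H L \<noteq> {}" "subs R M L P \<noteq> {}" "subs R M H P \<noteq> {}"
      using assms by (auto simp: subs_def)
    obtain C where C: "\<forall>i\<le>m. C i \<in> subs R M H L" "\<forall>i<m. C i \<subset> C (Suc i)"
      using m ne unfolding ilen_def by (auto simp: enat_le_chain_length_iff)
    obtain D where D: "\<forall>i\<le>n. D i \<in> subs R M L P" "\<forall>i<n. D i \<subset> D (Suc i)"
      using n ne unfolding ilen_def by (auto simp: enat_le_chain_length_iff)
    let ?E = "\<lambda>i. if i \<le> m then C i else D (i - m)"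
    have "?E i \<in> subs R M H P" if "i \<le> m + n" for i
    proof (cases "i \<le> m")
      case True
      then have "C i \<in> subs R M H L" using C by blast
      then show ?thesis using le True by (auto simp: subs_def)
    next
      case False
      then have "D (i - m) \<in> subs R M L P" using D that by auto
      then show ?thesis using le False by (auto simp: subs_def)
    qed
    moreover have "?E i \<subset> ?E (Suc i)" if i: "i < m + n" for i
    proof (cases "i < m")
      case True then show ?thesis using C by auto
    next
      case F: False
      show ?thesis
      proof (cases "i = m")
        case True
        have "C m \<subseteq> L" "L \<subseteq> D 0" using C D by (auto simp: subs_def)
        moreover have "D 0 \<subset> D 1" using D i True by auto
        ultimately show ?thesis using True by auto
      next
        case False
        then have "D (i - m) \<subset> D (Suc (i - m))" using F D i by auto
        then show ?thesis using F False by (auto simp: Suc_diff_le)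
      qed
    qed
    ultimately show "enat k \<le> ilen R M H P"
      unfolding ilen_def enat_le_chain_length_iff[OF ne(3)] k by (intro exI[of _ ?E]) blast
  qed
qed

lemma acc_add:
  assumes "submodule H R M" "submodule L R M" "submodule P R M" "H \<subseteq> L" "L \<subseteq> P"
    and "acc (subs R M H L)" "acc (subs R M L P)"
  shows "acc (subs R M H P)"
  by (rule acc_pair[OF subs_split(1)[OF assms(1-5)] _ subs_split(2)[OF assms(1-5)] _
          subs_split(3)[OF assms(1-5)]]) (auto simp: sum_mono assms)

lemma acc_subs_mono:
  assumes "acc (subs R M H P)" "H \<subseteq> H'" "P' \<subseteq> P" shows "acc (subs R M H' P')"
  by (rule acc_embed[of _ "\<lambda>H. H" "subs R M H P"]) (use assms in \<open>auto simp: subs_def\<close>)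

lemma ilen_self: "ilen R M H H = 0"
proof -
  have "ilen R M H H \<le> enat 0"
    unfolding ilen_def chain_length_def
  proof (rule Sup_least, clarify)
    fix n C assume C: "\<forall>i\<le>n. C i \<in> subs R M H H" "\<forall>i<n. C i \<subset> C (Suc i)"
    show "enat n \<le> enat 0"
    proof (cases n)
      case (Suc m)
      then have "C 0 \<in> subs R M H H" "C 1 \<in> subs R M H H" "C 0 \<subset> C 1" using C by auto
      then show ?thesis by (auto simp: subs_def)
    qed simp
  qed
  then show ?thesis by (simp flip: zero_enat_def)
qed

lemma ilen_mono:
  assumes "submodule H R M" "submodule H' R M" "submodule P R M" "submodule P' R M"
    and "H \<subseteq> H'" "H' \<subseteq> P'" "P' \<subseteq> P"
  shows "ilen R M H' P' \<le> ilen R M H P"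
  unfolding ilen_def by (rule chain_length_embed[of _ "\<lambda>H. H"]) (use assms in \<open>auto simp: subs_def\<close>)

end

context module_pair
begin

text \<open>A linear map that induces an injection \<open>P/Q \<rightarrow> P'/Q'\<close> embeds the interval from \<open>Q\<close> to \<open>P\<close> into
  the one from \<open>Q'\<close> to \<open>P'\<close>, by taking images and adding \<open>Q'\<close>.\<close>

lemma subs_inj:
  assumes P: "submodule P R M" and P': "submodule P' R N" and Q': "submodule Q' R N" "Q' \<subseteq> P'"
    and f: "linear_on R M P N f" and fP: "f ` P \<subseteq> P'"
    and inj: "\<And>x. x \<in> P \<Longrightarrow> f x \<in> Q' \<Longrightarrow> x \<in> Q"
  shows "\<And>U. U \<in> subs R M Q P \<Longrightarrow> f ` U <+>\<^bsub>N\<^esub> Q' \<in> subs R N Q' P'"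
    and "\<And>U V. U \<in> subs R M Q P \<Longrightarrow> V \<in> subs R M Q P \<Longrightarrow> U \<subseteq> V \<Longrightarrow>
      f ` U <+>\<^bsub>N\<^esub> Q' = f ` V <+>\<^bsub>N\<^esub> Q' \<Longrightarrow> U = V"
proof -
  fix U assume U: "U \<in> subs R M Q P"
  then have U': "submodule (f ` U) R N" by (intro image_submodule[OF P f]) (auto simp: subs_def)
  have "f ` U \<subseteq> P'" using fP U by (auto simp: subs_def)
  then show "f ` U <+>\<^bsub>N\<^esub> Q' \<in> subs R N Q' P'"
    using N.sum_submodule[OF U' Q'(1)] N.sum_upper2[OF U' Q'(1)] N.sum_least[OF P' _ Q'(2)]
    by (simp add: subs_def)
next
  fix U V assume U: "U \<in> subs R M Q P" and V: "V \<in> subs R M Q P" and le: "U \<subseteq> V"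
    and eq: "f ` U <+>\<^bsub>N\<^esub> Q' = f ` V <+>\<^bsub>N\<^esub> Q'"
  have sY: "submodule (f ` V) R N" using V by (intro image_submodule[OF P f]) (auto simp: subs_def)
  have sX: "submodule U R M" and XP: "U \<subseteq> P" and YP: "V \<subseteq> P" and QX: "Q \<subseteq> U"
    using U V by (auto simp: subs_def)
  have "y \<in> U" if y: "y \<in> V" for y
  proof -
    have "f y \<in> f ` U <+>\<^bsub>N\<^esub> Q'" using eq N.sum_upper1[OF sY Q'(1)] y by blast
    then obtain x q where xq: "x \<in> U" "q \<in> Q'" "f y = f x \<oplus>\<^bsub>N\<^esub> q" by (auto simp: N.mem_sum_iff)
    have "f (y \<ominus>\<^bsub>M\<^esub> x) = f y \<ominus>\<^bsub>N\<^esub> f x" using lin_minus[OF P f] y xq XP YP by blast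
    also have "\<dots> = q" using xq linear_onD(1)[OF f] XP N.sub_carr[OF Q'(1)]
      by (auto intro!: N.add_minus_self)
    finally have "y \<ominus>\<^bsub>M\<^esub> x \<in> Q"
      using inj[of "y \<ominus>\<^bsub>M\<^esub> x"] xq y XP YP M.sub_minus[OF P, of y x] by auto
    then show ?thesis using QX M.sub_minus_cancel[OF sX _ xq(1)] y YP M.sub_carr[OF P] by blast
  qed
  then show "U = V" using le by blast
qed

lemma ilen_inj:
  assumes "submodule P R M" "submodule P' R N" "submodule Q' R N" "Q' \<subseteq> P'"
    "linear_on R M P N f" "f ` P \<subseteq> P'" "\<And>x. x \<in> P \<Longrightarrow> f x \<in> Q' \<Longrightarrow> x \<in> Q"
  shows "ilen R M Q P \<le> ilen R N Q' P'"
  unfolding ilen_def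
  by (rule chain_length_embed[OF subs_inj(1)[OF assms(1-7)] _ subs_inj(2)[OF assms(1-7)]])
     (intro N.sum_mono image_mono order_refl | assumption)+

lemma acc_inj:
  assumes "submodule P R M" "submodule P' R N" "submodule Q' R N" "Q' \<subseteq> P'"
    "linear_on R M P N f" "f ` P \<subseteq> P'" "\<And>x. x \<in> P \<Longrightarrow> f x \<in> Q' \<Longrightarrow> x \<in> Q" "acc (subs R N Q' P')"
  shows "acc (subs R M Q P)"
  by (rule acc_embed[OF subs_inj(1)[OF assms(1-7)] _ subs_inj(2)[OF assms(1-7)] assms(8)])
     (intro N.sum_mono image_mono order_refl | assumption)+

text \<open>A linear map that induces a surjection \<open>P/Q \<rightarrow> P'/Q'\<close> embeds the interval from \<open>Q'\<close> to \<open>P'\<close> into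
  the one from \<open>Q\<close> to \<open>P\<close>, by taking preimages.\<close>

lemma subs_surj:
  assumes P: "submodule P R M" and f: "linear_on R M P N f"
    and Q: "Q \<subseteq> P" "f ` Q \<subseteq> Q'" and Q': "submodule Q' R N"
    and surj: "P' \<subseteq> f ` P <+>\<^bsub>N\<^esub> Q'"
  shows "\<And>V. V \<in> subs R N Q' P' \<Longrightarrow> {x \<in> P. f x \<in> V} \<in> subs R M Q P"
    and "\<And>U V. U \<in> subs R N Q' P' \<Longrightarrow> V \<in> subs R N Q' P' \<Longrightarrow> U \<subseteq> V \<Longrightarrow>
      {x \<in> P. f x \<in> U} = {x \<in> P. f x \<in> V} \<Longrightarrow> U = V"
proof -
  fix V assume "V \<in> subs R N Q' P'"
  then show "{x \<in> P. f x \<in> V} \<in> subs R M Q P"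
    using vimage_submodule[OF P f] Q by (auto simp: subs_def)
next
  fix U V assume U: "U \<in> subs R N Q' P'" and V: "V \<in> subs R N Q' P'" and le: "U \<subseteq> V"
    and eq: "{x \<in> P. f x \<in> U} = {x \<in> P. f x \<in> V}"
  have sX: "submodule U R N" and sY: "submodule V R N" and QX: "Q' \<subseteq> U" and QY: "Q' \<subseteq> V"
    and YP: "V \<subseteq> P'"
    using U V by (auto simp: subs_def)
  have "y \<in> U" if y: "y \<in> V" for y
  proof -
    obtain x q where xq: "x \<in> P" "q \<in> Q'" "y = f x \<oplus>\<^bsub>N\<^esub> q"
      using surj YP y by (force simp: N.mem_sum_iff)
    have "f x \<in> V" using N.sub_add_cancel[OF sY linear_onD(1)[OF f xq(1)]] xq QY y by blast
    then have "f x \<in> U" using xq(1) eq by blast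
    then show ?thesis using xq QX N.sub_add[OF sX] by blast
  qed
  then show "U = V" using le by blast
qed

lemma ilen_surj:
  assumes "submodule P R M" "linear_on R M P N f" "Q \<subseteq> P" "f ` Q \<subseteq> Q'" "submodule Q' R N"
    "P' \<subseteq> f ` P <+>\<^bsub>N\<^esub> Q'"
  shows "ilen R N Q' P' \<le> ilen R M Q P"
  unfolding ilen_def
  by (rule chain_length_embed[OF subs_surj(1)[OF assms] _ subs_surj(2)[OF assms]]) auto

lemma acc_surj:
  assumes "submodule P R M" "linear_on R M P N f" "Q \<subseteq> P" "f ` Q \<subseteq> Q'" "submodule Q' R N"
    "P' \<subseteq> f ` P <+>\<^bsub>N\<^esub> Q'" "acc (subs R M Q P)"
  shows "acc (subs R N Q' P')"
  by (rule acc_embed[OF subs_surj(1)[OF assms(1-6)] _ subs_surj(2)[OF assms(1-6)] assms(7)]) auto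

lemma ilen_iso:
  assumes P: "submodule P R M" "submodule P' R N" and Q: "Q \<subseteq> P" "submodule Q' R N" "Q' \<subseteq> P'"
    and f: "linear_on R M P N f" "f ` P \<subseteq> P'" "P' \<subseteq> f ` P <+>\<^bsub>N\<^esub> Q'"
    and iff: "\<And>x. x \<in> P \<Longrightarrow> f x \<in> Q' \<longleftrightarrow> x \<in> Q"
  shows "ilen R M Q P = ilen R N Q' P'"
proof (rule antisym)
  show "ilen R M Q P \<le> ilen R N Q' P'"
    by (rule ilen_inj[OF P Q(2,3) f(1,2)]) (use iff in blast)
  show "ilen R N Q' P' \<le> ilen R M Q P"
    by (rule ilen_surj[OF P(1) f(1) Q(1) _ Q(2) f(3)]) (use iff Q(1) in blast)
qed

end

lemma linear_on_id: "module R M \<Longrightarrow> P \<subseteq> carrier M \<Longrightarrow> linear_on R M P M (\<lambda>x. x)"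
  by (rule linear_onI) auto

lemma (in module) self_pair: "module_pair R M M"
  by (intro module_pairI module_axioms)

text \<open>The second isomorphism theorem, for lengths.\<close>

lemma (in module) ilen_second_iso:
  assumes H: "submodule H R M" and L: "submodule L R M"
  shows "ilen R M (H \<inter> L) H = ilen R M L (H <+>\<^bsub>M\<^esub> L)"
proof -
  interpret MM: module_pair R M M by (rule self_pair)
  show ?thesis
    by (rule MM.ilen_iso[where f = "\<lambda>x. x"])
      (use assms sub_carr[OF H] sum_submodule[OF H L] sum_upper1[OF H L] sum_upper2[OF H L]
        in \<open>auto intro!: linear_on_id module_axioms\<close>)
qed

section \<open>Products of ideals with submodules\<close>

definition sprod :: "('a, 'r) ring_scheme \<Rightarrow> ('a, 'b, 'm) module_scheme \<Rightarrow> 'a set \<Rightarrow> 'b set \<Rightarrow> 'b set"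
  where "sprod R M I P = gen_submodule R M {a \<odot>\<^bsub>M\<^esub> p | a p. a \<in> I \<and> p \<in> P}"

context module
begin

lemma sprod_submodule: "I \<subseteq> carrier R \<Longrightarrow> P \<subseteq> carrier M \<Longrightarrow> submodule (sprod R M I P) R M"
  unfolding sprod_def by (rule gen_submodule_submodule) auto

lemma sprod_memI: "a \<in> I \<Longrightarrow> p \<in> P \<Longrightarrow> a \<odot>\<^bsub>M\<^esub> p \<in> sprod R M I P"
  unfolding sprod_def by (rule gen_submodule_incl[THEN subsetD]) auto

lemma sprod_least:
  "submodule H R M \<Longrightarrow> (\<And>a p. a \<in> I \<Longrightarrow> p \<in> P \<Longrightarrow> a \<odot>\<^bsub>M\<^esub> p \<in> H) \<Longrightarrow> sprod R M I P \<subseteq> H"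
  unfolding sprod_def by (rule gen_submodule_least) auto

lemma sprod_mono: "I \<subseteq> J \<Longrightarrow> P \<subseteq> P' \<Longrightarrow> sprod R M I P \<subseteq> sprod R M J P'"
  unfolding sprod_def by (rule gen_submodule_mono) blast

lemma sprod_sub: "I \<subseteq> carrier R \<Longrightarrow> submodule P R M \<Longrightarrow> sprod R M I P \<subseteq> P"
  by (rule sprod_least) (auto simp: sub_smult)

lemma scaled_submodule:
  assumes x: "x \<in> carrier R" and P: "submodule P R M"
  shows "submodule ((\<lambda>p. x \<odot>\<^bsub>M\<^esub> p) ` P) R M" "linear_on R M P M (\<lambda>p. x \<odot>\<^bsub>M\<^esub> p)"
proof -
  show l: "linear_on R M P M (\<lambda>p. x \<odot>\<^bsub>M\<^esub> p)"
    by (rule linear_onI) (use x sub_carr[OF P] in \<open>auto simp: smult_r_distr smult_comm\<close>)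
  interpret MM: module_pair R M M by (rule self_pair)
  show "submodule ((\<lambda>p. x \<odot>\<^bsub>M\<^esub> p) ` P) R M"
    by (rule MM.image_submodule[OF P l P]) simp
qed

lemma sprod_insert:
  assumes x: "x \<in> carrier R" and I: "I \<subseteq> carrier R" and P: "submodule P R M"
  shows "sprod R M (insert x I) P = (\<lambda>p. x \<odot>\<^bsub>M\<^esub> p) ` P <+>\<^bsub>M\<^esub> sprod R M I P"
proof (rule equalityI)
  have s: "submodule (sprod R M I P) R M" "submodule (sprod R M (insert x I) P) R M"
    using x I P by (auto intro!: sprod_submodule simp: sub_carr)
  note l = scaled_submodule(1)[OF x P]
  show "sprod R M (insert x I) P \<subseteq> (\<lambda>p. x \<odot>\<^bsub>M\<^esub> p) ` P <+>\<^bsub>M\<^esub> sprod R M I P"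
  proof (rule sprod_least[OF sum_submodule[OF l s(1)]])
    fix a p assume "a \<in> insert x I" "p \<in> P"
    then consider "a \<odot>\<^bsub>M\<^esub> p \<in> (\<lambda>p. x \<odot>\<^bsub>M\<^esub> p) ` P" | "a \<odot>\<^bsub>M\<^esub> p \<in> sprod R M I P"
      using sprod_memI by blast
    then show "a \<odot>\<^bsub>M\<^esub> p \<in> (\<lambda>p. x \<odot>\<^bsub>M\<^esub> p) ` P <+>\<^bsub>M\<^esub> sprod R M I P"
      by cases (use sum_upper1[OF l s(1)] sum_upper2[OF l s(1)] in blast)+
  qed
  show "(\<lambda>p. x \<odot>\<^bsub>M\<^esub> p) ` P <+>\<^bsub>M\<^esub> sprod R M I P \<subseteq> sprod R M (insert x I) P"
    by (rule sum_least[OF s(2)]) (auto intro: sprod_memI sprod_mono[THEN subsetD, rotated 2])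
qed

end

section \<open>Hilbert's basis theorem for systems of submodules\<close>

text \<open>A pair of systems \<open>Q n \<subseteq> P n\<close> encodes the graded module with components \<open>P n / Q n\<close> over the
  polynomial ring with one variable for each element of \<open>U\<close>, the variables acting as multiplication
  from one component to the next. That it is generated by finitely many of its components is
  expressed by \<open>eventually_generated\<close>.\<close>

definition system :: "('a, 'r) ring_scheme \<Rightarrow> ('a, 'b, 'm) module_scheme \<Rightarrow> 'a set \<Rightarrow> (nat \<Rightarrow> 'b set) \<Rightarrow> bool"
  where "system R M U P \<longleftrightarrow> (\<forall>n. submodule (P n) R M) \<and> (\<forall>x\<in>U. \<forall>n. \<forall>p\<in>P n. x \<odot>\<^bsub>M\<^esub> p \<in> P (Suc n))"

definition eventually_generated ::
    "('a, 'r) ring_scheme \<Rightarrow> ('a, 'b, 'm) module_scheme \<Rightarrow> 'a set \<Rightarrow> (nat \<Rightarrow> 'b set) \<Rightarrow> (nat \<Rightarrow> 'b set) \<Rightarrow> bool"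
  where "eventually_generated R M U P Q \<longleftrightarrow>
    (\<exists>c. \<forall>n\<ge>c. P (Suc n) \<subseteq> sprod R M U (P n) <+>\<^bsub>M\<^esub> Q (Suc n))"

context module
begin

lemma systemD:
  assumes "system R M U P"
  shows "submodule (P n) R M" "x \<in> U \<Longrightarrow> p \<in> P n \<Longrightarrow> x \<odot>\<^bsub>M\<^esub> p \<in> P (Suc n)"
  using assms unfolding system_def by auto

lemma system_subset: "system R M U P \<Longrightarrow> V \<subseteq> U \<Longrightarrow> system R M V P"
  unfolding system_def by blast

end

text \<open>The inductive step of Hilbert's basis theorem, for one more variable \<open>x\<close>. Here
  \<open>C k n\<close> consists of the elements of \<open>P n\<close> whose multiple by \<open>x\<^sup>k\<close> lies in the
  subsystem \<open>P'\<close>, and \<open>L k n\<close> is \<open>C k n + x P\<close> in degree \<open>n\<close>, which is the set of coefficients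
  of \<open>x\<^sup>k\<close> in elements of \<open>P'\<close> divisible by \<open>x\<^sup>k\<close>. The sets \<open>L k\<close> increase with \<open>k\<close>; they
  are systems over the remaining variables, so the induction hypothesis applies to them.\<close>

locale basis_step = module +
  fixes x U P Q P'
  assumes x: "x \<in> carrier R" and U: "U \<subseteq> carrier R"
    and sP: "system R M (insert x U) P" and sQ: "system R M (insert x U) Q"
    and sP': "system R M (insert x U) P'"
    and QP': "\<And>n. Q n \<subseteq> P' n" and P'P: "\<And>n. P' n \<subseteq> P n"
    and acc_P: "\<And>n. acc (subs R M (Q n) (P n))"
    and gen_P: "eventually_generated R M (insert x U) P Q"
    and IH: "\<And>P Q P'. system R M U P \<Longrightarrow> system R M U Q \<Longrightarrow> system R M U P' \<Longrightarrow>
      (\<And>n. Q n \<subseteq> P' n) \<Longrightarrow> (\<And>n. P' n \<subseteq> P n) \<Longrightarrow> (\<And>n. acc (subs R M (Q n) (P n))) \<Longrightarrow>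
      eventually_generated R M U P Q \<Longrightarrow> eventually_generated R M U P' Q"
begin

primrec C :: "nat \<Rightarrow> nat \<Rightarrow> 'c set" where
  "C 0 n = P' n"
| "C (Suc k) n = {p \<in> P n. x \<odot>\<^bsub>M\<^esub> p \<in> C k (Suc n)}"

definition xP :: "nat \<Rightarrow> 'c set"
  where "xP n = (case n of 0 \<Rightarrow> {\<zero>\<^bsub>M\<^esub>} | Suc m \<Rightarrow> (\<lambda>p. x \<odot>\<^bsub>M\<^esub> p) ` P m)"

definition L :: "nat \<Rightarrow> nat \<Rightarrow> 'c set"
  where "L k n = C k n <+>\<^bsub>M\<^esub> xP n"

definition Qx :: "nat \<Rightarrow> 'c set"
  where "Qx n = Q n <+>\<^bsub>M\<^esub> xP n"

lemmas P_sub = systemD(1)[OF sP] and Q_sub = systemD(1)[OF sQ] and P'_sub = systemD(1)[OF sP']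

lemma C_system: "system R M (insert x U) (C k)"
  and C_bounds: "Q n \<subseteq> C k n" "C k n \<subseteq> P n"
proof (induction k arbitrary: n)
  case 0
  { case 1 then show ?case using sP' by (simp add: system_def) }
  { case 2 then show ?case using QP' by simp }
  { case 3 then show ?case using P'P by simp }
next
  case (Suc k)
  interpret MM: module_pair R M M by (rule self_pair)
  { case 1
    have "submodule (C (Suc k) n) R M" for n
      using MM.vimage_submodule[OF P_sub scaled_submodule(2)[OF x P_sub] systemD(1)[OF Suc(1)]]
      by simp
    moreover have "y \<odot>\<^bsub>M\<^esub> p \<in> C (Suc k) (Suc n)" if y: "y \<in> insert x U" and p: "p \<in> C (Suc k) n" for y p n
    proof -
      have y': "y \<in> carrier R" using y x U by auto
      have p': "p \<in> P n" "p \<in> carrier M" using p sub_carr[OF P_sub] by auto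
      have "y \<odot>\<^bsub>M\<^esub> (x \<odot>\<^bsub>M\<^esub> p) \<in> C k (Suc (Suc n))"
        using systemD(2)[OF Suc(1) y] p by simp
      then have "x \<odot>\<^bsub>M\<^esub> (y \<odot>\<^bsub>M\<^esub> p) \<in> C k (Suc (Suc n))"
        using smult_comm[OF x y' p'(2)] by simp
      then show ?thesis using systemD(2)[OF sP y p'(1)] by simp
    qed
    ultimately show ?case unfolding system_def by blast }
  { case 2
    show ?case
    proof
      fix q assume q: "q \<in> Q n"
      have "x \<odot>\<^bsub>M\<^esub> q \<in> C k (Suc n)" using systemD(2)[OF sQ _ q, of x] Suc(2)[of "Suc n"] by auto
      moreover have "q \<in> P n" using q QP' P'P by blast
      ultimately show "q \<in> C (Suc k) n" by simp
    qed }
  { case 3 show ?case by auto }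
qed

lemmas C_sub = systemD(1)[OF C_system]

lemma C_mono: "C k n \<subseteq> C (Suc k) n"
proof (induction k arbitrary: n)
  case 0
  show ?case using P'P systemD(2)[OF sP', of x] by auto
next
  case (Suc k)
  show ?case using Suc[of "Suc n"] by auto
qed

lemma xP_sub: "submodule (xP n) R M"
  by (cases n) (auto simp: xP_def zero_submodule scaled_submodule(1)[OF x P_sub])

lemma xP_P: "xP n \<subseteq> P n"
  using systemD(2)[OF sP, of x] sub_zero[OF P_sub] by (cases n) (auto simp: xP_def)

lemma xP_mult: "y \<in> U \<Longrightarrow> p \<in> xP n \<Longrightarrow> y \<odot>\<^bsub>M\<^esub> p \<in> xP (Suc n)"
proof (cases n)
  case 0
  assume *: "y \<in> U" "p \<in> xP n"
  have "x \<odot>\<^bsub>M\<^esub> \<zero>\<^bsub>M\<^esub> = \<zero>\<^bsub>M\<^esub>" using x by simp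
  then have "\<zero>\<^bsub>M\<^esub> \<in> (\<lambda>p. x \<odot>\<^bsub>M\<^esub> p) ` P 0" using sub_zero[OF P_sub[of 0]] by (metis imageI)
  then show ?thesis using * 0 U by (auto simp: xP_def subset_iff)
next
  case (Suc m)
  assume *: "y \<in> U" "p \<in> xP n"
  then obtain q where q: "q \<in> P m" "p = x \<odot>\<^bsub>M\<^esub> q" using Suc by (auto simp: xP_def)
  have "y \<odot>\<^bsub>M\<^esub> p = x \<odot>\<^bsub>M\<^esub> (y \<odot>\<^bsub>M\<^esub> q)"
    unfolding q(2) using * U x sub_carr[OF P_sub q(1)] by (intro smult_comm) auto
  then show ?thesis using systemD(2)[OF sP _ q(1), of y] * Suc by (auto simp: xP_def)
qed

lemma sum_xP_system:
  assumes s: "system R M U H" shows "system R M U (\<lambda>n. H n <+>\<^bsub>M\<^esub> xP n)"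
  unfolding system_def
proof (intro conjI allI ballI)
  show "submodule (H n <+>\<^bsub>M\<^esub> xP n) R M" for n
    by (rule sum_submodule[OF systemD(1)[OF s] xP_sub])
  fix y n p assume y: "y \<in> U" and "p \<in> H n <+>\<^bsub>M\<^esub> xP n"
  then obtain h q where hq: "h \<in> H n" "q \<in> xP n" "p = h \<oplus>\<^bsub>M\<^esub> q" by (auto simp: mem_sum_iff)
  have "y \<odot>\<^bsub>M\<^esub> p = y \<odot>\<^bsub>M\<^esub> h \<oplus>\<^bsub>M\<^esub> y \<odot>\<^bsub>M\<^esub> q"
    unfolding hq(3) using y U sub_carr[OF systemD(1)[OF s] hq(1)] sub_carr[OF xP_sub hq(2)]
    by (intro smult_r_distr) auto
  then show "y \<odot>\<^bsub>M\<^esub> p \<in> H (Suc n) <+>\<^bsub>M\<^esub> xP (Suc n)"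
    using systemD(2)[OF s y hq(1)] xP_mult[OF y hq(2)] by (simp add: sum_memI)
qed

lemma Qx_system: "system R M U Qx"
  using sum_xP_system[OF system_subset[OF sQ]] by (auto simp: Qx_def[abs_def])

lemma L_system: "system R M U (L k)"
  using sum_xP_system[OF system_subset[OF C_system]] by (auto simp: L_def[abs_def])

lemmas L_sub = systemD(1)[OF L_system]

lemma L_bounds: "Qx n \<subseteq> L k n" "L k n \<subseteq> P n"
  unfolding Qx_def L_def by (intro sum_mono C_bounds order_refl sum_least P_sub xP_P)+

lemma L_mono: "k \<le> l \<Longrightarrow> L k n \<subseteq> L l n"
proof -
  have "L k n \<subseteq> L (Suc k) n" for k unfolding L_def by (intro sum_mono C_mono order_refl)
  then show "k \<le> l \<Longrightarrow> L k n \<subseteq> L l n" by (rule lift_Suc_mono_le)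
qed

lemma gen_P_Qx: "eventually_generated R M U P Qx"
proof -
  obtain c where c: "\<And>n. n \<ge> c \<Longrightarrow> P (Suc n) \<subseteq> sprod R M (insert x U) (P n) <+>\<^bsub>M\<^esub> Q (Suc n)"
    using gen_P unfolding eventually_generated_def by blast
  have "P (Suc n) \<subseteq> sprod R M U (P n) <+>\<^bsub>M\<^esub> Qx (Suc n)" if "n \<ge> c" for n
  proof -
    have s: "submodule (sprod R M U (P n)) R M"
      using U sub_carr[OF P_sub] by (intro sprod_submodule) auto
    have q: "submodule (Qx (Suc n)) R M" by (rule systemD(1)[OF Qx_system])
    have "sprod R M (insert x U) (P n) = xP (Suc n) <+>\<^bsub>M\<^esub> sprod R M U (P n)"
      using sprod_insert[OF x U P_sub] by (simp add: xP_def)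
    also have "\<dots> \<subseteq> sprod R M U (P n) <+>\<^bsub>M\<^esub> Qx (Suc n)"
      using sum_upper1[OF s q] sum_upper2[OF s q] sum_upper2[OF Q_sub xP_sub, of "Suc n" "Suc n"]
      by (intro sum_least sum_submodule s q) (auto simp: Qx_def)
    finally have "sprod R M (insert x U) (P n) \<subseteq> sprod R M U (P n) <+>\<^bsub>M\<^esub> Qx (Suc n)" .
    moreover have "Q (Suc n) \<subseteq> sprod R M U (P n) <+>\<^bsub>M\<^esub> Qx (Suc n)"
      using sum_upper2[OF s q] sum_upper1[OF Q_sub xP_sub, of "Suc n" "Suc n"] by (auto simp: Qx_def)
    ultimately show ?thesis
      using c[OF that] sum_least[OF sum_submodule[OF s q]] by blast
  qed
  then show ?thesis unfolding eventually_generated_def by blast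
qed

lemma acc_Qx: "acc (subs R M (Qx n) (P n))"
  by (rule acc_subs_mono[OF acc_P[of n]]) (auto simp: Qx_def intro!: sum_upper1[THEN subsetD] Q_sub xP_sub)

lemma L_generated: "eventually_generated R M U (L k) Qx"
  by (rule IH[OF system_subset[OF sP] Qx_system L_system L_bounds acc_Qx gen_P_Qx]) auto

text \<open>The sets \<open>L k n\<close> stabilize in \<open>k\<close> for each \<open>n\<close>, and uniformly in \<open>n\<close>: the limits \<open>Li n\<close> form a system over
  the remaining variables, hence are generated by components of bounded degree, and the finitely many
  sets in these degrees stabilize together.\<close>

lemma L_stable: "\<exists>k0. \<forall>k\<ge>k0. \<forall>n. L k n = L k0 n"
proof -
  have "\<exists>k. \<forall>i\<ge>k. L i n = L k n" for n
    by (rule acc_Qx[of n, unfolded acc_def, rule_format])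
      (use L_sub L_bounds L_mono[of _ "Suc _"] in \<open>simp add: subs_def\<close>)
  then obtain K where K: "\<And>n i. i \<ge> K n \<Longrightarrow> L i n = L (K n) n" by metis
  define Li where "Li n = L (K n) n" for n
  have Li: "L k n \<subseteq> Li n" for k n
    using K[of n "max k (K n)"] L_mono[of k "max k (K n)" n] by (simp add: Li_def)
  have Li_sys: "system R M U Li"
    unfolding system_def
  proof (intro conjI allI ballI)
    show "submodule (Li n) R M" for n by (simp add: Li_def L_sub)
    fix y n p assume "y \<in> U" "p \<in> Li n"
    then have "y \<odot>\<^bsub>M\<^esub> p \<in> L (K n) (Suc n)" using systemD(2)[OF L_system] by (simp add: Li_def)
    then show "y \<odot>\<^bsub>M\<^esub> p \<in> Li (Suc n)" using Li by blast
  qed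
  have "eventually_generated R M U Li Qx"
    by (rule IH[OF system_subset[OF sP] Qx_system Li_sys _ _ acc_Qx gen_P_Qx])
       (use L_bounds in \<open>auto simp: Li_def\<close>)
  then obtain c where c: "\<And>n. n \<ge> c \<Longrightarrow> Li (Suc n) \<subseteq> sprod R M U (Li n) <+>\<^bsub>M\<^esub> Qx (Suc n)"
    unfolding eventually_generated_def by blast
  define k0 where "k0 = Max (K ` {..c})"
  have k0: "K n \<le> k0" if "n \<le> c" for n unfolding k0_def using that by (intro Max_ge) auto
  have main: "Li n \<subseteq> L k0 n" for n
  proof (induction n)
    case 0
    then show ?case using K[of 0 k0] k0[of 0] by (simp add: Li_def)
  next
    case (Suc n)
    show ?case
    proof (cases "Suc n \<le> c")
      case True
      then show ?thesis using K[of "Suc n" k0] k0[of "Suc n"] by (simp add: Li_def)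
    next
      case False
      then have "Li (Suc n) \<subseteq> sprod R M U (Li n) <+>\<^bsub>M\<^esub> Qx (Suc n)" using c by simp
      also have "\<dots> \<subseteq> L k0 (Suc n)"
      proof (rule sum_least[OF L_sub _ L_bounds(1)])
        show "sprod R M U (Li n) \<subseteq> L k0 (Suc n)"
          by (rule sprod_least[OF L_sub]) (use Suc systemD(2)[OF L_system] in blast)
      qed
      finally show ?thesis .
    qed
  qed
  have "L k n = L k0 n" if "k \<ge> k0" for k n
    using L_mono[OF that, of n] Li[of k n] main[of n] by blast
  then show ?thesis by blast
qed

text \<open>The aim is \<open>P' n \<subseteq> T n\<close> for large \<open>n\<close>, which is the case \<open>k = 0\<close> of \<open>C k n \<subseteq> D k n\<close>. The
  sets \<open>D k\<close> are formed from \<open>T\<close> as the sets \<open>C k\<close> are formed from \<open>P'\<close>; the general case is what an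
  induction on \<open>n\<close> that divides by \<open>x\<close> requires.\<close>

definition T :: "nat \<Rightarrow> 'c set"
  where "T n = (case n of 0 \<Rightarrow> P' 0 | Suc m \<Rightarrow> sprod R M (insert x U) (P' m) <+>\<^bsub>M\<^esub> Q (Suc m))"

primrec D :: "nat \<Rightarrow> nat \<Rightarrow> 'c set" where
  "D 0 n = T n"
| "D (Suc k) n = {p \<in> P n. x \<odot>\<^bsub>M\<^esub> p \<in> D k (Suc n)}"

lemma sprod_P'_sub: "submodule (sprod R M (insert x U) (P' m)) R M"
  using x U sub_carr[OF P'_sub] by (intro sprod_submodule) auto

lemma D_sub: "submodule (D k n) R M"
proof (induction k arbitrary: n)
  case 0
  show ?case by (cases n) (auto simp: T_def P'_sub sum_submodule[OF sprod_P'_sub Q_sub])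
next
  case (Suc k)
  interpret MM: module_pair R M M by (rule self_pair)
  show ?case using MM.vimage_submodule[OF P_sub scaled_submodule(2)[OF x P_sub] Suc] by simp
qed

lemma Q_D: "Q n \<subseteq> D k n"
proof (induction k arbitrary: n)
  case 0
  show ?case
    using sum_upper2[OF sprod_P'_sub Q_sub] QP' by (cases n) (auto simp: T_def)
next
  case (Suc k)
  show ?case
  proof
    fix q assume q: "q \<in> Q n"
    have "x \<odot>\<^bsub>M\<^esub> q \<in> D k (Suc n)" using systemD(2)[OF sQ _ q, of x] Suc[of "Suc n"] by auto
    moreover have "q \<in> P n" using q QP' P'P by blast
    ultimately show "q \<in> D (Suc k) n" by simp
  qed
qed

text \<open>A multiplication by some variable leads from \<open>P'\<close> to \<open>T\<close>, hence from \<open>C k\<close> to \<open>D k\<close>; for the variable \<open>x\<close>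
  it is absorbed by raising \<open>k\<close> (\<open>C_D_Suc\<close>).\<close>

lemma mult_C_D: "y \<in> U \<Longrightarrow> p \<in> C k n \<Longrightarrow> y \<odot>\<^bsub>M\<^esub> p \<in> D k (Suc n)"
proof (induction k arbitrary: n p)
  case 0
  then have "y \<odot>\<^bsub>M\<^esub> p \<in> sprod R M (insert x U) (P' n)" by (intro sprod_memI) auto
  then show ?case using sum_upper1[OF sprod_P'_sub Q_sub] by (auto simp: T_def)
next
  case (Suc k)
  then have p: "p \<in> P n" "x \<odot>\<^bsub>M\<^esub> p \<in> C k (Suc n)" by auto
  then have "y \<odot>\<^bsub>M\<^esub> (x \<odot>\<^bsub>M\<^esub> p) \<in> D k (Suc (Suc n))" using Suc by blast
  moreover have "y \<odot>\<^bsub>M\<^esub> (x \<odot>\<^bsub>M\<^esub> p) = x \<odot>\<^bsub>M\<^esub> (y \<odot>\<^bsub>M\<^esub> p)"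
    using Suc.prems(1) U x sub_carr[OF P_sub p(1)] by (intro smult_comm) auto
  ultimately show ?case using systemD(2)[OF sP _ p(1), of y] Suc.prems(1) by simp
qed

lemma C_D_Suc: "p \<in> C k n \<Longrightarrow> p \<in> D (Suc k) n"
proof (induction k arbitrary: n p)
  case 0
  then have "x \<odot>\<^bsub>M\<^esub> p \<in> sprod R M (insert x U) (P' n)" by (intro sprod_memI) auto
  then show ?case using sum_upper1[OF sprod_P'_sub Q_sub] 0 subsetD[OF P'P[of n], of p] by (auto simp: T_def)
qed auto

text \<open>For large \<open>n + k\<close>, an element of \<open>C k n\<close> is the sum of an element of \<open>C k n \<inter> D k n\<close> and of \<open>x q\<close> with
  \<open>q \<in> P (n - 1)\<close>: if \<open>k\<close> is large because \<open>C k\<close> and \<open>C (k - 1) \<subseteq> D k\<close> agree modulo \<open>xP\<close>, otherwise \<open>n\<close> is large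
  and \<open>L k\<close> is generated by its component in degree \<open>n - 1\<close>. Then \<open>q \<in> C (k + 1) (n - 1)\<close>, and \<open>n + k\<close> has not
  changed, so an induction on \<open>n\<close> applies to \<open>q\<close>.\<close>

lemma C_subset_D: "\<exists>c. \<forall>n k. n + k \<ge> c \<longrightarrow> C k n \<subseteq> D k n"
proof -
  obtain k0 where k0: "\<And>k n. k \<ge> k0 \<Longrightarrow> L k n = L k0 n" using L_stable by blast
  have "\<exists>c. \<forall>n\<ge>c. L k (Suc n) \<subseteq> sprod R M U (L k n) <+>\<^bsub>M\<^esub> Qx (Suc n)" for k
    using L_generated unfolding eventually_generated_def by blast
  then obtain cc where cc: "\<And>k n. n \<ge> cc k \<Longrightarrow> L k (Suc n) \<subseteq> sprod R M U (L k n) <+>\<^bsub>M\<^esub> Qx (Suc n)"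
    by metis
  \<comment> \<open>a common bound serves the finitely many \<open>k \<le> k0\<close>; for larger \<open>k\<close> the sets \<open>L k\<close> and \<open>L (k - 1)\<close> agree\<close>
  define c1 where "c1 = Max (cc ` {..k0})"
  have c1: "cc k \<le> c1" if "k \<le> k0" for k unfolding c1_def using that by (intro Max_ge) auto
  define S where "S k n = C k n \<inter> D k n" for k n
  have S_sub: "submodule (S k n) R M" for k n unfolding S_def by (intro Int_submodule C_sub D_sub)
  have split: "C k n \<subseteq> S k n <+>\<^bsub>M\<^esub> xP n" if big: "n + k \<ge> Suc (Suc (c1 + k0))" for k n
  proof (cases "k > k0")
    case True
    then obtain l where l: "k = Suc l" "l \<ge> k0" by (cases k) auto
    have "C k n \<subseteq> L k n" unfolding L_def by (rule sum_upper1[OF C_sub xP_sub])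
    also have "\<dots> = L l n" using k0[of k n] k0[of l n] l by simp
    also have "\<dots> \<subseteq> S k n <+>\<^bsub>M\<^esub> xP n"
      unfolding L_def S_def using C_mono[of l n] C_D_Suc[of _ l n] l by (intro sum_mono) auto
    finally show ?thesis .
  next
    case False
    then obtain m where m: "n = Suc m" "m \<ge> cc k" using big c1[of k] by (cases n) auto
    have s: "submodule (S k n <+>\<^bsub>M\<^esub> xP n) R M" by (intro sum_submodule S_sub xP_sub)
    have "C k n \<subseteq> L k n" unfolding L_def by (rule sum_upper1[OF C_sub xP_sub])
    also have "\<dots> \<subseteq> sprod R M U (L k m) <+>\<^bsub>M\<^esub> Qx n" using cc[OF m(2)] m(1) by simp
    also have "\<dots> \<subseteq> S k n <+>\<^bsub>M\<^esub> xP n"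
    proof (rule sum_least[OF s])
      show "Qx n \<subseteq> S k n <+>\<^bsub>M\<^esub> xP n"
        unfolding Qx_def S_def using C_bounds(1) Q_D by (intro sum_mono) auto
      show "sprod R M U (L k m) \<subseteq> S k n <+>\<^bsub>M\<^esub> xP n"
      proof (rule sprod_least[OF s])
        fix y p assume y: "y \<in> U" and "p \<in> L k m"
        then obtain h q where hq: "h \<in> C k m" "q \<in> xP m" "p = h \<oplus>\<^bsub>M\<^esub> q"
          by (auto simp: L_def mem_sum_iff)
        have "y \<odot>\<^bsub>M\<^esub> p = y \<odot>\<^bsub>M\<^esub> h \<oplus>\<^bsub>M\<^esub> y \<odot>\<^bsub>M\<^esub> q"
          unfolding hq(3) using y U sub_carr[OF C_sub hq(1)] sub_carr[OF xP_sub hq(2)]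
          by (intro smult_r_distr) auto
        moreover have "y \<odot>\<^bsub>M\<^esub> h \<in> S k n"
          unfolding S_def using mult_C_D[OF y hq(1)] systemD(2)[OF C_system _ hq(1), of y] y m by auto
        ultimately show "y \<odot>\<^bsub>M\<^esub> p \<in> S k n <+>\<^bsub>M\<^esub> xP n"
          using xP_mult[OF y hq(2)] m by (simp add: sum_memI)
      qed
    qed
    finally show ?thesis .
  qed
  have "C k n \<subseteq> D k n" if "n + k \<ge> Suc (Suc (c1 + k0))" for k n
    using that
  proof (induction n arbitrary: k)
    case 0
    have "C k 0 \<subseteq> S k 0 <+>\<^bsub>M\<^esub> xP 0" using split[of 0 k] 0 by simp
    also have "\<dots> \<subseteq> S k 0"
      using sum_least[OF S_sub order_refl, of "xP 0" k 0] sub_zero[OF S_sub] by (simp add: xP_def)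
    finally show ?case by (simp add: S_def)
  next
    case (Suc n)
    show ?case
    proof
      fix p assume p: "p \<in> C k (Suc n)"
      then have "p \<in> S k (Suc n) <+>\<^bsub>M\<^esub> xP (Suc n)" using split[of "Suc n" k] Suc.prems by blast
      then obtain s q where sq: "s \<in> S k (Suc n)" "q \<in> P n" "p = s \<oplus>\<^bsub>M\<^esub> x \<odot>\<^bsub>M\<^esub> q"
        by (auto simp: mem_sum_iff xP_def)
      have c: "s \<in> carrier M" "x \<odot>\<^bsub>M\<^esub> q \<in> carrier M"
        using sub_carr[OF S_sub sq(1)] sub_carr[OF P_sub sq(2)] x by auto
      have "p \<ominus>\<^bsub>M\<^esub> s = x \<odot>\<^bsub>M\<^esub> q" unfolding sq(3) by (rule add_minus_self[OF c])
      then have "x \<odot>\<^bsub>M\<^esub> q \<in> C k (Suc n)"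
        using sub_minus[OF C_sub p, of s] sq(1) by (simp add: S_def)
      then have "q \<in> C (Suc k) n" using sq(2) by simp
      then have "q \<in> D (Suc k) n" using Suc.IH[of "Suc k"] Suc.prems by auto
      then show "p \<in> D k (Suc n)"
        unfolding sq(3) using sq(1) by (intro sub_add[OF D_sub]) (auto simp: S_def)
    qed
  qed
  then show ?thesis by blast
qed

lemma P'_generated: "eventually_generated R M (insert x U) P' Q"
proof -
  obtain c where c: "\<And>n k. n + k \<ge> c \<Longrightarrow> C k n \<subseteq> D k n" using C_subset_D by blast
  have "P' (Suc n) \<subseteq> sprod R M (insert x U) (P' n) <+>\<^bsub>M\<^esub> Q (Suc n)" if "n \<ge> c" for n
    using c[of "Suc n" 0] that by (simp add: T_def)
  then show ?thesis unfolding eventually_generated_def by blast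
qed

end

context module
begin

text \<open>Hilbert's basis theorem for graded modules over a polynomial ring with variables \<open>U\<close>, whose
  degree zero part enters only through the chain condition on the components.\<close>

theorem subsystem_generated:
  assumes "finite U" "U \<subseteq> carrier R"
    and "system R M U P" "system R M U Q" "system R M U P'"
    and "\<And>n. Q n \<subseteq> P' n" "\<And>n. P' n \<subseteq> P n" "\<And>n. acc (subs R M (Q n) (P n))"
    and "eventually_generated R M U P Q"
  shows "eventually_generated R M U P' Q"
  using assms
proof (induction U arbitrary: P Q P' rule: finite_induct)
  case empty
  then obtain c where c: "\<And>n. n \<ge> c \<Longrightarrow> P (Suc n) \<subseteq> sprod R M {} (P n) <+>\<^bsub>M\<^esub> Q (Suc n)"
    unfolding eventually_generated_def by blast
  have "sprod R M {} (P n) = sprod R M {} (P' n)" for n by (simp add: sprod_def)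
  then have "P' (Suc n) \<subseteq> sprod R M {} (P' n) <+>\<^bsub>M\<^esub> Q (Suc n)" if "n \<ge> c" for n
    using c[OF that] empty.prems(6)[of "Suc n"] by auto
  then show ?case unfolding eventually_generated_def by blast
next
  case (insert x U)
  interpret basis_step R M x U P Q P'
    by unfold_locales (use insert in auto)
  show ?case by (rule P'_generated)
qed

end

section \<open>Functions that are eventually combinations of binomial coefficients\<close>

text \<open>The functions that eventually agree with a polynomial of degree less than \<open>r\<close>, given in the basis of
  binomial coefficients because differences and sums act on it by shifting the index.\<close>

definition binpoly :: "nat \<Rightarrow> (nat \<Rightarrow> real) \<Rightarrow> bool"
  where "binpoly r f \<longleftrightarrow> (\<exists>c. \<forall>\<^sub>F n in sequentially. f n = (\<Sum>i<r. c i * real (n choose i)))"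

lemma binpoly_diff:
  assumes "binpoly r f" "binpoly r g" shows "binpoly r (\<lambda>n. f n - g n)"
proof -
  obtain c d where "\<forall>\<^sub>F n in sequentially. f n = (\<Sum>i<r. c i * real (n choose i))"
    "\<forall>\<^sub>F n in sequentially. g n = (\<Sum>i<r. d i * real (n choose i))"
    using assms unfolding binpoly_def by blast
  then have "\<forall>\<^sub>F n in sequentially. f n - g n = (\<Sum>i<r. (c i - d i) * real (n choose i))"
    by eventually_elim (simp add: sum_subtractf left_diff_distrib)
  then show ?thesis unfolding binpoly_def by (intro exI[of _ "\<lambda>i. c i - d i"])
qed

lemma binpoly_summation:
  assumes "binpoly r (\<lambda>n. f (Suc n) - f n)" shows "binpoly (Suc r) f"
proof -
  obtain c N where c: "\<And>n. n \<ge> N \<Longrightarrow> f (Suc n) - f n = (\<Sum>i<r. c i * real (n choose i))"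
    using assms unfolding binpoly_def eventually_sequentially by blast
  \<comment> \<open>summation shifts the indices, and the constant term is determined by the value at \<open>N\<close>\<close>
  define c' where "c' i = (case i of 0 \<Rightarrow> f N - (\<Sum>i<r. c i * real (N choose Suc i)) | Suc j \<Rightarrow> c j)" for i
  have eq: "(\<Sum>i<Suc r. c' i * real (n choose i)) = c' 0 + (\<Sum>i<r. c i * real (n choose Suc i))" for n
    by (subst sum.lessThan_Suc_shift) (simp add: c'_def)
  have "f n = (\<Sum>i<Suc r. c' i * real (n choose i))" if "n \<ge> N" for n
    using that
  proof (induction n rule: nat_induct_at_least)
    case base
    show ?case unfolding eq by (simp add: c'_def)
  next
    case (Suc n)
    have "f (Suc n) = f n + (\<Sum>i<r. c i * real (n choose i))" using c[OF Suc(1)] by simp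
    also have "\<dots> = c' 0 + (\<Sum>i<r. c i * real (Suc n choose Suc i))"
      using Suc.IH unfolding eq by (simp add: sum.distrib distrib_left)
    finally show ?case unfolding eq .
  qed
  then show ?thesis unfolding binpoly_def eventually_sequentially
    by (intro exI[of _ c'] exI[of _ N] allI impI)
qed

lemma binpoly_difference:
  assumes "binpoly (Suc r) f" shows "binpoly r (\<lambda>n. f (Suc n) - f n)"
proof -
  obtain c N where c: "\<And>n. n \<ge> N \<Longrightarrow> f n = (\<Sum>i<Suc r. c i * real (n choose i))"
    using assms unfolding binpoly_def eventually_sequentially by blast
  have "f (Suc n) - f n = (\<Sum>i<r. c (Suc i) * real (n choose i))" if "n \<ge> N" for n
    using that unfolding c[OF that] c[OF le_SucI[OF that]] sum.lessThan_Suc_shift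
    by (simp add: distrib_left sum.distrib)
  then show ?thesis unfolding binpoly_def eventually_sequentially
    by (intro exI[of _ "\<lambda>i. c (Suc i)"] exI[of _ N] allI impI)
qed

lemma binomial_asymptotics: "(\<lambda>n. real (n choose i) / real n ^ i) \<longlonglongrightarrow> 1 / fact i"
proof -
  have lim: "(\<lambda>n. (\<Prod>j<i. (real n - real j) / real n)) \<longlonglongrightarrow> (\<Prod>j<i. 1)"
  proof (intro tendsto_prod)
    fix j
    have "(\<lambda>n. 1 - real j / real n) \<longlonglongrightarrow> 1 - 0"
      by (intro tendsto_diff tendsto_const lim_const_over_n)
    moreover have "\<forall>\<^sub>F n in sequentially. 1 - real j / real n = (real n - real j) / real n"
      using eventually_gt_at_top[of "0::nat"] by eventually_elim (simp add: diff_divide_distrib)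
    ultimately show "(\<lambda>n. (real n - real j) / real n) \<longlonglongrightarrow> 1"
      by (simp add: tendsto_cong)
  qed
  have "real (n choose i) / real n ^ i = (\<Prod>j<i. (real n - real j) / real n) / fact i" for n
    by (simp add: binomial_gbinomial gbinomial_prod_rev prod_dividef atLeast0LessThan)
  then show ?thesis using tendsto_divide[OF lim tendsto_const, of "fact i"] by simp
qed

lemma binomial_sum_asymptotics:
  "(\<lambda>n. (\<Sum>i<Suc e. c i * real (n choose i)) / real n ^ e) \<longlonglongrightarrow> c e / fact e"
proof -
  have "(\<lambda>n. c i * real (n choose i) / real n ^ e) \<longlonglongrightarrow> 0" if i: "i < e" for i
  proof -
    have l: "(\<lambda>n. c i * (real (n choose i) / real n ^ i) * (inverse (real n)) ^ (e - i))
        \<longlonglongrightarrow> c i * (1 / fact i) * 0 ^ (e - i)"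
      by (intro tendsto_intros binomial_asymptotics lim_inverse_n)
    have eq: "c i * (real (n choose i) / real n ^ i) * (inverse (real n)) ^ (e - i)
        = c i * real (n choose i) / real n ^ e" for n
      using power_add[of "real n" i "e - i"] i by (simp add: field_simps power_inverse)
    show ?thesis using l i unfolding eq by (simp add: power_0_left)
  qed
  then have "(\<lambda>n. \<Sum>i<e. c i * real (n choose i) / real n ^ e) \<longlonglongrightarrow> (\<Sum>i<e. 0)"
    by (intro tendsto_sum) auto
  moreover have "(\<lambda>n. c e * (real (n choose e) / real n ^ e)) \<longlonglongrightarrow> c e * (1 / fact e)"
    by (intro tendsto_intros binomial_asymptotics)
  ultimately have "(\<lambda>n. (\<Sum>i<e. c i * real (n choose i) / real n ^ e) +
      c e * (real (n choose e) / real n ^ e)) \<longlonglongrightarrow> (\<Sum>i<e. 0) + c e * (1 / fact e)"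
    by (rule tendsto_add)
  then show ?thesis by (simp add: add_divide_distrib sum_divide_distrib)
qed

lemma binpoly_limit:
  assumes "binpoly (Suc e) f" shows "convergent (\<lambda>n. f n / real n ^ e)"
proof -
  obtain c where c: "\<forall>\<^sub>F n in sequentially. f n = (\<Sum>i<Suc e. c i * real (n choose i))"
    using assms unfolding binpoly_def by blast
  have "(\<lambda>n. f n / real n ^ e) \<longlonglongrightarrow> c e / fact e"
    by (rule Lim_transform_eventually[OF binomial_sum_asymptotics])
       (use c in eventually_elim, simp)
  then show ?thesis unfolding convergent_def by blast
qed

lemma binpoly_bound:
  assumes "binpoly (Suc e) f" shows "\<exists>B. \<forall>\<^sub>F n in sequentially. f n \<le> B * real n ^ e"
proof -
  have "Bseq (\<lambda>n. f n / real n ^ e)" using binpoly_limit[OF assms] by (rule convergent_imp_Bseq)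
  then obtain B where B: "\<And>n. \<bar>f n / real n ^ e\<bar> \<le> B" unfolding Bseq_def by auto
  have "f n \<le> B * real n ^ e" if n: "n > 0" for n
    using B[of n] n by (simp add: pos_divide_le_eq abs_le_iff)
  then have "\<forall>\<^sub>F n in sequentially. f n \<le> B * real n ^ e"
    unfolding eventually_sequentially by (intro exI[of _ 1]) auto
  then show ?thesis by blast
qed

text \<open>A nonnegative function of this kind that is bounded by a multiple of \<open>n\<^sup>e\<close> has no terms of
  degree above \<open>e\<close>: otherwise the quotient by the top power would tend to a nonzero limit.\<close>

lemma binpoly_reduce:
  assumes "binpoly r f" and nn: "\<forall>\<^sub>F n in sequentially. 0 \<le> f n"
    and b: "\<forall>\<^sub>F n in sequentially. f n \<le> B * real n ^ e"
  shows "binpoly (Suc e) f"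
  using assms(1)
proof (induction r)
  case 0
  then have "\<forall>\<^sub>F n in sequentially. f n = (\<Sum>i<Suc e. 0 * real (n choose i))"
    by (simp add: binpoly_def)
  then show ?case unfolding binpoly_def by (intro exI[of _ "\<lambda>_. 0"])
next
  case (Suc r)
  then obtain c where c: "\<forall>\<^sub>F n in sequentially. f n = (\<Sum>i<Suc r. c i * real (n choose i))"
    unfolding binpoly_def by blast
  show ?case
  proof (cases "r \<le> e")
    case True
    have "(\<Sum>i<Suc e. (if i < Suc r then c i else 0) * real (n choose i)) =
        (\<Sum>i<Suc r. c i * real (n choose i))" for n
      using True by (intro sum.mono_neutral_cong_right) auto
    then show ?thesis using c unfolding binpoly_def
      by (intro exI[of _ "\<lambda>i. if i < Suc r then c i else 0"]) simp
  next
    case False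
    have "(\<lambda>n. f n / real n ^ r) \<longlonglongrightarrow> c r / fact r"
      by (rule Lim_transform_eventually[OF binomial_sum_asymptotics])
         (use c in eventually_elim, simp)
    moreover have "(\<lambda>n. f n / real n ^ r) \<longlonglongrightarrow> 0"
    proof (rule tendsto_sandwich[OF _ _ tendsto_const])
      show "\<forall>\<^sub>F n in sequentially. 0 \<le> f n / real n ^ r"
        using nn by eventually_elim simp
      have bnd: "f n / real n ^ r \<le> B * (inverse (real n)) ^ (r - e)"
        if "n > 0" "f n \<le> B * real n ^ e" for n
      proof -
        have "f n / real n ^ r \<le> B * real n ^ e / real n ^ r"
          using that by (intro divide_right_mono) auto
        also have "\<dots> = B * (inverse (real n)) ^ (r - e)"
          using power_add[of "real n" e "r - e"] False that by (simp add: field_simps power_inverse)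
        finally show ?thesis .
      qed
      show "\<forall>\<^sub>F n in sequentially. f n / real n ^ r \<le> B * (inverse (real n)) ^ (r - e)"
        using b eventually_gt_at_top[of "0::nat"] by eventually_elim (rule bnd)
      have "(\<lambda>n. B * (inverse (real n)) ^ (r - e)) \<longlonglongrightarrow> B * 0 ^ (r - e)"
        by (intro tendsto_intros lim_inverse_n)
      then show "(\<lambda>n. B * (inverse (real n)) ^ (r - e)) \<longlonglongrightarrow> 0" using False by (simp add: power_0_left)
    qed
    ultimately have "c r / fact r = 0" by (rule LIMSEQ_unique)
    then have "c r = 0" by simp
    then have "binpoly r f" using c unfolding binpoly_def by auto
    then show ?thesis by (rule Suc.IH)
  qed
qed

section \<open>Hilbert functions and the Artin--Rees lemma\<close>

context module
begin

abbreviation len :: "'c set \<Rightarrow> 'c set \<Rightarrow> real"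
  where "len H L \<equiv> real (the_enat (ilen R M H L))"

lemma len_add:
  assumes "submodule H R M" "submodule L R M" "submodule P R M" "H \<subseteq> L" "L \<subseteq> P"
    and "ilen R M H P < \<infinity>"
  shows "len H P = len H L + len L P"
  using ilen_add[OF assms(1-5)] assms(6)
  by (cases "ilen R M H L"; cases "ilen R M L P") auto

text \<open>The classical induction on the number of variables: multiplication by \<open>x\<close> maps the component of degree \<open>n\<close>
  to the next one, and its kernel and cokernel are annihilated by \<open>x\<close>, hence are finitely generated graded
  modules over the remaining variables. The difference of consecutive lengths is therefore known by the induction
  hypothesis. That the kernel is finitely generated is Hilbert's basis theorem.\<close>

theorem hilbert_serre:
  assumes "finite U" "U \<subseteq> carrier R" "system R M U P" "system R M U Q" "\<And>n. Q n \<subseteq> P n"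
    and "\<And>n. acc (subs R M (Q n) (P n))" "eventually_generated R M U P Q"
    and "\<And>n. ilen R M (Q n) (P n) < \<infinity>"
  shows "binpoly (card U) (\<lambda>n. len (Q n) (P n))"
  using assms
proof (induction U arbitrary: P Q rule: finite_induct)
  case empty
  then obtain c where c: "\<And>n. n \<ge> c \<Longrightarrow> P (Suc n) \<subseteq> sprod R M {} (P n) <+>\<^bsub>M\<^esub> Q (Suc n)"
    unfolding eventually_generated_def by blast
  have "len (Q n) (P n) = 0" if n: "n \<ge> Suc c" for n
  proof -
    obtain m where m: "n = Suc m" "m \<ge> c" using n by (cases n) auto
    have "sprod R M {} (P m) \<subseteq> {\<zero>\<^bsub>M\<^esub>}" by (rule sprod_least[OF zero_submodule]) auto
    then have "P n \<subseteq> Q n"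
      using c[OF m(2)] sum_least[OF systemD(1)[OF empty(3)], of "{\<zero>\<^bsub>M\<^esub>}" n "Q n"]
        sub_zero[OF systemD(1)[OF empty(3)], of n] m(1) sum_mono[of "sprod R M {} (P m)" "{\<zero>\<^bsub>M\<^esub>}" "Q n" "Q n"]
      by auto
    then have "P n = Q n" using empty(4)[of n] by auto
    then show ?thesis by (simp add: ilen_self zero_enat_def)
  qed
  then show ?case by (auto simp: binpoly_def eventually_sequentially intro!: exI[of _ "Suc c"])
next
  case (insert x U)
  have x: "x \<in> carrier R" and U: "U \<subseteq> carrier R" using insert.prems(1) by auto
  note sP = insert.prems(2) and sQ = insert.prems(3) and le = insert.prems(4)
    and ac = insert.prems(5) and fin = insert.prems(7)
  note P = systemD(1)[OF sP] and Q = systemD(1)[OF sQ]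
  interpret MM: module_pair R M M by (rule self_pair)
  obtain c where c: "\<And>n. n \<ge> c \<Longrightarrow> P (Suc n) \<subseteq> sprod R M (insert x U) (P n) <+>\<^bsub>M\<^esub> Q (Suc n)"
    using insert.prems(6) unfolding eventually_generated_def by blast
  \<comment> \<open>kernel and cokernel of multiplication by the variable \<open>x\<close> on the associated graded module\<close>
  define Ke where "Ke n = {p \<in> P n. x \<odot>\<^bsub>M\<^esub> p \<in> Q (Suc n)}" for n
  define Im where "Im n = (\<lambda>p. x \<odot>\<^bsub>M\<^esub> p) ` P n <+>\<^bsub>M\<^esub> Q (Suc n)" for n
  have xP: "submodule ((\<lambda>p. x \<odot>\<^bsub>M\<^esub> p) ` P n) R M" for n by (rule scaled_submodule(1)[OF x P])
  have Im: "submodule (Im n) R M" for n unfolding Im_def by (rule sum_submodule[OF xP Q])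
  have ImP: "Im n \<subseteq> P (Suc n)" for n
    unfolding Im_def using systemD(2)[OF sP, of x] le by (intro sum_least P) auto
  have QIm: "Q (Suc n) \<subseteq> Im n" for n unfolding Im_def by (rule sum_upper2[OF xP Q])
  have Ke: "submodule (Ke n) R M" for n
    unfolding Ke_def by (rule MM.vimage_submodule[OF P scaled_submodule(2)[OF x P] Q])
  have QKe: "Q n \<subseteq> Ke n" for n
    unfolding Ke_def using systemD(2)[OF sQ, of x] le[of n] by auto
  have KeP: "Ke n \<subseteq> P n" for n unfolding Ke_def by auto
  have sKe: "system R M (insert x U) Ke"
    unfolding system_def
  proof (intro conjI allI ballI)
    show "submodule (Ke n) R M" for n by (rule Ke)
    fix y n p assume y: "y \<in> insert x U" and p: "p \<in> Ke n"
    have "y \<odot>\<^bsub>M\<^esub> (x \<odot>\<^bsub>M\<^esub> p) \<in> Q (Suc (Suc n))"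
      using systemD(2)[OF sQ y] p by (simp add: Ke_def)
    moreover have "y \<odot>\<^bsub>M\<^esub> (x \<odot>\<^bsub>M\<^esub> p) = x \<odot>\<^bsub>M\<^esub> (y \<odot>\<^bsub>M\<^esub> p)"
      using y U x sub_carr[OF Ke p] by (intro smult_comm) auto
    ultimately show "y \<odot>\<^bsub>M\<^esub> p \<in> Ke (Suc n)"
      using systemD(2)[OF sP y] p by (simp add: Ke_def)
  qed
  have "eventually_generated R M (insert x U) Ke Q"
    by (rule subsystem_generated[OF _ insert.prems(1) sP sQ sKe QKe KeP ac insert.prems(6)])
       (simp add: insert.hyps(1))
  then obtain c' where c': "\<And>n. n \<ge> c' \<Longrightarrow> Ke (Suc n) \<subseteq> sprod R M (insert x U) (Ke n) <+>\<^bsub>M\<^esub> Q (Suc n)"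
    unfolding eventually_generated_def by blast
  have genKe: "eventually_generated R M U Ke Q"
    unfolding eventually_generated_def
  proof (intro exI[of _ c'] allI impI)
    fix n assume n: "n \<ge> c'"
    have s: "submodule (sprod R M U (Ke n)) R M"
      using U sub_carr[OF Ke] by (intro sprod_submodule) auto
    have "(\<lambda>p. x \<odot>\<^bsub>M\<^esub> p) ` Ke n \<subseteq> Q (Suc n)" unfolding Ke_def by auto
    then have "sprod R M (insert x U) (Ke n) \<subseteq> Q (Suc n) <+>\<^bsub>M\<^esub> sprod R M U (Ke n)"
      unfolding sprod_insert[OF x U Ke] by (intro sum_mono) auto
    also have "\<dots> \<subseteq> sprod R M U (Ke n) <+>\<^bsub>M\<^esub> Q (Suc n)"
      by (intro sum_least sum_submodule s Q sum_upper1 sum_upper2)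
    finally have "sprod R M (insert x U) (Ke n) \<subseteq> sprod R M U (Ke n) <+>\<^bsub>M\<^esub> Q (Suc n)" .
    then have "sprod R M (insert x U) (Ke n) <+>\<^bsub>M\<^esub> Q (Suc n) \<subseteq> sprod R M U (Ke n) <+>\<^bsub>M\<^esub> Q (Suc n)"
      by (intro sum_least sum_submodule s Q sum_upper2)
    then show "Ke (Suc n) \<subseteq> sprod R M U (Ke n) <+>\<^bsub>M\<^esub> Q (Suc n)" using c'[OF n] by blast
  qed
  have genIm: "eventually_generated R M U (\<lambda>n. P (Suc n)) Im"
    unfolding eventually_generated_def
  proof (intro exI[of _ c] allI impI)
    fix n assume n: "n \<ge> c"
    let ?s = "sprod R M U (P (Suc n))"
    have s: "submodule ?s R M" using U sub_carr[OF P] by (intro sprod_submodule) auto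
    have T: "submodule (?s <+>\<^bsub>M\<^esub> Im (Suc n)) R M" by (rule sum_submodule[OF s Im])
    have I: "Im (Suc n) \<subseteq> ?s <+>\<^bsub>M\<^esub> Im (Suc n)" by (rule sum_upper2[OF s Im])
    have "(\<lambda>p. x \<odot>\<^bsub>M\<^esub> p) ` P (Suc n) \<subseteq> Im (Suc n)" unfolding Im_def by (rule sum_upper1[OF xP Q])
    then have "sprod R M (insert x U) (P (Suc n)) \<subseteq> ?s <+>\<^bsub>M\<^esub> Im (Suc n)"
      unfolding sprod_insert[OF x U P] using I sum_upper1[OF s Im] by (intro sum_least[OF T]) auto
    then have "sprod R M (insert x U) (P (Suc n)) <+>\<^bsub>M\<^esub> Q (Suc (Suc n)) \<subseteq> ?s <+>\<^bsub>M\<^esub> Im (Suc n)"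
      using I QIm[of "Suc n"] by (intro sum_least[OF T]) auto
    then show "P (Suc (Suc n)) \<subseteq> ?s <+>\<^bsub>M\<^esub> Im (Suc n)" using c[of "Suc n"] n by auto
  qed
  have sIm: "system R M U Im"
    unfolding system_def
  proof (intro conjI allI ballI)
    show "submodule (Im n) R M" for n by (rule Im)
    fix y n q assume y: "y \<in> U" and "q \<in> Im n"
    then obtain p e where pe: "p \<in> P n" "e \<in> Q (Suc n)" "q = x \<odot>\<^bsub>M\<^esub> p \<oplus>\<^bsub>M\<^esub> e"
      by (auto simp: Im_def mem_sum_iff)
    have c: "p \<in> carrier M" "e \<in> carrier M" "y \<in> carrier R"
      using sub_carr[OF P pe(1)] sub_carr[OF Q pe(2)] y U by auto
    have "y \<odot>\<^bsub>M\<^esub> q = x \<odot>\<^bsub>M\<^esub> (y \<odot>\<^bsub>M\<^esub> p) \<oplus>\<^bsub>M\<^esub> y \<odot>\<^bsub>M\<^esub> e"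
      unfolding pe(3) using c x by (simp add: smult_r_distr smult_comm[of x y])
    moreover have "y \<odot>\<^bsub>M\<^esub> p \<in> P (Suc n)" "y \<odot>\<^bsub>M\<^esub> e \<in> Q (Suc (Suc n))"
      using systemD(2)[OF sP _ pe(1), of y] systemD(2)[OF sQ _ pe(2), of y] y by auto
    ultimately show "y \<odot>\<^bsub>M\<^esub> q \<in> Im (Suc n)"
      unfolding Im_def by (simp only:) (intro sum_memI imageI)
  qed
  have fin1: "ilen R M (Q n) (Ke n) < \<infinity>" for n
    using ilen_mono[OF Q Q P Ke order_refl QKe KeP] fin[of n] by (meson le_less_trans)
  have fin2: "ilen R M (Im n) (P (Suc n)) < \<infinity>" for n
    using ilen_mono[OF Q Im P P QIm ImP order_refl] fin[of "Suc n"] by (meson le_less_trans)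
  have b1: "binpoly (card U) (\<lambda>n. len (Q n) (Ke n))"
    by (rule insert.IH[OF U system_subset[OF sKe] system_subset[OF sQ] QKe _ genKe fin1])
       (auto intro: acc_subs_mono[OF ac order_refl KeP])
  have b2: "binpoly (card U) (\<lambda>n. len (Im n) (P (Suc n)))"
    by (rule insert.IH[OF U _ sIm ImP _ genIm fin2])
       (use sP acc_subs_mono[OF ac QIm order_refl] in \<open>auto simp: system_def\<close>)
  have "len (Q (Suc n)) (P (Suc n)) - len (Q n) (P n) = len (Im n) (P (Suc n)) - len (Q n) (Ke n)" for n
  proof -
    have "ilen R M (Ke n) (P n) = ilen R M (Q (Suc n)) (Im n)"
    proof (rule MM.ilen_iso[OF P Im KeP Q QIm scaled_submodule(2)[OF x P]])
      show "(\<lambda>p. x \<odot>\<^bsub>M\<^esub> p) ` P n \<subseteq> Im n" unfolding Im_def by (rule sum_upper1[OF xP Q])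
    qed (auto simp: Im_def Ke_def)
    moreover have "len (Q n) (P n) = len (Q n) (Ke n) + len (Ke n) (P n)"
      by (rule len_add[OF Q Ke P QKe KeP fin])
    moreover have "len (Q (Suc n)) (P (Suc n)) = len (Q (Suc n)) (Im n) + len (Im n) (P (Suc n))"
      by (rule len_add[OF Q Im P QIm ImP fin])
    ultimately show ?thesis by simp
  qed
  then have "binpoly (card U) (\<lambda>n. len (Q (Suc n)) (P (Suc n)) - len (Q n) (P n))"
    using binpoly_diff[OF b2 b1] by simp
  then show ?case using binpoly_summation[of "card U" "\<lambda>n. len (Q n) (P n)"] insert.hyps by simp
qed

end

text \<open>The submodule \<open>I\<^sup>n P\<close>, with \<open>I\<close> allowed to be a mere set of generators of an ideal.\<close>

definition spow :: "('a, 'r) ring_scheme \<Rightarrow> ('a, 'b, 'm) module_scheme \<Rightarrow> 'a set \<Rightarrow> nat \<Rightarrow> 'b set \<Rightarrow> 'b set"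
  where "spow R M I n = (sprod R M I ^^ n)"

context module
begin

lemma spow_0 [simp]: "spow R M I 0 P = P"
  and spow_Suc: "spow R M I (Suc n) P = sprod R M I (spow R M I n P)"
  and spow_add: "spow R M I (m + n) P = spow R M I m (spow R M I n P)"
  by (simp_all add: spow_def funpow_add)

lemma spow_submodule: "I \<subseteq> carrier R \<Longrightarrow> submodule P R M \<Longrightarrow> submodule (spow R M I n P) R M"
proof (induction n)
  case (Suc n)
  then show ?case unfolding spow_Suc by (intro sprod_submodule) (auto simp: sub_carr)
qed simp

lemma spow_mono: "I \<subseteq> J \<Longrightarrow> P \<subseteq> P' \<Longrightarrow> spow R M I n P \<subseteq> spow R M J n P'"
proof (induction n)
  case (Suc n)
  then show ?case unfolding spow_Suc by (intro sprod_mono) simp_all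
qed simp

lemma spow_sub: "I \<subseteq> carrier R \<Longrightarrow> submodule P R M \<Longrightarrow> spow R M I n P \<subseteq> P"
proof (induction n)
  case (Suc n)
  then show ?case unfolding spow_Suc using sprod_sub[OF Suc(2) spow_submodule[OF Suc(2,3)], of n] by blast
qed simp

lemma spow_decseq: "I \<subseteq> carrier R \<Longrightarrow> submodule P R M \<Longrightarrow> m \<le> n \<Longrightarrow> spow R M I n P \<subseteq> spow R M I m P"
  using spow_sub[OF _ spow_submodule, of I I P "n - m" m] by (simp flip: spow_add)

lemma spow_system:
  "I \<subseteq> carrier R \<Longrightarrow> submodule P R M \<Longrightarrow> system R M I (\<lambda>n. spow R M I n P)"
  by (auto simp: system_def spow_submodule spow_Suc sprod_memI)

lemma const_system: "submodule H R M \<Longrightarrow> U \<subseteq> carrier R \<Longrightarrow> system R M U (\<lambda>_. H)"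
  by (auto simp: system_def sub_smult)

lemma Int_system: "system R M U P \<Longrightarrow> system R M U Q \<Longrightarrow> system R M U (\<lambda>n. P n \<inter> Q n)"
  unfolding system_def by (simp add: Int_submodule)

text \<open>The intersections \<open>K \<inter> U\<^sup>nM\<close> form a subsystem of the system of all \<open>U\<^sup>nM\<close>, which is generated in degree
  zero.\<close>

theorem artin_rees:
  assumes U: "finite U" "U \<subseteq> carrier R" and K: "submodule K R M"
    and noeth: "acc (subs R M {\<zero>\<^bsub>M\<^esub>} (carrier M))"
  shows "\<exists>c. (\<forall>n\<ge>c. K \<inter> spow R M U (Suc n) (carrier M) \<subseteq> sprod R M U (K \<inter> spow R M U n (carrier M))) \<and>
    (\<forall>j. K \<inter> spow R M U (c + j) (carrier M) \<subseteq> spow R M U j K)"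
proof -
  let ?P = "\<lambda>n. spow R M U n (carrier M)" and ?K = "\<lambda>n. K \<inter> spow R M U n (carrier M)"
  have sP: "system R M U ?P" by (rule spow_system[OF U(2) carrier_is_submodule])
  have sK: "system R M U ?K" by (rule Int_system[OF const_system[OF K U(2)] sP])
  have "eventually_generated R M U ?K (\<lambda>_. {\<zero>\<^bsub>M\<^esub>})"
  proof (rule subsystem_generated[OF U sP const_system[OF zero_submodule U(2)] sK])
    show "{\<zero>\<^bsub>M\<^esub>} \<subseteq> ?K n" for n using sub_zero[OF systemD(1)[OF sK]] by simp
    show "acc (subs R M {\<zero>\<^bsub>M\<^esub>} (?P n))" for n
      by (rule acc_subs_mono[OF noeth order_refl spow_sub[OF U(2) carrier_is_submodule]])
    have "?P (Suc n) \<subseteq> sprod R M U (?P n) <+>\<^bsub>M\<^esub> {\<zero>\<^bsub>M\<^esub>}" for n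
      unfolding spow_Suc by (intro sum_upper1 zero_submodule sprod_submodule U(2))
        (use sub_carr[OF systemD(1)[OF sP]] in blast)
    then show "eventually_generated R M U ?P (\<lambda>_. {\<zero>\<^bsub>M\<^esub>})" unfolding eventually_generated_def by blast
  qed auto
  then obtain c where c: "\<And>n. n \<ge> c \<Longrightarrow> ?K (Suc n) \<subseteq> sprod R M U (?K n) <+>\<^bsub>M\<^esub> {\<zero>\<^bsub>M\<^esub>}"
    unfolding eventually_generated_def by blast
  have "submodule (sprod R M U (?K n)) R M" for n
    using sub_carr[OF systemD(1)[OF sK]] by (intro sprod_submodule U(2)) auto
  then have "sprod R M U (?K n) <+>\<^bsub>M\<^esub> {\<zero>\<^bsub>M\<^esub>} = sprod R M U (?K n)" for n
    by (intro sum_absorb zero_submodule) (auto dest: sub_zero)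
  then have c': "?K (Suc n) \<subseteq> sprod R M U (?K n)" if "n \<ge> c" for n using c[OF that] by simp
  have "?K (c + j) \<subseteq> spow R M U j K" for j
  proof (induction j)
    case (Suc j)
    have "?K (c + Suc j) \<subseteq> sprod R M U (?K (c + j))" using c'[of "c + j"] by simp
    also have "\<dots> \<subseteq> spow R M U (Suc j) K" unfolding spow_Suc by (rule sprod_mono[OF order_refl Suc])
    finally show ?case .
  qed simp
  then show ?thesis using c' by blast
qed

end

section \<open>Ideals as submodules, and the chain condition over Noetherian rings\<close>

context cring
begin

lemma self_module: "module R (self_module R)"
proof (rule moduleI)
  show "abelian_group (self_module R)"
  proof (rule abelian_groupI)
    show "\<exists>y\<in>carrier (self_module R). y \<oplus>\<^bsub>self_module R\<^esub> x = \<zero>\<^bsub>self_module R\<^esub>"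
      if "x \<in> carrier (self_module R)" for x
      using that by (auto simp: self_module_def l_neg intro!: bexI[of _ "\<ominus> x"])
  qed (auto simp: self_module_def a_ac)
qed (auto simp: self_module_def l_distr r_distr m_assoc is_cring)

lemma self_module_sel [simp]:
  "carrier (self_module R) = carrier R" "ring.add (self_module R) = ring.add R"
  "ring.zero (self_module R) = \<zero>" "smult (self_module R) = monoid.mult R"
  by (simp_all add: self_module_def)

lemma self_submodule_iff: "submodule H R (self_module R) \<longleftrightarrow> ideal H R"
proof
  interpret S: module R "self_module R" by (rule self_module)
  assume H: "submodule H R (self_module R)"
  show "ideal H R"
  proof (rule idealI)
    have "\<ominus> a \<in> H" if "a \<in> H" for a
      using S.sub_smult[OF H _ that, of "\<ominus> \<one>"] S.sub_carr[OF H that] by (simp add: l_minus)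
    then show "subgroup H (add_monoid R)"
      using S.submoduleE(1,2)[OF H] S.sub_add[OF H] by (intro add.subgroupI) (auto simp: a_inv_def)
    show l: "x \<otimes> a \<in> H" if "a \<in> H" "x \<in> carrier R" for a x using S.sub_smult[OF H that(2,1)] by simp
    show "a \<otimes> x \<in> H" if "a \<in> H" "x \<in> carrier R" for a x
      using l[OF that] m_comm[OF that(2), of a] S.sub_carr[OF H that(1)] by simp
  qed (rule ring_axioms)
next
  interpret S: module R "self_module R" by (rule self_module)
  assume "ideal H R"
  then interpret ideal H R .
  show "submodule H R (self_module R)"
    by (rule S.submoduleI') (use Icarr I_l_closed in auto)
qed

lemma gen_submodule_self: "gen_submodule R (self_module R) S = Idl S"
  unfolding gen_submodule_def genideal_def self_submodule_iff ..

lemma colon_ideal: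
  assumes "ideal I R" "y \<in> carrier R" shows "ideal {v \<in> carrier R. y \<otimes> v \<in> I} R"
proof -
  interpret S: module R "self_module R" by (rule self_module)
  interpret SS: module_pair R "self_module R" "self_module R" by (rule S.self_pair)
  show ?thesis
    using SS.vimage_submodule[OF S.carrier_is_submodule
        S.scaled_submodule(2)[OF assms(2) S.carrier_is_submodule], of I] assms(1)
    by (simp add: self_submodule_iff)
qed

text \<open>This makes the exclusion argument of \<open>exists_prime\<close> work: if \<open>ab \<in> I\<close> then \<open>(I + (a)) (I + (b)) \<subseteq> I\<close>.\<close>

lemma Idl_insert_prod:
  assumes I: "ideal I R" and a: "a \<in> carrier R" and b: "b \<in> carrier R" and ab: "a \<otimes> b \<in> I"
    and u: "u \<in> Idl (insert a I)" and v: "v \<in> Idl (insert b I)"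
  shows "u \<otimes> v \<in> I"
proof -
  interpret ideal I R by (rule I)
  have "insert b I \<subseteq> {v \<in> carrier R. a \<otimes> v \<in> I}" using a b ab Icarr I_l_closed by auto
  then have "Idl (insert b I) \<subseteq> {v \<in> carrier R. a \<otimes> v \<in> I}"
    by (rule genideal_minimal[OF colon_ideal[OF I a]])
  then have v': "v \<in> carrier R" "a \<otimes> v \<in> I" using v by auto
  have "insert a I \<subseteq> {u \<in> carrier R. v \<otimes> u \<in> I}" using a v' Icarr I_l_closed by (auto simp: m_comm)
  then have "Idl (insert a I) \<subseteq> {u \<in> carrier R. v \<otimes> u \<in> I}"
    by (rule genideal_minimal[OF colon_ideal[OF I v'(1)]])
  then show ?thesis using u v'(1) by (auto simp: m_comm)
qed

lemma Idl_insert_ideal: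
  assumes "ideal I R" "a \<in> carrier R"
  shows "ideal (Idl (insert a I)) R" "I \<subseteq> Idl (insert a I)" "a \<in> Idl (insert a I)"
proof -
  have "insert a I \<subseteq> carrier R" using assms ideal.Icarr[OF assms(1)] by auto
  then show "ideal (Idl (insert a I)) R" "I \<subseteq> Idl (insert a I)" "a \<in> Idl (insert a I)"
    using genideal_ideal genideal_self[of "insert a I"] by auto
qed

end

locale noetherian_cring = cring + assumes noetherian: "noetherian_ring R"
begin

lemma acc_ideals: "acc {I. ideal I R}"
  unfolding acc_def
proof (intro allI impI)
  fix C :: "nat \<Rightarrow> 'a set" assume C: "\<forall>i. C i \<in> {I. ideal I R} \<and> C i \<subseteq> C (Suc i)"
  have mono: "C i \<subseteq> C j" if "i \<le> j" for i j
    by (rule lift_Suc_mono_le[OF _ that]) (use C in blast)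
  have ch: "subset.chain {I. ideal I R} (range C)"
    unfolding subset_chain_def using C mono nat_le_linear by (auto, blast)
  have "\<Union> (range C) \<in> range C"
    by (rule noetherian_ring.ideal_chain_is_trivial[OF noetherian _ ch]) simp
  then obtain k where k: "\<Union> (range C) = C k" by auto
  have "C i = C k" if "i \<ge> k" for i
    using k mono[OF that] by blast
  then show "\<exists>k. \<forall>i\<ge>k. C i = C k" by blast
qed

lemma acc_self: "acc (subs R (self_module R) {\<zero>} (carrier R))"
  by (rule acc_embed[of _ "\<lambda>H. H", OF _ _ _ acc_ideals]) (auto simp: subs_def self_submodule_iff)

text \<open>An ideal maximal with respect to not being good is prime, for any notion of goodness that
  passes from two ideals to every ideal containing their product.\<close>

lemma exists_prime:
  assumes bad: "ideal I R" "\<not> G I" and top: "G (carrier R)"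
    and G: "\<And>I J1 J2. ideal I R \<Longrightarrow> ideal J1 R \<Longrightarrow> ideal J2 R \<Longrightarrow> G J1 \<Longrightarrow> G J2 \<Longrightarrow>
      (\<And>u v. u \<in> J1 \<Longrightarrow> v \<in> J2 \<Longrightarrow> u \<otimes> v \<in> I) \<Longrightarrow> G I"
  shows "\<exists>p. primeideal p R \<and> I \<subseteq> p \<and> \<not> G p"
proof -
  obtain p where p: "ideal p R" "\<not> G p" "I \<subseteq> p"
    and max: "\<And>J. ideal J R \<Longrightarrow> \<not> G J \<Longrightarrow> p \<subseteq> J \<Longrightarrow> J = p"
    using acc_maximal[OF acc_ideals, of I "\<lambda>J. \<not> G J"] bad by auto
  have "primeideal p R"
  proof (rule primeidealI[OF p(1) is_cring])
    show "carrier R \<noteq> p" using p(2) top by auto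
    fix a b assume a: "a \<in> carrier R" and b: "b \<in> carrier R" and ab: "a \<otimes> b \<in> p"
    show "a \<in> p \<or> b \<in> p"
    proof (rule ccontr)
      assume n: "\<not> (a \<in> p \<or> b \<in> p)"
      have "G (Idl (insert a p))"
        using max[OF Idl_insert_ideal(1)[OF p(1) a]] Idl_insert_ideal(2,3)[OF p(1) a] n by auto
      moreover have "G (Idl (insert b p))"
        using max[OF Idl_insert_ideal(1)[OF p(1) b]] Idl_insert_ideal(2,3)[OF p(1) b] n by auto
      ultimately have "G p"
        by (rule G[OF p(1) Idl_insert_ideal(1)[OF p(1) a] Idl_insert_ideal(1)[OF p(1) b]])
           (rule Idl_insert_prod[OF p(1) a b ab])
      then show False using p(2) by simp
    qed
  qed
  then show ?thesis using p by blast
qed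

lemma exists_maximal:
  assumes "ideal I R" "I \<noteq> carrier R"
  shows "\<exists>J. maximalideal J R \<and> I \<subseteq> J"
proof -
  obtain J where J: "ideal J R" "J \<noteq> carrier R" "I \<subseteq> J"
    and max: "\<And>L. ideal L R \<Longrightarrow> L \<noteq> carrier R \<Longrightarrow> J \<subseteq> L \<Longrightarrow> L = J"
    using acc_maximal[OF acc_ideals, of I "\<lambda>J. J \<noteq> carrier R"] assms by auto
  have "maximalideal J R"
    by (rule maximalidealI[OF J(1)]) (use J max in auto)
  then show ?thesis using J by blast
qed

end

context module
begin

lemma gen_submodule_empty: "gen_submodule R M {} = {\<zero>\<^bsub>M\<^esub>}"
  by (intro equalityI gen_submodule_least zero_submodule)
     (use sub_zero[OF gen_submodule_submodule[of "{}"]] in auto)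

lemma span_one:
  assumes "s \<in> carrier M"
  shows "linear_on R (self_module R) (carrier R) M (\<lambda>a. a \<odot>\<^bsub>M\<^esub> s)"
  by (rule linear_onI) (use assms in \<open>auto simp: smult_l_distr smult_assoc1\<close>)

lemma gen_insert_le:
  assumes s: "s \<in> carrier M" and S: "S \<subseteq> carrier M"
  shows "gen_submodule R M (insert s S) \<subseteq> (\<lambda>a. a \<odot>\<^bsub>M\<^esub> s) ` carrier R <+>\<^bsub>M\<^esub> gen_submodule R M S"
proof -
  interpret P: module_pair R "self_module R" M by (intro module_pairI self_module module_axioms)
  have 1: "submodule ((\<lambda>a. a \<odot>\<^bsub>M\<^esub> s) ` carrier R) R M"
    using P.image_submodule[OF P.M.carrier_is_submodule _ P.M.carrier_is_submodule] span_one[OF s] by simp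
  have 2: "submodule (gen_submodule R M S) R M" by (rule gen_submodule_submodule[OF S])
  show ?thesis
  proof (rule gen_submodule_least[OF sum_submodule[OF 1 2]])
    have "s = \<one> \<odot>\<^bsub>M\<^esub> s" using s by simp
    then have "s \<in> (\<lambda>a. a \<odot>\<^bsub>M\<^esub> s) ` carrier R" by blast
    then show "insert s S \<subseteq> (\<lambda>a. a \<odot>\<^bsub>M\<^esub> s) ` carrier R <+>\<^bsub>M\<^esub> gen_submodule R M S"
      using sum_upper1[OF 1 2] sum_upper2[OF 1 2] gen_submodule_incl[of S] by blast
  qed
qed

text \<open>Adjoining one generator \<open>s\<close> changes a submodule by a quotient of the ring, through \<open>a \<mapsto> a s\<close>.\<close>

lemma acc_fin_gen:
  assumes R: "acc (subs R (self_module R) {\<zero>} (carrier R))" and fg: "fin_gen R M"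
  shows "acc (subs R M {\<zero>\<^bsub>M\<^esub>} (carrier M))"
proof -
  interpret P: module_pair R "self_module R" M by (intro module_pairI self_module module_axioms)
  have "acc (subs R M {\<zero>\<^bsub>M\<^esub>} (gen_submodule R M S))" if "finite S" "S \<subseteq> carrier M" for S
    using that
  proof (induction S rule: finite_induct)
    case empty
    show ?case unfolding gen_submodule_empty acc_def subs_def by (auto intro!: exI[of _ 0])
  next
    case (insert s S)
    then have c: "s \<in> carrier M" "S \<subseteq> carrier M" by auto
    have sub: "submodule (gen_submodule R M S) R M" "submodule (gen_submodule R M (insert s S)) R M"
      using c by (auto intro!: gen_submodule_submodule)
    have R': "acc (subs R (self_module R) {\<zero>\<^bsub>self_module R\<^esub>} (carrier (self_module R)))"
      using R by simp
    have "acc (subs R M (gen_submodule R M S) (gen_submodule R M (insert s S)))"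
      by (rule P.acc_surj[OF P.M.carrier_is_submodule _ _ _ sub(1) _ R'])
         (use span_one[OF c(1)] gen_insert_le[OF c] c(1) sub_zero[OF sub(1)] in auto)
    then show ?case
      using insert.IH[OF c(2)] sub_zero[OF sub(1)]
      by (intro acc_add[OF zero_submodule sub(1) sub(2)] gen_submodule_mono) auto
  qed
  then show ?thesis using fg unfolding fin_gen_def by metis
qed

lemma acc_imp_fin_gen:
  assumes "acc (subs R M {\<zero>\<^bsub>M\<^esub>} (carrier M))" and H: "submodule H R M"
  shows "\<exists>S\<subseteq>H. finite S \<and> gen_submodule R M S = H"
proof -
  have HM: "H \<subseteq> carrier M" using sub_carr[OF H] by blast
  have "acc (subs R M {\<zero>\<^bsub>M\<^esub>} H)" by (rule acc_subs_mono[OF assms(1) order_refl HM])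
  moreover define fg where "fg L \<longleftrightarrow> (\<exists>S\<subseteq>H. finite S \<and> L = gen_submodule R M S)" for L
  have "{\<zero>\<^bsub>M\<^esub>} \<in> subs R M {\<zero>\<^bsub>M\<^esub>} H" using zero_submodule sub_zero[OF H] by (simp add: subs_def)
  moreover have "fg {\<zero>\<^bsub>M\<^esub>}" unfolding fg_def by (intro exI[of _ "{}"]) (simp add: gen_submodule_empty)
  ultimately obtain L where L: "fg L"
    and Lmax: "\<And>P. P \<in> subs R M {\<zero>\<^bsub>M\<^esub>} H \<Longrightarrow> fg P \<Longrightarrow> L \<subseteq> P \<Longrightarrow> P = L"
    using acc_maximal[of "subs R M {\<zero>\<^bsub>M\<^esub>} H" "{\<zero>\<^bsub>M\<^esub>}" fg] by auto
  from L obtain S where S: "S \<subseteq> H" "finite S" "L = gen_submodule R M S" unfolding fg_def by auto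
  have max: "gen_submodule R M T = gen_submodule R M S" if "T \<subseteq> H" "finite T"
    "gen_submodule R M T \<in> subs R M {\<zero>\<^bsub>M\<^esub>} H" "gen_submodule R M S \<subseteq> gen_submodule R M T" for T
    using Lmax[OF that(3)] that S(3) unfolding fg_def by auto
  have "h \<in> gen_submodule R M S" if h: "h \<in> H" for h
  proof -
    have T: "insert h S \<subseteq> H" "finite (insert h S)" "insert h S \<subseteq> carrier M" using S h HM by auto
    have "gen_submodule R M (insert h S) = gen_submodule R M S"
    proof (rule max[OF T(1,2)])
      show "gen_submodule R M (insert h S) \<in> subs R M {\<zero>\<^bsub>M\<^esub>} H"
        using gen_submodule_submodule[OF T(3)] gen_submodule_least[OF H T(1)] sub_zero
        by (auto simp: subs_def)
      show "gen_submodule R M S \<subseteq> gen_submodule R M (insert h S)" by (rule gen_submodule_mono) auto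
    qed
    then show ?thesis using gen_submodule_incl[of "insert h S"] by auto
  qed
  then show ?thesis using S gen_submodule_least[OF H S(1)] by (intro exI[of _ S]) auto
qed

text \<open>Allows a finite generating set, whose elements are the variables of a graded module, to be
  replaced by the ideal that it generates.\<close>

lemma sprod_Idl:
  assumes S: "S \<subseteq> carrier R" and P: "submodule P R M"
  shows "sprod R M (Idl S) P = sprod R M S P"
proof
  have sub: "submodule (sprod R M S P) R M" using S sub_carr[OF P] by (intro sprod_submodule) auto
  show "sprod R M (Idl S) P \<subseteq> sprod R M S P"
  proof (rule sprod_least[OF sub])
    fix a p assume a: "a \<in> Idl S" and p: "p \<in> P"
    interpret Q: module_pair R "self_module R" M by (intro module_pairI self_module module_axioms)
    have "submodule {a \<in> carrier R. a \<odot>\<^bsub>M\<^esub> p \<in> sprod R M S P} R (self_module R)"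
      using Q.vimage_submodule[OF Q.M.carrier_is_submodule _ sub] span_one[OF sub_carr[OF P p]] by simp
    then have "Idl S \<subseteq> {a \<in> carrier R. a \<odot>\<^bsub>M\<^esub> p \<in> sprod R M S P}"
      using S p by (intro genideal_minimal) (auto simp: self_submodule_iff sprod_memI)
    then show "a \<odot>\<^bsub>M\<^esub> p \<in> sprod R M S P" using a by auto
  qed
qed (rule sprod_mono[OF genideal_self[OF S] order_refl])

lemma spow_Idl:
  assumes S: "S \<subseteq> carrier R" and P: "submodule P R M"
  shows "spow R M (Idl S) n P = spow R M S n P"
proof (induction n)
  case (Suc n)
  then show ?case unfolding spow_Suc using sprod_Idl[OF S spow_submodule[OF S P]] by simp
qed simp

lemma sprod_ideal_prod:
  assumes I: "ideal I R" and J: "ideal J R" and P: "submodule P R M"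
  shows "sprod R M (I \<cdot> J) P = sprod R M I (sprod R M J P)"
proof
  have c: "I \<subseteq> carrier R" "J \<subseteq> carrier R" "I \<cdot> J \<subseteq> carrier R" "P \<subseteq> carrier M"
    using ideal.Icarr[OF I] ideal.Icarr[OF J] ideal_prod_in_carrier[OF I J] sub_carr[OF P] by auto
  have s: "submodule (sprod R M J P) R M" "submodule (sprod R M (I \<cdot> J) P) R M"
    by (auto intro!: sprod_submodule c)
  have s': "submodule (sprod R M I (sprod R M J P)) R M"
    using sub_carr[OF s(1)] by (intro sprod_submodule c) auto
  show "sprod R M (I \<cdot> J) P \<subseteq> sprod R M I (sprod R M J P)"
  proof (rule sprod_least[OF s'])
    fix a p assume a: "a \<in> I \<cdot> J" and p: "p \<in> P"
    have pc: "p \<in> carrier M" using p c by auto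
    from a show "a \<odot>\<^bsub>M\<^esub> p \<in> sprod R M I (sprod R M J P)"
    proof (induction rule: ideal_prod.induct)
      case (prod i j)
      have "(i \<otimes> j) \<odot>\<^bsub>M\<^esub> p = i \<odot>\<^bsub>M\<^esub> (j \<odot>\<^bsub>M\<^esub> p)" using prod c pc by (intro smult_assoc1) auto
      then show ?case using prod p by (auto intro!: sprod_memI)
    next
      case (sum a b)
      have "(a \<oplus> b) \<odot>\<^bsub>M\<^esub> p = a \<odot>\<^bsub>M\<^esub> p \<oplus>\<^bsub>M\<^esub> b \<odot>\<^bsub>M\<^esub> p" using sum(1,2) c pc by (intro smult_l_distr) auto
      then show ?case using sum sub_add[OF s'] by simp
    qed
  qed
  show "sprod R M I (sprod R M J P) \<subseteq> sprod R M (I \<cdot> J) P"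
  proof (rule sprod_least[OF s(2)])
    fix i q assume i: "i \<in> I" and q: "q \<in> sprod R M J P"
    interpret MM: module_pair R M M by (rule self_pair)
    have ic: "i \<in> carrier R" using i c by auto
    have "sprod R M J P \<subseteq> {q \<in> carrier M. i \<odot>\<^bsub>M\<^esub> q \<in> sprod R M (I \<cdot> J) P}"
    proof (rule sprod_least)
      show "submodule {q \<in> carrier M. i \<odot>\<^bsub>M\<^esub> q \<in> sprod R M (I \<cdot> J) P} R M"
        by (rule MM.vimage_submodule[OF carrier_is_submodule scaled_submodule(2)[OF ic carrier_is_submodule] s(2)])
      fix j p assume j: "j \<in> J" and p: "p \<in> P"
      have jc: "j \<in> carrier R" "p \<in> carrier M" using j p c by auto
      have "i \<odot>\<^bsub>M\<^esub> (j \<odot>\<^bsub>M\<^esub> p) = (i \<otimes> j) \<odot>\<^bsub>M\<^esub> p" using ic jc by (simp add: smult_assoc1)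
      then have "i \<odot>\<^bsub>M\<^esub> (j \<odot>\<^bsub>M\<^esub> p) \<in> sprod R M (I \<cdot> J) P"
        using sprod_memI[OF ideal_prod.prod[OF i j] p] by simp
      then show "j \<odot>\<^bsub>M\<^esub> p \<in> {q \<in> carrier M. i \<odot>\<^bsub>M\<^esub> q \<in> sprod R M (I \<cdot> J) P}" using jc by simp
    qed
    then show "i \<odot>\<^bsub>M\<^esub> q \<in> sprod R M (I \<cdot> J) P" using q by auto
  qed
qed

end

context cring
begin

lemma ideal_pow_Suc: "I [^]\<^bsub>ideals_set R\<^esub> Suc n = (I [^]\<^bsub>ideals_set R\<^esub> n) \<cdot> I"
  by (simp add: ideals_set_def)

lemma ideal_pow_0: "I [^]\<^bsub>ideals_set R\<^esub> (0::nat) = carrier R"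
  by (simp add: ideals_set_def)

lemma ideal_pow_ideal: "ideal I R \<Longrightarrow> ideal (I [^]\<^bsub>ideals_set R\<^esub> (n::nat)) R"
  by (induction n) (simp_all only: ideal_pow_0 ideal_pow_Suc oneideal ideal_prod_is_ideal)

end

lemma (in module) sprod_ideal_pow:
  assumes I: "ideal I R" and P: "submodule P R M"
  shows "sprod R M (I [^]\<^bsub>ideals_set R\<^esub> n) P = spow R M I n P"
  using P
proof (induction n arbitrary: P)
  case 0
  have "P \<subseteq> sprod R M (carrier R) P"
  proof
    fix p assume p: "p \<in> P"
    then have "p = \<one> \<odot>\<^bsub>M\<^esub> p" using sub_carr[OF 0] by simp
    then show "p \<in> sprod R M (carrier R) P" using sprod_memI[OF one_closed p] by metis
  qed
  then show ?case using sprod_sub[OF order_refl 0] unfolding ideal_pow_0 spow_0 by blast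
next
  case (Suc n)
  have "I \<subseteq> carrier R" using ideal.Icarr[OF I] by blast
  then have s: "submodule (sprod R M I P) R M" using sub_carr[OF Suc(2)] by (intro sprod_submodule) auto
  show ?case
    unfolding ideal_pow_Suc sprod_ideal_prod[OF ideal_pow_ideal[OF I] I Suc(2)] Suc.IH[OF s]
    using spow_add[of I n 1 P] by (simp add: spow_Suc)
qed

section \<open>Finite length over a Noetherian local ring\<close>

lemma enat_add_finite: "a < \<infinity> \<Longrightarrow> b < \<infinity> \<Longrightarrow> a + b < (\<infinity> :: enat)"
  by (cases a; cases b) auto

locale noetherian_local = noetherian_cring +
  fixes \<mm> assumes local_ring: "local_ring R \<mm>"
begin

lemma maximal: "maximalideal \<mm> R"
  and m_ideal: "ideal \<mm> R"
  and m_sub: "\<mm> \<subseteq> carrier R"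
proof -
  show m: "maximalideal \<mm> R" using local_ring by (simp add: local_ring_def)
  show i: "ideal \<mm> R" using m by (simp add: maximalideal_def)
  show "\<mm> \<subseteq> carrier R" using ideal.Icarr[OF i] by blast
qed

lemma proper_le_m: "ideal I R \<Longrightarrow> I \<noteq> carrier R \<Longrightarrow> I \<subseteq> \<mm>"
  using exists_maximal[of I] local_ring unfolding local_ring_def by metis

lemma ilen_residue_field: "ilen R (self_module R) \<mm> (carrier R) < \<infinity>"
proof -
  have two: "H = \<mm> \<or> H = carrier R" if "H \<in> subs R (self_module R) \<mm> (carrier R)" for H
    using maximalideal.I_maximal[OF maximal, of H] that by (simp add: subs_def self_submodule_iff)
  have "ilen R (self_module R) \<mm> (carrier R) \<le> enat 1"
    unfolding ilen_def chain_length_def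
  proof (rule Sup_least, clarify)
    fix n C assume C: "\<forall>i\<le>n. C i \<in> subs R (self_module R) \<mm> (carrier R)" "\<forall>i<n. C i \<subset> C (Suc i)"
    show "enat n \<le> enat 1"
    proof (rule ccontr)
      assume "\<not> enat n \<le> enat 1"
      then have n: "2 \<le> n" by simp
      have "C 0 \<in> subs R (self_module R) \<mm> (carrier R)" "C 1 \<in> subs R (self_module R) \<mm> (carrier R)"
        "C 2 \<in> subs R (self_module R) \<mm> (carrier R)" using C n by auto
      then have "C 0 = \<mm> \<or> C 0 = carrier R" "C 1 = \<mm> \<or> C 1 = carrier R" "C 2 = \<mm> \<or> C 2 = carrier R"
        using two by blast+
      moreover have "C 0 \<subset> C 1" "C 1 \<subset> C 2" using C n by (auto simp: numeral_2_eq_2)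
      ultimately show False using m_sub by auto
    qed
  qed
  then show ?thesis by (metis enat_ord_code(4) le_less_trans)
qed

end

locale local_module = noetherian_local + module +
  assumes noeth: "acc (subs R M {\<zero>\<^bsub>M\<^esub>} (carrier M))"
begin

text \<open>Each generator that \<open>\<mm>\<close> multiplies into \<open>H\<close> contributes a quotient of the residue field.\<close>

lemma finite_length_residue:
  assumes H: "submodule H R M" and S: "finite S" "S \<subseteq> carrier M"
    and mS: "\<And>a s. a \<in> \<mm> \<Longrightarrow> s \<in> S \<Longrightarrow> a \<odot>\<^bsub>M\<^esub> s \<in> H"
  shows "ilen R M H (H <+>\<^bsub>M\<^esub> gen_submodule R M S) < \<infinity>"
  using S mS
proof (induction S rule: finite_induct)
  case empty
  have "H <+>\<^bsub>M\<^esub> {\<zero>\<^bsub>M\<^esub>} = H" by (rule sum_absorb[OF H zero_submodule]) (use sub_zero[OF H] in simp)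
  then show ?case by (simp add: gen_submodule_empty ilen_self)
next
  case (insert s S)
  interpret P: module_pair R "self_module R" M by (intro module_pairI self_module module_axioms)
  have c: "s \<in> carrier M" "S \<subseteq> carrier M" using insert by auto
  let ?L = "H <+>\<^bsub>M\<^esub> gen_submodule R M S" and ?P = "H <+>\<^bsub>M\<^esub> gen_submodule R M (insert s S)"
  have g: "submodule (gen_submodule R M S) R M" "submodule (gen_submodule R M (insert s S)) R M"
    using c by (auto intro!: gen_submodule_submodule)
  have sub: "submodule ?L R M" "submodule ?P R M" by (auto intro!: sum_submodule H g)
  have le: "H \<subseteq> ?L" "?L \<subseteq> ?P"
    by (rule sum_upper1[OF H g(1)]) (intro sum_mono order_refl gen_submodule_mono subset_insertI)
  have sp: "submodule ((\<lambda>a. a \<odot>\<^bsub>M\<^esub> s) ` carrier R) R M"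
    using P.image_submodule[OF P.M.carrier_is_submodule _ P.M.carrier_is_submodule] span_one[OF c(1)]
    by simp
  have T: "submodule ((\<lambda>a. a \<odot>\<^bsub>M\<^esub> s) ` carrier R <+>\<^bsub>M\<^esub> ?L) R M" by (rule sum_submodule[OF sp sub(1)])
  have "gen_submodule R M (insert s S) \<subseteq> (\<lambda>a. a \<odot>\<^bsub>M\<^esub> s) ` carrier R <+>\<^bsub>M\<^esub> ?L"
    using gen_insert_le[OF c] sum_mono[OF order_refl sum_upper2[OF H g(1)]] by blast
  then have cover: "?P \<subseteq> (\<lambda>a. a \<odot>\<^bsub>M\<^esub> s) ` carrier R <+>\<^bsub>M\<^esub> ?L"
    using le(1) sum_upper2[OF sp sub(1)] by (intro sum_least[OF T]) auto
  have "ilen R M ?L ?P \<le> ilen R (self_module R) \<mm> (carrier (self_module R))"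
    by (rule P.ilen_surj[OF P.M.carrier_is_submodule _ _ _ sub(1)])
       (use span_one[OF c(1)] m_sub insert.prems(2)[of _ s] le(1) cover in auto)
  then have "ilen R M ?L ?P < \<infinity>"
    unfolding self_module_sel using ilen_residue_field by (rule le_less_trans)
  moreover have "ilen R M H ?L < \<infinity>" using insert.IH insert.prems by auto
  ultimately show ?case unfolding ilen_add[OF H sub le] by (rule enat_add_finite[rotated])
qed

lemma finite_length_m:
  assumes H: "submodule H R M" shows "ilen R M (sprod R M \<mm> H) H < \<infinity>"
proof -
  obtain S where S: "S \<subseteq> H" "finite S" "gen_submodule R M S = H"
    using acc_imp_fin_gen[OF noeth H] by blast
  have c: "S \<subseteq> carrier M" using S(1) sub_carr[OF H] by blast
  have s: "submodule (sprod R M \<mm> H) R M" using m_sub sub_carr[OF H] by (intro sprod_submodule) auto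
  have "ilen R M (sprod R M \<mm> H) (sprod R M \<mm> H <+>\<^bsub>M\<^esub> gen_submodule R M S) < \<infinity>"
    by (rule finite_length_residue[OF s S(2) c]) (use S(1) in \<open>auto intro!: sprod_memI\<close>)
  moreover have "sprod R M \<mm> H <+>\<^bsub>M\<^esub> H = H"
    by (intro equalityI sum_least H sprod_sub m_sub order_refl sum_upper2 s)
  ultimately show ?thesis using S(3) by simp
qed

lemmas spow_m_sub = spow_submodule[OF m_sub]

lemma finite_length_spow:
  assumes H: "submodule H R M" shows "ilen R M (spow R M \<mm> n H) H < \<infinity>"
proof (induction n)
  case 0
  show ?case by (simp add: ilen_self)
next
  case (Suc n)
  have "ilen R M (spow R M \<mm> (Suc n) H) H =
      ilen R M (spow R M \<mm> (Suc n) H) (spow R M \<mm> n H) + ilen R M (spow R M \<mm> n H) H"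
    by (intro ilen_add spow_m_sub H spow_decseq m_sub spow_sub) auto
  then show ?case
    using enat_add_finite[OF finite_length_m[OF spow_m_sub[OF H], of n] Suc] by (simp only: spow_Suc)
qed

lemma acc_sub: "submodule H R M \<Longrightarrow> acc (subs R M L H)" if "submodule L R M" for L
  using that by (intro acc_subs_mono[OF noeth]) (auto simp: sub_zero sub_carr)

text \<open>The lengths of \<open>U\<^sup>nH / U\<^sup>n\<^sup>+\<^sup>1H\<close> are covered by \<open>hilbert_serre\<close>, and those of \<open>H / U\<^sup>nH\<close> are obtained
  by summation.\<close>

lemma hilbert_samuel:
  assumes U: "finite U" "U \<subseteq> carrier R" and H: "submodule H R M"
    and fin: "\<And>P. submodule P R M \<Longrightarrow> ilen R M (sprod R M U P) P < \<infinity>"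
  shows "binpoly (Suc (card U)) (\<lambda>n. len (spow R M U n H) H)"
    and "\<And>n. ilen R M (spow R M U n H) H < \<infinity>"
proof -
  let ?P = "\<lambda>n. spow R M U n H"
  have sub: "submodule (?P n) R M" for n by (rule spow_submodule[OF U(2) H])
  show fin': "ilen R M (?P n) H < \<infinity>" for n
  proof (induction n)
    case (Suc n)
    have "ilen R M (?P (Suc n)) H = ilen R M (?P (Suc n)) (?P n) + ilen R M (?P n) H"
      by (intro ilen_add sub H spow_decseq U(2) spow_sub) auto
    then show ?case using enat_add_finite[OF fin[OF sub, of n] Suc] by (simp only: spow_Suc)
  qed (simp add: ilen_self)
  have sys: "system R M U ?P" by (rule spow_system[OF U(2) H])
  have sys': "system R M U (\<lambda>n. ?P (Suc n))" using sys by (simp add: system_def)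
  have gen: "eventually_generated R M U ?P (\<lambda>n. ?P (Suc n))"
    unfolding eventually_generated_def spow_Suc[symmetric]
    by (intro exI[of _ 0] allI impI sum_upper1 sub)
  have "binpoly (card U) (\<lambda>n. len (?P (Suc n)) (?P n))"
    by (rule hilbert_serre[OF U sys sys' spow_decseq[OF U(2) H] acc_sub[OF sub sub] gen
          fin[OF sub, folded spow_Suc]]) simp
  moreover have "len (?P (Suc n)) H - len (?P n) H = len (?P (Suc n)) (?P n)" for n
    using len_add[OF sub sub H spow_decseq[OF U(2) H] spow_sub[OF U(2) H] fin', of n "Suc n"] by simp
  ultimately show "binpoly (Suc (card U)) (\<lambda>n. len (?P n) H)"
    by (intro binpoly_summation) simp
qed

end

section \<open>Parameters of a Cohen--Macaulay local ring\<close>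

context noetherian_cring
begin

text \<open>An ideal maximal among those that miss a multiplicative set is prime.\<close>

lemma primes_avoiding:
  assumes I: "ideal I R" and S: "S \<subseteq> carrier R" "\<one> \<in> S" "\<And>s t. s \<in> S \<Longrightarrow> t \<in> S \<Longrightarrow> s \<otimes> t \<in> S"
    and disj: "I \<inter> S = {}"
  shows "\<exists>p. primeideal p R \<and> I \<subseteq> p \<and> p \<inter> S = {}"
proof -
  have "\<exists>p. primeideal p R \<and> I \<subseteq> p \<and> \<not> (p \<inter> S \<noteq> {})"
  proof (rule exists_prime[OF I])
    show "carrier R \<inter> S \<noteq> {}" using S(1,2) by blast
    fix I J1 J2
    assume "J1 \<inter> S \<noteq> {}" "J2 \<inter> S \<noteq> {}" and prod: "\<And>u v. u \<in> J1 \<Longrightarrow> v \<in> J2 \<Longrightarrow> u \<otimes> v \<in> I"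
    then obtain s t where "s \<in> J1" "s \<in> S" "t \<in> J2" "t \<in> S" by blast
    then have "s \<otimes> t \<in> I \<inter> S" using prod S(3) by blast
    then show "I \<inter> S \<noteq> {}" by blast
  qed (use disj in simp)
  then show ?thesis by simp
qed

text \<open>A prime that avoids all products of powers of \<open>x\<close> with elements outside \<open>p\<close> is contained in \<open>p\<close>
  and does not contain \<open>x\<close>. It exists above \<open>I\<close> because \<open>I\<close> contains none of these products: \<open>x\<close> is
  regular modulo \<open>I\<close>, and cancelling its powers would leave an element of \<open>I\<close> outside \<open>p\<close>.\<close>

lemma regular_step:
  assumes I: "ideal I R" and x: "x \<in> carrier R"
    and reg: "\<And>a. a \<in> carrier R \<Longrightarrow> x \<otimes> a \<in> I \<Longrightarrow> a \<in> I"
    and p: "primeideal p R" and Ip: "I \<subseteq> p" and xp: "x \<in> p"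
  shows "\<exists>q. primeideal q R \<and> I \<subseteq> q \<and> q \<subset> p"
proof -
  interpret primeideal p R by (rule p)
  define S where "S = {a \<otimes> x [^] k | a (k :: nat). a \<in> carrier R \<and> a \<notin> p}"
  have S: "a \<otimes> x [^] k \<in> S" if "a \<in> carrier R" "a \<notin> p" for a and k :: nat
    unfolding S_def using that by blast
  have one: "\<one> \<notin> p" using one_imp_carrier I_notcarr by blast
  have pow: "a \<in> I" if "a \<in> carrier R" "a \<otimes> x [^] (k::nat) \<in> I" for a k
    using that
  proof (induction k)
    case (Suc k)
    have "a \<otimes> x [^] Suc k = x \<otimes> (a \<otimes> x [^] k)" using Suc.prems(1) x by (simp add: m_ac)
    then have "a \<otimes> x [^] k \<in> I" using Suc.prems x reg[of "a \<otimes> x [^] k"] by simp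
    then show ?case using Suc by simp
  qed simp
  have "\<exists>q. primeideal q R \<and> I \<subseteq> q \<and> q \<inter> S = {}"
  proof (rule primes_avoiding[OF I])
    show "S \<subseteq> carrier R" using x by (auto simp: S_def)
    show "\<one> \<in> S" using S[of \<one> 0] one by simp
    show "I \<inter> S = {}" using pow Ip by (auto simp: S_def)
    fix s t assume "s \<in> S" "t \<in> S"
    then obtain a b k l where *: "a \<in> carrier R" "a \<notin> p" "b \<in> carrier R" "b \<notin> p"
      "s = a \<otimes> x [^] (k::nat)" "t = b \<otimes> x [^] (l::nat)" by (auto simp: S_def)
    have "s \<otimes> t = (a \<otimes> b) \<otimes> x [^] (k + l)"
      using * x by (simp add: nat_pow_mult[symmetric] m_ac)
    moreover have "a \<otimes> b \<notin> p" using * I_prime[of a b] by auto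
    ultimately show "s \<otimes> t \<in> S" using * S[of "a \<otimes> b"] by simp
  qed
  then obtain q where q: "primeideal q R" "I \<subseteq> q" "q \<inter> S = {}" by (elim exE conjE)
  have "q \<subseteq> p"
  proof
    fix a assume a: "a \<in> q"
    have c: "a \<in> carrier R" by (rule ideal.Icarr[OF primeideal.axioms(1)[OF q(1)] a])
    show "a \<in> p"
    proof (rule ccontr)
      assume "a \<notin> p"
      then show False using S[OF c, of 0] a q(3) c by auto
    qed
  qed
  moreover have "x \<notin> q"
  proof
    assume "x \<in> q"
    then show False using S[OF one_closed one, of 1] q(3) x by auto
  qed
  ultimately show ?thesis using q xp by blast
qed

lemma seq_submodule_self:
  assumes "set ys \<subseteq> carrier R"
  shows "seq_submodule R (self_module R) ys = Idl (set ys)"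
  unfolding seq_submodule_def gen_submodule_self
proof (rule equalityI)
  interpret I: ideal "Idl (set ys)" R by (rule genideal_ideal[OF assms])
  let ?S = "{a \<odot>\<^bsub>self_module R\<^esub> x | a x. a \<in> set ys \<and> x \<in> carrier (self_module R)}"
  have S: "?S \<subseteq> carrier R" using assms by auto
  show "Idl ?S \<subseteq> Idl (set ys)"
    by (rule genideal_minimal[OF genideal_ideal[OF assms]])
       (use I.I_r_closed genideal_self[OF assms] in auto)
  have "set ys \<subseteq> ?S"
  proof
    fix y assume "y \<in> set ys"
    then have "y = y \<odot>\<^bsub>self_module R\<^esub> \<one>" "y \<in> set ys" using assms by auto
    then show "y \<in> ?S" by (metis (mono_tags, lifting) mem_Collect_eq one_closed self_module_sel(1))
  qed
  then show "Idl (set ys) \<subseteq> Idl ?S"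
    using genideal_self[OF S] by (intro genideal_minimal[OF genideal_ideal[OF S]]) blast
qed

text \<open>A prime that contains a regular sequence of length \<open>i\<close> has height at least \<open>i\<close>: each element of
  the sequence allows one further step down.\<close>

lemma regular_sequence_prime_chain:
  assumes reg: "regular_sequence R (self_module R) xs" and "i \<le> length xs"
    and "primeideal p R" "Idl (set (take i xs)) \<subseteq> p"
  shows "\<exists>P :: nat \<Rightarrow> 'a set. (\<forall>j\<le>i. primeideal (P j) R) \<and> (\<forall>j<i. P j \<subset> P (Suc j)) \<and> P i = p"
  using assms(2-)
proof (induction i arbitrary: p)
  case 0
  then show ?case by (intro exI[of _ "\<lambda>_. p"]) auto
next
  case (Suc i)
  have xs: "set xs \<subseteq> carrier R" using reg by (simp add: regular_sequence_def)
  have i: "i < length xs" using Suc.prems(1) by simp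
  have c: "set (take i xs) \<subseteq> carrier R" "set (take (Suc i) xs) \<subseteq> carrier R" "xs ! i \<in> carrier R"
    using xs i by (auto dest: in_set_takeD)
  have "\<exists>q. primeideal q R \<and> Idl (set (take i xs)) \<subseteq> q \<and> q \<subset> p"
  proof (rule regular_step[OF genideal_ideal[OF c(1)] c(3) _ Suc.prems(2)])
    fix a assume a: "a \<in> carrier R" "(xs ! i) \<otimes> a \<in> Idl (set (take i xs))"
    have "\<forall>i<length xs. \<forall>x\<in>carrier (self_module R).
        (xs ! i) \<odot>\<^bsub>self_module R\<^esub> x \<in> seq_submodule R (self_module R) (take i xs) \<longrightarrow>
        x \<in> seq_submodule R (self_module R) (take i xs)"
      using reg unfolding regular_sequence_def by (elim conjE)
    from this[rule_format, OF i, of a] show "a \<in> Idl (set (take i xs))"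
      using a by (simp add: seq_submodule_self[OF c(1)])
  next
    have "set (take i xs) \<subseteq> set (take (Suc i) xs)" "xs ! i \<in> set (take (Suc i) xs)"
      using i by (auto simp: take_Suc_conv_app_nth)
    then show "Idl (set (take i xs)) \<subseteq> p" "xs ! i \<in> p"
      using Suc.prems(3) subset_Idl_subset[OF c(2)] genideal_self[OF c(2)] by blast+
  qed
  then obtain q where q: "primeideal q R" "Idl (set (take i xs)) \<subseteq> q" "q \<subset> p" by blast
  obtain P where P: "\<forall>j\<le>i. primeideal (P j) R" "\<forall>j<i. P j \<subset> P (Suc j)" "P i = q"
    using Suc.IH[OF _ q(1,2)] i by auto
  show ?case
    by (rule exI[of _ "\<lambda>j. if j \<le> i then P j else p"])
       (use P q Suc.prems(2) in \<open>auto simp: less_Suc_eq le_Suc_eq\<close>)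
qed

end

locale cm_local = noetherian_local +
  fixes d :: nat
  assumes cm: "CM_local_ring R \<mm>" and dim: "krull_dim R = enat d" and d: "d \<ge> 1"
begin

lemma exists_regular_sequence:
  "\<exists>xs. length xs = d \<and> set xs \<subseteq> \<mm> \<and> regular_sequence R (self_module R) xs"
proof (rule ccontr)
  assume neg: "\<not> ?thesis"
  have dp: "depth R \<mm> (self_module R) = enat d" using cm dim by (simp add: CM_local_ring_def)
  have "depth R \<mm> (self_module R) \<le> enat (d - 1)"
    unfolding depth_def
  proof (rule Sup_least, clarify)
    fix xs assume xs: "set xs \<subseteq> \<mm>" "regular_sequence R (self_module R) xs"
    then have "enat (length xs) \<le> depth R \<mm> (self_module R)"
      unfolding depth_def by (intro Sup_upper) auto
    then have "length xs \<le> d" using dp by simp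
    moreover have "length xs \<noteq> d" using neg xs by auto
    ultimately show "enat (length xs) \<le> enat (d - 1)" by simp
  qed
  then show False using dp d by simp
qed

text \<open>The only prime containing a regular sequence of length \<open>d = dim R\<close> is the maximal ideal, since
  any other would produce a chain of primes that is too long. An ideal that contains no power of \<open>\<mm>\<close>
  lies in a prime with the same property, so the ideal generated by the sequence contains such a
  power.\<close>

lemma exists_parameters:
  "\<exists>U. finite U \<and> card U \<le> d \<and> U \<subseteq> \<mm> \<and> (\<exists>k::nat. \<mm> [^]\<^bsub>ideals_set R\<^esub> k \<subseteq> Idl U)"
proof -
  obtain xs where xs: "length xs = d" "set xs \<subseteq> \<mm>" "regular_sequence R (self_module R) xs"
    using exists_regular_sequence by blast
  have c: "set xs \<subseteq> carrier R" using xs(2) m_sub by blast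
  have only: "p = \<mm>" if p: "primeideal p R" "Idl (set xs) \<subseteq> p" for p
  proof (rule ccontr)
    assume "p \<noteq> \<mm>"
    then have lt: "p \<subset> \<mm>"
      using proper_le_m[of p] p(1) by (auto simp: primeideal_def primeideal_axioms_def)
    obtain P where P: "\<forall>j\<le>d. primeideal (P j) R" "\<forall>j<d. P j \<subset> P (Suc j)" "P d = p"
      using regular_sequence_prime_chain[OF xs(3), of d p] xs(1) p by auto
    let ?P = "\<lambda>j. if j \<le> d then P j else \<mm>"
    have "(\<forall>i\<le>Suc d. primeideal (?P i) R) \<and> (\<forall>i<Suc d. ?P i \<subset> ?P (Suc i))"
      using P lt maximalideal_prime[OF maximal] by (auto simp: less_Suc_eq le_Suc_eq)
    then have "enat (Suc d) \<le> krull_dim R"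
      unfolding krull_dim_def by (intro Sup_upper CollectI exI[of _ "Suc d"] conjI refl exI[of _ ?P]) auto
    then show False using dim by simp
  qed
  have "\<exists>k::nat. \<mm> [^]\<^bsub>ideals_set R\<^esub> k \<subseteq> Idl (set xs)"
  proof (rule ccontr)
    assume neg: "\<not> ?thesis"
    have "\<exists>p. primeideal p R \<and> Idl (set xs) \<subseteq> p \<and> \<not> (\<exists>k::nat. \<mm> [^]\<^bsub>ideals_set R\<^esub> k \<subseteq> p)"
    proof (rule exists_prime[where G = "\<lambda>I. \<exists>k::nat. \<mm> [^]\<^bsub>ideals_set R\<^esub> k \<subseteq> I", OF genideal_ideal[OF c] neg])
      show "\<exists>k::nat. \<mm> [^]\<^bsub>ideals_set R\<^esub> k \<subseteq> carrier R"
        by (intro exI[of _ 0]) (simp only: ideal_pow_0 order_refl)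
      fix I J1 J2
      assume I: "ideal I R" and J: "ideal J1 R" "ideal J2 R"
        and "\<exists>k::nat. \<mm> [^]\<^bsub>ideals_set R\<^esub> k \<subseteq> J1" "\<exists>k::nat. \<mm> [^]\<^bsub>ideals_set R\<^esub> k \<subseteq> J2"
        and prod: "\<And>u v. u \<in> J1 \<Longrightarrow> v \<in> J2 \<Longrightarrow> u \<otimes> v \<in> I"
      then obtain k l :: nat where kl: "\<mm> [^]\<^bsub>ideals_set R\<^esub> k \<subseteq> J1" "\<mm> [^]\<^bsub>ideals_set R\<^esub> l \<subseteq> J2" by blast
      have "\<mm> [^]\<^bsub>ideals_set R\<^esub> (k + l) = (\<mm> [^]\<^bsub>ideals_set R\<^esub> k) \<otimes>\<^bsub>ideals_set R\<^esub> (\<mm> [^]\<^bsub>ideals_set R\<^esub> l)"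
        by (rule monoid.nat_pow_mult[symmetric])
           (use ideals_set_is_comm_monoid m_ideal in \<open>auto simp: comm_monoid_def ideals_set_def\<close>)
      also have "\<dots> = (\<mm> [^]\<^bsub>ideals_set R\<^esub> k) \<cdot> (\<mm> [^]\<^bsub>ideals_set R\<^esub> l)" by (simp add: ideals_set_def)
      also have "\<dots> \<subseteq> I"
      proof
        fix w assume "w \<in> (\<mm> [^]\<^bsub>ideals_set R\<^esub> k) \<cdot> (\<mm> [^]\<^bsub>ideals_set R\<^esub> l)"
        then show "w \<in> I"
          by (induction rule: ideal_prod.induct)
             (use kl prod in \<open>auto intro: additive_subgroup.a_closed[OF ideal.axioms(1)[OF I]]\<close>)
      qed
      finally show "\<exists>k::nat. \<mm> [^]\<^bsub>ideals_set R\<^esub> k \<subseteq> I" by blast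
    qed
    then obtain p where p: "primeideal p R" "Idl (set xs) \<subseteq> p"
      "\<not> (\<exists>k::nat. \<mm> [^]\<^bsub>ideals_set R\<^esub> k \<subseteq> p)" by blast
    have "\<mm> [^]\<^bsub>ideals_set R\<^esub> Suc 0 \<subseteq> p"
      unfolding ideal_pow_Suc ideal_pow_0 only[OF p(1,2)]
      using ideal_prod_commute[OF m_ideal oneideal] ideal_prod_one[OF m_ideal] by simp
    then show False using p(3) by blast
  qed
  then show ?thesis using card_length[of xs] xs(1,2) by (intro exI[of _ "set xs"]) auto
qed

end

section \<open>The growth of the torsion lengths\<close>

locale cm_local_module = cm_local + local_module
begin

lemma m_gens: "\<exists>U. finite U \<and> U \<subseteq> carrier R \<and> \<mm> = Idl U"
  using noetherian_ring.finetely_gen[OF noetherian m_ideal] by blast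

text \<open>The Hilbert--Samuel function for the maximal ideal is a combination of binomial coefficients
  whose degree a priori depends on the number of generators of \<open>\<mm>\<close>; comparison with the
  one for a parameter ideal bounds the degree by \<open>d\<close>.\<close>

lemma hilbert_samuel_m:
  assumes H: "submodule H R M"
  shows "binpoly (Suc d) (\<lambda>n. len (spow R M \<mm> n H) H)"
proof -
  obtain U where U: "finite U" "U \<subseteq> carrier R" "\<mm> = Idl U" using m_gens by blast
  have eq: "sprod R M U P = sprod R M \<mm> P" "spow R M U n P = spow R M \<mm> n P" if "submodule P R M" for P n
    using sprod_Idl[OF U(2) that] spow_Idl[OF U(2) that] U(3) by auto
  have poly: "binpoly (Suc (card U)) (\<lambda>n. len (spow R M \<mm> n H) H)"
    using hilbert_samuel(1)[OF U(1,2) H] finite_length_m by (simp add: eq H)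
  obtain V k where V: "finite V" "card V \<le> d" "V \<subseteq> \<mm>" "\<mm> [^]\<^bsub>ideals_set R\<^esub> (k::nat) \<subseteq> Idl V"
    using exists_parameters by blast
  have VR: "V \<subseteq> carrier R" using V(3) m_sub by blast
  have k: "spow R M \<mm> k P \<subseteq> sprod R M V P" if P: "submodule P R M" for P
    using sprod_mono[OF V(4) order_refl, of P] sprod_ideal_pow[OF m_ideal P] sprod_Idl[OF VR P] by simp
  have finV: "ilen R M (sprod R M V P) P < \<infinity>" if P: "submodule P R M" for P
  proof -
    have s: "submodule (sprod R M V P) R M" using VR sub_carr[OF P] by (intro sprod_submodule) auto
    show ?thesis
      using ilen_mono[OF spow_m_sub[OF P] s P P k[OF P] sprod_sub[OF VR P] order_refl]
        finite_length_spow[OF P, of k] by (meson le_less_trans)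
  qed
  note hs = hilbert_samuel[OF V(1) VR H finV]
  obtain B where B: "\<forall>\<^sub>F n in sequentially. len (spow R M V n H) H \<le> B * real n ^ card V"
    using binpoly_bound[OF hs(1)] by blast
  have "\<forall>\<^sub>F n in sequentially. len (spow R M \<mm> n H) H \<le> \<bar>B\<bar> * real n ^ d"
    using B eventually_ge_at_top[of "1::nat"]
  proof eventually_elim
    fix n :: nat assume n: "len (spow R M V n H) H \<le> B * real n ^ card V" "1 \<le> n"
    have "ilen R M (spow R M \<mm> n H) H \<le> ilen R M (spow R M V n H) H"
      by (intro ilen_mono spow_submodule VR m_sub H spow_mono V(3) spow_sub order_refl)
    then have "len (spow R M \<mm> n H) H \<le> len (spow R M V n H) H"
      using hs(2)[of n] by (cases "ilen R M (spow R M \<mm> n H) H"; cases "ilen R M (spow R M V n H) H") auto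
    also have "\<dots> \<le> \<bar>B\<bar> * real n ^ card V" using n(1) by (rule order_trans) (simp add: mult_right_mono)
    also have "\<dots> \<le> \<bar>B\<bar> * real n ^ d" using n(2) V(2) by (intro mult_left_mono power_increasing) auto
    finally show "len (spow R M \<mm> n H) H \<le> \<bar>B\<bar> * real n ^ d" .
  qed
  then show ?thesis by (rule binpoly_reduce[OF poly, rotated]) simp
qed

lemma hilbert_function_bound:
  assumes H: "submodule H R M"
  shows "\<exists>B N. \<forall>n\<ge>N. len (spow R M \<mm> (Suc n) H) (spow R M \<mm> n H) \<le> B * real n ^ (d - 1)"
proof -
  have "len (spow R M \<mm> (Suc n) H) H - len (spow R M \<mm> n H) H =
      len (spow R M \<mm> (Suc n) H) (spow R M \<mm> n H)" for n
    using len_add[OF spow_m_sub[OF H] spow_m_sub[OF H] H spow_decseq[OF m_sub H]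
        spow_sub[OF m_sub H] finite_length_spow[OF H], of n "Suc n"] by simp
  moreover have "binpoly (Suc (d - 1)) (\<lambda>n. len (spow R M \<mm> (Suc n) H) H - len (spow R M \<mm> n H) H)"
    using binpoly_difference[OF hilbert_samuel_m[OF H]] d by simp
  ultimately have "binpoly (Suc (d - 1)) (\<lambda>n. len (spow R M \<mm> (Suc n) H) (spow R M \<mm> n H))" by simp
  from binpoly_bound[OF this] show ?thesis unfolding eventually_sequentially by blast
qed

lemma artin_rees_m:
  assumes K: "submodule K R M"
  shows "\<exists>c. (\<forall>n\<ge>c. K \<inter> spow R M \<mm> (Suc n) (carrier M) \<subseteq> sprod R M \<mm> (K \<inter> spow R M \<mm> n (carrier M))) \<and>
    (\<forall>j. K \<inter> spow R M \<mm> (c + j) (carrier M) \<subseteq> spow R M \<mm> j K)"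
proof -
  obtain U where U: "finite U" "U \<subseteq> carrier R" "\<mm> = Idl U" using m_gens by blast
  have "spow R M U n P = spow R M \<mm> n P" "sprod R M U P = sprod R M \<mm> P"
    if "submodule P R M" for n P using sprod_Idl[OF U(2) that] spow_Idl[OF U(2) that] U(3) by auto
  then show ?thesis
    using artin_rees[OF U(1,2) K noeth]
    by (simp add: K carrier_is_submodule Int_submodule spow_m_sub)
qed

text \<open>If \<open>M\<close> is free, \<open>V n\<close> is the length of \<open>Tor(M/K, R/\<mm>\<^sup>n\<^sup>+\<^sup>1)\<close>. It is a combination of binomial
  coefficients because the subquotients form a graded module that is generated in finitely many
  degrees, by Artin--Rees. Also by Artin--Rees, \<open>K \<inter> \<mm>\<^sup>nM \<subseteq> \<mm>\<^sup>n\<^sup>-\<^sup>cK\<close>, so that \<open>V n\<close> is at most a sum of \<open>c\<close>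
  values of the Hilbert function of \<open>K\<close>, whose degree is \<open>d - 1\<close>.\<close>

theorem torsion_limit:
  assumes K: "submodule K R M"
  defines "V \<equiv> \<lambda>n. ilen R M (spow R M \<mm> (Suc n) K) (K \<inter> spow R M \<mm> (Suc n) (carrier M))"
  shows "V n < \<infinity>" and "convergent (\<lambda>n. real (the_enat (V n)) / real n ^ (d - 1))"
proof -
  let ?Q = "\<lambda>n. spow R M \<mm> (Suc n) K" and ?P = "\<lambda>n. K \<inter> spow R M \<mm> (Suc n) (carrier M)"
  obtain U where U: "finite U" "U \<subseteq> carrier R" "\<mm> = Idl U" using m_gens by blast
  have eq: "sprod R M U P = sprod R M \<mm> P" if "submodule P R M" for P
    using sprod_Idl[OF U(2) that] U(3) by auto
  obtain c where c1: "\<And>n. n \<ge> c \<Longrightarrow>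
      K \<inter> spow R M \<mm> (Suc n) (carrier M) \<subseteq> sprod R M \<mm> (K \<inter> spow R M \<mm> n (carrier M))"
    and c2: "\<And>j. K \<inter> spow R M \<mm> (c + j) (carrier M) \<subseteq> spow R M \<mm> j K"
    using artin_rees_m[OF K] by blast
  have Q: "submodule (?Q n) R M" for n by (rule spow_m_sub[OF K])
  have P: "submodule (?P n) R M" for n
    by (rule Int_submodule[OF K spow_m_sub[OF carrier_is_submodule]])
  have QP: "?Q n \<subseteq> ?P n" for n
    using spow_sub[OF m_sub K, of "Suc n"] spow_mono[OF order_refl submoduleE(1)[OF K], of \<mm> "Suc n"] by blast
  have PK: "?P n \<subseteq> K" for n by blast
  show fin: "V n < \<infinity>" for n
    using ilen_mono[OF Q Q K P order_refl QP PK, of n] finite_length_spow[OF K, of "Suc n"]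
    unfolding V_def by (meson le_less_trans)
  have Um: "U \<subseteq> \<mm>" using genideal_self[OF U(2)] U(3) by simp
  have s: "system R M U (\<lambda>n. spow R M \<mm> n H)" if "submodule H R M" for H
    by (rule system_subset[OF spow_system[OF m_sub that] Um])
  then have s': "system R M U (\<lambda>n. spow R M \<mm> (Suc n) H)" if "submodule H R M" for H
    using that by (simp add: system_def)
  have sP: "system R M U ?P"
    by (rule Int_system[OF const_system[OF K U(2)] s'[OF carrier_is_submodule]])
  have gen: "eventually_generated R M U ?P ?Q"
    unfolding eventually_generated_def
  proof (intro exI[of _ c] allI impI)
    fix n assume n: "n \<ge> c"
    have sp: "submodule (sprod R M \<mm> (?P n)) R M" using sub_carr[OF P] by (intro sprod_submodule m_sub) auto
    have "?P (Suc n) \<subseteq> sprod R M \<mm> (?P n)" using c1[of "Suc n"] n by simp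
    also have "\<dots> \<subseteq> sprod R M \<mm> (?P n) <+>\<^bsub>M\<^esub> ?Q (Suc n)" by (rule sum_upper1[OF sp Q])
    finally show "?P (Suc n) \<subseteq> sprod R M U (?P n) <+>\<^bsub>M\<^esub> ?Q (Suc n)" by (simp only: eq[OF P])
  qed
  have poly: "binpoly (card U) (\<lambda>n. real (the_enat (V n)))"
    unfolding V_def
    by (rule hilbert_serre[OF U(1,2) sP s'[OF K] QP acc_sub[OF Q P] gen fin[unfolded V_def]])
  obtain B N where B: "\<And>n. n \<ge> N \<Longrightarrow> len (spow R M \<mm> (Suc n) K) (spow R M \<mm> n K) \<le> B * real n ^ (d - 1)"
    using hilbert_function_bound[OF K] by blast
  have steps: "len (spow R M \<mm> (j + i) K) (spow R M \<mm> j K) \<le> real i * (\<bar>B\<bar> * real (j + i) ^ (d - 1))"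
    if "j \<ge> N" for i j
  proof (induction i)
    case 0
    show ?case by (simp add: ilen_self zero_enat_def)
  next
    case (Suc i)
    let ?k = "j + i"
    have "len (spow R M \<mm> (Suc ?k) K) (spow R M \<mm> j K) =
        len (spow R M \<mm> (Suc ?k) K) (spow R M \<mm> ?k K) + len (spow R M \<mm> ?k K) (spow R M \<mm> j K)"
    proof (rule len_add)
      show "ilen R M (spow R M \<mm> (Suc ?k) K) (spow R M \<mm> j K) < \<infinity>"
        using ilen_mono[OF spow_m_sub[OF K] spow_m_sub[OF K] K spow_m_sub[OF K] order_refl
            spow_decseq[OF m_sub K] spow_sub[OF m_sub K], of j "Suc ?k"]
          finite_length_spow[OF K, of "Suc ?k"] by (metis le_less_trans le_SucI le_add1)
    qed (intro spow_m_sub K spow_decseq m_sub le_SucI le_add1 le_refl)+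
    also have "\<dots> \<le> \<bar>B\<bar> * real ?k ^ (d - 1) + real i * (\<bar>B\<bar> * real ?k ^ (d - 1))"
    proof -
      have "B * real ?k ^ (d - 1) \<le> \<bar>B\<bar> * real ?k ^ (d - 1)" by (intro mult_right_mono) auto
      moreover have "N \<le> ?k" using that by simp
      ultimately show ?thesis using B[of ?k] Suc by linarith
    qed
    also have "\<dots> = real (Suc i) * (\<bar>B\<bar> * real ?k ^ (d - 1))" by (simp add: algebra_simps)
    also have "\<dots> \<le> real (Suc i) * (\<bar>B\<bar> * real (j + Suc i) ^ (d - 1))"
      by (intro mult_left_mono power_mono) auto
    finally show ?case by simp
  qed
  have bound: "real (the_enat (V n)) \<le> (real c * \<bar>B\<bar> * 2 ^ (d - 1)) * real n ^ (d - 1)" if n: "n \<ge> Suc (c + N)" for n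
  proof -
    define j where "j = Suc n - c"
    have j: "Suc n = c + j" "j \<ge> N" using n by (auto simp: j_def)
    have "?P n \<subseteq> spow R M \<mm> j K" using c2[of j] j by simp
    then have le: "V n \<le> ilen R M (?Q n) (spow R M \<mm> j K)"
      unfolding V_def by (intro ilen_mono Q P spow_m_sub K order_refl QP)
    have "ilen R M (?Q n) (spow R M \<mm> j K) \<le> ilen R M (?Q n) K"
      using j(1) by (intro ilen_mono Q K spow_m_sub order_refl spow_decseq m_sub spow_sub) auto
    also have "\<dots> < \<infinity>" by (rule finite_length_spow[OF K])
    finally have "real (the_enat (V n)) \<le> len (?Q n) (spow R M \<mm> j K)"
      using le by (cases "V n"; cases "ilen R M (?Q n) (spow R M \<mm> j K)") auto
    also have "\<dots> \<le> real c * (\<bar>B\<bar> * real (Suc n) ^ (d - 1))"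
      using steps[OF j(2), of c] j(1) by (simp add: add.commute)
    also have "\<dots> \<le> real c * (\<bar>B\<bar> * (2 * real n) ^ (d - 1))"
      using n by (intro mult_left_mono power_mono) auto
    finally show ?thesis by (simp add: power_mult_distrib mult.assoc)
  qed
  have "binpoly (Suc (d - 1)) (\<lambda>n. real (the_enat (V n)))"
    by (rule binpoly_reduce[OF poly, where B = "real c * \<bar>B\<bar> * 2 ^ (d - 1)"])
       (use bound in \<open>auto simp: eventually_sequentially\<close>)
  then show "convergent (\<lambda>n. real (the_enat (V n)) / real n ^ (d - 1))" by (rule binpoly_limit)
qed

end

section \<open>Free modules, quotients and products\<close>

context cring
begin

lemma free_module_sel [simp]:
  "ring.zero (free_module R B) = (\<lambda>_. \<zero>)"
  "ring.add (free_module R B) = (\<lambda>f g x. f x \<oplus> g x)"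
  "smult (free_module R B) = (\<lambda>a f x. a \<otimes> f x)"
  by (simp_all add: free_module_def)

lemma free_carrier_iff:
  "f \<in> carrier (free_module R B) \<longleftrightarrow>
    finite {x. f x \<noteq> \<zero>} \<and> (\<forall>x\<in>B. f x \<in> carrier R) \<and> (\<forall>x. x \<notin> B \<longrightarrow> f x = \<zero>)"
  by (simp add: free_module_def)

lemma free_carrierD: "f \<in> carrier (free_module R B) \<Longrightarrow> f x \<in> carrier R"
  by (cases "x \<in> B") (auto simp: free_carrier_iff)

lemma free_module_module: "module R (free_module R B)"
proof (rule moduleI)
  let ?F = "free_module R B"
  have add: "(\<lambda>x. f x \<oplus> g x) \<in> carrier ?F" if "f \<in> carrier ?F" "g \<in> carrier ?F" for f g
  proof -
    have "{x. f x \<oplus> g x \<noteq> \<zero>} \<subseteq> {x. f x \<noteq> \<zero>} \<union> {x. g x \<noteq> \<zero>}" by auto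
    then have "finite {x. f x \<oplus> g x \<noteq> \<zero>}" using that by (auto simp: free_carrier_iff intro: finite_subset)
    then show ?thesis using that by (simp add: free_carrier_iff)
  qed
  have smult: "(\<lambda>x. a \<otimes> f x) \<in> carrier ?F" if "a \<in> carrier R" "f \<in> carrier ?F" for a f
  proof -
    have "{x. a \<otimes> f x \<noteq> \<zero>} \<subseteq> {x. f x \<noteq> \<zero>}" using that(1) by auto
    then have "finite {x. a \<otimes> f x \<noteq> \<zero>}" using that by (auto simp: free_carrier_iff intro: finite_subset)
    then show ?thesis using that by (simp add: free_carrier_iff)
  qed
  show "abelian_group ?F"
  proof (rule abelian_groupI)
    fix f assume f: "f \<in> carrier ?F"
    show "\<exists>g\<in>carrier ?F. g \<oplus>\<^bsub>?F\<^esub> f = \<zero>\<^bsub>?F\<^esub>"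
      using smult[of "\<ominus> \<one>" f] f
      by (intro bexI[of _ "\<lambda>x. \<ominus> \<one> \<otimes> f x"]) (auto simp: fun_eq_iff free_carrierD l_minus l_neg)
  qed (auto simp: add free_carrierD a_ac, simp add: free_carrier_iff)
  show "a \<odot>\<^bsub>?F\<^esub> f \<in> carrier ?F" if "a \<in> carrier R" "f \<in> carrier ?F" for a f using smult[OF that] by simp
qed (auto simp: fun_eq_iff free_carrierD is_cring l_distr r_distr m_assoc)

lemma basis_elt_carrier: "x \<in> B \<Longrightarrow> basis_elt R x \<in> carrier (free_module R B)"
  by (auto simp: free_carrier_iff basis_elt_def)

text \<open>Identities between linear maps and membership statements on free modules are reduced to the basis
  with the help of this.\<close>

lemma free_span:
  assumes H: "submodule H R (free_module R B)" and b: "\<And>x. x \<in> B \<Longrightarrow> basis_elt R x \<in> H"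
  shows "carrier (free_module R B) \<subseteq> H"
proof
  interpret F: module R "free_module R B" by (rule free_module_module)
  fix f assume f: "f \<in> carrier (free_module R B)"
  then have "finite {x. f x \<noteq> \<zero>}" by (simp add: free_carrier_iff)
  then show "f \<in> H" using f
  proof (induction "{x. f x \<noteq> \<zero>}" arbitrary: f rule: finite_induct)
    case empty
    then have "f = \<zero>\<^bsub>free_module R B\<^esub>" by (auto simp: fun_eq_iff)
    then show ?case using F.sub_zero[OF H] by simp
  next
    case (insert y S)
    let ?g = "f(y := \<zero>)"
    have y: "f y \<noteq> \<zero>" using insert.hyps(4) by blast
    then have yB: "y \<in> B" using insert.prems by (auto simp: free_carrier_iff)
    have S: "S = {x. ?g x \<noteq> \<zero>}" using insert.hyps(2,4) by (auto simp: set_eq_iff)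
    have g': "?g \<in> carrier (free_module R B)"
      using insert.prems insert.hyps(1) S by (auto simp: free_carrier_iff)
    have g: "?g \<in> H" by (rule insert.hyps(3)[OF S g'])
    have "f = ?g \<oplus>\<^bsub>free_module R B\<^esub> f y \<odot>\<^bsub>free_module R B\<^esub> basis_elt R y"
      using free_carrierD[OF insert.prems] by (auto simp: fun_eq_iff basis_elt_def)
    then show ?case
      using F.sub_add[OF H g F.sub_smult[OF H free_carrierD[OF insert.prems, of y] b[OF yB]]] by simp
  qed
qed

end

context module
begin

lemma free_lift_eq:
  assumes f: "f \<in> carrier (free_module R B)" and \<phi>: "\<And>x. x \<in> B \<Longrightarrow> \<phi> x \<in> carrier M"
    and S: "finite S" "{x. f x \<noteq> \<zero>} \<subseteq> S" "S \<subseteq> B"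
  shows "free_lift R M \<phi> f = (\<Oplus>\<^bsub>M\<^esub>x\<in>S. f x \<odot>\<^bsub>M\<^esub> \<phi> x)"
  unfolding free_lift_def
proof (rule M.add.finprod_mono_neutral_cong_left[OF S(1,2)])
  show "f x \<odot>\<^bsub>M\<^esub> \<phi> x = \<zero>\<^bsub>M\<^esub>" if "x \<in> S - {x. f x \<noteq> \<zero>}" for x
    using that \<phi>[of x] S(3) by auto
  show "(\<lambda>x. f x \<odot>\<^bsub>M\<^esub> \<phi> x) \<in> S \<rightarrow> carrier M"
    using \<phi> S(3) free_carrierD[OF f] by auto
qed simp

lemma free_lift_linear:
  assumes \<phi>: "\<And>x. x \<in> B \<Longrightarrow> \<phi> x \<in> carrier M"
  shows "linear_on R (free_module R B) (carrier (free_module R B)) M (free_lift R M \<phi>)"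
proof (rule linear_onI)
  interpret F: module R "free_module R B" by (rule free_module_module)
  have fin: "finite {x. f x \<noteq> \<zero>}" "{x. f x \<noteq> \<zero>} \<subseteq> B" if "f \<in> carrier (free_module R B)" for f
    using that by (auto simp: free_carrier_iff)
  fix f assume f: "f \<in> carrier (free_module R B)"
  show "free_lift R M \<phi> f \<in> carrier M"
    unfolding free_lift_def using \<phi> fin[OF f] free_carrierD[OF f] by (intro M.finsum_closed) auto
  fix g assume g: "g \<in> carrier (free_module R B)"
  let ?S = "{x. f x \<noteq> \<zero>} \<union> {x. g x \<noteq> \<zero>}"
  have S: "finite ?S" "?S \<subseteq> B" using fin[OF f] fin[OF g] by auto
  have fg: "f \<oplus>\<^bsub>free_module R B\<^esub> g \<in> carrier (free_module R B)" using f g by (rule F.M.a_closed)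
  have eq: "(f \<oplus>\<^bsub>free_module R B\<^esub> g) x \<odot>\<^bsub>M\<^esub> \<phi> x = f x \<odot>\<^bsub>M\<^esub> \<phi> x \<oplus>\<^bsub>M\<^esub> g x \<odot>\<^bsub>M\<^esub> \<phi> x" if "x \<in> ?S" for x
    using \<phi>[of x] S(2) that free_carrierD[OF f] free_carrierD[OF g] by (auto simp: smult_l_distr)
  have "free_lift R M \<phi> (f \<oplus>\<^bsub>free_module R B\<^esub> g) = (\<Oplus>\<^bsub>M\<^esub>x\<in>?S. (f \<oplus>\<^bsub>free_module R B\<^esub> g) x \<odot>\<^bsub>M\<^esub> \<phi> x)"
    by (rule free_lift_eq[OF fg \<phi> S(1) _ S(2)]) auto
  also have "\<dots> = (\<Oplus>\<^bsub>M\<^esub>x\<in>?S. f x \<odot>\<^bsub>M\<^esub> \<phi> x \<oplus>\<^bsub>M\<^esub> g x \<odot>\<^bsub>M\<^esub> \<phi> x)"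
    using \<phi> S(2) free_carrierD[OF f] free_carrierD[OF g] eq by (intro M.finsum_cong') auto
  also have "\<dots> = (\<Oplus>\<^bsub>M\<^esub>x\<in>?S. f x \<odot>\<^bsub>M\<^esub> \<phi> x) \<oplus>\<^bsub>M\<^esub> (\<Oplus>\<^bsub>M\<^esub>x\<in>?S. g x \<odot>\<^bsub>M\<^esub> \<phi> x)"
    using \<phi> S(2) free_carrierD[OF f] free_carrierD[OF g] by (intro M.finsum_addf) auto
  also have "\<dots> = free_lift R M \<phi> f \<oplus>\<^bsub>M\<^esub> free_lift R M \<phi> g"
    using free_lift_eq[OF f \<phi> S(1) _ S(2)] free_lift_eq[OF g \<phi> S(1) _ S(2)] by auto
  finally show "free_lift R M \<phi> (f \<oplus>\<^bsub>free_module R B\<^esub> g) = free_lift R M \<phi> f \<oplus>\<^bsub>M\<^esub> free_lift R M \<phi> g" .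
next
  interpret F: module R "free_module R B" by (rule free_module_module)
  fix a f assume a: "a \<in> carrier R" and f: "f \<in> carrier (free_module R B)"
  let ?S = "{x. f x \<noteq> \<zero>}"
  have S: "finite ?S" "?S \<subseteq> B" using f by (auto simp: free_carrier_iff)
  have af: "a \<odot>\<^bsub>free_module R B\<^esub> f \<in> carrier (free_module R B)" using a f by (rule F.smult_closed)
  have "free_lift R M \<phi> (a \<odot>\<^bsub>free_module R B\<^esub> f) = (\<Oplus>\<^bsub>M\<^esub>x\<in>?S. (a \<odot>\<^bsub>free_module R B\<^esub> f) x \<odot>\<^bsub>M\<^esub> \<phi> x)"
    by (rule free_lift_eq[OF af \<phi> S(1) _ S(2)]) (use a in auto)
  also have "\<dots> = (\<Oplus>\<^bsub>M\<^esub>x\<in>?S. a \<odot>\<^bsub>M\<^esub> (f x \<odot>\<^bsub>M\<^esub> \<phi> x))"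
    using \<phi> S(2) free_carrierD[OF f] a by (intro M.finsum_cong') (auto simp: smult_assoc1 subset_iff)
  also have "\<dots> = a \<odot>\<^bsub>M\<^esub> free_lift R M \<phi> f"
    unfolding free_lift_def using \<phi> S free_carrierD[OF f] a
    by (intro finsum_smult_ldistr[symmetric]) auto
  finally show "free_lift R M \<phi> (a \<odot>\<^bsub>free_module R B\<^esub> f) = a \<odot>\<^bsub>M\<^esub> free_lift R M \<phi> f" .
qed

lemma free_lift_basis:
  assumes \<phi>: "\<And>x. x \<in> B \<Longrightarrow> \<phi> x \<in> carrier M" and x: "x \<in> B"
  shows "free_lift R M \<phi> (basis_elt R x) = \<phi> x"
proof -
  have "free_lift R M \<phi> (basis_elt R x) = (\<Oplus>\<^bsub>M\<^esub>y\<in>{x}. basis_elt R x y \<odot>\<^bsub>M\<^esub> \<phi> y)"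
    by (rule free_lift_eq[OF basis_elt_carrier[OF x] \<phi>]) (use x in \<open>auto simp: basis_elt_def\<close>)
  then show ?thesis using \<phi>[OF x] by (simp add: basis_elt_def)
qed

lemma free_linear_eqI:
  assumes f: "linear_on R (free_module R B) (carrier (free_module R B)) M f"
    and g: "linear_on R (free_module R B) (carrier (free_module R B)) M g"
    and eq: "\<And>x. x \<in> B \<Longrightarrow> f (basis_elt R x) = g (basis_elt R x)"
    and u: "u \<in> carrier (free_module R B)"
  shows "f u = g u"
proof -
  interpret FM: module_pair R "free_module R B" M
    by (intro module_pairI free_module_module module_axioms)
  have c: "submodule (carrier (free_module R B)) R (free_module R B)" by (rule FM.M.carrier_is_submodule)
  have "submodule {u \<in> carrier (free_module R B). f u = g u} R (free_module R B)"
  proof (rule FM.M.submoduleI')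
    show "\<zero>\<^bsub>free_module R B\<^esub> \<in> {u \<in> carrier (free_module R B). f u = g u}"
      using FM.lin_zero[OF c f] FM.lin_zero[OF c g] FM.M.M.zero_closed by simp
  qed (use FM.M.M.a_closed FM.M.smult_closed linear_onD(2,3)[OF f] linear_onD(2,3)[OF g] in auto)
  then have "carrier (free_module R B) \<subseteq> {u \<in> carrier (free_module R B). f u = g u}"
    by (rule free_span) (use eq basis_elt_carrier in auto)
  then show ?thesis using u by blast
qed

end

text \<open>Free modules are projective: a lift is found by choosing preimages of the images of the basis.\<close>

lemma (in cring) free_projective:
  assumes G: "module R G" and M: "module R M"
    and p: "linear_on R G (carrier G) M p" "p ` carrier G = carrier M"
    and q: "linear_on R (free_module R B) (carrier (free_module R B)) M q"
  shows "\<exists>l. linear_on R (free_module R B) (carrier (free_module R B)) G l \<and>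
    (\<forall>u\<in>carrier (free_module R B). p (l u) = q u)"
proof -
  interpret G: module R G by (rule G)
  interpret M: module R M by (rule M)
  have "\<exists>g. g \<in> carrier G \<and> p g = q (basis_elt R x)" if "x \<in> B" for x
    using linear_onD(1)[OF q basis_elt_carrier[OF that]] p(2) by (metis imageE)
  then obtain \<phi> where \<phi>: "\<And>x. x \<in> B \<Longrightarrow> \<phi> x \<in> carrier G" "\<And>x. x \<in> B \<Longrightarrow> p (\<phi> x) = q (basis_elt R x)"
    by metis
  let ?l = "free_lift R G \<phi>"
  have l: "linear_on R (free_module R B) (carrier (free_module R B)) G ?l"
    by (rule G.free_lift_linear[OF \<phi>(1)])
  have pl: "linear_on R (free_module R B) (carrier (free_module R B)) M (p \<circ> ?l)"
    by (rule linear_on_comp[OF l p(1)]) (use linear_onD(1)[OF l] in auto)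
  have b: "(p \<circ> ?l) (basis_elt R x) = q (basis_elt R x)" if x: "x \<in> B" for x
  proof -
    have "free_lift R G \<phi> (basis_elt R x) = \<phi> x"
      by (rule G.free_lift_basis[where B = B]) (use \<phi>(1) x in auto)
    then show ?thesis using \<phi>(2)[OF x] by simp
  qed
  have "p (?l u) = q u" if "u \<in> carrier (free_module R B)" for u
    using M.free_linear_eqI[OF pl q b that] by simp
  then show ?thesis using l by blast
qed

context module
begin

lemma submodule_abelian_subgroup: "submodule H R M \<Longrightarrow> abelian_subgroup H M"
  by (rule abelian_subgroupI3)
     (auto simp: additive_subgroup_def submodule_def M.abelian_group_axioms)

lemma coset_eq_iff:
  assumes H: "submodule H R M" and "x \<in> carrier M" "y \<in> carrier M"
  shows "H +>\<^bsub>M\<^esub> x = H +>\<^bsub>M\<^esub> y \<longleftrightarrow> x \<ominus>\<^bsub>M\<^esub> y \<in> H"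
proof -
  interpret abelian_subgroup H M by (rule submodule_abelian_subgroup[OF H])
  have "x \<in> H +>\<^bsub>M\<^esub> y \<longleftrightarrow> x \<ominus>\<^bsub>M\<^esub> y \<in> H" using a_rcos_module[of y x] assms by (simp add: a_minus_def)
  moreover have "x \<in> H +>\<^bsub>M\<^esub> y \<longleftrightarrow> H +>\<^bsub>M\<^esub> x = H +>\<^bsub>M\<^esub> y"
    using a_repr_independence'[of x y] a_rcos_self[OF assms(2)] assms by metis
  ultimately show ?thesis by blast
qed

lemma coset_zero: "submodule H R M \<Longrightarrow> H +>\<^bsub>M\<^esub> \<zero>\<^bsub>M\<^esub> = H"
  using M.a_coset_add_zero submoduleE(1) by blast

lemma coset_mem_iff: "u \<in> H +>\<^bsub>M\<^esub> x \<longleftrightarrow> (\<exists>h\<in>H. u = h \<oplus>\<^bsub>M\<^esub> x)"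
  by (auto simp: a_r_coset_def')

lemma coset_eq_self_iff:
  assumes H: "submodule H R M" and x: "x \<in> carrier M"
  shows "H +>\<^bsub>M\<^esub> x = H \<longleftrightarrow> x \<in> H"
  using coset_eq_iff[OF H x M.zero_closed] coset_zero[OF H] sub_minus[OF H _ sub_zero[OF H], of x]
    sub_minus_cancel[OF H x sub_zero[OF H]] by auto

lemma quot_module_sel [simp]:
  "carrier (quot_module M H) = a_rcosets\<^bsub>M\<^esub> H" "ring.zero (quot_module M H) = H"
  "ring.add (quot_module M H) = set_add M"
  "smult (quot_module M H) = (\<lambda>a C. \<Union>x\<in>C. H +>\<^bsub>M\<^esub> (a \<odot>\<^bsub>M\<^esub> x))"
  by (simp_all add: quot_module_def)

lemma quot_carrier: "carrier (quot_module M H) = (\<lambda>x. H +>\<^bsub>M\<^esub> x) ` carrier M"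
  by (auto simp: A_RCOSETS_def')

lemma quot_smult:
  assumes H: "submodule H R M" and a: "a \<in> carrier R" and x: "x \<in> carrier M"
  shows "(\<Union>u\<in>H +>\<^bsub>M\<^esub> x. H +>\<^bsub>M\<^esub> (a \<odot>\<^bsub>M\<^esub> u)) = H +>\<^bsub>M\<^esub> (a \<odot>\<^bsub>M\<^esub> x)"
proof -
  have "H +>\<^bsub>M\<^esub> (a \<odot>\<^bsub>M\<^esub> u) = H +>\<^bsub>M\<^esub> (a \<odot>\<^bsub>M\<^esub> x)" if u: "u \<in> H +>\<^bsub>M\<^esub> x" for u
  proof -
    obtain h where h: "h \<in> H" "u = h \<oplus>\<^bsub>M\<^esub> x" using u by (auto simp: coset_mem_iff)
    have hc: "h \<in> carrier M" using sub_carr[OF H h(1)] .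
    have "a \<odot>\<^bsub>M\<^esub> u = a \<odot>\<^bsub>M\<^esub> x \<oplus>\<^bsub>M\<^esub> a \<odot>\<^bsub>M\<^esub> h" unfolding h(2) using a x hc by (simp add: smult_r_distr M.a_comm)
    then have "a \<odot>\<^bsub>M\<^esub> u \<ominus>\<^bsub>M\<^esub> a \<odot>\<^bsub>M\<^esub> x = a \<odot>\<^bsub>M\<^esub> h" using a x hc by (simp add: add_minus_self)
    then show ?thesis using coset_eq_iff[OF H, of "a \<odot>\<^bsub>M\<^esub> u" "a \<odot>\<^bsub>M\<^esub> x"] sub_smult[OF H a h(1)] a x hc h(2) by simp
  qed
  moreover have "x \<in> H +>\<^bsub>M\<^esub> x" using x sub_zero[OF H] by (auto simp: coset_mem_iff intro!: bexI[of _ "\<zero>\<^bsub>M\<^esub>"])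
  ultimately show ?thesis by (intro SUP_eq_const) blast+
qed

lemma quot_module_module:
  assumes H: "submodule H R M"
  shows "module R (quot_module M H)"
    and "linear_on R M (carrier M) (quot_module M H) (\<lambda>x. H +>\<^bsub>M\<^esub> x)"
proof -
  interpret abelian_subgroup H M by (rule submodule_abelian_subgroup[OF H])
  have add: "(H +>\<^bsub>M\<^esub> x) <+>\<^bsub>M\<^esub> (H +>\<^bsub>M\<^esub> y) = H +>\<^bsub>M\<^esub> (x \<oplus>\<^bsub>M\<^esub> y)" if "x \<in> carrier M" "y \<in> carrier M" for x y
    by (rule a_rcos_sum[OF that])
  show "module R (quot_module M H)"
    by (rule surjective_image_module[OF module_axioms, of "\<lambda>x. H +>\<^bsub>M\<^esub> x"])
       (simp_all add: quot_carrier[unfolded quot_module_sel] coset_zero[OF H] add quot_smult[OF H])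
  show "linear_on R M (carrier M) (quot_module M H) (\<lambda>x. H +>\<^bsub>M\<^esub> x)"
    by (rule linear_onI) (simp_all add: quot_carrier[unfolded quot_module_sel] add quot_smult[OF H])
qed

lemma mod_length_eq: "mod_length R M = ilen R M {\<zero>\<^bsub>M\<^esub>} (carrier M)"
proof -
  have "submodule P R M \<longleftrightarrow> P \<in> subs R M {\<zero>\<^bsub>M\<^esub>} (carrier M)" for P
    using sub_zero[of P] sub_carr[of P] by (auto simp: subs_def)
  then show ?thesis unfolding mod_length_def ilen_def chain_length_def by simp
qed

lemma ilen_quot:
  assumes H: "submodule H R M" and P: "submodule P R M" and HP: "H \<subseteq> P"
  shows "ilen R (quot_module M H) {\<zero>\<^bsub>quot_module M H\<^esub>} ((\<lambda>x. H +>\<^bsub>M\<^esub> x) ` P) = ilen R M H P"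
proof -
  note q = quot_module_module[OF H]
  interpret Q: module_pair R M "quot_module M H" by (intro module_pairI module_axioms q)
  have l: "linear_on R M P (quot_module M H) (\<lambda>x. H +>\<^bsub>M\<^esub> x)"
    by (rule linear_on_subset[OF q(2)]) (use sub_carr[OF P] in blast)
  have im: "submodule ((\<lambda>x. H +>\<^bsub>M\<^esub> x) ` P) R (quot_module M H)" by (rule Q.image_submodule[OF P l P]) simp
  show ?thesis
  proof (rule Q.ilen_iso[symmetric, OF P im HP Q.N.zero_submodule _ l order_refl])
    show "{\<zero>\<^bsub>quot_module M H\<^esub>} \<subseteq> (\<lambda>x. H +>\<^bsub>M\<^esub> x) ` P" using Q.N.sub_zero[OF im] by simp
    show "(\<lambda>x. H +>\<^bsub>M\<^esub> x) ` P \<subseteq> (\<lambda>x. H +>\<^bsub>M\<^esub> x) ` P <+>\<^bsub>quot_module M H\<^esub> {\<zero>\<^bsub>quot_module M H\<^esub>}"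
      by (rule Q.N.sum_upper1[OF im Q.N.zero_submodule])
    show "(H +>\<^bsub>M\<^esub> x \<in> {\<zero>\<^bsub>quot_module M H\<^esub>}) = (x \<in> H)" if "x \<in> P" for x
      using coset_eq_self_iff[OF H sub_carr[OF P that]] by simp
  qed
qed

lemma mod_length_quot:
  assumes H: "submodule H R M"
  shows "mod_length R (quot_module M H) = ilen R M H (carrier M)"
proof -
  note q = quot_module_module[OF H]
  have "H \<subseteq> carrier M" using sub_carr[OF H] by blast
  then show ?thesis
    using module.mod_length_eq[OF q(1)] ilen_quot[OF H carrier_is_submodule] by (simp only: quot_carrier)
qed

lemma submodule_restrict:
  assumes K: "submodule K R M"
  shows "module R (M\<lparr>carrier := K\<rparr>)" "submodule P R (M\<lparr>carrier := K\<rparr>) \<longleftrightarrow> submodule P R M \<and> P \<subseteq> K"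
proof -
  show m: "module R (M\<lparr>carrier := K\<rparr>)" by (rule submodule.submodule_is_module[OF K module_axioms])
  interpret K: module R "M\<lparr>carrier := K\<rparr>" by (rule m)
  show "submodule P R (M\<lparr>carrier := K\<rparr>) \<longleftrightarrow> submodule P R M \<and> P \<subseteq> K"
  proof (intro iffI conjI; (elim conjE)?)
    assume P: "submodule P R (M\<lparr>carrier := K\<rparr>)"
    show PK: "P \<subseteq> K" using K.sub_carr[OF P] by auto
    show "submodule P R M"
      by (rule submoduleI')
         (use PK sub_carr[OF K] K.sub_zero[OF P] K.sub_add[OF P] K.sub_smult[OF P] in auto)
  next
    assume P: "submodule P R M" "P \<subseteq> K"
    show "submodule P R (M\<lparr>carrier := K\<rparr>)"
      by (rule K.submoduleI') (use P sub_zero[OF P(1)] sub_add[OF P(1)] sub_smult[OF P(1)] in auto)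
  qed
qed

lemma ilen_restrict:
  assumes "submodule K R M" "P \<subseteq> K"
  shows "ilen R (M\<lparr>carrier := K\<rparr>) H P = ilen R M H P"
proof -
  have "subs R (M\<lparr>carrier := K\<rparr>) H P = subs R M H P"
    unfolding subs_def submodule_restrict(2)[OF assms(1)] using assms(2) by auto
  then show ?thesis by (simp add: ilen_def)
qed

end

lemma prod_module_sel [simp]:
  "carrier (prod_module M N) = carrier M \<times> carrier N"
  "ring.zero (prod_module M N) = (\<zero>\<^bsub>M\<^esub>, \<zero>\<^bsub>N\<^esub>)"
  "x \<oplus>\<^bsub>prod_module M N\<^esub> y = (fst x \<oplus>\<^bsub>M\<^esub> fst y, snd x \<oplus>\<^bsub>N\<^esub> snd y)"
  "a \<odot>\<^bsub>prod_module M N\<^esub> x = (a \<odot>\<^bsub>M\<^esub> fst x, a \<odot>\<^bsub>N\<^esub> snd x)"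
  by (simp_all add: prod_module_def case_prod_beta)

lemma (in module_pair) prod_module_module: "module R (prod_module M N)"
proof (rule moduleI)
  show "cring R" by (rule M.R.is_cring)
  show "abelian_group (prod_module M N)"
  proof (rule abelian_groupI)
    fix x assume "x \<in> carrier (prod_module M N)"
    then show "\<exists>y\<in>carrier (prod_module M N). y \<oplus>\<^bsub>prod_module M N\<^esub> x = \<zero>\<^bsub>prod_module M N\<^esub>"
      by (intro bexI[of _ "(\<ominus>\<^bsub>M\<^esub> fst x, \<ominus>\<^bsub>N\<^esub> snd x)"]) (auto simp: M.M.l_neg N.M.l_neg)
  qed (auto simp: M.M.a_ac N.M.a_ac)
qed (auto simp: M.smult_l_distr M.smult_r_distr M.smult_assoc1 N.smult_l_distr N.smult_r_distr N.smult_assoc1)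

section \<open>The length of Tor against a cyclic module\<close>

lemma (in cring) self_module_a_inv:
  assumes "b \<in> carrier R" shows "\<ominus>\<^bsub>self_module R\<^esub> b = \<ominus> b"
proof -
  interpret S: module R "self_module R" by (rule self_module)
  show ?thesis by (rule S.M.minus_equality) (use assms in \<open>simp_all add: l_neg\<close>)
qed

context module_pair
begin

abbreviation TF :: "('a, 'c \<times> 'e \<Rightarrow> 'a) module"
  where "TF \<equiv> free_module R (carrier M \<times> carrier N)"

abbreviation trel :: "('c \<times> 'e \<Rightarrow> 'a) set"
  where "trel \<equiv> tensor_relations R M N"

abbreviation \<delta> :: "'c \<times> 'e \<Rightarrow> 'c \<times> 'e \<Rightarrow> 'a"
  where "\<delta> \<equiv> basis_elt R"

lemma TF_module: "module R TF"
  by (rule M.R.free_module_module)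

lemma \<delta>_carrier: "x \<in> carrier M \<Longrightarrow> y \<in> carrier N \<Longrightarrow> \<delta> (x, y) \<in> carrier TF"
  by (rule M.R.basis_elt_carrier) simp

lemma
  assumes "x \<in> carrier M" "y \<in> carrier N"
  shows trel_add1: "x' \<in> carrier M \<Longrightarrow> \<delta> (x \<oplus>\<^bsub>M\<^esub> x', y) \<ominus>\<^bsub>TF\<^esub> (\<delta> (x, y) \<oplus>\<^bsub>TF\<^esub> \<delta> (x', y)) \<in> trel"
    and trel_add2: "y' \<in> carrier N \<Longrightarrow> \<delta> (x, y \<oplus>\<^bsub>N\<^esub> y') \<ominus>\<^bsub>TF\<^esub> (\<delta> (x, y) \<oplus>\<^bsub>TF\<^esub> \<delta> (x, y')) \<in> trel"
    and trel_smult1: "a \<in> carrier R \<Longrightarrow> \<delta> (a \<odot>\<^bsub>M\<^esub> x, y) \<ominus>\<^bsub>TF\<^esub> (a \<odot>\<^bsub>TF\<^esub> \<delta> (x, y)) \<in> trel"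
    and trel_smult2: "a \<in> carrier R \<Longrightarrow> \<delta> (x, a \<odot>\<^bsub>N\<^esub> y) \<ominus>\<^bsub>TF\<^esub> (a \<odot>\<^bsub>TF\<^esub> \<delta> (x, y)) \<in> trel"
proof -
  interpret T: module R TF by (rule TF_module)
  show "x' \<in> carrier M \<Longrightarrow> \<delta> (x \<oplus>\<^bsub>M\<^esub> x', y) \<ominus>\<^bsub>TF\<^esub> (\<delta> (x, y) \<oplus>\<^bsub>TF\<^esub> \<delta> (x', y)) \<in> trel"
    unfolding tensor_relations_def Let_def
    by (rule T.gen_submodule_incl[THEN subsetD], rule UnI1, rule UnI1, rule UnI1, rule CollectI,
        rule exI[of _ x], rule exI[of _ x'], rule exI[of _ y]) (use assms in auto)
  show "y' \<in> carrier N \<Longrightarrow> \<delta> (x, y \<oplus>\<^bsub>N\<^esub> y') \<ominus>\<^bsub>TF\<^esub> (\<delta> (x, y) \<oplus>\<^bsub>TF\<^esub> \<delta> (x, y')) \<in> trel"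
    unfolding tensor_relations_def Let_def
    by (rule T.gen_submodule_incl[THEN subsetD], rule UnI1, rule UnI1, rule UnI2, rule CollectI,
        rule exI[of _ x], rule exI[of _ y], rule exI[of _ y']) (use assms in auto)
  show "a \<in> carrier R \<Longrightarrow> \<delta> (a \<odot>\<^bsub>M\<^esub> x, y) \<ominus>\<^bsub>TF\<^esub> (a \<odot>\<^bsub>TF\<^esub> \<delta> (x, y)) \<in> trel"
    unfolding tensor_relations_def Let_def
    by (rule T.gen_submodule_incl[THEN subsetD], rule UnI1, rule UnI2, intro CollectI exI conjI refl)
       (use assms in auto)
  show "a \<in> carrier R \<Longrightarrow> \<delta> (x, a \<odot>\<^bsub>N\<^esub> y) \<ominus>\<^bsub>TF\<^esub> (a \<odot>\<^bsub>TF\<^esub> \<delta> (x, y)) \<in> trel"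
    unfolding tensor_relations_def Let_def
    by (rule T.gen_submodule_incl[THEN subsetD], rule UnI2, intro CollectI exI conjI refl)
       (use assms in auto)
qed

text \<open>Used with the preimage of a submodule under a linear map on symbols: the map descends to the
  tensor product if it sends the four kinds of generators into that submodule.\<close>

lemma trel_least:
  assumes H: "submodule H R TF"
    and "\<And>x x' y. x \<in> carrier M \<Longrightarrow> x' \<in> carrier M \<Longrightarrow> y \<in> carrier N \<Longrightarrow>
      \<delta> (x \<oplus>\<^bsub>M\<^esub> x', y) \<ominus>\<^bsub>TF\<^esub> (\<delta> (x, y) \<oplus>\<^bsub>TF\<^esub> \<delta> (x', y)) \<in> H"
    and "\<And>x y y'. x \<in> carrier M \<Longrightarrow> y \<in> carrier N \<Longrightarrow> y' \<in> carrier N \<Longrightarrow>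
      \<delta> (x, y \<oplus>\<^bsub>N\<^esub> y') \<ominus>\<^bsub>TF\<^esub> (\<delta> (x, y) \<oplus>\<^bsub>TF\<^esub> \<delta> (x, y')) \<in> H"
    and "\<And>a x y. a \<in> carrier R \<Longrightarrow> x \<in> carrier M \<Longrightarrow> y \<in> carrier N \<Longrightarrow>
      \<delta> (a \<odot>\<^bsub>M\<^esub> x, y) \<ominus>\<^bsub>TF\<^esub> (a \<odot>\<^bsub>TF\<^esub> \<delta> (x, y)) \<in> H"
    and "\<And>a x y. a \<in> carrier R \<Longrightarrow> x \<in> carrier M \<Longrightarrow> y \<in> carrier N \<Longrightarrow>
      \<delta> (x, a \<odot>\<^bsub>N\<^esub> y) \<ominus>\<^bsub>TF\<^esub> (a \<odot>\<^bsub>TF\<^esub> \<delta> (x, y)) \<in> H"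
  shows "trel \<subseteq> H"
proof -
  interpret T: module R TF by (rule TF_module)
  show ?thesis
    unfolding tensor_relations_def Let_def
  proof (rule T.gen_submodule_least[OF H], intro Un_least subsetI)
  qed (elim CollectE exE conjE, simp only: assms(2-))+
qed

lemma trel_submodule: "submodule trel R TF"
proof -
  interpret T: module R TF by (rule TF_module)
  show ?thesis
    unfolding tensor_relations_def Let_def
    by (rule T.gen_submodule_submodule, intro Un_least subsetI; elim CollectE exE conjE; simp only:)
       (intro T.M.minus_closed T.M.a_closed T.smult_closed \<delta>_carrier M.M.a_closed N.M.a_closed
          M.smult_closed N.smult_closed; assumption)+
qed

definition tensor_elt :: "'c \<Rightarrow> 'e \<Rightarrow> ('c \<times> 'e \<Rightarrow> 'a) set"
  where "tensor_elt x y = trel +>\<^bsub>TF\<^esub> \<delta> (x, y)"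

lemma tensor_module: "module R (tensor R M N)"
  and tensor_proj: "linear_on R TF (carrier TF) (tensor R M N) (\<lambda>t. trel +>\<^bsub>TF\<^esub> t)"
  and tensor_carrier: "carrier (tensor R M N) = (\<lambda>t. trel +>\<^bsub>TF\<^esub> t) ` carrier TF"
  and tensor_zero: "\<zero>\<^bsub>tensor R M N\<^esub> = trel"
  using module.quot_module_module[OF TF_module trel_submodule] module.quot_carrier[OF TF_module]
  by (simp_all only: tensor_def module.quot_module_sel[OF TF_module])

lemma tensor_elt_carrier: "x \<in> carrier M \<Longrightarrow> y \<in> carrier N \<Longrightarrow> tensor_elt x y \<in> carrier (tensor R M N)"
  unfolding tensor_elt_def tensor_carrier by (intro imageI \<delta>_carrier)

lemma coset_eqI:
  assumes "t \<in> carrier TF" "u \<in> carrier TF" "t \<ominus>\<^bsub>TF\<^esub> u \<in> trel"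
  shows "trel +>\<^bsub>TF\<^esub> t = trel +>\<^bsub>TF\<^esub> u"
  using module.coset_eq_iff[OF TF_module trel_submodule assms(1,2)] assms(3) by simp

lemma
  assumes x: "x \<in> carrier M" and y: "y \<in> carrier N"
  shows tensor_elt_add1: "x' \<in> carrier M \<Longrightarrow>
      tensor_elt (x \<oplus>\<^bsub>M\<^esub> x') y = tensor_elt x y \<oplus>\<^bsub>tensor R M N\<^esub> tensor_elt x' y"
    and tensor_elt_smult1: "a \<in> carrier R \<Longrightarrow>
      tensor_elt (a \<odot>\<^bsub>M\<^esub> x) y = a \<odot>\<^bsub>tensor R M N\<^esub> tensor_elt x y"
    and tensor_elt_smult2: "a \<in> carrier R \<Longrightarrow>
      tensor_elt x (a \<odot>\<^bsub>N\<^esub> y) = a \<odot>\<^bsub>tensor R M N\<^esub> tensor_elt x y"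
proof -
  interpret T: module R TF by (rule TF_module)
  note d = \<delta>_carrier
  show "tensor_elt (x \<oplus>\<^bsub>M\<^esub> x') y = tensor_elt x y \<oplus>\<^bsub>tensor R M N\<^esub> tensor_elt x' y" if "x' \<in> carrier M"
    unfolding tensor_elt_def linear_onD(2)[OF tensor_proj d[OF x y] d[OF that y], symmetric]
    by (intro coset_eqI trel_add1 T.M.a_closed d M.M.a_closed x y that)
  show "tensor_elt (a \<odot>\<^bsub>M\<^esub> x) y = a \<odot>\<^bsub>tensor R M N\<^esub> tensor_elt x y" if "a \<in> carrier R"
    unfolding tensor_elt_def linear_onD(3)[OF tensor_proj that d[OF x y], symmetric]
    by (intro coset_eqI trel_smult1 T.smult_closed d M.smult_closed x y that)
  show "tensor_elt x (a \<odot>\<^bsub>N\<^esub> y) = a \<odot>\<^bsub>tensor R M N\<^esub> tensor_elt x y" if "a \<in> carrier R"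
    unfolding tensor_elt_def linear_onD(3)[OF tensor_proj that d[OF x y], symmetric]
    by (intro coset_eqI trel_smult2 T.smult_closed d N.smult_closed x y that)
qed

end

lemma tensor_map_elt:
  assumes M: "module R M" and M': "module R M'" and N: "module R N"
    and f: "linear_on R M (carrier M) M' f" and x: "x \<in> carrier M" and y: "y \<in> carrier N"
  shows "tensor_map R M' N f (module_pair.tensor_elt R M N x y) = module_pair.tensor_elt R M' N (f x) y"
proof -
  interpret A: module_pair R M N by (intro module_pairI M N)
  interpret B: module_pair R M' N by (intro module_pairI M' N)
  interpret TA: module R A.TF by (rule A.TF_module)
  interpret TB: module R B.TF by (rule B.TF_module)
  interpret P: module_pair R A.TF B.TF by (intro module_pairI A.TF_module B.TF_module)
  let ?\<phi> = "\<lambda>(x, l). basis_elt R (f x, l)" and ?g = "free_lift R B.TF (\<lambda>(x, l). basis_elt R (f x, l))"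
  have \<phi>: "?\<phi> z \<in> carrier B.TF" if "z \<in> carrier M \<times> carrier N" for z
    using that linear_onD(1)[OF f] by (auto intro!: B.\<delta>_carrier)
  have g: "linear_on R A.TF (carrier A.TF) B.TF ?g" by (rule TB.free_lift_linear[OF \<phi>])
  have g\<delta>: "?g (basis_elt R (x, y)) = basis_elt R (f x, y)" if "x \<in> carrier M" "y \<in> carrier N" for x y
    using TB.free_lift_basis[of "carrier M \<times> carrier N" ?\<phi> "(x, y)"] \<phi> that by simp
  note d = A.\<delta>_carrier
  note c = TA.carrier_is_submodule
  have "A.trel \<subseteq> {t \<in> carrier A.TF. ?g t \<in> B.trel}"
  proof (rule A.trel_least[OF P.vimage_submodule[OF c g B.trel_submodule]]; intro CollectI conjI)
    fix x x' y assume *: "x \<in> carrier M" "x' \<in> carrier M" "y \<in> carrier N"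
    show "basis_elt R (x \<oplus>\<^bsub>M\<^esub> x', y) \<ominus>\<^bsub>A.TF\<^esub> (basis_elt R (x, y) \<oplus>\<^bsub>A.TF\<^esub> basis_elt R (x', y)) \<in> carrier A.TF"
      using * by (intro TA.M.minus_closed TA.M.a_closed d A.M.M.a_closed)
    have "?g (basis_elt R (x \<oplus>\<^bsub>M\<^esub> x', y) \<ominus>\<^bsub>A.TF\<^esub> (basis_elt R (x, y) \<oplus>\<^bsub>A.TF\<^esub> basis_elt R (x', y))) =
       basis_elt R (f (x \<oplus>\<^bsub>M\<^esub> x'), y) \<ominus>\<^bsub>B.TF\<^esub> (basis_elt R (f x, y) \<oplus>\<^bsub>B.TF\<^esub> basis_elt R (f x', y))"
      using * by (simp only: P.lin_minus[OF c g] linear_onD(2)[OF g] d A.M.M.a_closed TA.M.a_closed g\<delta>)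
    then show "?g (basis_elt R (x \<oplus>\<^bsub>M\<^esub> x', y) \<ominus>\<^bsub>A.TF\<^esub> (basis_elt R (x, y) \<oplus>\<^bsub>A.TF\<^esub> basis_elt R (x', y))) \<in> B.trel"
      using * linear_onD(1,2)[OF f] by (simp only: B.trel_add1)
  next
    fix x y y' assume *: "x \<in> carrier M" "y \<in> carrier N" "y' \<in> carrier N"
    show "basis_elt R (x, y \<oplus>\<^bsub>N\<^esub> y') \<ominus>\<^bsub>A.TF\<^esub> (basis_elt R (x, y) \<oplus>\<^bsub>A.TF\<^esub> basis_elt R (x, y')) \<in> carrier A.TF"
      using * by (intro TA.M.minus_closed TA.M.a_closed d A.N.M.a_closed)
    have "?g (basis_elt R (x, y \<oplus>\<^bsub>N\<^esub> y') \<ominus>\<^bsub>A.TF\<^esub> (basis_elt R (x, y) \<oplus>\<^bsub>A.TF\<^esub> basis_elt R (x, y'))) =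
       basis_elt R (f x, y \<oplus>\<^bsub>N\<^esub> y') \<ominus>\<^bsub>B.TF\<^esub> (basis_elt R (f x, y) \<oplus>\<^bsub>B.TF\<^esub> basis_elt R (f x, y'))"
      using * by (simp only: P.lin_minus[OF c g] linear_onD(2)[OF g] d A.N.M.a_closed TA.M.a_closed g\<delta>)
    then show "?g (basis_elt R (x, y \<oplus>\<^bsub>N\<^esub> y') \<ominus>\<^bsub>A.TF\<^esub> (basis_elt R (x, y) \<oplus>\<^bsub>A.TF\<^esub> basis_elt R (x, y'))) \<in> B.trel"
      using * linear_onD(1)[OF f] by (simp only: B.trel_add2)
  next
    fix a x y assume *: "a \<in> carrier R" "x \<in> carrier M" "y \<in> carrier N"
    show "basis_elt R (a \<odot>\<^bsub>M\<^esub> x, y) \<ominus>\<^bsub>A.TF\<^esub> (a \<odot>\<^bsub>A.TF\<^esub> basis_elt R (x, y)) \<in> carrier A.TF"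
      using * by (intro TA.M.minus_closed TA.smult_closed d A.M.smult_closed)
    have "?g (basis_elt R (a \<odot>\<^bsub>M\<^esub> x, y) \<ominus>\<^bsub>A.TF\<^esub> (a \<odot>\<^bsub>A.TF\<^esub> basis_elt R (x, y))) =
       basis_elt R (f (a \<odot>\<^bsub>M\<^esub> x), y) \<ominus>\<^bsub>B.TF\<^esub> (a \<odot>\<^bsub>B.TF\<^esub> basis_elt R (f x, y))"
      using * by (simp only: P.lin_minus[OF c g] linear_onD(3)[OF g] d A.M.smult_closed TA.smult_closed g\<delta>)
    then show "?g (basis_elt R (a \<odot>\<^bsub>M\<^esub> x, y) \<ominus>\<^bsub>A.TF\<^esub> (a \<odot>\<^bsub>A.TF\<^esub> basis_elt R (x, y))) \<in> B.trel"
      using * linear_onD(1,3)[OF f] by (simp only: B.trel_smult1)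
    show "basis_elt R (x, a \<odot>\<^bsub>N\<^esub> y) \<ominus>\<^bsub>A.TF\<^esub> (a \<odot>\<^bsub>A.TF\<^esub> basis_elt R (x, y)) \<in> carrier A.TF"
      using * by (intro TA.M.minus_closed TA.smult_closed d A.N.smult_closed)
    have "?g (basis_elt R (x, a \<odot>\<^bsub>N\<^esub> y) \<ominus>\<^bsub>A.TF\<^esub> (a \<odot>\<^bsub>A.TF\<^esub> basis_elt R (x, y))) =
       basis_elt R (f x, a \<odot>\<^bsub>N\<^esub> y) \<ominus>\<^bsub>B.TF\<^esub> (a \<odot>\<^bsub>B.TF\<^esub> basis_elt R (f x, y))"
      using * by (simp only: P.lin_minus[OF c g] linear_onD(3)[OF g] d A.N.smult_closed TA.smult_closed g\<delta>)
    then show "?g (basis_elt R (x, a \<odot>\<^bsub>N\<^esub> y) \<ominus>\<^bsub>A.TF\<^esub> (a \<odot>\<^bsub>A.TF\<^esub> basis_elt R (x, y))) \<in> B.trel"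
      using * linear_onD(1)[OF f] by (simp only: B.trel_smult2)
  qed
  then have rel: "?g t \<in> B.trel" "t \<in> carrier A.TF" if "t \<in> A.trel" for t using that by auto
  have fx: "f x \<in> carrier M'" using linear_onD(1)[OF f x] .
  have const: "B.trel +>\<^bsub>B.TF\<^esub> ?g t = B.tensor_elt (f x) y" if t: "t \<in> A.tensor_elt x y" for t
  proof -
    obtain r where r: "r \<in> A.trel" "t = r \<oplus>\<^bsub>A.TF\<^esub> basis_elt R (x, y)"
      using t unfolding A.tensor_elt_def TA.coset_mem_iff by blast
    have gt: "?g t = ?g r \<oplus>\<^bsub>B.TF\<^esub> basis_elt R (f x, y)"
      unfolding r(2) linear_onD(2)[OF g rel(2)[OF r(1)] d[OF x y]] g\<delta>[OF x y] ..
    have gr: "?g r \<in> carrier B.TF" using linear_onD(1)[OF g rel(2)[OF r(1)]] .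
    have "?g t \<ominus>\<^bsub>B.TF\<^esub> basis_elt R (f x, y) = ?g r"
      unfolding gt TB.M.a_comm[OF gr B.\<delta>_carrier[OF fx y]] by (rule TB.add_minus_self[OF B.\<delta>_carrier[OF fx y] gr])
    then show ?thesis
      unfolding B.tensor_elt_def
      using gt gr rel(1)[OF r(1)] B.\<delta>_carrier[OF fx y] TB.M.a_closed by (intro B.coset_eqI) simp_all
  qed
  have "\<zero>\<^bsub>A.TF\<^esub> \<oplus>\<^bsub>A.TF\<^esub> basis_elt R (x, y) \<in> A.tensor_elt x y"
    unfolding A.tensor_elt_def TA.coset_mem_iff using TA.sub_zero[OF A.trel_submodule] by blast
  then have "A.tensor_elt x y \<noteq> {}" by blast
  then show ?thesis
    unfolding tensor_map_def Let_def using const by (intro SUP_eq_const) auto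
qed

text \<open>For the cyclic module \<open>L = R/I\<close>, the map \<open>u \<mapsto> u \<otimes> 1\<close> presents \<open>F \<otimes> L\<close> as \<open>F/IF\<close>.
  That its kernel is no larger than \<open>IF\<close> is seen from the map on the free module of symbols that
  sends \<open>(u, C)\<close> to \<open>r u\<close> for a chosen representative \<open>r\<close> of the class \<open>C\<close>.\<close>

locale cyclic_tensor = module R F for R (structure) and F + fixes I assumes I: "ideal I R"
begin

abbreviation L :: "('a, 'a set) module" where "L \<equiv> quot_module (self_module R) I"

abbreviation one_L :: "'a set" where "one_L \<equiv> I +>\<^bsub>self_module R\<^esub> \<one>"

lemma I_submodule: "submodule I R (self_module R)"
  using I by (simp add: self_submodule_iff)

lemma L_module: "module R L"
  by (rule module.quot_module_module(1)[OF self_module I_submodule])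

lemma one_L: "one_L \<in> carrier L"
  using module.quot_carrier[OF self_module, of I] by simp

lemma L_cyclic:
  assumes "y \<in> carrier L" "r \<in> y" shows "r \<in> carrier R" "y = r \<odot>\<^bsub>L\<^esub> one_L"
proof -
  interpret S: module R "self_module R" by (rule self_module)
  obtain b where b: "b \<in> carrier R" "y = I +>\<^bsub>self_module R\<^esub> b"
    using assms(1) unfolding module.quot_carrier[OF self_module] by auto
  obtain i where i: "i \<in> I" "r = i \<oplus>\<^bsub>self_module R\<^esub> b" using assms(2) b(2) by (auto simp: S.coset_mem_iff)
  show r: "r \<in> carrier R" using i b(1) ideal.Icarr[OF I i(1)] by simp
  have "r \<ominus>\<^bsub>self_module R\<^esub> b \<in> I"
  proof -
    have "(b \<oplus>\<^bsub>self_module R\<^esub> i) \<ominus>\<^bsub>self_module R\<^esub> b = i"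
      by (rule S.add_minus_self) (use b(1) ideal.Icarr[OF I i(1)] in auto)
    moreover have "b \<oplus>\<^bsub>self_module R\<^esub> i = r" using i b(1) ideal.Icarr[OF I i(1)] by (simp add: R.a_comm[of b i])
    ultimately show ?thesis using i(1) by simp
  qed
  then have "y = I +>\<^bsub>self_module R\<^esub> r"
    using S.coset_eq_iff[OF I_submodule, of r b] r b by simp
  also have "\<dots> = I +>\<^bsub>self_module R\<^esub> (r \<odot>\<^bsub>self_module R\<^esub> \<one>)" using r by simp
  also have "\<dots> = r \<odot>\<^bsub>L\<^esub> one_L"
    using linear_onD(3)[OF S.quot_module_module(2)[OF I_submodule] r, of \<one>] by simp
  finally show "y = r \<odot>\<^bsub>L\<^esub> one_L" .
qed

sublocale FL: module_pair R F L
  by (intro module_pairI module_axioms L_module)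

abbreviation \<theta> :: "'c \<Rightarrow> ('c \<times> 'a set \<Rightarrow> 'a) set"
  where "\<theta> u \<equiv> FL.tensor_elt u one_L"

lemma \<theta>_linear: "linear_on R F (carrier F) (tensor R F L) \<theta>"
  by (rule linear_onI) (simp_all only: FL.tensor_elt_carrier FL.tensor_elt_add1 FL.tensor_elt_smult1 one_L)

text \<open>Every symbol \<open>u \<otimes> y\<close> equals \<open>r u \<otimes> 1\<close> for a representative \<open>r\<close> of \<open>y\<close>.\<close>

lemma \<theta>_surj: "carrier (tensor R F L) \<subseteq> \<theta> ` carrier F"
proof -
  interpret T: module R "tensor R F L" by (rule FL.tensor_module)
  interpret P: module_pair R FL.TF "tensor R F L" by (intro module_pairI FL.TF_module FL.tensor_module)
  interpret Q: module_pair R F "tensor R F L" by (intro module_pairI module_axioms FL.tensor_module)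
  have im: "submodule (\<theta> ` carrier F) R (tensor R F L)"
    by (rule Q.image_submodule[OF carrier_is_submodule \<theta>_linear carrier_is_submodule order_refl])
  have "carrier FL.TF \<subseteq> {t \<in> carrier FL.TF. FL.trel +>\<^bsub>FL.TF\<^esub> t \<in> \<theta> ` carrier F}"
  proof (rule free_span[OF P.vimage_submodule[OF P.M.carrier_is_submodule FL.tensor_proj im]])
    fix z assume z: "z \<in> carrier F \<times> carrier L"
    obtain u y where uy: "z = (u, y)" "u \<in> carrier F" "y \<in> carrier L" using z by blast
    have "\<exists>b\<in>carrier R. y = I +>\<^bsub>self_module R\<^esub> b"
      using uy(3) unfolding module.quot_carrier[OF self_module] by auto
    then obtain b where "b \<in> carrier R" "y = I +>\<^bsub>self_module R\<^esub> b" ..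
    then have "\<zero>\<^bsub>self_module R\<^esub> \<oplus>\<^bsub>self_module R\<^esub> b \<in> y"
      using module.coset_mem_iff[OF self_module] ideal.axioms(1)[OF I] additive_subgroup.zero_closed
      by fastforce
    then obtain r where "r \<in> y" by blast
    note r = L_cyclic[OF uy(3) this]
    have "FL.tensor_elt u y = FL.tensor_elt u (r \<odot>\<^bsub>L\<^esub> one_L)" using r(2) by simp
    also have "\<dots> = r \<odot>\<^bsub>tensor R F L\<^esub> \<theta> u" by (rule FL.tensor_elt_smult2[OF uy(2) one_L r(1)])
    also have "\<dots> = \<theta> (r \<odot>\<^bsub>F\<^esub> u)" by (rule FL.tensor_elt_smult1[OF uy(2) one_L r(1), symmetric])
    finally have "FL.tensor_elt u y \<in> \<theta> ` carrier F" using r(1) uy(2) by blast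
    then show "basis_elt R z \<in> {t \<in> carrier FL.TF. FL.trel +>\<^bsub>FL.TF\<^esub> t \<in> \<theta> ` carrier F}"
      using FL.\<delta>_carrier[OF uy(2,3)] unfolding FL.tensor_elt_def uy(1) by simp
  qed
  then show ?thesis unfolding FL.tensor_carrier by blast
qed

lemma IF_submodule: "submodule (sprod R F I (carrier F)) R F"
  by (rule sprod_submodule) (use ideal.Icarr[OF I] in auto)

lemma IF_smult: "a \<in> carrier R \<Longrightarrow> a \<ominus> b \<in> I \<Longrightarrow> b \<in> carrier R \<Longrightarrow> u \<in> carrier F \<Longrightarrow>
    a \<odot>\<^bsub>F\<^esub> u \<ominus>\<^bsub>F\<^esub> b \<odot>\<^bsub>F\<^esub> u \<in> sprod R F I (carrier F)"
  using sprod_memI[of "a \<ominus> b" I u "carrier F"]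
  by (simp add: minus_eq smult_l_distr smult_l_minus a_minus_def)

lemma \<theta>_kernel:
  assumes u: "u \<in> carrier F"
  shows "\<theta> u = FL.trel \<longleftrightarrow> u \<in> sprod R F I (carrier F)"
proof
  assume "u \<in> sprod R F I (carrier F)"
  interpret Q: module_pair R F "tensor R F L" by (intro module_pairI module_axioms FL.tensor_module)
  interpret S: module R "self_module R" by (rule self_module)
  have "sprod R F I (carrier F) \<subseteq> {u \<in> carrier F. \<theta> u \<in> {\<zero>\<^bsub>tensor R F L\<^esub>}}"
  proof (rule sprod_least[OF Q.vimage_submodule[OF carrier_is_submodule \<theta>_linear Q.N.zero_submodule]])
    fix a p assume a: "a \<in> I" and p: "p \<in> carrier F"
    have ac: "a \<in> carrier R" using ideal.Icarr[OF I a] .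
    have "a \<odot>\<^bsub>L\<^esub> one_L = I +>\<^bsub>self_module R\<^esub> (a \<odot>\<^bsub>self_module R\<^esub> \<one>)"
      using linear_onD(3)[OF S.quot_module_module(2)[OF I_submodule] ac, of \<one>] by simp
    also have "\<dots> = \<zero>\<^bsub>L\<^esub>" using S.coset_eq_self_iff[OF I_submodule, of a] ac a by simp
    also have "\<dots> = \<zero> \<odot>\<^bsub>L\<^esub> one_L" using FL.N.smult_l_null[OF one_L] by simp
    finally have "\<theta> (a \<odot>\<^bsub>F\<^esub> p) = \<zero> \<odot>\<^bsub>tensor R F L\<^esub> \<theta> p"
      using FL.tensor_elt_smult2[OF p one_L ac] FL.tensor_elt_smult1[OF p one_L ac]
        FL.tensor_elt_smult2[OF p one_L R.zero_closed] by simp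
    then show "a \<odot>\<^bsub>F\<^esub> p \<in> {u \<in> carrier F. \<theta> u \<in> {\<zero>\<^bsub>tensor R F L\<^esub>}}"
      using Q.N.smult_l_null[OF linear_onD(1)[OF \<theta>_linear p]] ac p by simp
  qed
  then show "\<theta> u = FL.trel" using \<open>u \<in> sprod R F I (carrier F)\<close> FL.tensor_zero by auto
next
  assume "\<theta> u = FL.trel"
  interpret S: module R "self_module R" by (rule self_module)
  interpret T: module R FL.TF by (rule FL.TF_module)
  interpret P: module_pair R FL.TF F by (intro module_pairI FL.TF_module module_axioms)
  let ?IF = "sprod R F I (carrier F)"
  \<comment> \<open>the choice of \<open>r\<close> is additive and linear only modulo \<open>I\<close>, so \<open>\<rho>\<close> maps relations into \<open>IF\<close>, not to zero\<close>
  define r where "r y = (SOME b. b \<in> carrier R \<and> y = I +>\<^bsub>self_module R\<^esub> b)" for y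
  have r: "r y \<in> carrier R" "y = I +>\<^bsub>self_module R\<^esub> r y" if "y \<in> carrier L" for y
  proof -
    have "\<exists>b. b \<in> carrier R \<and> y = I +>\<^bsub>self_module R\<^esub> b"
      using that unfolding module.quot_carrier[OF self_module] by auto
    from someI_ex[OF this] show "r y \<in> carrier R" "y = I +>\<^bsub>self_module R\<^esub> r y" unfolding r_def by auto
  qed
  have req: "r y \<ominus> b \<in> I" if "y \<in> carrier L" "b \<in> carrier R" "y = I +>\<^bsub>self_module R\<^esub> b" for y b
    using S.coset_eq_iff[OF I_submodule, of "r y" b] r[OF that(1)] that(2,3)
    by (simp add: a_minus_def self_module_a_inv)
  note q = linear_onD[OF S.quot_module_module(2)[OF I_submodule], unfolded self_module_sel]
  define \<rho> where "\<rho> = free_lift R F (\<lambda>(v, y). r y \<odot>\<^bsub>F\<^esub> v)"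
  have \<phi>: "(\<lambda>(v, y). r y \<odot>\<^bsub>F\<^esub> v) z \<in> carrier F" if "z \<in> carrier F \<times> carrier L" for z
    using that r by auto
  have \<rho>: "linear_on R FL.TF (carrier FL.TF) F \<rho>" unfolding \<rho>_def by (rule free_lift_linear[OF \<phi>])
  have \<rho>\<delta>: "\<rho> (basis_elt R (v, y)) = r y \<odot>\<^bsub>F\<^esub> v" if "v \<in> carrier F" "y \<in> carrier L" for v y
    unfolding \<rho>_def using free_lift_basis[of "carrier F \<times> carrier L" "\<lambda>(v, y). r y \<odot>\<^bsub>F\<^esub> v" "(v, y)"] \<phi> that
    by simp
  note d = FL.\<delta>_carrier
  note c = T.carrier_is_submodule
  have z: "v \<ominus>\<^bsub>F\<^esub> w \<in> ?IF" if "v = w" "w \<in> carrier F" for v w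
    using that sub_zero[OF IF_submodule] by (simp add: a_minus_def M.r_neg)
  have "FL.trel \<subseteq> {t \<in> carrier FL.TF. \<rho> t \<in> ?IF}"
  proof (rule FL.trel_least[OF P.vimage_submodule[OF c \<rho> IF_submodule]]; intro CollectI conjI)
    fix x x' y assume *: "x \<in> carrier F" "x' \<in> carrier F" "y \<in> carrier L"
    show "basis_elt R (x \<oplus>\<^bsub>F\<^esub> x', y) \<ominus>\<^bsub>FL.TF\<^esub> (basis_elt R (x, y) \<oplus>\<^bsub>FL.TF\<^esub> basis_elt R (x', y)) \<in> carrier FL.TF"
      using * by (intro T.M.minus_closed T.M.a_closed d M.a_closed)
    have "\<rho> (basis_elt R (x \<oplus>\<^bsub>F\<^esub> x', y) \<ominus>\<^bsub>FL.TF\<^esub> (basis_elt R (x, y) \<oplus>\<^bsub>FL.TF\<^esub> basis_elt R (x', y))) =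
        r y \<odot>\<^bsub>F\<^esub> (x \<oplus>\<^bsub>F\<^esub> x') \<ominus>\<^bsub>F\<^esub> (r y \<odot>\<^bsub>F\<^esub> x \<oplus>\<^bsub>F\<^esub> r y \<odot>\<^bsub>F\<^esub> x')"
      using * by (simp only: P.lin_minus[OF c \<rho>] linear_onD(2)[OF \<rho>] d M.a_closed T.M.a_closed \<rho>\<delta>)
    also have "\<dots> \<in> ?IF" using * r(1)[of y] by (intro z) (auto simp: smult_r_distr)
    finally show "\<rho> (basis_elt R (x \<oplus>\<^bsub>F\<^esub> x', y) \<ominus>\<^bsub>FL.TF\<^esub> (basis_elt R (x, y) \<oplus>\<^bsub>FL.TF\<^esub> basis_elt R (x', y))) \<in> ?IF" .
  next
    fix x y y' assume *: "x \<in> carrier F" "y \<in> carrier L" "y' \<in> carrier L"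
    have yy: "y \<oplus>\<^bsub>L\<^esub> y' \<in> carrier L" by (rule FL.N.M.a_closed[OF *(2,3)])
    show "basis_elt R (x, y \<oplus>\<^bsub>L\<^esub> y') \<ominus>\<^bsub>FL.TF\<^esub> (basis_elt R (x, y) \<oplus>\<^bsub>FL.TF\<^esub> basis_elt R (x, y')) \<in> carrier FL.TF"
      using * yy by (intro T.M.minus_closed T.M.a_closed d)
    have "\<rho> (basis_elt R (x, y \<oplus>\<^bsub>L\<^esub> y') \<ominus>\<^bsub>FL.TF\<^esub> (basis_elt R (x, y) \<oplus>\<^bsub>FL.TF\<^esub> basis_elt R (x, y'))) =
        r (y \<oplus>\<^bsub>L\<^esub> y') \<odot>\<^bsub>F\<^esub> x \<ominus>\<^bsub>F\<^esub> (r y \<odot>\<^bsub>F\<^esub> x \<oplus>\<^bsub>F\<^esub> r y' \<odot>\<^bsub>F\<^esub> x)"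
      using * yy by (simp only: P.lin_minus[OF c \<rho>] linear_onD(2)[OF \<rho>] d T.M.a_closed \<rho>\<delta>)
    also have "\<dots> = r (y \<oplus>\<^bsub>L\<^esub> y') \<odot>\<^bsub>F\<^esub> x \<ominus>\<^bsub>F\<^esub> (r y \<oplus> r y') \<odot>\<^bsub>F\<^esub> x"
      using * r(1) by (simp only: smult_l_distr)
    also have "\<dots> \<in> ?IF"
    proof (rule IF_smult[OF r(1)[OF yy] req[OF yy]])
      show "y \<oplus>\<^bsub>L\<^esub> y' = I +>\<^bsub>self_module R\<^esub> (r y \<oplus> r y')"
        using q(2)[OF r(1)[OF *(2)] r(1)[OF *(3)]] r(2)[OF *(2)] r(2)[OF *(3)] by metis
    qed (use * r(1) in auto)
    finally show "\<rho> (basis_elt R (x, y \<oplus>\<^bsub>L\<^esub> y') \<ominus>\<^bsub>FL.TF\<^esub> (basis_elt R (x, y) \<oplus>\<^bsub>FL.TF\<^esub> basis_elt R (x, y'))) \<in> ?IF" .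
  next
    fix a x y assume *: "a \<in> carrier R" "x \<in> carrier F" "y \<in> carrier L"
    show "basis_elt R (a \<odot>\<^bsub>F\<^esub> x, y) \<ominus>\<^bsub>FL.TF\<^esub> (a \<odot>\<^bsub>FL.TF\<^esub> basis_elt R (x, y)) \<in> carrier FL.TF"
      using * by (intro T.M.minus_closed T.smult_closed d smult_closed)
    have "\<rho> (basis_elt R (a \<odot>\<^bsub>F\<^esub> x, y) \<ominus>\<^bsub>FL.TF\<^esub> (a \<odot>\<^bsub>FL.TF\<^esub> basis_elt R (x, y))) =
        r y \<odot>\<^bsub>F\<^esub> (a \<odot>\<^bsub>F\<^esub> x) \<ominus>\<^bsub>F\<^esub> a \<odot>\<^bsub>F\<^esub> (r y \<odot>\<^bsub>F\<^esub> x)"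
      using * by (simp only: P.lin_minus[OF c \<rho>] linear_onD(3)[OF \<rho>] d smult_closed T.smult_closed \<rho>\<delta>)
    also have "\<dots> \<in> ?IF" using * r(1)[of y] by (intro z smult_comm) auto
    finally show "\<rho> (basis_elt R (a \<odot>\<^bsub>F\<^esub> x, y) \<ominus>\<^bsub>FL.TF\<^esub> (a \<odot>\<^bsub>FL.TF\<^esub> basis_elt R (x, y))) \<in> ?IF" .
    have ay: "a \<odot>\<^bsub>L\<^esub> y \<in> carrier L" by (rule FL.N.smult_closed[OF *(1,3)])
    show "basis_elt R (x, a \<odot>\<^bsub>L\<^esub> y) \<ominus>\<^bsub>FL.TF\<^esub> (a \<odot>\<^bsub>FL.TF\<^esub> basis_elt R (x, y)) \<in> carrier FL.TF"
      using * ay by (intro T.M.minus_closed T.smult_closed d)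
    have "\<rho> (basis_elt R (x, a \<odot>\<^bsub>L\<^esub> y) \<ominus>\<^bsub>FL.TF\<^esub> (a \<odot>\<^bsub>FL.TF\<^esub> basis_elt R (x, y))) =
        r (a \<odot>\<^bsub>L\<^esub> y) \<odot>\<^bsub>F\<^esub> x \<ominus>\<^bsub>F\<^esub> a \<odot>\<^bsub>F\<^esub> (r y \<odot>\<^bsub>F\<^esub> x)"
      using * ay by (simp only: P.lin_minus[OF c \<rho>] linear_onD(3)[OF \<rho>] d T.smult_closed \<rho>\<delta>)
    also have "\<dots> = r (a \<odot>\<^bsub>L\<^esub> y) \<odot>\<^bsub>F\<^esub> x \<ominus>\<^bsub>F\<^esub> (a \<otimes> r y) \<odot>\<^bsub>F\<^esub> x"
      using * r(1) by (simp only: smult_assoc1)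
    also have "\<dots> \<in> ?IF"
    proof (rule IF_smult[OF r(1)[OF ay] req[OF ay]])
      show "a \<odot>\<^bsub>L\<^esub> y = I +>\<^bsub>self_module R\<^esub> (a \<otimes> r y)"
        using q(3)[OF *(1) r(1)[OF *(3)]] r(2)[OF *(3)] by metis
    qed (use * r(1) in auto)
    finally show "\<rho> (basis_elt R (x, a \<odot>\<^bsub>L\<^esub> y) \<ominus>\<^bsub>FL.TF\<^esub> (a \<odot>\<^bsub>FL.TF\<^esub> basis_elt R (x, y))) \<in> ?IF" .
  qed
  moreover have "basis_elt R (u, one_L) \<in> FL.trel"
    using \<open>\<theta> u = FL.trel\<close> T.coset_eq_self_iff[OF FL.trel_submodule d[OF u one_L]]
    by (simp add: FL.tensor_elt_def)
  ultimately have "r one_L \<odot>\<^bsub>F\<^esub> u \<in> ?IF" using \<rho>\<delta>[OF u one_L] by auto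
  moreover have "r one_L \<odot>\<^bsub>F\<^esub> u \<ominus>\<^bsub>F\<^esub> \<one> \<odot>\<^bsub>F\<^esub> u \<in> ?IF"
    by (rule IF_smult[OF r(1)[OF one_L] req[OF one_L]]) (use u in auto)
  ultimately have "r one_L \<odot>\<^bsub>F\<^esub> u \<ominus>\<^bsub>F\<^esub> (r one_L \<odot>\<^bsub>F\<^esub> u \<ominus>\<^bsub>F\<^esub> \<one> \<odot>\<^bsub>F\<^esub> u) \<in> ?IF"
    by (rule sub_minus[OF IF_submodule])
  moreover have "v \<ominus>\<^bsub>F\<^esub> (v \<ominus>\<^bsub>F\<^esub> w) = w" if "v \<in> carrier F" "w \<in> carrier F" for v w
    using that by (simp add: a_minus_def M.minus_add M.a_assoc[symmetric] M.r_neg)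
  ultimately show "u \<in> ?IF" using r(1)[OF one_L] u by simp
qed

end

lemma (in module_pair) sprod_image:
  assumes I: "I \<subseteq> carrier R" and P: "submodule P R M" and f: "linear_on R M (carrier M) N f"
    and P': "submodule P' R N" and fP: "f ` P \<subseteq> P'"
  shows "f ` sprod R M I P \<subseteq> sprod R N I P'"
proof -
  have s: "submodule (sprod R N I P') R N" using N.sub_carr[OF P'] by (intro N.sprod_submodule I) auto
  have "sprod R M I P \<subseteq> {u \<in> carrier M. f u \<in> sprod R N I P'}"
  proof (rule M.sprod_least[OF vimage_submodule[OF M.carrier_is_submodule f s]])
    fix a p assume a: "a \<in> I" and p: "p \<in> P"
    have c: "a \<in> carrier R" "p \<in> carrier M" using a I M.sub_carr[OF P p] by auto
    have "f (a \<odot>\<^bsub>M\<^esub> p) = a \<odot>\<^bsub>N\<^esub> f p" by (rule linear_onD(3)[OF f c])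
    then show "a \<odot>\<^bsub>M\<^esub> p \<in> {u \<in> carrier M. f u \<in> sprod R N I P'}"
      using N.sprod_memI[OF a, of "f p" P'] fP p c by auto
  qed
  then show ?thesis by blast
qed

text \<open>The length of \<open>Tor\<^sub>1\<close> computed from a presentation \<open>0 \<rightarrow> K \<rightarrow> F \<rightarrow> M \<rightarrow> 0\<close> with \<open>F\<close> free,
  namely of \<open>(K \<inter> IF) / IK\<close>.\<close>

definition tor_length ::
    "('a, 'r) ring_scheme \<Rightarrow> ('a, 'b, 'm) module_scheme \<Rightarrow> 'b set \<Rightarrow> 'a set \<Rightarrow> enat"
  where "tor_length R F K I = ilen R F (sprod R F I K) (K \<inter> sprod R F I (carrier F))"

lemma kernel_submodule:
  assumes "module R M" "module R N" "linear_on R M (carrier M) N f"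
  shows "submodule (a_kernel M N f) R M" "a_kernel M N f = {x \<in> carrier M. f x = \<zero>\<^bsub>N\<^esub>}"
proof -
  interpret module_pair R M N by (intro module_pairI assms)
  show e: "a_kernel M N f = {x \<in> carrier M. f x = \<zero>\<^bsub>N\<^esub>}" by (auto simp: a_kernel_def')
  show "submodule (a_kernel M N f) R M"
    using vimage_submodule[OF M.carrier_is_submodule assms(3) N.zero_submodule] by (simp add: e)
qed

text \<open>Two presentations that map to each other give the same length: the composite of the two maps
  differs from the identity by a map into the kernel, which sends \<open>IF\<close> to \<open>IK\<close>.\<close>

lemma tor_length_le:
  assumes I: "ideal I R" and F: "module R F" and G: "module R G" and M: "module R M"
    and p: "linear_on R F (carrier F) M p" and q: "linear_on R G (carrier G) M q"
    and a: "linear_on R F (carrier F) G a" "\<And>u. u \<in> carrier F \<Longrightarrow> q (a u) = p u"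
    and b: "linear_on R G (carrier G) F b" "\<And>v. v \<in> carrier G \<Longrightarrow> p (b v) = q v"
  shows "tor_length R F (a_kernel F M p) I \<le> tor_length R G (a_kernel G M q) I"
proof -
  interpret FG: module_pair R F G by (intro module_pairI F G)
  interpret GF: module_pair R G F by (intro module_pairI F G)
  interpret FF: module_pair R F F by (intro module_pairI F)
  interpret FM: module_pair R F M by (intro module_pairI F M)
  have Ic: "I \<subseteq> carrier R" using ideal.Icarr[OF I] by blast
  let ?K = "a_kernel F M p" and ?L = "a_kernel G M q"
  note K = kernel_submodule[OF F M p] and L = kernel_submodule[OF G M q]
  have IF: "submodule (sprod R F I (carrier F)) R F" "submodule (sprod R F I ?K) R F"
    using FG.M.sub_carr[OF K(1)] by (auto intro!: FG.M.sprod_submodule Ic)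
  have IG: "submodule (sprod R G I (carrier G)) R G" "submodule (sprod R G I ?L) R G"
    using FG.N.sub_carr[OF L(1)] by (auto intro!: FG.N.sprod_submodule Ic)
  have P: "submodule (?K \<inter> sprod R F I (carrier F)) R F" by (rule FG.M.Int_submodule[OF K(1) IF(1)])
  have P': "submodule (?L \<inter> sprod R G I (carrier G)) R G" by (rule FG.N.Int_submodule[OF L(1) IG(1)])
  have ac: "a u \<in> carrier G" if "u \<in> carrier F" for u using linear_onD(1)[OF a(1) that] .
  have bc: "b v \<in> carrier F" if "v \<in> carrier G" for v using linear_onD(1)[OF b(1) that] .
  have aK: "a ` ?K \<subseteq> ?L" using ac a(2) by (auto simp: K(2) L(2))
  have bL: "b ` ?L \<subseteq> ?K" using bc b(2) by (auto simp: K(2) L(2))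
  have aIF: "a ` sprod R F I (carrier F) \<subseteq> sprod R G I (carrier G)"
    by (rule FG.sprod_image[OF Ic FG.M.carrier_is_submodule a(1) FG.N.carrier_is_submodule]) (use ac in auto)
  have bIL: "b ` sprod R G I ?L \<subseteq> sprod R F I ?K"
    by (rule GF.sprod_image[OF Ic L(1) b(1) K(1) bL])
  \<comment> \<open>the difference between the identity of \<open>F\<close> and the composite of the two maps; it maps \<open>F\<close> into \<open>K\<close>\<close>
  define h where "h u = u \<ominus>\<^bsub>F\<^esub> b (a u)" for u
  have h: "linear_on R F (carrier F) F h"
  proof (rule linear_onI)
    fix u v assume uv: "u \<in> carrier F" "v \<in> carrier F"
    show "h u \<in> carrier F" unfolding h_def using uv ac bc by simp
    have "b (a (u \<oplus>\<^bsub>F\<^esub> v)) = b (a u) \<oplus>\<^bsub>F\<^esub> b (a v)"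
      using uv ac linear_onD(2)[OF a(1)] linear_onD(2)[OF b(1)] by simp
    then show "h (u \<oplus>\<^bsub>F\<^esub> v) = h u \<oplus>\<^bsub>F\<^esub> h v"
      unfolding h_def using uv ac bc by (simp add: a_minus_def FG.M.M.minus_add FG.M.M.a_ac)
  next
    fix r u assume ru: "r \<in> carrier R" "u \<in> carrier F"
    have "b (a (r \<odot>\<^bsub>F\<^esub> u)) = r \<odot>\<^bsub>F\<^esub> b (a u)"
      using ru ac linear_onD(3)[OF a(1)] linear_onD(3)[OF b(1)] by simp
    then show "h (r \<odot>\<^bsub>F\<^esub> u) = r \<odot>\<^bsub>F\<^esub> h u"
      unfolding h_def using ru ac bc by (simp add: FG.M.smult_minus_distr)
  qed
  have "h ` carrier F \<subseteq> ?K"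
  proof (intro image_subsetI)
    fix u assume u: "u \<in> carrier F"
    have "p (h u) = p u \<ominus>\<^bsub>M\<^esub> p (b (a u))"
      unfolding h_def by (rule FM.lin_minus[OF FG.M.carrier_is_submodule p u bc[OF ac[OF u]]])
    also have "\<dots> = \<zero>\<^bsub>M\<^esub>" using u ac a(2) b(2) linear_onD(1)[OF p u] by (simp add: a_minus_def FM.N.M.r_neg)
    finally show "h u \<in> ?K" using linear_onD(1)[OF h u] by (simp add: K(2))
  qed
  then have hIF: "h ` sprod R F I (carrier F) \<subseteq> sprod R F I ?K"
    by (rule FF.sprod_image[OF Ic FG.M.carrier_is_submodule h K(1)])
  show ?thesis
    unfolding tor_length_def
  proof (rule FG.ilen_inj[OF P P' IG(2)])
    show "sprod R G I ?L \<subseteq> ?L \<inter> sprod R G I (carrier G)"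
      using FG.N.sprod_sub[OF Ic L(1)] FG.N.sprod_mono[OF order_refl, of ?L "carrier G" I]
        FG.N.sub_carr[OF L(1)] by blast
    show "linear_on R F (?K \<inter> sprod R F I (carrier F)) G a"
      by (rule linear_on_subset[OF a(1)]) (use FG.M.sub_carr[OF P] in blast)
    show "a ` (?K \<inter> sprod R F I (carrier F)) \<subseteq> ?L \<inter> sprod R G I (carrier G)"
      using aK aIF by blast
    fix u assume u: "u \<in> ?K \<inter> sprod R F I (carrier F)" and au: "a u \<in> sprod R G I ?L"
    have uc: "u \<in> carrier F" using FG.M.sub_carr[OF P u] .
    have 1: "b (a u) \<in> sprod R F I ?K" using bIL au by blast
    have 2: "u \<ominus>\<^bsub>F\<^esub> b (a u) \<in> sprod R F I ?K" using hIF u unfolding h_def by blast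
    show "u \<in> sprod R F I ?K" by (rule FG.M.sub_minus_cancel[OF IF(2) uc 1 2])
  qed
qed

lemma tor_length_eq:
  assumes "ideal I R" "module R F" "module R G" "module R M"
    "linear_on R F (carrier F) M p" "linear_on R G (carrier G) M q"
    "linear_on R F (carrier F) G a" "\<And>u. u \<in> carrier F \<Longrightarrow> q (a u) = p u"
    "linear_on R G (carrier G) F b" "\<And>v. v \<in> carrier G \<Longrightarrow> p (b v) = q v"
  shows "tor_length R F (a_kernel F M p) I = tor_length R G (a_kernel G M q) I"
  by (rule antisym) (rule tor_length_le; fact assms)+

lemma (in module) free_lift_restrict:
  assumes K: "submodule K R M" and \<phi>: "\<And>x. x \<in> B \<Longrightarrow> \<phi> x \<in> K"
    and u: "u \<in> carrier (free_module R B)"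
  shows "free_lift R (M\<lparr>carrier := K\<rparr>) \<phi> u = free_lift R M \<phi> u"
    and "free_lift R M \<phi> u \<in> K"
proof -
  interpret K: module R "M\<lparr>carrier := K\<rparr>" by (rule submodule_restrict(1)[OF K])
  have \<phi>': "\<phi> x \<in> carrier M" "\<phi> x \<in> carrier (M\<lparr>carrier := K\<rparr>)" if "x \<in> B" for x
    using \<phi>[OF that] sub_carr[OF K] by auto
  have l: "linear_on R (free_module R B) (carrier (free_module R B)) (M\<lparr>carrier := K\<rparr>)
      (free_lift R (M\<lparr>carrier := K\<rparr>) \<phi>)"
    by (rule K.free_lift_linear[OF \<phi>'(2)])
  have l': "linear_on R (free_module R B) (carrier (free_module R B)) M (free_lift R (M\<lparr>carrier := K\<rparr>) \<phi>)"
  proof (rule linear_onI)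
    show "free_lift R (M\<lparr>carrier := K\<rparr>) \<phi> v \<in> carrier M" if "v \<in> carrier (free_module R B)" for v
      using linear_onD(1)[OF l that] sub_carr[OF K] by auto
  qed (use linear_onD(2,3)[OF l] in simp_all)
  show eq: "free_lift R (M\<lparr>carrier := K\<rparr>) \<phi> u = free_lift R M \<phi> u"
  proof (rule free_linear_eqI[OF l' free_lift_linear[OF \<phi>'(1)] _ u])
    fix x assume x: "x \<in> B"
    have "free_lift R (M\<lparr>carrier := K\<rparr>) \<phi> (basis_elt R x) = \<phi> x"
      by (rule K.free_lift_basis[of B \<phi> x, OF _ x]) (use \<phi>'(2) in auto)
    moreover have "free_lift R M \<phi> (basis_elt R x) = \<phi> x"
      by (rule free_lift_basis[of B \<phi> x, OF _ x]) (use \<phi>'(1) in auto)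
    ultimately show "free_lift R (M\<lparr>carrier := K\<rparr>) \<phi> (basis_elt R x) = free_lift R M \<phi> (basis_elt R x)"
      by simp
  qed
  show "free_lift R M \<phi> u \<in> K" using linear_onD(1)[OF l u] unfolding eq by simp
qed

context module
begin

abbreviation free_cover :: "('a, 'c \<Rightarrow> 'a) module" where "free_cover \<equiv> free_module R (carrier M)"

lemma free_cover_map: "linear_on R free_cover (carrier free_cover) M (free_lift R M id)"
  by (rule free_lift_linear) simp

lemma free_cover_surj: "free_lift R M id ` carrier free_cover = carrier M"
proof
  show "free_lift R M id ` carrier free_cover \<subseteq> carrier M" using linear_onD(1)[OF free_cover_map] by blast
  show "carrier M \<subseteq> free_lift R M id ` carrier free_cover"
  proof
    fix x assume x: "x \<in> carrier M"
    have "free_lift R M id (basis_elt R x) = id x" by (rule free_lift_basis[OF _ x]) simp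
    then show "x \<in> free_lift R M id ` carrier free_cover" using basis_elt_carrier[OF x] by (metis id_apply imageI)
  qed
qed

lemma syz_kernel: "carrier (syz R M) = a_kernel free_cover M (free_lift R M id)"
  and syz_eq: "syz R M = free_cover\<lparr>carrier := carrier (syz R M)\<rparr>"
  by (simp_all add: syz_def Let_def)

lemma syz_submodule: "submodule (carrier (syz R M)) R free_cover"
  unfolding syz_kernel by (rule kernel_submodule(1)[OF free_module_module module_axioms free_cover_map])

lemma syz_module: "module R (syz R M)"
  using module.submodule_restrict(1)[OF free_module_module syz_submodule] syz_eq by simp

text \<open>By definition \<open>Tor\<^sub>1\<close> is the homology at \<open>F\<^sub>1 \<otimes> L\<close> of the free resolution tensored with \<open>L = R/I\<close>. Since
  \<open>F\<^sub>1 \<otimes> L = F\<^sub>1 / IF\<^sub>1\<close>, it is the subquotient of \<open>F\<^sub>1\<close> between \<open>Z + IF\<^sub>1\<close>, where \<open>Z\<close> is the kernel of \<open>F\<^sub>1 \<rightarrow> F\<^sub>0\<close>,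
  and the preimage \<open>P\<close> of \<open>IF\<^sub>0\<close>. The map \<open>F\<^sub>1 \<rightarrow> F\<^sub>0\<close> has image the syzygy \<open>Sz\<close>, and it carries this
  subquotient isomorphically to \<open>(Sz \<inter> IF\<^sub>0) / I Sz\<close>.\<close>

theorem mod_length_Tor1:
  assumes I: "ideal I R"
  shows "mod_length R (Tor1 R M (quot_module (self_module R) I)) =
    tor_length R free_cover (a_kernel free_cover M (free_lift R M id)) I"
proof -
  define F0 where "F0 = free_module R (carrier M)"
  define Sz where "Sz = carrier (syz R M)"
  define F1 where "F1 = free_module R Sz"
  define Z where "Z = carrier (syz R (syz R M))"
  define F2 where "F2 = free_module R Z"
  define L where "L = quot_module (self_module R) I"
  define e1 where "e1 = free_lift R F0 id"
  define e2 where "e2 = free_lift R F1 id"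
  have mF: "module R F0" "module R F1" "module R F2"
    unfolding F0_def F1_def F2_def by (rule free_module_module)+
  interpret F0: module R F0 by (rule mF(1))
  interpret F1: module R F1 by (rule mF(2))
  interpret F2: module R F2 by (rule mF(3))
  interpret S: module R "syz R M" by (rule syz_module)
  have Ic: "I \<subseteq> carrier R" using ideal.Icarr[OF I] by blast
  have Sz: "submodule Sz R F0" unfolding Sz_def F0_def by (rule syz_submodule)
  have syzF0: "syz R M = F0\<lparr>carrier := Sz\<rparr>" using syz_eq by (simp add: F0_def Sz_def)
  have e1: "linear_on R F1 (carrier F1) F0 e1"
    unfolding F1_def e1_def by (rule F0.free_lift_linear) (use F0.sub_carr[OF Sz] in auto)
  have e1_syz: "free_lift R (syz R M) id u = e1 u" "e1 u \<in> Sz" if "u \<in> carrier F1" for u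
    using F0.free_lift_restrict[OF Sz, of Sz id u] that unfolding syzF0 e1_def F1_def by auto
  have e1_im: "e1 ` carrier F1 = Sz"
    using S.free_cover_surj e1_syz by (auto simp: Sz_def[symmetric] F1_def[symmetric])
  have Zk: "Z = {u \<in> carrier F1. e1 u = \<zero>\<^bsub>F0\<^esub>}"
    unfolding Z_def S.syz_kernel kernel_submodule(2)[OF free_module_module syz_module S.free_cover_map]
    using e1_syz(1) by (auto simp: syzF0 Sz_def[symmetric] F1_def[symmetric])
  have Z: "submodule Z R F1" using S.syz_submodule unfolding Z_def F1_def Sz_def .
  have e2: "linear_on R F2 (carrier F2) F1 e2"
    unfolding F2_def e2_def by (rule F1.free_lift_linear) (use F1.sub_carr[OF Z] in auto)
  have e2_im: "e2 ` carrier F2 = Z"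
  proof
    show "e2 ` carrier F2 \<subseteq> Z"
      using F1.free_lift_restrict(2)[OF Z, of Z id] by (auto simp: e2_def F2_def)
    show "Z \<subseteq> e2 ` carrier F2"
    proof
      fix z assume z: "z \<in> Z"
      have "e2 (basis_elt R z) = id z"
        unfolding e2_def by (rule F1.free_lift_basis[OF _ z]) (use F1.sub_carr[OF Z] in simp)
      then show "z \<in> e2 ` carrier F2" using basis_elt_carrier[OF z] unfolding F2_def by (metis id_apply imageI)
    qed
  qed
  interpret C0: cyclic_tensor R F0 I by (intro cyclic_tensor.intro cyclic_tensor_axioms.intro mF I)
  interpret C1: cyclic_tensor R F1 I by (intro cyclic_tensor.intro cyclic_tensor_axioms.intro mF I)
  interpret C2: cyclic_tensor R F2 I by (intro cyclic_tensor.intro cyclic_tensor_axioms.intro mF I)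
  interpret F10: module_pair R F1 F0 by (intro module_pairI mF)
  let ?T1 = "tensor R F1 L" and ?T0 = "tensor R F0 L" and ?T2 = "tensor R F2 L"
  have T1: "module R ?T1" unfolding L_def by (rule C1.FL.tensor_module)
  interpret FT: module_pair R F1 ?T1 by (intro module_pairI mF T1)
  have \<theta>1: "linear_on R F1 (carrier F1) ?T1 C1.\<theta>" unfolding L_def by (rule C1.\<theta>_linear)
  have Tc: "carrier (tensor R F1 L) = C1.\<theta> ` carrier F1" "carrier (tensor R F2 L) = C2.\<theta> ` carrier F2"
    using C1.\<theta>_surj linear_onD(1)[OF C1.\<theta>_linear] C2.\<theta>_surj linear_onD(1)[OF C2.\<theta>_linear]
    by (auto simp: L_def)
  have d1: "tensor_map R F0 L e1 (C1.\<theta> u) = C0.\<theta> (e1 u)" if "u \<in> carrier F1" for u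
    unfolding L_def by (rule tensor_map_elt[OF mF(2,1) C1.L_module e1 that C1.one_L])
  have d2: "tensor_map R F1 L e2 (C2.\<theta> u) = C1.\<theta> (e2 u)" if "u \<in> carrier F2" for u
    unfolding L_def by (rule tensor_map_elt[OF mF(3,2) C1.L_module e2 that C1.one_L])
  have im2: "tensor_map R F1 L e2 ` carrier ?T2 = C1.\<theta> ` Z"
    unfolding Tc(2) image_image e2_im[symmetric] by (rule image_cong[OF refl d2])
  let ?IF0 = "sprod R F0 I (carrier F0)" and ?IF1 = "sprod R F1 I (carrier F1)"
  define P where "P = {u \<in> carrier F1. e1 u \<in> ?IF0}"
  have ker1: "a_kernel ?T1 ?T0 (tensor_map R F0 L e1) = C1.\<theta> ` P"
  proof -
    have "a_kernel ?T1 ?T0 (tensor_map R F0 L e1) = C1.\<theta> ` {u \<in> carrier F1. C0.\<theta> (e1 u) = \<zero>\<^bsub>?T0\<^esub>}"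
      unfolding a_kernel_def' Tc(1) using d1 by auto
    moreover have "C0.\<theta> (e1 u) = \<zero>\<^bsub>?T0\<^esub> \<longleftrightarrow> e1 u \<in> ?IF0" if "u \<in> carrier F1" for u
      using C0.\<theta>_kernel[OF linear_onD(1)[OF e1 that]] C0.FL.tensor_zero by (simp add: L_def)
    then have "{u \<in> carrier F1. C0.\<theta> (e1 u) = \<zero>\<^bsub>?T0\<^esub>} = P"
      unfolding P_def by (intro Collect_cong conj_cong refl)
    ultimately show ?thesis by simp
  qed
  have P: "submodule P R F1"
    unfolding P_def by (rule F10.vimage_submodule[OF F1.carrier_is_submodule e1 C0.IF_submodule])
  have Pc: "P \<subseteq> carrier F1" unfolding P_def by blast
  have ZP: "Z \<subseteq> P" unfolding Zk P_def using F0.sub_zero[OF C0.IF_submodule] by auto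
  have IFP: "?IF1 \<subseteq> P"
    using F10.sprod_image[OF Ic F1.carrier_is_submodule e1 F0.carrier_is_submodule] linear_onD(1)[OF e1]
      F1.sub_carr[OF C1.IF_submodule] unfolding P_def by blast
  have Q: "submodule (Z <+>\<^bsub>F1\<^esub> ?IF1) R F1" by (rule F1.sum_submodule[OF Z C1.IF_submodule])
  have QP: "Z <+>\<^bsub>F1\<^esub> ?IF1 \<subseteq> P" by (rule F1.sum_least[OF P ZP IFP])
  have K: "submodule (C1.\<theta> ` P) R ?T1" by (rule FT.image_submodule[OF F1.carrier_is_submodule \<theta>1 P Pc])
  have B: "submodule (C1.\<theta> ` Z) R ?T1"
    by (rule FT.image_submodule[OF F1.carrier_is_submodule \<theta>1 Z]) (use ZP Pc in blast)
  have "mod_length R (Tor1 R M L) = mod_length R (quot_module (?T1\<lparr>carrier := C1.\<theta> ` P\<rparr>) (C1.\<theta> ` Z))"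
    unfolding Tor1_def Let_def F0_def[symmetric] Sz_def[symmetric] F1_def[symmetric] Z_def[symmetric]
      F2_def[symmetric] e1_def[symmetric] e2_def[symmetric] im2 ker1 ..
  also have "\<dots> = ilen R (?T1\<lparr>carrier := C1.\<theta> ` P\<rparr>) (C1.\<theta> ` Z) (carrier (?T1\<lparr>carrier := C1.\<theta> ` P\<rparr>))"
    by (rule module.mod_length_quot[OF FT.N.submodule_restrict(1)[OF K]])
       (use FT.N.submodule_restrict(2)[OF K] B ZP in auto)
  also have "\<dots> = ilen R ?T1 (C1.\<theta> ` Z) (C1.\<theta> ` P)"
    using FT.N.ilen_restrict[OF K order_refl] by simp
  also have "\<dots> = ilen R F1 (Z <+>\<^bsub>F1\<^esub> ?IF1) P"
  proof (rule FT.ilen_iso[symmetric, OF P K QP B])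
    show "C1.\<theta> ` Z \<subseteq> C1.\<theta> ` P" using ZP by blast
    show "C1.\<theta> ` P \<subseteq> C1.\<theta> ` P" by (rule order_refl)
    show "linear_on R F1 P ?T1 C1.\<theta>" by (rule linear_on_subset[OF \<theta>1 Pc])
    show "C1.\<theta> ` P \<subseteq> C1.\<theta> ` P <+>\<^bsub>?T1\<^esub> C1.\<theta> ` Z" by (rule FT.N.sum_upper1[OF K B])
    fix u assume u: "u \<in> P"
    have uc: "u \<in> carrier F1" using u Pc by blast
    have ker: "C1.\<theta> w = \<zero>\<^bsub>?T1\<^esub> \<longleftrightarrow> w \<in> ?IF1" if "w \<in> carrier F1" for w
      using C1.\<theta>_kernel[OF that] C1.FL.tensor_zero by (simp add: L_def)
    show "C1.\<theta> u \<in> C1.\<theta> ` Z \<longleftrightarrow> u \<in> Z <+>\<^bsub>F1\<^esub> ?IF1"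
    proof
      assume "C1.\<theta> u \<in> C1.\<theta> ` Z"
      then obtain z where z: "z \<in> Z" "C1.\<theta> u = C1.\<theta> z" by blast
      have zc: "z \<in> carrier F1" using z ZP Pc by blast
      have "C1.\<theta> (u \<ominus>\<^bsub>F1\<^esub> z) = C1.\<theta> u \<ominus>\<^bsub>?T1\<^esub> C1.\<theta> z"
        by (rule FT.lin_minus[OF F1.carrier_is_submodule \<theta>1 uc zc])
      also have "\<dots> = \<zero>\<^bsub>?T1\<^esub>" using linear_onD(1)[OF \<theta>1 zc] z(2) by (simp add: a_minus_def FT.N.M.r_neg)
      finally have "u \<ominus>\<^bsub>F1\<^esub> z \<in> ?IF1" using ker[OF F1.M.minus_closed[OF uc zc]] by simp
      then have "z \<oplus>\<^bsub>F1\<^esub> (u \<ominus>\<^bsub>F1\<^esub> z) \<in> Z <+>\<^bsub>F1\<^esub> ?IF1" by (rule F1.sum_memI[OF z(1)])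
      then show "u \<in> Z <+>\<^bsub>F1\<^esub> ?IF1" unfolding F1.minus_add_self[OF uc zc] .
    next
      assume "u \<in> Z <+>\<^bsub>F1\<^esub> ?IF1"
      then obtain z w where zw: "z \<in> Z" "w \<in> ?IF1" "u = z \<oplus>\<^bsub>F1\<^esub> w" unfolding F1.mem_sum_iff by blast
      have c: "z \<in> carrier F1" "w \<in> carrier F1" using zw ZP IFP Pc by blast+
      have "C1.\<theta> u = C1.\<theta> z \<oplus>\<^bsub>?T1\<^esub> C1.\<theta> w" unfolding zw(3) by (rule linear_onD(2)[OF \<theta>1 c])
      also have "C1.\<theta> w = \<zero>\<^bsub>?T1\<^esub>" using ker[OF c(2)] zw(2) by simp
      finally have "C1.\<theta> u = C1.\<theta> z" using linear_onD(1)[OF \<theta>1 c(1)] by simp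
      then show "C1.\<theta> u \<in> C1.\<theta> ` Z" using zw(1) by blast
    qed
  qed
  also have "\<dots> = ilen R F0 (sprod R F0 I Sz) (Sz \<inter> ?IF0)"
  proof (rule F10.ilen_iso[OF P F0.Int_submodule[OF Sz C0.IF_submodule] QP])
    show ISz: "submodule (sprod R F0 I Sz) R F0" using F0.sub_carr[OF Sz] by (intro F0.sprod_submodule Ic) auto
    show "sprod R F0 I Sz \<subseteq> Sz \<inter> ?IF0"
      using F0.sprod_sub[OF Ic Sz] F0.sprod_mono[OF order_refl, of Sz "carrier F0" I] F0.sub_carr[OF Sz] by blast
    show "linear_on R F1 P F0 e1" by (rule linear_on_subset[OF e1 Pc])
    show "e1 ` P \<subseteq> Sz \<inter> ?IF0" using e1_syz(2) unfolding P_def by auto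
    have "Sz \<inter> ?IF0 \<subseteq> e1 ` P" unfolding e1_im[symmetric] P_def by blast
    moreover have "submodule (e1 ` P) R F0" by (rule F10.image_submodule[OF F1.carrier_is_submodule e1 P Pc])
    ultimately show "Sz \<inter> ?IF0 \<subseteq> e1 ` P <+>\<^bsub>F0\<^esub> sprod R F0 I Sz"
      using F0.sum_upper1[OF _ ISz] by blast
    fix u assume u: "u \<in> P"
    have uc: "u \<in> carrier F1" using u Pc by blast
    show "e1 u \<in> sprod R F0 I Sz \<longleftrightarrow> u \<in> Z <+>\<^bsub>F1\<^esub> ?IF1"
    proof
      assume "u \<in> Z <+>\<^bsub>F1\<^esub> ?IF1"
      then obtain z w where zw: "z \<in> Z" "w \<in> ?IF1" "u = z \<oplus>\<^bsub>F1\<^esub> w" unfolding F1.mem_sum_iff by blast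
      have c: "z \<in> carrier F1" "w \<in> carrier F1" using zw ZP IFP Pc by blast+
      have "e1 u = e1 z \<oplus>\<^bsub>F0\<^esub> e1 w" unfolding zw(3) by (rule linear_onD(2)[OF e1 c])
      also have "\<dots> = e1 w" using zw(1) linear_onD(1)[OF e1 c(2)] by (simp add: Zk)
      finally have "e1 u = e1 w" .
      moreover have "e1 w \<in> sprod R F0 I Sz"
        using F10.sprod_image[OF Ic F1.carrier_is_submodule e1 Sz] e1_im zw(2) by blast
      ultimately show "e1 u \<in> sprod R F0 I Sz" by simp
    next
      assume eu: "e1 u \<in> sprod R F0 I Sz"
      have im: "submodule (e1 ` ?IF1) R F0"
        by (rule F10.image_submodule[OF F1.carrier_is_submodule e1 C1.IF_submodule]) (use IFP Pc in blast)
      have "sprod R F0 I Sz \<subseteq> e1 ` ?IF1"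
      proof (rule F0.sprod_least[OF im])
        fix a s assume a: "a \<in> I" and "s \<in> Sz"
        then obtain v where v: "v \<in> carrier F1" "s = e1 v" unfolding e1_im[symmetric] by blast
        have "a \<odot>\<^bsub>F0\<^esub> s = e1 (a \<odot>\<^bsub>F1\<^esub> v)" unfolding v(2) using linear_onD(3)[OF e1 _ v(1)] a Ic by auto
        then show "a \<odot>\<^bsub>F0\<^esub> s \<in> e1 ` ?IF1" using F1.sprod_memI[OF a v(1)] by blast
      qed
      then obtain w where w: "w \<in> ?IF1" "e1 u = e1 w" using eu by blast
      have wc: "w \<in> carrier F1" using w IFP Pc by blast
      have "e1 (u \<ominus>\<^bsub>F1\<^esub> w) = e1 u \<ominus>\<^bsub>F0\<^esub> e1 w" by (rule F10.lin_minus[OF F1.carrier_is_submodule e1 uc wc])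
      also have "\<dots> = \<zero>\<^bsub>F0\<^esub>" using linear_onD(1)[OF e1 wc] w(2) by (simp add: a_minus_def F0.M.r_neg)
      finally have z: "u \<ominus>\<^bsub>F1\<^esub> w \<in> Z" using uc wc by (simp add: Zk)
      have "(u \<ominus>\<^bsub>F1\<^esub> w) \<oplus>\<^bsub>F1\<^esub> w \<in> Z <+>\<^bsub>F1\<^esub> ?IF1" by (rule F1.sum_memI[OF z w(1)])
      moreover have "(u \<ominus>\<^bsub>F1\<^esub> w) \<oplus>\<^bsub>F1\<^esub> w = u" using uc wc by (simp add: a_minus_def F1.M.a_assoc F1.M.l_neg)
      ultimately show "u \<in> Z <+>\<^bsub>F1\<^esub> ?IF1" by simp
    qed
  qed
  also have "\<dots> = tor_length R free_cover (a_kernel free_cover M (free_lift R M id)) I"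
    unfolding tor_length_def syz_kernel[symmetric] F0_def Sz_def ..
  finally show ?thesis unfolding L_def .
qed

end

section \<open>Extensions classified by homomorphisms from a syzygy\<close>

lemma (in module) minus_eq_zero_iff:
  assumes "x \<in> carrier M" "y \<in> carrier M" shows "x \<ominus>\<^bsub>M\<^esub> y = \<zero>\<^bsub>M\<^esub> \<longleftrightarrow> x = y"
  using minus_add_self[OF assms] assms by (auto simp: a_minus_def M.r_neg)

text \<open>Two surjections with the same kernel differ by an isomorphism of their targets.\<close>

lemma surjections_iso:
  assumes G: "module R G" and E: "module R E" and E': "module R E'"
    and f: "linear_on R G (carrier G) E f" "f ` carrier G = carrier E"
    and g: "linear_on R G (carrier G) E' g" "g ` carrier G = carrier E'"
    and ker: "\<And>x. x \<in> carrier G \<Longrightarrow> f x = \<zero>\<^bsub>E\<^esub> \<longleftrightarrow> g x = \<zero>\<^bsub>E'\<^esub>"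
  shows "\<exists>\<chi>. linear_on R E (carrier E) E' \<chi> \<and> bij_betw \<chi> (carrier E) (carrier E') \<and>
    (\<forall>x\<in>carrier G. \<chi> (f x) = g x)"
proof -
  interpret A: module_pair R G E by (intro module_pairI G E)
  interpret B: module_pair R G E' by (intro module_pairI G E')
  have eq: "f x = f y \<longleftrightarrow> g x = g y" if xy: "x \<in> carrier G" "y \<in> carrier G" for x y
  proof -
    have "f (x \<ominus>\<^bsub>G\<^esub> y) = f x \<ominus>\<^bsub>E\<^esub> f y" "g (x \<ominus>\<^bsub>G\<^esub> y) = g x \<ominus>\<^bsub>E'\<^esub> g y"
      using A.lin_minus[OF A.M.carrier_is_submodule f(1) xy] B.lin_minus[OF A.M.carrier_is_submodule g(1) xy] by auto
    moreover have "f x \<ominus>\<^bsub>E\<^esub> f y = \<zero>\<^bsub>E\<^esub> \<longleftrightarrow> f x = f y" "g x \<ominus>\<^bsub>E'\<^esub> g y = \<zero>\<^bsub>E'\<^esub> \<longleftrightarrow> g x = g y"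
      using A.N.minus_eq_zero_iff B.N.minus_eq_zero_iff linear_onD(1)[OF f(1)] linear_onD(1)[OF g(1)] xy
      by auto
    ultimately show ?thesis using ker[of "x \<ominus>\<^bsub>G\<^esub> y"] xy by simp
  qed
  define \<chi> where "\<chi> e = g (SOME x. x \<in> carrier G \<and> f x = e)" for e
  have \<chi>: "\<chi> (f x) = g x" if x: "x \<in> carrier G" for x
  proof -
    have "\<exists>y. y \<in> carrier G \<and> f y = f x" using x by blast
    from someI_ex[OF this] show ?thesis unfolding \<chi>_def using eq x by blast
  qed
  have ex: "\<exists>x\<in>carrier G. e = f x" if "e \<in> carrier E" for e using that f(2) by blast
  have "linear_on R E (carrier E) E' \<chi>"
  proof (rule linear_onI)
    fix e assume "e \<in> carrier E"
    then obtain x where x: "x \<in> carrier G" "e = f x" using ex by blast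
    then show "\<chi> e \<in> carrier E'" using \<chi> linear_onD(1)[OF g(1)] by simp
    fix e' assume "e' \<in> carrier E"
    then obtain y where y: "y \<in> carrier G" "e' = f y" using ex by blast
    have "\<chi> (f (x \<oplus>\<^bsub>G\<^esub> y)) = g (x \<oplus>\<^bsub>G\<^esub> y)" using x y by (intro \<chi>) simp
    then show "\<chi> (e \<oplus>\<^bsub>E\<^esub> e') = \<chi> e \<oplus>\<^bsub>E'\<^esub> \<chi> e'"
      using x y \<chi> linear_onD(2)[OF f(1)] linear_onD(2)[OF g(1)] by simp
  next
    fix a e assume a: "a \<in> carrier R" and "e \<in> carrier E"
    then obtain x where x: "x \<in> carrier G" "e = f x" using ex by blast
    have "\<chi> (f (a \<odot>\<^bsub>G\<^esub> x)) = g (a \<odot>\<^bsub>G\<^esub> x)" using x a by (intro \<chi>) simp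
    then show "\<chi> (a \<odot>\<^bsub>E\<^esub> e) = a \<odot>\<^bsub>E'\<^esub> \<chi> e"
      using x a \<chi> linear_onD(3)[OF f(1)] linear_onD(3)[OF g(1)] by simp
  qed
  moreover have "bij_betw \<chi> (carrier E) (carrier E')"
    unfolding bij_betw_def
  proof
    show "inj_on \<chi> (carrier E)"
    proof (rule inj_onI)
      fix e e' assume "e \<in> carrier E" "e' \<in> carrier E" and h: "\<chi> e = \<chi> e'"
      then obtain x y where "x \<in> carrier G" "e = f x" "y \<in> carrier G" "e' = f y" using ex by metis
      then show "e = e'" using h \<chi> eq by simp
    qed
    show "\<chi> ` carrier E = carrier E'"
      unfolding f(2)[symmetric] g(2)[symmetric] image_image by (rule image_cong[OF refl \<chi>])
  qed
  ultimately show ?thesis using \<chi> by blast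
qed

lemma extensionD:
  assumes "extension R M N (i, E, p)"
  shows "module R E" "linear_on R N (carrier N) E i" "linear_on R E (carrier E) M p"
    "inj_on i (carrier N)" "i ` carrier N = {e \<in> carrier E. p e = \<zero>\<^bsub>M\<^esub>}" "p ` carrier E = carrier M"
  using assms by (auto simp: extension_def mod_hom_iff a_kernel_def')

lemma extensionI:
  assumes "module R E" "linear_on R N (carrier N) E i" "linear_on R E (carrier E) M p"
    "inj_on i (carrier N)" "i ` carrier N = {e \<in> carrier E. p e = \<zero>\<^bsub>M\<^esub>}" "p ` carrier E = carrier M"
  shows "extension R M N (i, E, p)"
  using assms by (auto simp: extension_def mod_hom_iff a_kernel_def')

locale ext_setup = module_pair +
  fixes B :: "'x set" and \<pi>
  assumes \<pi>: "linear_on R (free_module R B) (carrier (free_module R B)) M \<pi>"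
    and \<pi>_surj: "\<pi> ` carrier (free_module R B) = carrier M"
begin

abbreviation Fr :: "('a, 'x \<Rightarrow> 'a) module" where "Fr \<equiv> free_module R B"

definition K :: "('x \<Rightarrow> 'a) set" where "K = a_kernel Fr M \<pi>"

text \<open>\<open>Hom(K, N)\<close>, with homomorphisms extended by zero outside \<open>K\<close> so that equality of functions is
  equality of homomorphisms.\<close>

definition H :: "('a, ('x \<Rightarrow> 'a) \<Rightarrow> 'e) module"
  where "H = \<lparr>carrier = {\<phi>. linear_on R Fr K N \<phi> \<and> (\<forall>x. x \<notin> K \<longrightarrow> \<phi> x = \<zero>\<^bsub>N\<^esub>)},
    monoid.mult = undefined, monoid.one = undefined, ring.zero = (\<lambda>_. \<zero>\<^bsub>N\<^esub>),
    ring.add = (\<lambda>\<phi> \<psi> x. \<phi> x \<oplus>\<^bsub>N\<^esub> \<psi> x), smult = (\<lambda>a \<phi> x. a \<odot>\<^bsub>N\<^esub> \<phi> x)\<rparr>"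

lemma Fr: "module R Fr"
  by (rule M.R.free_module_module)

sublocale Fr: module R Fr
  by (rule Fr)

sublocale FM: module_pair R Fr M
  by (intro module_pairI Fr M.module_axioms)

sublocale FN: module_pair R Fr N
  by (intro module_pairI Fr N.module_axioms)

lemma K: "submodule K R Fr" and K_iff: "x \<in> K \<longleftrightarrow> x \<in> carrier Fr \<and> \<pi> x = \<zero>\<^bsub>M\<^esub>"
  using kernel_submodule[OF Fr M.module_axioms \<pi>] by (auto simp: K_def)

lemmas K_carr = Fr.sub_carr[OF K]

lemma H_sel [simp]:
  "ring.zero H = (\<lambda>_. \<zero>\<^bsub>N\<^esub>)" "ring.add H = (\<lambda>\<phi> \<psi> x. \<phi> x \<oplus>\<^bsub>N\<^esub> \<psi> x)"
  "smult H = (\<lambda>a \<phi> x. a \<odot>\<^bsub>N\<^esub> \<phi> x)"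
  by (simp_all add: H_def)

lemma H_iff: "\<phi> \<in> carrier H \<longleftrightarrow> linear_on R Fr K N \<phi> \<and> (\<forall>x. x \<notin> K \<longrightarrow> \<phi> x = \<zero>\<^bsub>N\<^esub>)"
  by (simp add: H_def)

lemma H_lin: "\<phi> \<in> carrier H \<Longrightarrow> linear_on R Fr K N \<phi>"
  by (simp add: H_iff)

lemma H_closed: "\<phi> \<in> carrier H \<Longrightarrow> \<phi> x \<in> carrier N"
  by (cases "x \<in> K") (auto simp: H_iff linear_on_def)

lemma H_module: "module R H"
proof (rule moduleI)
  show "cring R" by (rule M.R.is_cring)
  have add: "(\<lambda>x. \<phi> x \<oplus>\<^bsub>N\<^esub> \<psi> x) \<in> carrier H" if "\<phi> \<in> carrier H" "\<psi> \<in> carrier H" for \<phi> \<psi>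
    unfolding H_iff
  proof (intro conjI allI impI linear_onI)
    show "\<phi> x \<oplus>\<^bsub>N\<^esub> \<psi> x = \<zero>\<^bsub>N\<^esub>" if "x \<notin> K" for x using that \<open>\<phi> \<in> carrier H\<close> \<open>\<psi> \<in> carrier H\<close> by (simp add: H_iff)
  qed (use that in \<open>simp_all add: H_closed linear_onD(2,3)[OF H_lin, unfolded M.R.free_module_sel] N.smult_r_distr N.M.a_ac\<close>)
  have smult: "(\<lambda>x. a \<odot>\<^bsub>N\<^esub> \<phi> x) \<in> carrier H" if "a \<in> carrier R" "\<phi> \<in> carrier H" for a \<phi>
    unfolding H_iff
  proof (intro conjI allI impI linear_onI)
    show "a \<odot>\<^bsub>N\<^esub> \<phi> x = \<zero>\<^bsub>N\<^esub>" if "x \<notin> K" for x using that \<open>a \<in> carrier R\<close> \<open>\<phi> \<in> carrier H\<close> by (simp add: H_iff)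
  qed (use that in \<open>simp_all add: H_closed linear_onD(2,3)[OF H_lin, unfolded M.R.free_module_sel] N.smult_r_distr N.smult_comm[of a]\<close>)
  show "abelian_group H"
  proof (rule abelian_groupI)
    fix \<phi> assume \<phi>: "\<phi> \<in> carrier H"
    show "\<exists>\<psi>\<in>carrier H. \<psi> \<oplus>\<^bsub>H\<^esub> \<phi> = \<zero>\<^bsub>H\<^esub>"
      using smult[OF _ \<phi>, of "\<ominus>\<^bsub>R\<^esub> \<one>\<^bsub>R\<^esub>"] \<phi>
      by (intro bexI[of _ "\<lambda>x. (\<ominus>\<^bsub>R\<^esub> \<one>\<^bsub>R\<^esub>) \<odot>\<^bsub>N\<^esub> \<phi> x"]) (auto simp: fun_eq_iff H_closed N.smult_l_minus N.M.l_neg)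
  next
    show "\<zero>\<^bsub>H\<^esub> \<in> carrier H" unfolding H_iff by (auto intro!: linear_onI)
  qed (auto simp: add H_closed N.M.a_ac fun_eq_iff)
  show "a \<odot>\<^bsub>H\<^esub> \<phi> \<in> carrier H" if "a \<in> carrier R" "\<phi> \<in> carrier H" for a \<phi> using smult[OF that] by simp
qed (auto simp: fun_eq_iff H_closed N.smult_l_distr N.smult_r_distr N.smult_assoc1)

sublocale H: module R H
  by (rule H_module)

text \<open>An extension is classified by the restriction to \<open>K\<close> of a lift of \<open>\<pi>\<close> to its middle
  term. This is the connecting map \<open>Hom(K, N) \<rightarrow> Ext(M, N)\<close>, read as a relation so that it makes
  sense whatever the type of the middle term.\<close>

definition classified :: "(('x \<Rightarrow> 'a) \<Rightarrow> 'e) \<Rightarrow> ('a, 'c, 'e, 'z) extn \<Rightarrow> bool"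
  where "classified \<phi> = (\<lambda>(i, E, p). \<exists>l. linear_on R Fr (carrier Fr) E l \<and>
    (\<forall>u\<in>carrier Fr. p (l u) = \<pi> u) \<and> (\<forall>k\<in>K. l k = i (\<phi> k)))"

lemma classified_exists:
  assumes s: "extension R M N s"
  shows "\<exists>\<phi>\<in>carrier H. classified \<phi> s"
proof -
  obtain i E p where s_eq: "s = (i, E, p)" by (cases s)
  note e = extensionD[OF s[unfolded s_eq]]
  interpret E: module R E by (rule e(1))
  obtain l where l: "linear_on R Fr (carrier Fr) E l" "\<And>u. u \<in> carrier Fr \<Longrightarrow> p (l u) = \<pi> u"
    using M.R.free_projective[OF e(1) M.module_axioms e(3,6) \<pi>] by blast
  have lk: "\<exists>n. n \<in> carrier N \<and> i n = l k" if "k \<in> K" for k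
  proof -
    have "l k \<in> i ` carrier N" unfolding e(5) using that l linear_onD(1)[OF l(1)] by (auto simp: K_iff)
    then show ?thesis by (metis imageE)
  qed
  define \<phi> where "\<phi> k = (if k \<in> K then SOME n. n \<in> carrier N \<and> i n = l k else \<zero>\<^bsub>N\<^esub>)" for k
  have \<phi>: "\<phi> k \<in> carrier N" "i (\<phi> k) = l k" if "k \<in> K" for k
    using someI_ex[OF lk[OF that]] that by (auto simp: \<phi>_def)
  have "linear_on R Fr K N \<phi>"
  proof (rule linear_onI)
    fix x y assume xy: "x \<in> K" "y \<in> K"
    have "i (\<phi> (x \<oplus>\<^bsub>Fr\<^esub> y)) = i (\<phi> x \<oplus>\<^bsub>N\<^esub> \<phi> y)"
      using \<phi> xy Fr.sub_add[OF K xy] linear_onD(2)[OF l(1) K_carr[OF xy(1)] K_carr[OF xy(2)]]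
        linear_onD(2)[OF e(2), of "\<phi> x" "\<phi> y"] by simp
    then show "\<phi> (x \<oplus>\<^bsub>Fr\<^esub> y) = \<phi> x \<oplus>\<^bsub>N\<^esub> \<phi> y"
      using inj_onD[OF e(4)] \<phi>(1) xy Fr.sub_add[OF K xy] N.M.a_closed by blast
  next
    fix a x assume a: "a \<in> carrier R" and x: "x \<in> K"
    have "i (\<phi> (a \<odot>\<^bsub>Fr\<^esub> x)) = i (a \<odot>\<^bsub>N\<^esub> \<phi> x)"
      using \<phi> x Fr.sub_smult[OF K a x] linear_onD(3)[OF l(1) a K_carr[OF x]]
        linear_onD(3)[OF e(2) a, of "\<phi> x"] by simp
    then show "\<phi> (a \<odot>\<^bsub>Fr\<^esub> x) = a \<odot>\<^bsub>N\<^esub> \<phi> x"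
      using inj_onD[OF e(4)] \<phi>(1) a x Fr.sub_smult[OF K a x] N.smult_closed by blast
  qed (rule \<phi>)
  then have "\<phi> \<in> carrier H" by (simp add: H_iff \<phi>_def)
  moreover have "classified \<phi> s" unfolding classified_def s_eq using l \<phi>(2) by auto
  ultimately show ?thesis by blast
qed

text \<open>The middle term is the pushout of \<open>N \<leftarrow> K \<rightarrow> F\<close>: the kernel of \<open>N \<oplus> F \<rightarrow> E\<close> is the graph of \<open>- \<phi>\<close>,
  which depends on \<open>\<phi>\<close> only.\<close>

lemma middle_presentation:
  assumes s: "extension R M N (i, E, p)"
    and l: "linear_on R Fr (carrier Fr) E l" "\<And>u. u \<in> carrier Fr \<Longrightarrow> p (l u) = \<pi> u" "\<And>k. k \<in> K \<Longrightarrow> l k = i (\<phi> k)"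
    and \<phi>: "\<phi> \<in> carrier H"
  defines "w \<equiv> \<lambda>(n, f). i n \<oplus>\<^bsub>E\<^esub> l f"
  shows "linear_on R (prod_module N Fr) (carrier (prod_module N Fr)) E w"
    and "w ` carrier (prod_module N Fr) = carrier E"
    and "\<And>n f. n \<in> carrier N \<Longrightarrow> f \<in> carrier Fr \<Longrightarrow> w (n, f) = \<zero>\<^bsub>E\<^esub> \<longleftrightarrow> f \<in> K \<and> n = \<ominus>\<^bsub>N\<^esub> \<phi> f"
proof -
  note e = extensionD[OF s]
  interpret E: module R E by (rule e(1))
  interpret NE: module_pair R N E by (intro module_pairI N.module_axioms e(1))
  interpret EM: module_pair R E M by (intro module_pairI M.module_axioms e(1))
  have ic: "i n \<in> carrier E" if "n \<in> carrier N" for n using linear_onD(1)[OF e(2) that] .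
  have lc: "l f \<in> carrier E" if "f \<in> carrier Fr" for f using linear_onD(1)[OF l(1) that] .
  have pi0: "p (i n) = \<zero>\<^bsub>M\<^esub>" if "n \<in> carrier N" for n using e(5) that by blast
  show lin: "linear_on R (prod_module N Fr) (carrier (prod_module N Fr)) E w"
    by (rule linear_onI)
       (auto simp: w_def ic lc linear_onD(2,3)[OF e(2)] linear_onD(2,3)[OF l(1), unfolded M.R.free_module_sel]
          E.M.a_ac E.smult_r_distr)
  have pw: "p (w (n, f)) = \<pi> f" if "n \<in> carrier N" "f \<in> carrier Fr" for n f
    using that ic lc pi0 l(2) linear_onD(2)[OF e(3), of "i n" "l f"] linear_onD(1)[OF \<pi>] by (simp add: w_def)
  show "w ` carrier (prod_module N Fr) = carrier E"
  proof
    show "w ` carrier (prod_module N Fr) \<subseteq> carrier E" using linear_onD(1)[OF lin] by blast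
    show "carrier E \<subseteq> w ` carrier (prod_module N Fr)"
    proof
      fix x assume x: "x \<in> carrier E"
      have "p x \<in> \<pi> ` carrier Fr" using x linear_onD(1)[OF e(3)] \<pi>_surj by simp
      then obtain f where f: "f \<in> carrier Fr" "p x = \<pi> f" by blast
      have "p (x \<ominus>\<^bsub>E\<^esub> l f) = p x \<ominus>\<^bsub>M\<^esub> p (l f)"
        by (rule EM.lin_minus[OF E.carrier_is_submodule e(3) x lc[OF f(1)]])
      also have "\<dots> = \<zero>\<^bsub>M\<^esub>" using f l(2) linear_onD(1)[OF \<pi>] by (simp add: a_minus_def M.M.r_neg)
      finally have "x \<ominus>\<^bsub>E\<^esub> l f \<in> i ` carrier N" unfolding e(5) using x lc[OF f(1)] by simp
      then obtain n where n: "n \<in> carrier N" "x \<ominus>\<^bsub>E\<^esub> l f = i n" by blast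
      have "x = l f \<oplus>\<^bsub>E\<^esub> i n" using E.minus_add_self[OF x lc[OF f(1)]] n(2) by simp
      then have "x = w (n, f)" using ic[OF n(1)] lc[OF f(1)] by (simp add: w_def E.M.a_comm)
      then show "x \<in> w ` carrier (prod_module N Fr)" using n f by auto
    qed
  qed
  fix n f assume nf: "n \<in> carrier N" "f \<in> carrier Fr"
  show "w (n, f) = \<zero>\<^bsub>E\<^esub> \<longleftrightarrow> f \<in> K \<and> n = \<ominus>\<^bsub>N\<^esub> \<phi> f"
  proof
    assume w0: "w (n, f) = \<zero>\<^bsub>E\<^esub>"
    then have "\<pi> f = \<zero>\<^bsub>M\<^esub>" using pw[OF nf] EM.lin_zero[OF E.carrier_is_submodule e(3)] by simp
    then have f: "f \<in> K" using nf by (simp add: K_iff)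
    have "i (n \<oplus>\<^bsub>N\<^esub> \<phi> f) = i \<zero>\<^bsub>N\<^esub>"
      using w0 linear_onD(2)[OF e(2) nf(1) H_closed[OF \<phi>]] l(3)[OF f] NE.lin_zero[OF N.carrier_is_submodule e(2)]
      by (simp add: w_def)
    then have "n \<oplus>\<^bsub>N\<^esub> \<phi> f = \<zero>\<^bsub>N\<^esub>" using inj_onD[OF e(4)] nf(1) H_closed[OF \<phi>] by simp
    then have "n = \<ominus>\<^bsub>N\<^esub> \<phi> f" using N.M.minus_equality[of n "\<phi> f"] nf(1) H_closed[OF \<phi>] by simp
    then show "f \<in> K \<and> n = \<ominus>\<^bsub>N\<^esub> \<phi> f" using f by simp
  next
    assume *: "f \<in> K \<and> n = \<ominus>\<^bsub>N\<^esub> \<phi> f"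
    have "w (n, f) = i (\<ominus>\<^bsub>N\<^esub> \<phi> f \<oplus>\<^bsub>N\<^esub> \<phi> f)"
      using * linear_onD(2)[OF e(2), of "\<ominus>\<^bsub>N\<^esub> \<phi> f" "\<phi> f"] H_closed[OF \<phi>] l(3) by (simp add: w_def)
    then show "w (n, f) = \<zero>\<^bsub>E\<^esub>"
      using H_closed[OF \<phi>] NE.lin_zero[OF N.carrier_is_submodule e(2)] by (simp add: N.M.l_neg)
  qed
qed

text \<open>Both middle terms are quotients of \<open>N \<oplus> F\<close> by the same submodule.\<close>

lemma classified_equiv:
  assumes s: "extension R M N s" "classified \<phi> s" and t: "extension R M N t" "classified \<phi> t"
    and \<phi>: "\<phi> \<in> carrier H"
  shows "ext_equiv R N s t"
proof -
  obtain i E p where s_eq: "s = (i, E, p)" by (cases s)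
  obtain i' E' p' where t_eq: "t = (i', E', p')" by (cases t)
  note e = extensionD[OF s(1)[unfolded s_eq]] and e' = extensionD[OF t(1)[unfolded t_eq]]
  obtain l where l: "linear_on R Fr (carrier Fr) E l" "\<And>u. u \<in> carrier Fr \<Longrightarrow> p (l u) = \<pi> u"
    "\<And>k. k \<in> K \<Longrightarrow> l k = i (\<phi> k)" using s(2) unfolding s_eq classified_def by auto
  obtain l' where l': "linear_on R Fr (carrier Fr) E' l'" "\<And>u. u \<in> carrier Fr \<Longrightarrow> p' (l' u) = \<pi> u"
    "\<And>k. k \<in> K \<Longrightarrow> l' k = i' (\<phi> k)" using t(2) unfolding t_eq classified_def by auto
  interpret E: module R E by (rule e(1))
  interpret E': module R E' by (rule e'(1))
  interpret NF: module_pair R N Fr by (intro module_pairI N.module_axioms Fr)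
  interpret NE: module_pair R N E by (intro module_pairI N.module_axioms e(1))
  interpret NE': module_pair R N E' by (intro module_pairI N.module_axioms e'(1))
  interpret FE: module_pair R Fr E by (intro module_pairI Fr e(1))
  interpret FE': module_pair R Fr E' by (intro module_pairI Fr e'(1))
  note w = middle_presentation[OF s(1)[unfolded s_eq] l \<phi>]
  note w' = middle_presentation[OF t(1)[unfolded t_eq] l' \<phi>]
  let ?w = "\<lambda>(n, f). i n \<oplus>\<^bsub>E\<^esub> l f" and ?w' = "\<lambda>(n, f). i' n \<oplus>\<^bsub>E'\<^esub> l' f"
  have ker: "?w x = \<zero>\<^bsub>E\<^esub> \<longleftrightarrow> ?w' x = \<zero>\<^bsub>E'\<^esub>" if "x \<in> carrier (prod_module N Fr)" for x
    using w(3)[of "fst x" "snd x"] w'(3)[of "fst x" "snd x"] that by (cases x) auto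
  obtain \<chi> where \<chi>: "linear_on R E (carrier E) E' \<chi>" "bij_betw \<chi> (carrier E) (carrier E')"
    "\<And>x. x \<in> carrier (prod_module N Fr) \<Longrightarrow> \<chi> (?w x) = ?w' x"
    using surjections_iso[OF NF.prod_module_module e(1) e'(1) w(1,2) w'(1,2) ker] by blast
  have l0: "l \<zero>\<^bsub>Fr\<^esub> = \<zero>\<^bsub>E\<^esub>" "l' \<zero>\<^bsub>Fr\<^esub> = \<zero>\<^bsub>E'\<^esub>"
    using FE.lin_zero[OF Fr.carrier_is_submodule l(1)] FE'.lin_zero[OF Fr.carrier_is_submodule l'(1)] by auto
  have c: "i n \<in> carrier E" "i' n \<in> carrier E'" if "n \<in> carrier N" for n
    using linear_onD(1)[OF e(2) that] linear_onD(1)[OF e'(2) that] by auto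
  have "\<chi> (i n) = i' n" if n: "n \<in> carrier N" for n
    using \<chi>(3)[of "(n, \<zero>\<^bsub>Fr\<^esub>)"] n c l0 Fr.M.zero_closed by (simp del: M.R.free_module_sel)
  moreover have "p' (\<chi> y) = p y" if y: "y \<in> carrier E" for y
  proof -
    from subsetD[OF equalityD2[OF w(2)] y]
    obtain z where "y = ?w z" "z \<in> carrier (prod_module N Fr)" by (rule imageE)
    then obtain n f where nf: "n \<in> carrier N" "f \<in> carrier Fr" "y = i n \<oplus>\<^bsub>E\<^esub> l f" by auto
    have lc: "l f \<in> carrier E" "l' f \<in> carrier E'" using linear_onD(1)[OF l(1) nf(2)] linear_onD(1)[OF l'(1) nf(2)] by auto
    have z: "p (i n) = \<zero>\<^bsub>M\<^esub>" "p' (i' n) = \<zero>\<^bsub>M\<^esub>" using e(5) e'(5) nf(1) by blast+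
    have "\<chi> y = i' n \<oplus>\<^bsub>E'\<^esub> l' f" using \<chi>(3)[of "(n, f)"] nf by simp
    then show ?thesis
      using linear_onD(2)[OF e(3) c(1)[OF nf(1)] lc(1)] linear_onD(2)[OF e'(3) c(2)[OF nf(1)] lc(2)] z nf l(2) l'(2)
      by simp
  qed
  ultimately show ?thesis unfolding s_eq t_eq ext_equiv_def by (auto simp: mod_hom_iff \<chi> intro!: bexI[of _ \<chi>])
qed

lemma classified_transfer:
  assumes "extension R M N s" "classified \<phi> s" "ext_equiv R N s t" "\<phi> \<in> carrier H"
  shows "classified \<phi> t"
proof -
  obtain i E p where s_eq: "s = (i, E, p)" by (cases s)
  obtain i' E' p' where t_eq: "t = (i', E', p')" by (cases t)
  obtain l where l: "linear_on R Fr (carrier Fr) E l" "\<And>u. u \<in> carrier Fr \<Longrightarrow> p (l u) = \<pi> u"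
    "\<And>k. k \<in> K \<Longrightarrow> l k = i (\<phi> k)" using assms(2) unfolding s_eq classified_def by auto
  obtain \<chi> where \<chi>: "linear_on R E (carrier E) E' \<chi>" "\<And>x. x \<in> carrier N \<Longrightarrow> \<chi> (i x) = i' x"
    "\<And>y. y \<in> carrier E \<Longrightarrow> p' (\<chi> y) = p y"
    using assms(3) unfolding s_eq t_eq ext_equiv_def by (auto simp: mod_hom_iff)
  have lc: "l u \<in> carrier E" if "u \<in> carrier Fr" for u using linear_onD(1)[OF l(1) that] .
  have "linear_on R Fr (carrier Fr) E' (\<chi> \<circ> l)" by (rule linear_on_comp[OF l(1) \<chi>(1)]) (use lc in auto)
  moreover have "p' ((\<chi> \<circ> l) u) = \<pi> u" if "u \<in> carrier Fr" for u using \<chi>(3)[OF lc[OF that]] l(2)[OF that] by simp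
  moreover have "(\<chi> \<circ> l) k = i' (\<phi> k)" if "k \<in> K" for k using l(3)[OF that] \<chi>(2)[OF H_closed[OF assms(4)]] by simp
  ultimately show ?thesis unfolding t_eq classified_def by auto
qed

text \<open>The extensions whose middle term has the type \<open>N \<times> M\<close> and which are classified by \<open>\<phi>\<close>; as a set this is
  the Ext class of any of them (\<open>ext_class_eq\<close>).\<close>

definition \<Phi> :: "(('x \<Rightarrow> 'a) \<Rightarrow> 'e) \<Rightarrow> ('a, 'c, 'e, 'e \<times> 'c) extn set"
  where "\<Phi> \<phi> = {t. extension R M N t \<and> classified \<phi> t}"

lemma ext_class_eq:
  assumes "extension R M N s" "classified \<phi> s" "\<phi> \<in> carrier H"
  shows "ext_class R M N s = \<Phi> \<phi>"
  unfolding ext_class_def \<Phi>_def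
  using classified_transfer[OF assms(1,2) _ assms(3)] classified_equiv[OF assms(1,2) _ _ assms(3)] by blast


text \<open>The extension with a given class, on the set \<open>N \<times> M\<close>: transport the quotient of \<open>N \<oplus> F\<close> by
  the graph of \<open>- \<phi>\<close> along a set-theoretic section \<open>\<sigma>\<close> of \<open>\<pi>\<close>.\<close>

lemma realization:
  assumes \<phi>: "\<phi> \<in> carrier H"
  shows "\<exists>t :: ('a, 'c, 'e, 'e \<times> 'c) extn. extension R M N t \<and> classified \<phi> t"
proof -
  interpret NF: module_pair R N Fr by (intro module_pairI N.module_axioms Fr)
  let ?G = "prod_module N Fr"
  have ex: "\<exists>f. f \<in> carrier Fr \<and> \<pi> f = m" if "m \<in> carrier M" for m using \<pi>_surj that by (metis imageE)
  \<comment> \<open>the section respects zero, so that \<open>n \<mapsto> (n, 0)\<close> is the inclusion of \<open>N\<close>\<close>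
  define \<sigma> where "\<sigma> m = (if m = \<zero>\<^bsub>M\<^esub> then \<zero>\<^bsub>Fr\<^esub> else SOME f. f \<in> carrier Fr \<and> \<pi> f = m)" for m
  have \<pi>0: "\<pi> \<zero>\<^bsub>Fr\<^esub> = \<zero>\<^bsub>M\<^esub>" by (rule FM.lin_zero[OF Fr.carrier_is_submodule \<pi>])
  have \<sigma>: "\<sigma> m \<in> carrier Fr" "\<pi> (\<sigma> m) = m" if "m \<in> carrier M" for m
    using someI_ex[OF ex[OF that]] Fr.M.zero_closed \<pi>0 by (auto simp: \<sigma>_def simp del: M.R.free_module_sel)
  \<comment> \<open>the quotient map by the graph, in coordinates: \<open>(n, f)\<close> is moved along the graph to a pair
    whose second entry is a value of \<open>\<sigma>\<close>\<close>
  define q where "q g = (fst g \<oplus>\<^bsub>N\<^esub> \<phi> (snd g \<ominus>\<^bsub>Fr\<^esub> \<sigma> (\<pi> (snd g))), \<pi> (snd g))" for g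
  define lf where "lf = map_prod (\<lambda>n :: 'e. n) \<sigma>"
  define E :: "('a, 'e \<times> 'c) module" where "E = \<lparr>carrier = carrier N \<times> carrier M, monoid.mult = undefined,
    monoid.one = undefined, ring.zero = (\<zero>\<^bsub>N\<^esub>, \<zero>\<^bsub>M\<^esub>),
    ring.add = (\<lambda>x y. q (lf x \<oplus>\<^bsub>?G\<^esub> lf y)), smult = (\<lambda>a x. q (a \<odot>\<^bsub>?G\<^esub> lf x))\<rparr>"
  have kk: "f \<ominus>\<^bsub>Fr\<^esub> \<sigma> (\<pi> f) \<in> K" if "f \<in> carrier Fr" for f
  proof -
    have c: "\<pi> f \<in> carrier M" by (rule linear_onD(1)[OF \<pi> that])
    have "\<pi> (f \<ominus>\<^bsub>Fr\<^esub> \<sigma> (\<pi> f)) = \<pi> f \<ominus>\<^bsub>M\<^esub> \<pi> (\<sigma> (\<pi> f))"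
      by (rule FM.lin_minus[OF Fr.carrier_is_submodule \<pi> that \<sigma>(1)[OF c]])
    then show ?thesis using \<sigma>[OF c] c that by (simp add: K_iff a_minus_def M.M.r_neg del: M.R.free_module_sel)
  qed
  have q_add: "q (lf (q g) \<oplus>\<^bsub>?G\<^esub> lf (q h)) = q (g \<oplus>\<^bsub>?G\<^esub> h)" if gh: "g \<in> carrier ?G" "h \<in> carrier ?G" for g h
  proof -
    obtain n f where g: "g = (n, f)" "n \<in> carrier N" "f \<in> carrier Fr" using gh(1) by auto
    obtain n' f' where h: "h = (n', f')" "n' \<in> carrier N" "f' \<in> carrier Fr" using gh(2) by auto
    define s where "s = \<sigma> (\<pi> f)" define s' where "s' = \<sigma> (\<pi> f')"
    define s2 where "s2 = \<sigma> (\<pi> f \<oplus>\<^bsub>M\<^esub> \<pi> f')"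
    have c: "\<pi> f \<in> carrier M" "\<pi> f' \<in> carrier M" using linear_onD(1)[OF \<pi>] g h by auto
    have sc: "s \<in> carrier Fr" "s' \<in> carrier Fr" "s2 \<in> carrier Fr"
      "\<pi> s = \<pi> f" "\<pi> s' = \<pi> f'" "\<pi> s2 = \<pi> f \<oplus>\<^bsub>M\<^esub> \<pi> f'"
      unfolding s_def s'_def s2_def using \<sigma> c by simp_all
    have pi: "\<pi> (s \<oplus>\<^bsub>Fr\<^esub> s') = \<pi> f \<oplus>\<^bsub>M\<^esub> \<pi> f'" "\<pi> (f \<oplus>\<^bsub>Fr\<^esub> f') = \<pi> f \<oplus>\<^bsub>M\<^esub> \<pi> f'"
      using linear_onD(2)[OF \<pi>] sc g h by auto
    have k: "f \<ominus>\<^bsub>Fr\<^esub> s \<in> K" "f' \<ominus>\<^bsub>Fr\<^esub> s' \<in> K" "(s \<oplus>\<^bsub>Fr\<^esub> s') \<ominus>\<^bsub>Fr\<^esub> s2 \<in> K"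
      using kk[OF g(3)] kk[OF h(3)] kk[of "s \<oplus>\<^bsub>Fr\<^esub> s'"] pi Fr.M.a_closed[OF sc(1,2)]
      by (simp_all add: s_def s'_def s2_def del: M.R.free_module_sel)
    have "(f \<ominus>\<^bsub>Fr\<^esub> s) \<oplus>\<^bsub>Fr\<^esub> ((f' \<ominus>\<^bsub>Fr\<^esub> s') \<oplus>\<^bsub>Fr\<^esub> ((s \<oplus>\<^bsub>Fr\<^esub> s') \<ominus>\<^bsub>Fr\<^esub> s2)) = (f \<oplus>\<^bsub>Fr\<^esub> f') \<ominus>\<^bsub>Fr\<^esub> s2"
    proof -
      have "(f \<ominus>\<^bsub>Fr\<^esub> s) \<oplus>\<^bsub>Fr\<^esub> ((f' \<ominus>\<^bsub>Fr\<^esub> s') \<oplus>\<^bsub>Fr\<^esub> ((s \<oplus>\<^bsub>Fr\<^esub> s') \<ominus>\<^bsub>Fr\<^esub> s2))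
          = ((s \<oplus>\<^bsub>Fr\<^esub> (f \<ominus>\<^bsub>Fr\<^esub> s)) \<oplus>\<^bsub>Fr\<^esub> (s' \<oplus>\<^bsub>Fr\<^esub> (f' \<ominus>\<^bsub>Fr\<^esub> s'))) \<ominus>\<^bsub>Fr\<^esub> s2"
        using g h sc Fr.M.minus_closed Fr.M.a_closed
        by (simp add: a_minus_def Fr.M.a_ac del: M.R.free_module_sel)
      then show ?thesis by (simp only: Fr.minus_add_self[OF g(3) sc(1)] Fr.minus_add_self[OF h(3) sc(2)])
    qed
    then have "\<phi> (f \<ominus>\<^bsub>Fr\<^esub> s) \<oplus>\<^bsub>N\<^esub> (\<phi> (f' \<ominus>\<^bsub>Fr\<^esub> s') \<oplus>\<^bsub>N\<^esub> \<phi> ((s \<oplus>\<^bsub>Fr\<^esub> s') \<ominus>\<^bsub>Fr\<^esub> s2)) = \<phi> ((f \<oplus>\<^bsub>Fr\<^esub> f') \<ominus>\<^bsub>Fr\<^esub> s2)"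
      using linear_onD(2)[OF H_lin[OF \<phi>]] k Fr.sub_add[OF K] by metis
    moreover have "q (lf (q g) \<oplus>\<^bsub>?G\<^esub> lf (q h)) =
        ((n \<oplus>\<^bsub>N\<^esub> \<phi> (f \<ominus>\<^bsub>Fr\<^esub> s)) \<oplus>\<^bsub>N\<^esub> (n' \<oplus>\<^bsub>N\<^esub> \<phi> (f' \<ominus>\<^bsub>Fr\<^esub> s')) \<oplus>\<^bsub>N\<^esub> \<phi> ((s \<oplus>\<^bsub>Fr\<^esub> s') \<ominus>\<^bsub>Fr\<^esub> s2), \<pi> f \<oplus>\<^bsub>M\<^esub> \<pi> f')"
      by (simp add: q_def lf_def g h pi s_def[symmetric] s'_def[symmetric] s2_def[symmetric]
          del: M.R.free_module_sel)
    moreover have "q (g \<oplus>\<^bsub>?G\<^esub> h) = (n \<oplus>\<^bsub>N\<^esub> n' \<oplus>\<^bsub>N\<^esub> \<phi> ((f \<oplus>\<^bsub>Fr\<^esub> f') \<ominus>\<^bsub>Fr\<^esub> s2), \<pi> f \<oplus>\<^bsub>M\<^esub> \<pi> f')"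
      by (simp add: q_def g h pi s2_def del: M.R.free_module_sel)
    ultimately show ?thesis using H_closed[OF \<phi>] g h by (simp add: N.M.a_ac)
  qed
  have q_smult: "q (a \<odot>\<^bsub>?G\<^esub> lf (q g)) = q (a \<odot>\<^bsub>?G\<^esub> g)" if a: "a \<in> carrier R" and gc: "g \<in> carrier ?G" for a g
  proof -
    obtain n f where g: "g = (n, f)" "n \<in> carrier N" "f \<in> carrier Fr" using gc by auto
    define s where "s = \<sigma> (\<pi> f)"
    define s2 where "s2 = \<sigma> (a \<odot>\<^bsub>M\<^esub> \<pi> f)"
    have c: "\<pi> f \<in> carrier M" "a \<odot>\<^bsub>M\<^esub> \<pi> f \<in> carrier M" using linear_onD(1)[OF \<pi>] g a by auto
    have sc: "s \<in> carrier Fr" "s2 \<in> carrier Fr" "\<pi> s = \<pi> f"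
      unfolding s_def s2_def using \<sigma> c by simp_all
    have pi: "\<pi> (a \<odot>\<^bsub>Fr\<^esub> s) = a \<odot>\<^bsub>M\<^esub> \<pi> f" "\<pi> (a \<odot>\<^bsub>Fr\<^esub> f) = a \<odot>\<^bsub>M\<^esub> \<pi> f"
      using linear_onD(3)[OF \<pi> a] sc g by auto
    have k: "f \<ominus>\<^bsub>Fr\<^esub> s \<in> K" "(a \<odot>\<^bsub>Fr\<^esub> s) \<ominus>\<^bsub>Fr\<^esub> s2 \<in> K"
      using kk[OF g(3)] kk[of "a \<odot>\<^bsub>Fr\<^esub> s"] pi Fr.smult_closed[OF a sc(1)]
      by (simp_all add: s_def s2_def del: M.R.free_module_sel)
    have "a \<odot>\<^bsub>Fr\<^esub> (f \<ominus>\<^bsub>Fr\<^esub> s) \<oplus>\<^bsub>Fr\<^esub> ((a \<odot>\<^bsub>Fr\<^esub> s) \<ominus>\<^bsub>Fr\<^esub> s2) = (a \<odot>\<^bsub>Fr\<^esub> f) \<ominus>\<^bsub>Fr\<^esub> s2"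
    proof -
      have "a \<odot>\<^bsub>Fr\<^esub> (f \<ominus>\<^bsub>Fr\<^esub> s) \<oplus>\<^bsub>Fr\<^esub> ((a \<odot>\<^bsub>Fr\<^esub> s) \<ominus>\<^bsub>Fr\<^esub> s2) = (a \<odot>\<^bsub>Fr\<^esub> s \<oplus>\<^bsub>Fr\<^esub> (a \<odot>\<^bsub>Fr\<^esub> f \<ominus>\<^bsub>Fr\<^esub> a \<odot>\<^bsub>Fr\<^esub> s)) \<ominus>\<^bsub>Fr\<^esub> s2"
        unfolding Fr.smult_minus_distr[OF a g(3) sc(1)]
        using g sc a Fr.M.minus_closed Fr.M.a_closed Fr.smult_closed
        by (simp add: a_minus_def Fr.M.a_ac del: M.R.free_module_sel)
      then show ?thesis
        by (simp only: Fr.minus_add_self[OF Fr.smult_closed[OF a g(3)] Fr.smult_closed[OF a sc(1)]])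
    qed
    then have "a \<odot>\<^bsub>N\<^esub> \<phi> (f \<ominus>\<^bsub>Fr\<^esub> s) \<oplus>\<^bsub>N\<^esub> \<phi> ((a \<odot>\<^bsub>Fr\<^esub> s) \<ominus>\<^bsub>Fr\<^esub> s2) = \<phi> ((a \<odot>\<^bsub>Fr\<^esub> f) \<ominus>\<^bsub>Fr\<^esub> s2)"
      using linear_onD(2,3)[OF H_lin[OF \<phi>]] a k Fr.sub_smult[OF K] by metis
    moreover have "q (a \<odot>\<^bsub>?G\<^esub> lf (q g)) =
        (a \<odot>\<^bsub>N\<^esub> (n \<oplus>\<^bsub>N\<^esub> \<phi> (f \<ominus>\<^bsub>Fr\<^esub> s)) \<oplus>\<^bsub>N\<^esub> \<phi> ((a \<odot>\<^bsub>Fr\<^esub> s) \<ominus>\<^bsub>Fr\<^esub> s2), a \<odot>\<^bsub>M\<^esub> \<pi> f)"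
      by (simp add: q_def lf_def g pi s_def[symmetric] s2_def[symmetric] del: M.R.free_module_sel)
    moreover have "q (a \<odot>\<^bsub>?G\<^esub> g) = (a \<odot>\<^bsub>N\<^esub> n \<oplus>\<^bsub>N\<^esub> \<phi> ((a \<odot>\<^bsub>Fr\<^esub> f) \<ominus>\<^bsub>Fr\<^esub> s2), a \<odot>\<^bsub>M\<^esub> \<pi> f)"
      by (simp add: q_def g pi s2_def del: M.R.free_module_sel)
    ultimately show ?thesis using H_closed[OF \<phi>] g a by (simp add: N.M.a_ac N.smult_r_distr)
  qed
  have \<phi>0: "\<phi> \<zero>\<^bsub>Fr\<^esub> = \<zero>\<^bsub>N\<^esub>" by (rule FN.lin_zero[OF K H_lin[OF \<phi>]])
  have qn: "q (n, \<zero>\<^bsub>Fr\<^esub>) = (n, \<zero>\<^bsub>M\<^esub>)" if "n \<in> carrier N" for n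
  proof -
    have "\<zero>\<^bsub>Fr\<^esub> \<ominus>\<^bsub>Fr\<^esub> \<zero>\<^bsub>Fr\<^esub> = \<zero>\<^bsub>Fr\<^esub>" using Fr.M.zero_closed by (simp add: a_minus_def Fr.M.r_neg del: M.R.free_module_sel)
    then show ?thesis using that by (simp add: q_def \<sigma>_def \<pi>0 \<phi>0 del: M.R.free_module_sel)
  qed
  have q_lf: "q (lf x) = x" if "x \<in> carrier N \<times> carrier M" for x
  proof -
    have "\<sigma> (snd x) \<ominus>\<^bsub>Fr\<^esub> \<sigma> (snd x) = \<zero>\<^bsub>Fr\<^esub>"
      using that \<sigma>(1)[of "snd x"] by (auto simp add: a_minus_def Fr.M.r_neg simp del: M.R.free_module_sel)
    then show ?thesis using that \<sigma>[of "snd x"] by (auto simp: q_def lf_def \<phi>0 simp del: M.R.free_module_sel)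
  qed
  have lfc: "lf x \<in> carrier ?G" if "x \<in> carrier N \<times> carrier M" for x using that \<sigma>(1) by (auto simp: lf_def)
  have qc: "q g \<in> carrier N \<times> carrier M" if "g \<in> carrier ?G" for g
    using that H_closed[OF \<phi>] linear_onD(1)[OF \<pi>] by (auto simp: q_def)
  have im: "q ` carrier ?G = carrier E"
  proof
    show "q ` carrier ?G \<subseteq> carrier E"
    proof (intro image_subsetI)
      fix g assume "g \<in> carrier ?G"
      from qc[OF this] show "q g \<in> carrier E" by (simp add: E_def)
    qed
    show "carrier E \<subseteq> q ` carrier ?G"
    proof
      fix x assume "x \<in> carrier E"
      then have x: "x \<in> carrier N \<times> carrier M" by (simp add: E_def)
      show "x \<in> q ` carrier ?G" using q_lf[OF x] lfc[OF x] by (metis imageI)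
    qed
  qed
  have Esel: "ring.add E = (\<lambda>x y. q (lf x \<oplus>\<^bsub>?G\<^esub> lf y))" "smult E = (\<lambda>a x. q (a \<odot>\<^bsub>?G\<^esub> lf x))"
    "ring.zero E = (\<zero>\<^bsub>N\<^esub>, \<zero>\<^bsub>M\<^esub>)" "carrier E = carrier N \<times> carrier M" by (simp_all add: E_def)
  have Emod: "module R E"
    by (rule surjective_image_module[OF NF.prod_module_module im])
       (simp_all only: Esel q_add q_smult prod_module_sel(2) qn[OF N.M.zero_closed])
  have qlin: "linear_on R ?G (carrier ?G) E q"
    by (rule linear_onI) (simp_all only: Esel q_add q_smult qc)
  let ?i = "\<lambda>n. q (n, \<zero>\<^bsub>Fr\<^esub>)" and ?l = "\<lambda>f. q (\<zero>\<^bsub>N\<^esub>, f)"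
  have z: "\<zero>\<^bsub>Fr\<^esub> \<in> carrier Fr" by (rule Fr.M.zero_closed)
  have i: "linear_on R N (carrier N) E ?i"
  proof -
    have "linear_on R N (carrier N) ?G (\<lambda>n. (n, \<zero>\<^bsub>Fr\<^esub>))"
      by (rule linear_onI) (use z Fr.M.r_zero[OF z] Fr.smult_r_null in \<open>simp_all del: M.R.free_module_sel\<close>)
    from linear_on_comp[OF this qlin] show ?thesis using z by (auto simp: comp_def simp del: M.R.free_module_sel)
  qed
  have l: "linear_on R Fr (carrier Fr) E ?l"
  proof -
    have "linear_on R Fr (carrier Fr) ?G (\<lambda>f. (\<zero>\<^bsub>N\<^esub>, f))"
      by (rule linear_onI) (use Fr.M.a_closed Fr.smult_closed in \<open>simp_all del: M.R.free_module_sel\<close>)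
    from linear_on_comp[OF this qlin] show ?thesis by (auto simp: comp_def)
  qed
  have snd_q: "snd (q g) = \<pi> (snd g)" for g by (simp add: q_def)
  have p: "linear_on R E (carrier E) M snd"
  proof (rule linear_onI)
    fix x y assume xy: "x \<in> carrier E" "y \<in> carrier E"
    then have c: "x \<in> carrier N \<times> carrier M" "y \<in> carrier N \<times> carrier M" by (auto simp: Esel)
    show "snd x \<in> carrier M" using c by auto
    show "snd (x \<oplus>\<^bsub>E\<^esub> y) = snd x \<oplus>\<^bsub>M\<^esub> snd y"
      using c \<sigma> linear_onD(2)[OF \<pi>] by (auto simp: Esel snd_q lf_def simp del: M.R.free_module_sel)
    show "snd (a \<odot>\<^bsub>E\<^esub> x) = a \<odot>\<^bsub>M\<^esub> snd x" if "a \<in> carrier R" for a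
      using c \<sigma> linear_onD(3)[OF \<pi> that] by (auto simp: Esel snd_q lf_def simp del: M.R.free_module_sel)
  qed
  have ext: "extension R M N (?i, E, snd)"
  proof (rule extensionI[OF Emod i p])
    show "inj_on ?i (carrier N)" by (rule inj_onI) (simp add: qn del: M.R.free_module_sel)
    have "?i ` carrier N = (\<lambda>n. (n, \<zero>\<^bsub>M\<^esub>)) ` carrier N" by (rule image_cong[OF refl qn])
    also have "\<dots> = {e \<in> carrier E. snd e = \<zero>\<^bsub>M\<^esub>}" by (auto simp: Esel)
    finally show "?i ` carrier N = {e \<in> carrier E. snd e = \<zero>\<^bsub>M\<^esub>}" .
    show "snd ` carrier E = carrier M" using N.M.zero_closed by (force simp: Esel)
  qed
  have "classified \<phi> (?i, E, snd)"
    unfolding classified_def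
  proof (simp only: prod.case, intro exI[of _ ?l] conjI ballI l)
    fix u assume u: "u \<in> carrier Fr"
    show "snd (q (\<zero>\<^bsub>N\<^esub>, u)) = \<pi> u" by (simp add: snd_q)
  next
    fix k assume k: "k \<in> K"
    then have "\<pi> k = \<zero>\<^bsub>M\<^esub>" "k \<in> carrier Fr" by (auto simp: K_iff)
    moreover have "k \<ominus>\<^bsub>Fr\<^esub> \<zero>\<^bsub>Fr\<^esub> = k"
      using Fr.minus_add_self[of k "\<zero>\<^bsub>Fr\<^esub>"] Fr.M.minus_closed[of k "\<zero>\<^bsub>Fr\<^esub>"] Fr.M.l_zero z \<open>k \<in> carrier Fr\<close> by metis
    ultimately have "q (\<zero>\<^bsub>N\<^esub>, k) = (\<phi> k, \<zero>\<^bsub>M\<^esub>)"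
      using H_closed[OF \<phi>, of k] by (simp add: q_def \<sigma>_def del: M.R.free_module_sel)
    then show "q (\<zero>\<^bsub>N\<^esub>, k) = q (\<phi> k, \<zero>\<^bsub>Fr\<^esub>)" using qn[OF H_closed[OF \<phi>]] by simp
  qed
  then show ?thesis using ext by blast
qed

text \<open>If \<open>l\<close> lifts \<open>\<pi>\<close> to \<open>E\<close>, then \<open>f \<mapsto> (a l f, \<pi> f)\<close> lifts it to the pullback along multiplication by \<open>a\<close>.\<close>

lemma smult_classified:
  assumes s: "extension R M N s" "classified \<phi> s" and \<phi>: "\<phi> \<in> carrier H" and a: "a \<in> carrier R"
  shows "extension R M N (ext_smult M a s)" "classified (a \<odot>\<^bsub>H\<^esub> \<phi>) (ext_smult M a s)"
proof -
  obtain i E p where s_eq: "s = (i, E, p)" by (cases s)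
  note e = extensionD[OF s(1)[unfolded s_eq]]
  obtain l where l: "linear_on R Fr (carrier Fr) E l" "\<And>u. u \<in> carrier Fr \<Longrightarrow> p (l u) = \<pi> u"
    "\<And>k. k \<in> K \<Longrightarrow> l k = i (\<phi> k)" using s(2) unfolding s_eq classified_def by auto
  interpret EM: module_pair R E M by (intro module_pairI M.module_axioms e(1))
  interpret NE: module_pair R N E by (intro module_pairI N.module_axioms e(1))
  interpret PM: module R "prod_module E M" by (rule EM.prod_module_module)
  let ?C = "{(x, y). x \<in> carrier E \<and> y \<in> carrier M \<and> p x = a \<odot>\<^bsub>M\<^esub> y}"
  let ?P = "fibre_product E p M (\<lambda>z. a \<odot>\<^bsub>M\<^esub> z)"
  have P_eq: "?P = (prod_module E M)\<lparr>carrier := ?C\<rparr>" by (simp add: fibre_product_def)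
  have p0: "p \<zero>\<^bsub>E\<^esub> = \<zero>\<^bsub>M\<^esub>" by (rule EM.lin_zero[OF EM.M.carrier_is_submodule e(3)])
  have sub: "submodule ?C R (prod_module E M)"
    by (rule PM.submoduleI')
       (auto simp: p0 a linear_onD(2,3)[OF e(3)] M.smult_r_distr M.smult_comm[of a])
  have Pmod: "module R ?P" unfolding P_eq by (rule PM.submodule_restrict(1)[OF sub])
  have sel: "carrier ?P = ?C" "ring.add ?P = ring.add (prod_module E M)"
    "smult ?P = smult (prod_module E M)" by (simp_all add: P_eq)
  have ic: "i n \<in> carrier E" if "n \<in> carrier N" for n using linear_onD(1)[OF e(2) that] .
  have pi0: "p (i n) = \<zero>\<^bsub>M\<^esub>" if "n \<in> carrier N" for n using e(5) that by blast
  have es: "ext_smult M a s = (\<lambda>x. (i x, \<zero>\<^bsub>M\<^esub>), ?P, snd)" by (simp add: ext_smult_def s_eq)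
  show "extension R M N (ext_smult M a s)"
    unfolding es
  proof (rule extensionI[OF Pmod])
    show "linear_on R N (carrier N) ?P (\<lambda>x. (i x, \<zero>\<^bsub>M\<^esub>))"
      by (rule linear_onI) (auto simp: sel ic pi0 a linear_onD(2,3)[OF e(2)])
    show "linear_on R ?P (carrier ?P) M snd" by (rule linear_onI) (auto simp: sel)
    show "inj_on (\<lambda>x. (i x, \<zero>\<^bsub>M\<^esub>)) (carrier N)" using e(4) by (auto simp: inj_on_def)
    have "{x \<in> carrier ?P. snd x = \<zero>\<^bsub>M\<^esub>} = (\<lambda>x. (x, \<zero>\<^bsub>M\<^esub>)) ` {x \<in> carrier E. p x = \<zero>\<^bsub>M\<^esub>}"
      using a by (auto simp: sel)
    then show "(\<lambda>x. (i x, \<zero>\<^bsub>M\<^esub>)) ` carrier N = {x \<in> carrier ?P. snd x = \<zero>\<^bsub>M\<^esub>}"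
      by (simp only: e(5)[symmetric] image_image)
    show "snd ` carrier ?P = carrier M"
    proof
      show "snd ` carrier ?P \<subseteq> carrier M" by (auto simp: sel)
      show "carrier M \<subseteq> snd ` carrier ?P"
      proof
        fix z assume z: "z \<in> carrier M"
        have "a \<odot>\<^bsub>M\<^esub> z \<in> p ` carrier E" using e(6) a z by simp
        then obtain x where "x \<in> carrier E" "p x = a \<odot>\<^bsub>M\<^esub> z" by auto
        then have "(x, z) \<in> carrier ?P" using z by (simp add: sel)
        then show "z \<in> snd ` carrier ?P" by force
      qed
    qed
  qed
  have lc: "l u \<in> carrier E" if "u \<in> carrier Fr" for u using linear_onD(1)[OF l(1) that] .
  show "classified (a \<odot>\<^bsub>H\<^esub> \<phi>) (ext_smult M a s)"
    unfolding es classified_def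
  proof (simp only: prod.case, intro exI[of _ "\<lambda>f. (a \<odot>\<^bsub>E\<^esub> l f, \<pi> f)"] conjI ballI)
    show "linear_on R Fr (carrier Fr) ?P (\<lambda>f. (a \<odot>\<^bsub>E\<^esub> l f, \<pi> f))"
      by (rule linear_onI)
         (simp_all add: sel lc a l(2) linear_onD[OF \<pi>] linear_onD(2,3)[OF l(1)] linear_onD(3)[OF e(3)]
            EM.M.smult_r_distr EM.M.smult_comm[of a] del: M.R.free_module_sel)
    fix k assume k: "k \<in> K"
    show "(a \<odot>\<^bsub>E\<^esub> l k, \<pi> k) = (i ((a \<odot>\<^bsub>H\<^esub> \<phi>) k), \<zero>\<^bsub>M\<^esub>)"
      using k l(3)[OF k] linear_onD(3)[OF e(2) a H_closed[OF \<phi>]] by (simp add: K_iff)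
  qed simp
qed

text \<open>If \<open>l\<close> and \<open>l'\<close> lift \<open>\<pi>\<close> to the two middle terms, the class of \<open>(l, l')\<close> lifts it to the Baer sum; modulo the
  antidiagonal, \<open>(i (\<phi> k), i' (\<psi> k))\<close> is \<open>(i (\<phi> k + \<psi> k), 0)\<close>.\<close>

lemma baer_sum_classified:
  assumes s: "extension R M N s" "classified \<phi> s" and t: "extension R M N t" "classified \<psi> t"
    and \<phi>: "\<phi> \<in> carrier H" and \<psi>: "\<psi> \<in> carrier H"
  shows "extension R M N (baer_sum N s t)" "classified (\<phi> \<oplus>\<^bsub>H\<^esub> \<psi>) (baer_sum N s t)"
proof -
  obtain i E p where s_eq: "s = (i, E, p)" by (cases s)
  obtain i' E' p' where t_eq: "t = (i', E', p')" by (cases t)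
  note e = extensionD[OF s(1)[unfolded s_eq]] and e' = extensionD[OF t(1)[unfolded t_eq]]
  obtain l where l: "linear_on R Fr (carrier Fr) E l" "\<And>u. u \<in> carrier Fr \<Longrightarrow> p (l u) = \<pi> u"
    "\<And>k. k \<in> K \<Longrightarrow> l k = i (\<phi> k)" using s(2) unfolding s_eq classified_def by auto
  obtain l' where l': "linear_on R Fr (carrier Fr) E' l'" "\<And>u. u \<in> carrier Fr \<Longrightarrow> p' (l' u) = \<pi> u"
    "\<And>k. k \<in> K \<Longrightarrow> l' k = i' (\<psi> k)" using t(2) unfolding t_eq classified_def by auto
  interpret EE: module_pair R E E' by (intro module_pairI e(1) e'(1))
  interpret EM: module_pair R E M by (intro module_pairI M.module_axioms e(1))
  interpret EM': module_pair R E' M by (intro module_pairI M.module_axioms e'(1))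
  interpret NE: module_pair R N E by (intro module_pairI N.module_axioms e(1))
  interpret NE': module_pair R N E' by (intro module_pairI N.module_axioms e'(1))
  interpret PE: module R "prod_module E E'" by (rule EE.prod_module_module)
  let ?C = "{(x, y). x \<in> carrier E \<and> y \<in> carrier E' \<and> p x = p' y}"
  define P where "P = fibre_product E p E' p'"
  have P_eq: "P = (prod_module E E')\<lparr>carrier := ?C\<rparr>" by (simp add: P_def fibre_product_def)
  have p0: "p \<zero>\<^bsub>E\<^esub> = \<zero>\<^bsub>M\<^esub>" "p' \<zero>\<^bsub>E'\<^esub> = \<zero>\<^bsub>M\<^esub>"
    using EM.lin_zero[OF EE.M.carrier_is_submodule e(3)] EM'.lin_zero[OF EE.N.carrier_is_submodule e'(3)] by auto
  have sub: "submodule ?C R (prod_module E E')"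
    by (rule PE.submoduleI') (auto simp: p0 linear_onD(2,3)[OF e(3)] linear_onD(2,3)[OF e'(3)])
  have Pmod: "module R P" unfolding P_eq by (rule PE.submodule_restrict(1)[OF sub])
  interpret P: module R P by (rule Pmod)
  have sel: "carrier P = ?C" "ring.add P = ring.add (prod_module E E')"
    "smult P = smult (prod_module E E')" "ring.zero P = (\<zero>\<^bsub>E\<^esub>, \<zero>\<^bsub>E'\<^esub>)" by (simp_all add: P_eq)
  have ic: "i n \<in> carrier E" "i' n \<in> carrier E'" if "n \<in> carrier N" for n
    using linear_onD(1)[OF e(2) that] linear_onD(1)[OF e'(2) that] by auto
  have pi0: "p (i n) = \<zero>\<^bsub>M\<^esub>" "p' (i' n) = \<zero>\<^bsub>M\<^esub>" if "n \<in> carrier N" for n using e(5) e'(5) that by blast+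
  have i0: "i \<zero>\<^bsub>N\<^esub> = \<zero>\<^bsub>E\<^esub>" "i' \<zero>\<^bsub>N\<^esub> = \<zero>\<^bsub>E'\<^esub>"
    using NE.lin_zero[OF N.carrier_is_submodule e(2)] NE'.lin_zero[OF N.carrier_is_submodule e'(2)] by auto
  have ineg: "\<ominus>\<^bsub>E'\<^esub> i' n = i' (\<ominus>\<^bsub>N\<^esub> n)" if "n \<in> carrier N" for n
    using NE'.lin_neg[OF N.carrier_is_submodule e'(2) that] by simp
  let ?h = "\<lambda>n. (i n, i' (\<ominus>\<^bsub>N\<^esub> n))"
  have h: "linear_on R N (carrier N) P ?h"
    by (rule linear_onI)
       (auto simp: sel ic pi0 linear_onD(2,3)[OF e(2)] linear_onD(2)[OF e'(2), symmetric]
          linear_onD(3)[OF e'(2), symmetric] N.M.minus_add N.smult_r_minus)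
  define A where "A = {(i x, \<ominus>\<^bsub>E'\<^esub> i' x) | x. x \<in> carrier N}"
  have A_im: "A = ?h ` carrier N" unfolding A_def by (auto simp: ineg)
  interpret NP: module_pair R N P by (intro module_pairI N.module_axioms Pmod)
  have A: "submodule A R P"
    unfolding A_im by (rule NP.image_submodule[OF N.carrier_is_submodule h N.carrier_is_submodule order_refl])
  let ?Q = "quot_module P A" and ?c = "\<lambda>x. A +>\<^bsub>P\<^esub> x"
  note Q = P.quot_module_module[OF A]
  interpret Q: module R ?Q by (rule Q(1))
  interpret PQ: module_pair R P ?Q by (intro module_pairI Pmod Q(1))
  have Qc: "carrier ?Q = ?c ` carrier P" by (rule P.quot_carrier)
  let ?i = "\<lambda>x. ?c (i x, \<zero>\<^bsub>E'\<^esub>)" and ?p = "\<lambda>C. the_elem ((\<lambda>(y, y'). p y) ` C)"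
  have inP: "(i x, \<zero>\<^bsub>E'\<^esub>) \<in> carrier P" if "x \<in> carrier N" for x using that ic pi0 p0 by (simp add: sel)
  have pc: "?p (?c x) = p (fst x)" if x: "x \<in> carrier P" for x
  proof -
    have "(\<lambda>(y, y'). p y) ` ?c x = {p (fst x)}"
    proof
      show "(\<lambda>(y, y'). p y) ` ?c x \<subseteq> {p (fst x)}"
      proof (intro image_subsetI)
        fix y assume "y \<in> ?c x"
        then obtain n where n: "n \<in> carrier N" "y = ?h n \<oplus>\<^bsub>P\<^esub> x" unfolding P.coset_mem_iff A_im by blast
        have "fst x \<in> carrier E" using x by (auto simp: sel)
        then show "(case y of (y, y') \<Rightarrow> p y) \<in> {p (fst x)}"
          using n ic pi0 linear_onD(2)[OF e(3), of "i n" "fst x"] linear_onD(1)[OF e(3), of "fst x"]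
          by (simp add: sel case_prod_beta)
      qed
      have "\<zero>\<^bsub>P\<^esub> \<oplus>\<^bsub>P\<^esub> x \<in> ?c x" unfolding P.coset_mem_iff using P.sub_zero[OF A] by blast
      then have "x \<in> ?c x" using x by simp
      then show "{p (fst x)} \<subseteq> (\<lambda>(y, y'). p y) ` ?c x" by (auto simp: case_prod_beta intro!: image_eqI[of _ _ x])
    qed
    then show ?thesis by simp
  qed
  have ilin: "linear_on R N (carrier N) ?Q ?i"
  proof -
    have "linear_on R N (carrier N) P (\<lambda>x. (i x, \<zero>\<^bsub>E'\<^esub>))"
      by (rule linear_onI) (auto simp: sel ic pi0 p0 linear_onD(2,3)[OF e(2)])
    from linear_on_comp[OF this Q(2)] show ?thesis using inP by (auto simp: comp_def)
  qed
  have Qex: "\<exists>x\<in>carrier P. C = ?c x" if "C \<in> carrier ?Q" for C using that unfolding Qc by blast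
  have fc: "fst x \<in> carrier E" if "x \<in> carrier P" for x using that by (auto simp: sel)
  have plin: "linear_on R ?Q (carrier ?Q) M ?p"
  proof (rule linear_onI)
    fix C assume "C \<in> carrier ?Q"
    then obtain x where x: "x \<in> carrier P" "C = ?c x" using Qex by blast
    show "?p C \<in> carrier M" unfolding x(2) pc[OF x(1)] by (rule linear_onD(1)[OF e(3) fc[OF x(1)]])
    fix D assume "D \<in> carrier ?Q"
    then obtain y where y: "y \<in> carrier P" "D = ?c y" using Qex by blast
    have "C \<oplus>\<^bsub>?Q\<^esub> D = ?c (x \<oplus>\<^bsub>P\<^esub> y)" unfolding x(2) y(2) by (rule linear_onD(2)[OF Q(2) x(1) y(1), symmetric])
    then have "?p (C \<oplus>\<^bsub>?Q\<^esub> D) = p (fst (x \<oplus>\<^bsub>P\<^esub> y))" using pc[OF P.M.a_closed[OF x(1) y(1)]] by simp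
    also have "\<dots> = p (fst x) \<oplus>\<^bsub>M\<^esub> p (fst y)" using linear_onD(2)[OF e(3) fc[OF x(1)] fc[OF y(1)]] by (simp add: sel)
    finally show "?p (C \<oplus>\<^bsub>?Q\<^esub> D) = ?p C \<oplus>\<^bsub>M\<^esub> ?p D" using pc x y by simp
  next
    fix a C assume a: "a \<in> carrier R" and "C \<in> carrier ?Q"
    then obtain x where x: "x \<in> carrier P" "C = ?c x" using Qex by blast
    have "a \<odot>\<^bsub>?Q\<^esub> C = ?c (a \<odot>\<^bsub>P\<^esub> x)" unfolding x(2) by (rule linear_onD(3)[OF Q(2) a x(1), symmetric])
    then have "?p (a \<odot>\<^bsub>?Q\<^esub> C) = p (fst (a \<odot>\<^bsub>P\<^esub> x))" using pc[OF P.smult_closed[OF a x(1)]] by simp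
    also have "\<dots> = a \<odot>\<^bsub>M\<^esub> p (fst x)" using linear_onD(3)[OF e(3) a fc[OF x(1)]] by (simp add: sel)
    finally show "?p (a \<odot>\<^bsub>?Q\<^esub> C) = a \<odot>\<^bsub>M\<^esub> ?p C" using pc x by simp
  qed
  have es: "baer_sum N s t = (?i, ?Q, ?p)"
    by (simp add: baer_sum_def s_eq t_eq Let_def P_def A_def)
  \<comment> \<open>two elements are congruent as soon as their difference is an antidiagonal element\<close>
  have cong: "?c x = ?c y" if "n \<in> carrier N" "y \<in> carrier P" "x = ?h n \<oplus>\<^bsub>P\<^esub> y" for x y n
  proof -
    have hc: "?h n \<in> carrier P" "?h n \<in> A" using linear_onD(1)[OF h that(1)] that(1) by (auto simp: A_im)
    have "y \<oplus>\<^bsub>P\<^esub> ?h n \<ominus>\<^bsub>P\<^esub> y = ?h n" by (rule P.add_minus_self[OF that(2) hc(1)])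
    then have "x \<ominus>\<^bsub>P\<^esub> y \<in> A" using hc that(2) unfolding that(3) P.M.a_comm[OF hc(1) that(2)] by simp
    then show ?thesis using P.coset_eq_iff[OF A _ that(2), of x] hc(1) that(2,3) by simp
  qed
  show "extension R M N (baer_sum N s t)"
    unfolding es
  proof (rule extensionI[OF Q(1) ilin plin])
    show "inj_on ?i (carrier N)"
    proof (rule inj_onI)
      fix x y assume xy: "x \<in> carrier N" "y \<in> carrier N" and eq: "?i x = ?i y"
      have "(i x, \<zero>\<^bsub>E'\<^esub>) \<in> ?c (i y, \<zero>\<^bsub>E'\<^esub>)"
      proof -
        have "\<zero>\<^bsub>P\<^esub> \<oplus>\<^bsub>P\<^esub> (i x, \<zero>\<^bsub>E'\<^esub>) \<in> ?i x" unfolding P.coset_mem_iff using P.sub_zero[OF A] by blast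
        then show ?thesis using eq P.M.l_zero[OF inP[OF xy(1)]] by simp
      qed
      then obtain n where n: "n \<in> carrier N" "(i x, \<zero>\<^bsub>E'\<^esub>) = ?h n \<oplus>\<^bsub>P\<^esub> (i y, \<zero>\<^bsub>E'\<^esub>)"
        unfolding P.coset_mem_iff A_im by blast
      then have 1: "i x = i n \<oplus>\<^bsub>E\<^esub> i y" "i' (\<ominus>\<^bsub>N\<^esub> n) = i' \<zero>\<^bsub>N\<^esub>" using ic i0 by (auto simp: sel)
      have "\<ominus>\<^bsub>N\<^esub> n = \<zero>\<^bsub>N\<^esub>" using inj_onD[OF e'(4) 1(2)] n(1) by simp
      then have "n = \<zero>\<^bsub>N\<^esub>" using N.M.r_neg[OF n(1)] N.M.r_zero[OF n(1)] by simp
      then show "x = y" using 1(1) i0 ic xy inj_onD[OF e(4)] by simp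
    qed
    show "?i ` carrier N = {C \<in> carrier ?Q. ?p C = \<zero>\<^bsub>M\<^esub>}"
    proof
      show "?i ` carrier N \<subseteq> {C \<in> carrier ?Q. ?p C = \<zero>\<^bsub>M\<^esub>}"
        using inP pc pi0 unfolding Qc by auto
      show "{C \<in> carrier ?Q. ?p C = \<zero>\<^bsub>M\<^esub>} \<subseteq> ?i ` carrier N"
      proof
        fix C assume C: "C \<in> {C \<in> carrier ?Q. ?p C = \<zero>\<^bsub>M\<^esub>}"
        then obtain x where x: "x \<in> carrier P" "C = ?c x" using Qex by blast
        have x': "fst x \<in> carrier E" "snd x \<in> carrier E'" "p (fst x) = \<zero>\<^bsub>M\<^esub>" "p' (snd x) = \<zero>\<^bsub>M\<^esub>"
          using C x pc[OF x(1)] by (auto simp: sel)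
        have "fst x \<in> i ` carrier N" "snd x \<in> i' ` carrier N" unfolding e(5) e'(5) using x' by auto
        then obtain n n' where n: "n \<in> carrier N" "fst x = i n" "n' \<in> carrier N" "snd x = i' n'" by blast
        have nn: "n \<oplus>\<^bsub>N\<^esub> n' \<in> carrier N" using n by simp
        have "x = ?h (\<ominus>\<^bsub>N\<^esub> n') \<oplus>\<^bsub>P\<^esub> (i (n \<oplus>\<^bsub>N\<^esub> n'), \<zero>\<^bsub>E'\<^esub>)"
        proof -
          have "i (\<ominus>\<^bsub>N\<^esub> n') \<oplus>\<^bsub>E\<^esub> i (n \<oplus>\<^bsub>N\<^esub> n') = i n"
            using n linear_onD(2)[OF e(2), of "\<ominus>\<^bsub>N\<^esub> n'" "n \<oplus>\<^bsub>N\<^esub> n'"] N.M.a_comm[of n n'] N.M.r_neg1[of n' n] N.M.r_neg2[of n' n]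
            by simp
          then show ?thesis using n ic by (cases x) (simp add: sel)
        qed
        from cong[OF _ inP[OF nn] this] n show "C \<in> ?i ` carrier N" unfolding x(2) using nn by auto
      qed
    qed
    show "?p ` carrier ?Q = carrier M"
    proof
      show "?p ` carrier ?Q \<subseteq> carrier M" using linear_onD(1)[OF plin] by blast
      show "carrier M \<subseteq> ?p ` carrier ?Q"
      proof
        fix m assume "m \<in> carrier M"
        then have "m \<in> p ` carrier E" "m \<in> p' ` carrier E'" using e(6) e'(6) by auto
        then obtain y y' where y: "y \<in> carrier E" "m = p y" "y' \<in> carrier E'" "m = p' y'"
          by (elim imageE)
        then have yP: "(y, y') \<in> carrier P" by (simp add: sel)
        show "m \<in> ?p ` carrier ?Q"
          unfolding Qc by (rule image_eqI[OF _ imageI[OF yP]]) (simp only: pc[OF yP] y(2) fst_conv)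
      qed
    qed
  qed
  have lc: "l u \<in> carrier E" "l' u \<in> carrier E'" if "u \<in> carrier Fr" for u
    using linear_onD(1)[OF l(1) that] linear_onD(1)[OF l'(1) that] by auto
  have llc: "(l u, l' u) \<in> carrier P" if "u \<in> carrier Fr" for u using lc[OF that] l(2)[OF that] l'(2)[OF that] by (simp add: sel)
  have ll: "linear_on R Fr (carrier Fr) P (\<lambda>f. (l f, l' f))"
    by (rule linear_onI)
       (simp_all only: llc, simp_all add: sel linear_onD(2,3)[OF l(1)] linear_onD(2,3)[OF l'(1)] del: M.R.free_module_sel)
  show "classified (\<phi> \<oplus>\<^bsub>H\<^esub> \<psi>) (baer_sum N s t)"
    unfolding es classified_def
  proof (simp only: prod.case, intro exI[of _ "\<lambda>f. ?c (l f, l' f)"] conjI ballI)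
    show "linear_on R Fr (carrier Fr) ?Q (\<lambda>f. ?c (l f, l' f))"
      using linear_on_comp[OF ll Q(2)] llc by (auto simp: comp_def)
    show "?p (?c (l u, l' u)) = \<pi> u" if "u \<in> carrier Fr" for u
      using pc[OF llc[OF that]] l(2)[OF that] by simp
    fix k assume k: "k \<in> K"
    have c: "\<phi> k \<in> carrier N" "\<psi> k \<in> carrier N" using H_closed \<phi> \<psi> by auto
    have "i (\<ominus>\<^bsub>N\<^esub> \<psi> k) \<oplus>\<^bsub>E\<^esub> i (\<phi> k \<oplus>\<^bsub>N\<^esub> \<psi> k) = i (\<phi> k)"
      using c linear_onD(2)[OF e(2), of "\<ominus>\<^bsub>N\<^esub> \<psi> k" "\<phi> k \<oplus>\<^bsub>N\<^esub> \<psi> k"] N.M.a_comm[of "\<phi> k" "\<psi> k"]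
        N.M.r_neg1[of "\<psi> k" "\<phi> k"] N.M.r_neg2[of "\<psi> k" "\<phi> k"] by simp
    then have "(l k, l' k) = ?h (\<ominus>\<^bsub>N\<^esub> \<psi> k) \<oplus>\<^bsub>P\<^esub> (i (\<phi> k \<oplus>\<^bsub>N\<^esub> \<psi> k), \<zero>\<^bsub>E'\<^esub>)"
      using l(3)[OF k] l'(3)[OF k] ic c by (simp add: sel)
    from cong[OF _ _ this] inP[of "\<phi> k \<oplus>\<^bsub>N\<^esub> \<psi> k"] c
    show "?c (l k, l' k) = ?c (i ((\<phi> \<oplus>\<^bsub>H\<^esub> \<psi>) k), \<zero>\<^bsub>E'\<^esub>)" by simp
  qed
qed

lemma split_classified:
  shows "extension R M N (split_ext M N)" "classified \<zero>\<^bsub>H\<^esub> (split_ext M N)"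
proof -
  interpret NM: module_pair R N M by (intro module_pairI N.module_axioms M.module_axioms)
  show "extension R M N (split_ext M N)"
    unfolding split_ext_def
  proof (rule extensionI[OF NM.prod_module_module])
    show "snd ` carrier (prod_module N M) = carrier M" using N.M.zero_closed by force
  qed (auto simp: inj_on_def intro!: linear_onI)
  show "classified \<zero>\<^bsub>H\<^esub> (split_ext M N)"
    unfolding split_ext_def classified_def
    by (simp only: prod.case, intro exI[of _ "\<lambda>f. (\<zero>\<^bsub>N\<^esub>, \<pi> f)"] conjI ballI linear_onI)
       (simp_all add: linear_onD[OF \<pi>] K_iff del: M.R.free_module_sel)
qed

lemma \<Phi>_elt:
  assumes "\<phi> \<in> carrier H" shows "\<exists>t. t \<in> \<Phi> \<phi>"
  using realization[OF assms] by (auto simp: \<Phi>_def)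

lemma Ext1_sel:
  "carrier (Ext1 R M N) = ext_class R M N ` {s :: ('a, 'c, 'e, 'e \<times> 'c) extn. extension R M N s}"
  "ring.zero (Ext1 R M N) = ext_class R M N (split_ext M N)"
  "ring.add (Ext1 R M N) = (\<lambda>B C. \<Union>s\<in>B. \<Union>t\<in>C. ext_class R M N (baer_sum N s t))"
  "smult (Ext1 R M N) = (\<lambda>a B. \<Union>s\<in>B. ext_class R M N (ext_smult M a s))"
  by (simp_all add: Ext1_def)

text \<open>The operations of the Ext module are computed on representatives, so that the map from
  \<open>Hom(K, N)\<close> is additive and linear by the previous results; being surjective, it carries the module axioms
  over.\<close>

theorem Ext1_module:
  "module R (Ext1 R M N)" "linear_on R H (carrier H) (Ext1 R M N) \<Phi>" "\<Phi> ` carrier H = carrier (Ext1 R M N)"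
proof -
  show im: "\<Phi> ` carrier H = carrier (Ext1 R M N)"
  proof
    show "\<Phi> ` carrier H \<subseteq> carrier (Ext1 R M N)"
    proof (intro image_subsetI)
      fix \<phi> assume \<phi>: "\<phi> \<in> carrier H"
      obtain t where t: "t \<in> \<Phi> \<phi>" using \<Phi>_elt[OF \<phi>] by blast
      then have t': "extension R M N t" "classified \<phi> t" by (auto simp: \<Phi>_def)
      show "\<Phi> \<phi> \<in> carrier (Ext1 R M N)"
        unfolding Ext1_sel
        by (rule image_eqI[of "\<Phi> \<phi>" "ext_class R M N" t]) (simp_all add: t' ext_class_eq[OF t' \<phi>])
    qed
    show "carrier (Ext1 R M N) \<subseteq> \<Phi> ` carrier H"
      unfolding Ext1_sel
    proof (intro image_subsetI)
      fix s :: "('a, 'c, 'e, 'e \<times> 'c) extn" assume "s \<in> {s. extension R M N s}"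
      then have s: "extension R M N s" by simp
      obtain \<phi> where "\<phi> \<in> carrier H" "classified \<phi> s" using classified_exists[OF s] by blast
      then show "ext_class R M N s \<in> \<Phi> ` carrier H" using ext_class_eq[OF s] by blast
    qed
  qed
  have zero: "\<Phi> \<zero>\<^bsub>H\<^esub> = \<zero>\<^bsub>Ext1 R M N\<^esub>"
    unfolding Ext1_sel using ext_class_eq[OF split_classified H.M.zero_closed] by simp
  have add: "\<Phi> \<phi> \<oplus>\<^bsub>Ext1 R M N\<^esub> \<Phi> \<psi> = \<Phi> (\<phi> \<oplus>\<^bsub>H\<^esub> \<psi>)" if \<phi>: "\<phi> \<in> carrier H" and \<psi>: "\<psi> \<in> carrier H" for \<phi> \<psi>
  proof -
    have c: "ext_class R M N (baer_sum N s t) = \<Phi> (\<phi> \<oplus>\<^bsub>H\<^esub> \<psi>)" if "s \<in> \<Phi> \<phi>" "t \<in> \<Phi> \<psi>" for s t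
    proof -
      have st: "extension R M N s" "classified \<phi> s" "extension R M N t" "classified \<psi> t"
        using that by (auto simp: \<Phi>_def)
      note b = baer_sum_classified[OF st \<phi> \<psi>]
      show ?thesis by (rule ext_class_eq[OF b H.M.a_closed[OF \<phi> \<psi>]])
    qed
    have ne: "\<Phi> \<phi> \<noteq> {}" "\<Phi> \<psi> \<noteq> {}" using \<Phi>_elt[OF \<phi>] \<Phi>_elt[OF \<psi>] by blast+
    show ?thesis
      unfolding Ext1_sel by (rule SUP_eq_const[OF ne(1)], rule SUP_eq_const[OF ne(2)]) (rule c)
  qed
  have smult: "a \<odot>\<^bsub>Ext1 R M N\<^esub> \<Phi> \<phi> = \<Phi> (a \<odot>\<^bsub>H\<^esub> \<phi>)" if a: "a \<in> carrier R" and \<phi>: "\<phi> \<in> carrier H" for a \<phi>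
  proof -
    have c: "ext_class R M N (ext_smult M a s) = \<Phi> (a \<odot>\<^bsub>H\<^esub> \<phi>)" if "s \<in> \<Phi> \<phi>" for s
    proof -
      have s: "extension R M N s" "classified \<phi> s" using that by (auto simp: \<Phi>_def)
      note b = smult_classified[OF s \<phi> a]
      show ?thesis by (rule ext_class_eq[OF b H.smult_closed[OF a \<phi>]])
    qed
    have ne: "\<Phi> \<phi> \<noteq> {}" using \<Phi>_elt[OF \<phi>] by blast
    show ?thesis unfolding Ext1_sel by (rule SUP_eq_const[OF ne]) (rule c)
  qed
  show "module R (Ext1 R M N)"
    by (rule surjective_image_module[where f = \<Phi> and M = H])
       (simp_all only: H_module im zero add smult)
  show "linear_on R H (carrier H) (Ext1 R M N) \<Phi>"
    by (rule linear_onI) (use im in blast, simp_all only: add smult)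
qed

end

section \<open>The defect of additivity of Tor lengths along an extension\<close>

context module_pair
begin

lemma
  shows fst_linear: "linear_on R (prod_module M N) (carrier (prod_module M N)) M fst"
    and snd_linear: "linear_on R (prod_module M N) (carrier (prod_module M N)) N snd"
    and inl_linear: "linear_on R M (carrier M) (prod_module M N) (\<lambda>x. (x, \<zero>\<^bsub>N\<^esub>))"
    and inr_linear: "linear_on R N (carrier N) (prod_module M N) (\<lambda>y. (\<zero>\<^bsub>M\<^esub>, y))"
  by (rule linear_onI; auto)+

lemma sprod_prod_iff:
  assumes I: "I \<subseteq> carrier R"
  shows "x \<in> sprod R (prod_module M N) I (carrier (prod_module M N)) \<longleftrightarrow>
    fst x \<in> sprod R M I (carrier M) \<and> snd x \<in> sprod R N I (carrier N)"
proof -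
  interpret P: module R "prod_module M N" by (rule prod_module_module)
  interpret PM: module_pair R "prod_module M N" M by (intro module_pairI prod_module_module M.module_axioms)
  interpret PN: module_pair R "prod_module M N" N by (intro module_pairI prod_module_module N.module_axioms)
  interpret MP: module_pair R M "prod_module M N" by (intro module_pairI prod_module_module M.module_axioms)
  interpret NP: module_pair R N "prod_module M N" by (intro module_pairI prod_module_module N.module_axioms)
  let ?S = "sprod R (prod_module M N) I (carrier (prod_module M N))"
  have S: "submodule ?S R (prod_module M N)" by (rule P.sprod_submodule[OF I]) simp
  have SM: "submodule (sprod R M I (carrier M)) R M" by (rule M.sprod_submodule[OF I order_refl])
  have SN: "submodule (sprod R N I (carrier N)) R N" by (rule N.sprod_submodule[OF I order_refl])
  have 1: "fst ` ?S \<subseteq> sprod R M I (carrier M)" "snd ` ?S \<subseteq> sprod R N I (carrier N)"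
    by (rule PM.sprod_image[OF I P.carrier_is_submodule fst_linear M.carrier_is_submodule], force)
       (rule PN.sprod_image[OF I P.carrier_is_submodule snd_linear N.carrier_is_submodule], force)
  have 2: "(\<lambda>x. (x, \<zero>\<^bsub>N\<^esub>)) ` sprod R M I (carrier M) \<subseteq> ?S" "(\<lambda>y. (\<zero>\<^bsub>M\<^esub>, y)) ` sprod R N I (carrier N) \<subseteq> ?S"
    by (rule MP.sprod_image[OF I M.carrier_is_submodule inl_linear P.carrier_is_submodule], force)
       (rule NP.sprod_image[OF I N.carrier_is_submodule inr_linear P.carrier_is_submodule], force)
  show ?thesis
  proof
    assume "x \<in> ?S" then show "fst x \<in> sprod R M I (carrier M) \<and> snd x \<in> sprod R N I (carrier N)"
      using 1 by blast
  next
    assume x: "fst x \<in> sprod R M I (carrier M) \<and> snd x \<in> sprod R N I (carrier N)"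
    then have "(fst x, \<zero>\<^bsub>N\<^esub>) \<in> ?S" "(\<zero>\<^bsub>M\<^esub>, snd x) \<in> ?S" using 2 by blast+
    then have "(fst x, \<zero>\<^bsub>N\<^esub>) \<oplus>\<^bsub>prod_module M N\<^esub> (\<zero>\<^bsub>M\<^esub>, snd x) \<in> ?S" by (rule P.sub_add[OF S])
    moreover have "fst x \<in> carrier M" "snd x \<in> carrier N" using x M.sub_carr[OF SM] N.sub_carr[OF SN] by auto
    ultimately show "x \<in> ?S" by simp
  qed
qed

end

locale tsplit_setup = ext_setup R M N B \<pi>
  for R :: "('a, 'r) ring_scheme" (structure) and M :: "('a, 'c, 'm) module_scheme"
    and N :: "('a, 'e, 'n) module_scheme" and B :: "'x set" and \<pi> :: "('x \<Rightarrow> 'a) \<Rightarrow> 'c" +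
  fixes C :: "'y set" and \<rho>
  assumes \<rho>: "linear_on R (free_module R C) (carrier (free_module R C)) N \<rho>"
    and \<rho>_surj: "\<rho> ` carrier (free_module R C) = carrier N"
begin

abbreviation Fn :: "('a, 'y \<Rightarrow> 'a) module" where "Fn \<equiv> free_module R C"

abbreviation G :: "('a, ('y \<Rightarrow> 'a) \<times> ('x \<Rightarrow> 'a)) module" where "G \<equiv> prod_module Fn Fr"

lemma Fn: "module R Fn" by (rule M.R.free_module_module)

sublocale Fn: module R Fn by (rule Fn)

sublocale NN: module_pair R Fn N by (intro module_pairI Fn N.module_axioms)

sublocale FF: module_pair R Fn Fr by (intro module_pairI Fn Fr)

lemma G: "module R G" by (rule FF.prod_module_module)

sublocale G: module R G by (rule G)

sublocale GF: module_pair R G Fr by (intro module_pairI G Fr)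

sublocale GN: module_pair R G Fn by (intro module_pairI G Fn)

sublocale FG: module_pair R Fn G by (intro module_pairI Fn G)

definition KN :: "('y \<Rightarrow> 'a) set" where "KN = a_kernel Fn N \<rho>"

definition KE :: "(('x \<Rightarrow> 'a) \<Rightarrow> 'e) \<Rightarrow> (('y \<Rightarrow> 'a) \<times> ('x \<Rightarrow> 'a)) set"
  where "KE \<phi> = {x \<in> carrier G. snd x \<in> K \<and> \<rho> (fst x) = \<ominus>\<^bsub>N\<^esub> \<phi> (snd x)}"

lemma KN: "submodule KN R Fn" and KN_iff: "x \<in> KN \<longleftrightarrow> x \<in> carrier Fn \<and> \<rho> x = \<zero>\<^bsub>N\<^esub>"
  using kernel_submodule[OF Fn N.module_axioms \<rho>] by (auto simp: KN_def)

lemma \<phi>0: "\<phi> \<in> carrier H \<Longrightarrow> \<phi> \<zero>\<^bsub>Fr\<^esub> = \<zero>\<^bsub>N\<^esub>"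
  by (rule FN.lin_zero[OF K H_lin])

lemma \<rho>0: "\<rho> \<zero>\<^bsub>Fn\<^esub> = \<zero>\<^bsub>N\<^esub>"
  by (rule NN.lin_zero[OF Fn.carrier_is_submodule \<rho>])

lemma neg_zero [simp]: "\<ominus>\<^bsub>N\<^esub> \<zero>\<^bsub>N\<^esub> = \<zero>\<^bsub>N\<^esub>"
  using N.M.minus_equality[of "\<zero>\<^bsub>N\<^esub>" "\<zero>\<^bsub>N\<^esub>"] by simp

lemma KE_submodule:
  assumes \<phi>: "\<phi> \<in> carrier H" shows "submodule (KE \<phi>) R G"
proof (rule G.submoduleI')
  show "KE \<phi> \<subseteq> carrier G" by (auto simp: KE_def)
  show "\<zero>\<^bsub>G\<^esub> \<in> KE \<phi>"
    using Fr.M.zero_closed Fn.M.zero_closed Fr.sub_zero[OF K] \<phi>0[OF \<phi>] \<rho>0 neg_zero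
    by (simp add: KE_def del: M.R.free_module_sel)
next
  fix x y assume xy: "x \<in> KE \<phi>" "y \<in> KE \<phi>"
  then have k: "snd x \<in> K" "snd y \<in> K" "fst x \<in> carrier Fn" "fst y \<in> carrier Fn"
    "\<rho> (fst x) = \<ominus>\<^bsub>N\<^esub> \<phi> (snd x)" "\<rho> (fst y) = \<ominus>\<^bsub>N\<^esub> \<phi> (snd y)" by (auto simp: KE_def)
  have "\<rho> (fst x \<oplus>\<^bsub>Fn\<^esub> fst y) = \<ominus>\<^bsub>N\<^esub> \<phi> (snd x \<oplus>\<^bsub>Fr\<^esub> snd y)"
    unfolding linear_onD(2)[OF \<rho> k(3,4)] linear_onD(2)[OF H_lin[OF \<phi>] k(1,2)]
    using k H_closed[OF \<phi>] by (simp add: N.M.minus_add)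
  then show "x \<oplus>\<^bsub>G\<^esub> y \<in> KE \<phi>"
    using Fr.sub_add[OF K k(1,2)] K_carr Fn.M.a_closed[OF k(3,4)] by (simp add: KE_def del: M.R.free_module_sel)
next
  fix a x assume a: "a \<in> carrier R" and x: "x \<in> KE \<phi>"
  then have k: "snd x \<in> K" "fst x \<in> carrier Fn" "\<rho> (fst x) = \<ominus>\<^bsub>N\<^esub> \<phi> (snd x)" by (auto simp: KE_def)
  have "\<rho> (a \<odot>\<^bsub>Fn\<^esub> fst x) = \<ominus>\<^bsub>N\<^esub> \<phi> (a \<odot>\<^bsub>Fr\<^esub> snd x)"
    unfolding linear_onD(3)[OF \<rho> a k(2)] linear_onD(3)[OF H_lin[OF \<phi>] a k(1)]
    using k a H_closed[OF \<phi>] by (simp add: N.smult_r_minus)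
  then show "a \<odot>\<^bsub>G\<^esub> x \<in> KE \<phi>"
    using Fr.sub_smult[OF K a k(1)] K_carr Fn.smult_closed[OF a k(2)] by (simp add: KE_def del: M.R.free_module_sel)
qed

lemma KE_lift:
  assumes "\<phi> \<in> carrier H" "k \<in> K" shows "\<exists>g. (g, k) \<in> KE \<phi>"
proof -
  have "\<ominus>\<^bsub>N\<^esub> \<phi> k \<in> \<rho> ` carrier Fn" unfolding \<rho>_surj using H_closed[OF assms(1)] by simp
  then obtain g where "g \<in> carrier Fn" "\<rho> g = \<ominus>\<^bsub>N\<^esub> \<phi> k" by (metis imageE)
  then show ?thesis using assms(2) K_carr by (auto simp: KE_def)
qed

text \<open>Composing \<open>N \<oplus> Fr \<rightarrow> E\<close> with the presentation of \<open>N\<close> presents the middle term of any extension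
  classified by \<open>\<phi>\<close> by \<open>Fn \<oplus> Fr\<close> with kernel \<open>KE \<phi>\<close>, so the length of its Tor module depends on \<open>\<phi>\<close>
  only.\<close>

lemma tor_length_middle:
  assumes s: "extension R M N (i, E, p)" "classified \<phi> (i, E, p)" and \<phi>: "\<phi> \<in> carrier H" and I: "ideal I R"
  shows "mod_length R (Tor1 R E (quot_module (self_module R) I)) = tor_length R G (KE \<phi>) I"
proof -
  note e = extensionD[OF s(1)]
  interpret E: module R E by (rule e(1))
  obtain l where l: "linear_on R Fr (carrier Fr) E l" "\<And>u. u \<in> carrier Fr \<Longrightarrow> p (l u) = \<pi> u"
    "\<And>k. k \<in> K \<Longrightarrow> l k = i (\<phi> k)" using s(2) unfolding classified_def by auto
  note w = middle_presentation[OF s(1) l \<phi>]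
  let ?w = "\<lambda>(n, f). i n \<oplus>\<^bsub>E\<^esub> l f"
  define r where "r x = (\<rho> (fst x), snd x)" for x :: "('y \<Rightarrow> 'a) \<times> ('x \<Rightarrow> 'a)"
  define v where "v = ?w \<circ> r"
  have \<rho>c: "\<rho> g \<in> carrier N" if "g \<in> carrier Fn" for g by (rule linear_onD(1)[OF \<rho> that])
  have ic: "i n \<in> carrier E" if "n \<in> carrier N" for n using linear_onD(1)[OF e(2) that] .
  have lc: "l f \<in> carrier E" if "f \<in> carrier Fr" for f using linear_onD(1)[OF l(1) that] .
  have r: "linear_on R G (carrier G) (prod_module N Fr) r"
    by (rule linear_onI) (auto simp: r_def \<rho>c linear_onD(2,3)[OF \<rho>] Fr.M.a_closed Fr.smult_closed simp del: M.R.free_module_sel)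
  have rc: "r ` carrier G = carrier (prod_module N Fr)"
  proof
    show "r ` carrier G \<subseteq> carrier (prod_module N Fr)" using linear_onD(1)[OF r] by blast
    show "carrier (prod_module N Fr) \<subseteq> r ` carrier G"
    proof
      fix x assume "x \<in> carrier (prod_module N Fr)"
      then obtain n f where nf: "x = (n, f)" "n \<in> \<rho> ` carrier Fn" "f \<in> carrier Fr" using \<rho>_surj by auto
      then obtain g where "g \<in> carrier Fn" "n = \<rho> g" by blast
      then show "x \<in> r ` carrier G" using nf by (intro image_eqI[of _ _ "(g, f)"]) (auto simp: r_def)
    qed
  qed
  have v: "linear_on R G (carrier G) E v" unfolding v_def by (rule linear_on_comp[OF r w(1)]) (assumption | rule equalityD1[OF rc])+
  have vs: "v ` carrier G = carrier E" unfolding v_def image_comp[symmetric] rc by (rule w(2))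
  have ker: "a_kernel G E v = KE \<phi>"
  proof -
    have "v x = \<zero>\<^bsub>E\<^esub> \<longleftrightarrow> snd x \<in> K \<and> \<rho> (fst x) = \<ominus>\<^bsub>N\<^esub> \<phi> (snd x)" if "x \<in> carrier G" for x
      using w(3)[of "\<rho> (fst x)" "snd x"] that \<rho>c by (auto simp: v_def r_def)
    then show ?thesis unfolding kernel_submodule(2)[OF G e(1) v] KE_def by auto
  qed
  let ?F = "free_module R (carrier E)" and ?q = "free_lift R E id"
  have Fm: "module R ?F" by (rule M.R.free_module_module)
  interpret F: module R ?F by (rule Fm)
  \<comment> \<open>comparison maps between \<open>G\<close> and the free cover of \<open>E\<close> that defines Tor, from projectivity\<close>
  obtain b where b: "linear_on R ?F (carrier ?F) G b" "\<And>u. u \<in> carrier ?F \<Longrightarrow> v (b u) = ?q u"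
    using M.R.free_projective[OF G e(1) v vs E.free_cover_map] by blast
  have v1: "linear_on R Fn (carrier Fn) E (\<lambda>g. i (\<rho> g))"
    using linear_on_comp[OF \<rho> e(2)] \<rho>_surj by (simp add: comp_def)
  obtain a1 where a1: "linear_on R Fn (carrier Fn) ?F a1" "\<And>u. u \<in> carrier Fn \<Longrightarrow> ?q (a1 u) = i (\<rho> u)"
    using M.R.free_projective[OF Fm e(1) E.free_cover_map E.free_cover_surj v1] by blast
  obtain a2 where a2: "linear_on R Fr (carrier Fr) ?F a2" "\<And>u. u \<in> carrier Fr \<Longrightarrow> ?q (a2 u) = l u"
    using M.R.free_projective[OF Fm e(1) E.free_cover_map E.free_cover_surj l(1)] by blast
  define a where "a x = a1 (fst x) \<oplus>\<^bsub>?F\<^esub> a2 (snd x)" for x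
  have ac: "a1 g \<in> carrier ?F" "a2 f \<in> carrier ?F" if "g \<in> carrier Fn" "f \<in> carrier Fr" for g f
    using linear_onD(1)[OF a1(1) that(1)] linear_onD(1)[OF a2(1) that(2)] by auto
  have a: "linear_on R G (carrier G) ?F a"
  proof (rule linear_onI)
    fix x y assume x: "x \<in> carrier G" and y: "y \<in> carrier G"
    have c: "fst x \<in> carrier Fn" "snd x \<in> carrier Fr" "fst y \<in> carrier Fn" "snd y \<in> carrier Fr" using x y by auto
    show "a x \<in> carrier ?F" unfolding a_def by (rule F.M.a_closed[OF ac[OF c(1,2)]])
    have "a (x \<oplus>\<^bsub>G\<^esub> y) = (a1 (fst x) \<oplus>\<^bsub>?F\<^esub> a1 (fst y)) \<oplus>\<^bsub>?F\<^esub> (a2 (snd x) \<oplus>\<^bsub>?F\<^esub> a2 (snd y))"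
      unfolding a_def prod_module_sel fst_conv snd_conv linear_onD(2)[OF a1(1) c(1,3)] linear_onD(2)[OF a2(1) c(2,4)] ..
    then show "a (x \<oplus>\<^bsub>G\<^esub> y) = a x \<oplus>\<^bsub>?F\<^esub> a y"
      using ac[OF c(1,2)] ac[OF c(3,4)] by (simp add: a_def F.M.a_ac del: M.R.free_module_sel)
    fix c assume "c \<in> carrier R"
    then show "a (c \<odot>\<^bsub>G\<^esub> x) = c \<odot>\<^bsub>?F\<^esub> a x"
      using ac[OF c(1,2)] linear_onD(3)[OF a1(1)] linear_onD(3)[OF a2(1)] c
      by (simp add: a_def F.smult_r_distr del: M.R.free_module_sel)
  qed
  have qa: "?q (a x) = v x" if x: "x \<in> carrier G" for x
  proof -
    have c: "fst x \<in> carrier Fn" "snd x \<in> carrier Fr" using x by auto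
    show ?thesis unfolding a_def linear_onD(2)[OF E.free_cover_map ac[OF c]] a1(2)[OF c(1)] a2(2)[OF c(2)]
      by (simp add: v_def r_def)
  qed
  have "tor_length R ?F (a_kernel ?F E ?q) I = tor_length R G (a_kernel G E v) I"
    by (rule tor_length_eq[where a = b and b = a]; fact I Fm G e(1) E.free_cover_map v b a qa)
  then show ?thesis using E.mod_length_Tor1[OF I] ker by simp
qed

text \<open>The images of the two connecting maps in the long exact sequence of an extension classified by \<open>\<phi>\<close>:
  the kernel of \<open>Tor(N) \<rightarrow> Tor(E)\<close>, which is the image of \<open>Tor\<^sub>2(M)\<close>, is \<open>J \<phi> I / I KN\<close>, and the
  cokernel of \<open>Tor(E) \<rightarrow> Tor(M)\<close>, which is isomorphic to the image of \<open>Tor(M)\<close> in \<open>N/IN\<close>, is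
  \<open>(K \<inter> I Fr) / Z \<phi> I\<close>.\<close>

definition J :: "(('x \<Rightarrow> 'a) \<Rightarrow> 'e) \<Rightarrow> 'a set \<Rightarrow> ('y \<Rightarrow> 'a) set"
  where "J \<phi> I = {g \<in> carrier Fn. (g, \<zero>\<^bsub>Fr\<^esub>) \<in> sprod R G I (KE \<phi>)}"

definition Z :: "(('x \<Rightarrow> 'a) \<Rightarrow> 'e) \<Rightarrow> 'a set \<Rightarrow> ('x \<Rightarrow> 'a) set"
  where "Z \<phi> I = {f \<in> K. \<phi> f \<in> sprod R N I (carrier N)} \<inter> sprod R Fr I (carrier Fr)"

definition defect :: "(('x \<Rightarrow> 'a) \<Rightarrow> 'e) \<Rightarrow> 'a set \<Rightarrow> enat"
  where "defect \<phi> I = ilen R Fn (sprod R Fn I KN) (J \<phi> I) +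
    ilen R Fr (Z \<phi> I) (K \<inter> sprod R Fr I (carrier Fr))"

context
  fixes I assumes I: "I \<subseteq> carrier R"
begin

lemma IKE: "\<phi> \<in> carrier H \<Longrightarrow> submodule (sprod R G I (KE \<phi>)) R G"
  using G.sub_carr[OF KE_submodule] by (intro G.sprod_submodule I) blast

lemma IG: "submodule (sprod R G I (carrier G)) R G" by (rule G.sprod_submodule[OF I order_refl])

lemma IFr: "submodule (sprod R Fr I (carrier Fr)) R Fr" by (rule Fr.sprod_submodule[OF I order_refl])

lemma IFn: "submodule (sprod R Fn I (carrier Fn)) R Fn" by (rule Fn.sprod_submodule[OF I order_refl])

lemma IN: "submodule (sprod R N I (carrier N)) R N" by (rule N.sprod_submodule[OF I order_refl])

lemma IK: "submodule (sprod R Fr I K) R Fr" using K_carr by (intro Fr.sprod_submodule I) blast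

lemma IKN: "submodule (sprod R Fn I KN) R Fn" using Fn.sub_carr[OF KN] by (intro Fn.sprod_submodule I) blast

lemma top_M: "submodule (K \<inter> sprod R Fr I (carrier Fr)) R Fr" by (rule Fr.Int_submodule[OF K IFr])

lemma top_N: "submodule (KN \<inter> sprod R Fn I (carrier Fn)) R Fn" by (rule Fn.Int_submodule[OF KN IFn])

lemma Z_submodule: "\<phi> \<in> carrier H \<Longrightarrow> submodule (Z \<phi> I) R Fr"
  unfolding Z_def by (intro Fr.Int_submodule FN.vimage_submodule[OF K H_lin IN] IFr)

lemma Z_top: "Z \<phi> I \<subseteq> K \<inter> sprod R Fr I (carrier Fr)" by (auto simp: Z_def)

lemma IK_Z: assumes \<phi>: "\<phi> \<in> carrier H" shows "sprod R Fr I K \<subseteq> Z \<phi> I"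
proof (rule Fr.sprod_least[OF Z_submodule[OF \<phi>]])
  fix a k assume a: "a \<in> I" and k: "k \<in> K"
  have ac: "a \<in> carrier R" using a I by blast
  have "\<phi> (a \<odot>\<^bsub>Fr\<^esub> k) = a \<odot>\<^bsub>N\<^esub> \<phi> k" by (rule linear_onD(3)[OF H_lin[OF \<phi>] ac k])
  then show "a \<odot>\<^bsub>Fr\<^esub> k \<in> Z \<phi> I"
    using N.sprod_memI[OF a, of "\<phi> k" "carrier N"] Fr.sprod_memI[OF a K_carr[OF k]] Fr.sub_smult[OF K ac k] H_closed[OF \<phi>]
    by (simp add: Z_def del: M.R.free_module_sel)
qed

lemma J_submodule: assumes \<phi>: "\<phi> \<in> carrier H" shows "submodule (J \<phi> I) R Fn"
  unfolding J_def by (rule FG.vimage_submodule[OF Fn.carrier_is_submodule FF.inl_linear IKE[OF \<phi>]])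

lemma J_top: assumes \<phi>: "\<phi> \<in> carrier H" shows "J \<phi> I \<subseteq> KN \<inter> sprod R Fn I (carrier Fn)"
proof
  fix g assume g: "g \<in> J \<phi> I"
  have "(g, \<zero>\<^bsub>Fr\<^esub>) \<in> KE \<phi>" "(g, \<zero>\<^bsub>Fr\<^esub>) \<in> sprod R G I (carrier G)"
    using g G.sprod_sub[OF I KE_submodule[OF \<phi>]] G.sprod_mono[OF order_refl, of "KE \<phi>" "carrier G" I]
      G.sub_carr[OF KE_submodule[OF \<phi>]] unfolding J_def by blast+
  then show "g \<in> KN \<inter> sprod R Fn I (carrier Fn)"
    using FF.sprod_prod_iff[OF I, of "(g, \<zero>\<^bsub>Fr\<^esub>)"] \<phi>0[OF \<phi>] neg_zero
    by (simp add: KE_def KN_iff del: M.R.free_module_sel)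
qed

lemma inl_KE: assumes \<phi>: "\<phi> \<in> carrier H" shows "(\<lambda>g. (g, \<zero>\<^bsub>Fr\<^esub>)) ` KN \<subseteq> KE \<phi>"
  using Fr.sub_zero[OF K] Fr.M.zero_closed \<phi>0[OF \<phi>] neg_zero by (auto simp: KE_def KN_iff simp del: M.R.free_module_sel)

lemma IKN_J: assumes \<phi>: "\<phi> \<in> carrier H" shows "sprod R Fn I KN \<subseteq> J \<phi> I"
  using FG.sprod_image[OF I KN FF.inl_linear KE_submodule[OF \<phi>] inl_KE[OF \<phi>]] Fn.sub_carr[OF IKN]
  unfolding J_def by blast

lemma snd_IKE: assumes \<phi>: "\<phi> \<in> carrier H" shows "snd ` sprod R G I (KE \<phi>) = sprod R Fr I K"
proof
  show "snd ` sprod R G I (KE \<phi>) \<subseteq> sprod R Fr I K"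
    by (rule GF.sprod_image[OF I KE_submodule[OF \<phi>] FF.snd_linear K]) (auto simp: KE_def)
  have im: "submodule (snd ` sprod R G I (KE \<phi>)) R Fr"
    by (rule GF.image_submodule[OF G.carrier_is_submodule FF.snd_linear IKE[OF \<phi>]]) (use G.sub_carr[OF IKE[OF \<phi>]] in blast)
  show "sprod R Fr I K \<subseteq> snd ` sprod R G I (KE \<phi>)"
  proof (rule Fr.sprod_least[OF im])
    fix a k assume a: "a \<in> I" and k: "k \<in> K"
    obtain g where "(g, k) \<in> KE \<phi>" using KE_lift[OF \<phi> k] by blast
    then have "a \<odot>\<^bsub>G\<^esub> (g, k) \<in> sprod R G I (KE \<phi>)" by (rule G.sprod_memI[OF a])
    then have "snd (a \<odot>\<^bsub>G\<^esub> (g, k)) \<in> snd ` sprod R G I (KE \<phi>)" by (rule imageI)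
    then show "a \<odot>\<^bsub>Fr\<^esub> k \<in> snd ` sprod R G I (KE \<phi>)" unfolding prod_module_sel snd_conv .
  qed
qed

text \<open>The kernel \<open>(S + Q) / Q\<close> of \<open>Tor(E) \<rightarrow> Tor(M)\<close> is \<open>Tor(N)\<close> modulo \<open>J\<close>, and its image is \<open>Z / IK\<close>.\<close>

theorem defect_eq:
  assumes \<phi>: "\<phi> \<in> carrier H"
  shows "tor_length R Fn KN I + tor_length R Fr K I = tor_length R G (KE \<phi>) I + defect \<phi> I"
proof -
  let ?TN = "KN \<inter> sprod R Fn I (carrier Fn)" and ?TM = "K \<inter> sprod R Fr I (carrier Fr)"
  let ?Q = "sprod R G I (KE \<phi>)"
  define P where "P = KE \<phi> \<inter> sprod R G I (carrier G)"
  define S where "S = {x \<in> P. snd x \<in> {\<zero>\<^bsub>Fr\<^esub>}}"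
  note Q = IKE[OF \<phi>]
  have P: "submodule P R G" unfolding P_def by (rule G.Int_submodule[OF KE_submodule[OF \<phi>] IG])
  have Pc: "P \<subseteq> carrier G" using G.sub_carr[OF P] by blast
  have sndP: "linear_on R G P Fr snd" by (rule linear_on_subset[OF FF.snd_linear Pc])
  have S: "submodule S R G" unfolding S_def by (rule GF.vimage_submodule[OF P sndP Fr.zero_submodule])
  have QP: "?Q \<subseteq> P"
    unfolding P_def using G.sprod_sub[OF I KE_submodule[OF \<phi>]] G.sprod_mono[OF order_refl, of "KE \<phi>" "carrier G" I]
      G.sub_carr[OF KE_submodule[OF \<phi>]] by blast
  have SQ: "submodule (S <+>\<^bsub>G\<^esub> ?Q) R G" by (rule G.sum_submodule[OF S Q])
  have SQP: "S <+>\<^bsub>G\<^esub> ?Q \<subseteq> P" by (rule G.sum_least[OF P _ QP]) (auto simp: S_def)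
  have inlS: "(\<lambda>g. (g, \<zero>\<^bsub>Fr\<^esub>)) ` ?TN = S"
  proof
    show "(\<lambda>g. (g, \<zero>\<^bsub>Fr\<^esub>)) ` ?TN \<subseteq> S"
    proof (intro image_subsetI)
      fix g assume g: "g \<in> ?TN"
      have "(g, \<zero>\<^bsub>Fr\<^esub>) \<in> KE \<phi>" using inl_KE[OF \<phi>] g by blast
      moreover have "(g, \<zero>\<^bsub>Fr\<^esub>) \<in> sprod R G I (carrier G)"
        unfolding FF.sprod_prod_iff[OF I] using g Fr.sub_zero[OF IFr] by (simp del: M.R.free_module_sel)
      ultimately show "(g, \<zero>\<^bsub>Fr\<^esub>) \<in> S" unfolding S_def P_def by simp
    qed
    show "S \<subseteq> (\<lambda>g. (g, \<zero>\<^bsub>Fr\<^esub>)) ` ?TN"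
    proof
      fix x assume x: "x \<in> S"
      then have 1: "x \<in> KE \<phi>" "x \<in> sprod R G I (carrier G)" "snd x = \<zero>\<^bsub>Fr\<^esub>" unfolding S_def P_def by auto
      have "fst x \<in> ?TN"
        using 1 FF.sprod_prod_iff[OF I, of x] \<phi>0[OF \<phi>] neg_zero
        by (auto simp: KE_def KN_iff simp del: M.R.free_module_sel)
      moreover have "x = (fst x, \<zero>\<^bsub>Fr\<^esub>)" using 1(3) by (metis prod.collapse)
      ultimately show "x \<in> (\<lambda>g. (g, \<zero>\<^bsub>Fr\<^esub>)) ` ?TN" by blast
    qed
  qed
  have "ilen R Fn (J \<phi> I) ?TN = ilen R G ?Q (S <+>\<^bsub>G\<^esub> ?Q)"
  proof (rule FG.ilen_iso[OF top_N SQ J_top[OF \<phi>] Q G.sum_upper2[OF S Q]])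
    show "linear_on R Fn ?TN G (\<lambda>g. (g, \<zero>\<^bsub>Fr\<^esub>))"
      by (rule linear_on_subset[OF FF.inl_linear]) (use Fn.sub_carr[OF top_N] in blast)
    show "(\<lambda>g. (g, \<zero>\<^bsub>Fr\<^esub>)) ` ?TN \<subseteq> S <+>\<^bsub>G\<^esub> ?Q" unfolding inlS by (rule G.sum_upper1[OF S Q])
    show "S <+>\<^bsub>G\<^esub> ?Q \<subseteq> (\<lambda>g. (g, \<zero>\<^bsub>Fr\<^esub>)) ` ?TN <+>\<^bsub>G\<^esub> ?Q" unfolding inlS by (rule order_refl)
    show "((g, \<zero>\<^bsub>Fr\<^esub>) \<in> ?Q) = (g \<in> J \<phi> I)" if "g \<in> ?TN" for g
      using Fn.sub_carr[OF top_N that] unfolding J_def by blast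
  qed
  moreover have "ilen R G (S <+>\<^bsub>G\<^esub> ?Q) P = ilen R Fr (sprod R Fr I K) (Z \<phi> I)"
  proof (rule GF.ilen_iso[OF P Z_submodule[OF \<phi>] SQP IK IK_Z[OF \<phi>] sndP])
    have "snd ` P = Z \<phi> I"
    proof
      show "snd ` P \<subseteq> Z \<phi> I"
      proof (intro image_subsetI)
        fix x assume "x \<in> P"
        then have x: "x \<in> KE \<phi>" "fst x \<in> sprod R Fn I (carrier Fn)" "snd x \<in> sprod R Fr I (carrier Fr)"
          unfolding P_def using FF.sprod_prod_iff[OF I] by auto
        have "\<rho> (fst x) \<in> sprod R N I (carrier N)"
          using NN.sprod_image[OF I Fn.carrier_is_submodule \<rho> N.carrier_is_submodule] \<rho>_surj x(2) by blast
        then have "\<ominus>\<^bsub>N\<^esub> (\<ominus>\<^bsub>N\<^esub> \<phi> (snd x)) \<in> sprod R N I (carrier N)"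
          using x(1) N.sub_neg[OF IN] by (simp add: KE_def)
        then show "snd x \<in> Z \<phi> I" using x H_closed[OF \<phi>] by (simp add: Z_def KE_def)
      qed
      have IN_im: "sprod R N I (carrier N) \<subseteq> \<rho> ` sprod R Fn I (carrier Fn)"
      proof (rule N.sprod_least)
        show "submodule (\<rho> ` sprod R Fn I (carrier Fn)) R N"
          by (rule NN.image_submodule[OF Fn.carrier_is_submodule \<rho> IFn]) (use Fn.sub_carr[OF IFn] in blast)
        fix a n assume a: "a \<in> I" and n: "n \<in> carrier N"
        then obtain g where g: "g \<in> carrier Fn" "n = \<rho> g" using \<rho>_surj by blast
        have "a \<odot>\<^bsub>N\<^esub> n = \<rho> (a \<odot>\<^bsub>Fn\<^esub> g)" unfolding g(2) using linear_onD(3)[OF \<rho> _ g(1)] a I by auto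
        then show "a \<odot>\<^bsub>N\<^esub> n \<in> \<rho> ` sprod R Fn I (carrier Fn)" using Fn.sprod_memI[OF a g(1)] by blast
      qed
      show "Z \<phi> I \<subseteq> snd ` P"
      proof
        fix f assume f: "f \<in> Z \<phi> I"
        then have "\<ominus>\<^bsub>N\<^esub> \<phi> f \<in> sprod R N I (carrier N)" using N.sub_neg[OF IN] by (simp add: Z_def)
        then obtain g where g: "g \<in> sprod R Fn I (carrier Fn)" "\<ominus>\<^bsub>N\<^esub> \<phi> f = \<rho> g" using IN_im by blast
        have "(g, f) \<in> P"
          unfolding P_def using g f K_carr Fn.sub_carr[OF IFn g(1)] FF.sprod_prod_iff[OF I, of "(g, f)"]
          by (auto simp: KE_def Z_def)
        then show "f \<in> snd ` P" by force
      qed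
    qed
    then show "snd ` P \<subseteq> Z \<phi> I" "Z \<phi> I \<subseteq> snd ` P <+>\<^bsub>Fr\<^esub> sprod R Fr I K"
      using Fr.sum_upper1[OF Z_submodule[OF \<phi>] IK] by auto
    fix x assume x: "x \<in> P"
    show "snd x \<in> sprod R Fr I K \<longleftrightarrow> x \<in> S <+>\<^bsub>G\<^esub> ?Q"
    proof
      assume "snd x \<in> sprod R Fr I K"
      then obtain y where y: "y \<in> ?Q" "snd x = snd y" unfolding snd_IKE[OF \<phi>, symmetric] by blast
      have yP: "y \<in> P" using y QP by blast
      have "snd (x \<ominus>\<^bsub>G\<^esub> y) = snd x \<ominus>\<^bsub>Fr\<^esub> snd y" by (rule GF.lin_minus[OF P sndP x yP])
      also have "\<dots> = \<zero>\<^bsub>Fr\<^esub>" unfolding y(2) using linear_onD(1)[OF sndP yP] Fr.minus_eq_zero_iff by blast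
      finally have xy: "x \<ominus>\<^bsub>G\<^esub> y \<in> S" unfolding S_def using G.sub_minus[OF P x yP] by simp
      have "(x \<ominus>\<^bsub>G\<^esub> y) \<oplus>\<^bsub>G\<^esub> y \<in> S <+>\<^bsub>G\<^esub> ?Q" by (rule G.sum_memI[OF xy y(1)])
      moreover have "(x \<ominus>\<^bsub>G\<^esub> y) \<oplus>\<^bsub>G\<^esub> y = x"
        using subsetD[OF Pc x] subsetD[OF Pc yP]
        by (simp add: a_minus_def G.M.a_assoc G.M.l_neg del: M.R.free_module_sel prod_module_sel)
      ultimately show "x \<in> S <+>\<^bsub>G\<^esub> ?Q" by simp
    next
      assume "x \<in> S <+>\<^bsub>G\<^esub> ?Q"
      then obtain u y where uy: "u \<in> S" "y \<in> ?Q" "x = u \<oplus>\<^bsub>G\<^esub> y" unfolding G.mem_sum_iff by blast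
      have "snd y \<in> sprod R Fr I K" using uy(2) unfolding snd_IKE[OF \<phi>, symmetric] by blast
      moreover have "snd x = \<zero>\<^bsub>Fr\<^esub> \<oplus>\<^bsub>Fr\<^esub> snd y" using uy(1) unfolding uy(3) S_def prod_module_sel snd_conv by simp
      ultimately show "snd x \<in> sprod R Fr I K" using Fr.sub_carr[OF IK] Fr.M.l_zero by simp
    qed
  qed
  moreover have "ilen R G ?Q P = ilen R G ?Q (S <+>\<^bsub>G\<^esub> ?Q) + ilen R G (S <+>\<^bsub>G\<^esub> ?Q) P"
    by (rule G.ilen_add[OF Q SQ P G.sum_upper2[OF S Q] SQP])
  moreover have "ilen R Fn (sprod R Fn I KN) ?TN = ilen R Fn (sprod R Fn I KN) (J \<phi> I) + ilen R Fn (J \<phi> I) ?TN"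
    by (rule Fn.ilen_add[OF IKN J_submodule[OF \<phi>] top_N IKN_J[OF \<phi>] J_top[OF \<phi>]])
  moreover have "ilen R Fr (sprod R Fr I K) ?TM = ilen R Fr (sprod R Fr I K) (Z \<phi> I) + ilen R Fr (Z \<phi> I) ?TM"
    by (rule Fr.ilen_add[OF IK Z_submodule[OF \<phi>] top_M IK_Z[OF \<phi>] Z_top])
  ultimately show ?thesis unfolding tor_length_def defect_def P_def by (simp add: ac_simps)
qed

text \<open>Both connecting maps depend linearly on the extension class. For the one on \<open>J\<close> this is
  the statement that lifts of \<open>a \<phi> + \<psi>\<close> are combinations of lifts of \<open>\<phi>\<close> and of \<open>\<psi>\<close>,
  up to elements of \<open>KN\<close>.\<close>

lemma IKE_combination:
  assumes \<phi>: "\<phi> \<in> carrier H" and \<psi>: "\<psi> \<in> carrier H" and a: "a \<in> carrier R"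
    and x: "x \<in> sprod R G I (KE (a \<odot>\<^bsub>H\<^esub> \<phi> \<oplus>\<^bsub>H\<^esub> \<psi>))"
  shows "\<exists>g h. (g, snd x) \<in> sprod R G I (KE \<phi>) \<and> (h, snd x) \<in> sprod R G I (KE \<psi>) \<and>
    fst x \<ominus>\<^bsub>Fn\<^esub> (a \<odot>\<^bsub>Fn\<^esub> g \<oplus>\<^bsub>Fn\<^esub> h) \<in> sprod R Fn I KN"
proof -
  define W where "W = {x \<in> carrier G. \<exists>g h. (g, snd x) \<in> sprod R G I (KE \<phi>) \<and> (h, snd x) \<in> sprod R G I (KE \<psi>) \<and>
    fst x \<ominus>\<^bsub>Fn\<^esub> (a \<odot>\<^bsub>Fn\<^esub> g \<oplus>\<^bsub>Fn\<^esub> h) \<in> sprod R Fn I KN}"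
  note Q\<phi> = IKE[OF \<phi>] and Q\<psi> = IKE[OF \<psi>]
  have c: "g \<in> carrier Fn" "f \<in> carrier Fr" if "(g, f) \<in> sprod R G I (KE \<chi>)" "\<chi> \<in> carrier H" for g f \<chi>
    using G.sub_carr[OF IKE[OF that(2)] that(1)] by auto
  have "submodule W R G"
  proof (rule G.submoduleI')
    show "W \<subseteq> carrier G" by (auto simp: W_def)
    have "(\<zero>\<^bsub>Fn\<^esub>, \<zero>\<^bsub>Fr\<^esub>) \<in> sprod R G I (KE \<phi>)" "(\<zero>\<^bsub>Fn\<^esub>, \<zero>\<^bsub>Fr\<^esub>) \<in> sprod R G I (KE \<psi>)"
      using G.sub_zero[OF Q\<phi>] G.sub_zero[OF Q\<psi>] by (simp_all only: prod_module_sel)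
    moreover have "\<zero>\<^bsub>Fn\<^esub> \<ominus>\<^bsub>Fn\<^esub> (a \<odot>\<^bsub>Fn\<^esub> \<zero>\<^bsub>Fn\<^esub> \<oplus>\<^bsub>Fn\<^esub> \<zero>\<^bsub>Fn\<^esub>) = \<zero>\<^bsub>Fn\<^esub>"
      using Fn.smult_r_null[OF a] Fn.M.r_zero[OF Fn.M.zero_closed] Fn.minus_eq_zero_iff Fn.M.zero_closed by metis
    ultimately show "\<zero>\<^bsub>G\<^esub> \<in> W"
      unfolding W_def using Fn.sub_zero[OF IKN] G.M.zero_closed
      by (intro CollectI conjI exI[of _ "\<zero>\<^bsub>Fn\<^esub>"]) (simp_all only: prod_module_sel fst_conv snd_conv)
  next
    fix x y assume "x \<in> W" "y \<in> W"
    then obtain g h g' h' where x: "x \<in> carrier G" "(g, snd x) \<in> sprod R G I (KE \<phi>)" "(h, snd x) \<in> sprod R G I (KE \<psi>)"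
        "fst x \<ominus>\<^bsub>Fn\<^esub> (a \<odot>\<^bsub>Fn\<^esub> g \<oplus>\<^bsub>Fn\<^esub> h) \<in> sprod R Fn I KN"
      and y: "y \<in> carrier G" "(g', snd y) \<in> sprod R G I (KE \<phi>)" "(h', snd y) \<in> sprod R G I (KE \<psi>)"
        "fst y \<ominus>\<^bsub>Fn\<^esub> (a \<odot>\<^bsub>Fn\<^esub> g' \<oplus>\<^bsub>Fn\<^esub> h') \<in> sprod R Fn I KN"
      unfolding W_def by (elim CollectE conjE exE)
    have cc: "fst x \<in> carrier Fn" "fst y \<in> carrier Fn" "g \<in> carrier Fn" "h \<in> carrier Fn" "g' \<in> carrier Fn" "h' \<in> carrier Fn"
      using x y c \<phi> \<psi> by auto
    have 1: "(g \<oplus>\<^bsub>Fn\<^esub> g', snd x \<oplus>\<^bsub>Fr\<^esub> snd y) \<in> sprod R G I (KE \<phi>)"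
      using G.sub_add[OF Q\<phi> x(2) y(2)] unfolding prod_module_sel fst_conv snd_conv .
    have 2: "(h \<oplus>\<^bsub>Fn\<^esub> h', snd x \<oplus>\<^bsub>Fr\<^esub> snd y) \<in> sprod R G I (KE \<psi>)"
      using G.sub_add[OF Q\<psi> x(3) y(3)] unfolding prod_module_sel fst_conv snd_conv .
    have "(fst x \<ominus>\<^bsub>Fn\<^esub> (a \<odot>\<^bsub>Fn\<^esub> g \<oplus>\<^bsub>Fn\<^esub> h)) \<oplus>\<^bsub>Fn\<^esub> (fst y \<ominus>\<^bsub>Fn\<^esub> (a \<odot>\<^bsub>Fn\<^esub> g' \<oplus>\<^bsub>Fn\<^esub> h')) =
        (fst x \<oplus>\<^bsub>Fn\<^esub> fst y) \<ominus>\<^bsub>Fn\<^esub> (a \<odot>\<^bsub>Fn\<^esub> (g \<oplus>\<^bsub>Fn\<^esub> g') \<oplus>\<^bsub>Fn\<^esub> (h \<oplus>\<^bsub>Fn\<^esub> h'))"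
      using cc a Fn.smult_closed Fn.M.a_closed
      by (simp add: a_minus_def Fn.smult_r_distr Fn.M.minus_add Fn.M.a_ac del: M.R.free_module_sel)
    then have 3: "(fst x \<oplus>\<^bsub>Fn\<^esub> fst y) \<ominus>\<^bsub>Fn\<^esub> (a \<odot>\<^bsub>Fn\<^esub> (g \<oplus>\<^bsub>Fn\<^esub> g') \<oplus>\<^bsub>Fn\<^esub> (h \<oplus>\<^bsub>Fn\<^esub> h')) \<in> sprod R Fn I KN"
      using Fn.sub_add[OF IKN x(4) y(4)] by simp
    show "x \<oplus>\<^bsub>G\<^esub> y \<in> W"
      unfolding W_def using G.M.a_closed[OF x(1) y(1)] 1 2 3
      by (intro CollectI conjI exI[of _ "g \<oplus>\<^bsub>Fn\<^esub> g'"] exI[of _ "h \<oplus>\<^bsub>Fn\<^esub> h'"]) (simp_all only: prod_module_sel fst_conv snd_conv)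
  next
    fix b x assume b: "b \<in> carrier R" and "x \<in> W"
    then obtain g h where x: "x \<in> carrier G" "(g, snd x) \<in> sprod R G I (KE \<phi>)" "(h, snd x) \<in> sprod R G I (KE \<psi>)"
        "fst x \<ominus>\<^bsub>Fn\<^esub> (a \<odot>\<^bsub>Fn\<^esub> g \<oplus>\<^bsub>Fn\<^esub> h) \<in> sprod R Fn I KN"
      unfolding W_def by (elim CollectE conjE exE)
    have cc: "fst x \<in> carrier Fn" "g \<in> carrier Fn" "h \<in> carrier Fn" using x c \<phi> \<psi> by auto
    have 1: "(b \<odot>\<^bsub>Fn\<^esub> g, b \<odot>\<^bsub>Fr\<^esub> snd x) \<in> sprod R G I (KE \<phi>)"
      using G.sub_smult[OF Q\<phi> b x(2)] unfolding prod_module_sel fst_conv snd_conv .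
    have 2: "(b \<odot>\<^bsub>Fn\<^esub> h, b \<odot>\<^bsub>Fr\<^esub> snd x) \<in> sprod R G I (KE \<psi>)"
      using G.sub_smult[OF Q\<psi> b x(3)] unfolding prod_module_sel fst_conv snd_conv .
    have ag: "a \<odot>\<^bsub>Fn\<^esub> g \<in> carrier Fn" by (rule Fn.smult_closed[OF a cc(2)])
    have "b \<odot>\<^bsub>Fn\<^esub> (fst x \<ominus>\<^bsub>Fn\<^esub> (a \<odot>\<^bsub>Fn\<^esub> g \<oplus>\<^bsub>Fn\<^esub> h)) = b \<odot>\<^bsub>Fn\<^esub> fst x \<ominus>\<^bsub>Fn\<^esub> (a \<odot>\<^bsub>Fn\<^esub> (b \<odot>\<^bsub>Fn\<^esub> g) \<oplus>\<^bsub>Fn\<^esub> b \<odot>\<^bsub>Fn\<^esub> h)"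
      unfolding Fn.smult_minus_distr[OF b cc(1) Fn.M.a_closed[OF ag cc(3)]] Fn.smult_r_distr[OF b ag cc(3)]
        Fn.smult_comm[OF b a cc(2)] ..
    then have 3: "b \<odot>\<^bsub>Fn\<^esub> fst x \<ominus>\<^bsub>Fn\<^esub> (a \<odot>\<^bsub>Fn\<^esub> (b \<odot>\<^bsub>Fn\<^esub> g) \<oplus>\<^bsub>Fn\<^esub> b \<odot>\<^bsub>Fn\<^esub> h) \<in> sprod R Fn I KN"
      using Fn.sub_smult[OF IKN b x(4)] by simp
    show "b \<odot>\<^bsub>G\<^esub> x \<in> W"
      unfolding W_def using G.smult_closed[OF b x(1)] 1 2 3
      by (intro CollectI conjI exI[of _ "b \<odot>\<^bsub>Fn\<^esub> g"] exI[of _ "b \<odot>\<^bsub>Fn\<^esub> h"]) (simp_all only: prod_module_sel fst_conv snd_conv)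
  qed
  then have "sprod R G I (KE (a \<odot>\<^bsub>H\<^esub> \<phi> \<oplus>\<^bsub>H\<^esub> \<psi>)) \<subseteq> W"
  proof (rule G.sprod_least)
    fix b y assume b: "b \<in> I" and y: "y \<in> KE (a \<odot>\<^bsub>H\<^esub> \<phi> \<oplus>\<^bsub>H\<^esub> \<psi>)"
    have bc: "b \<in> carrier R" using b I by blast
    have y': "y \<in> carrier G" "fst y \<in> carrier Fn" "snd y \<in> K" "\<rho> (fst y) = \<ominus>\<^bsub>N\<^esub> (a \<odot>\<^bsub>N\<^esub> \<phi> (snd y) \<oplus>\<^bsub>N\<^esub> \<psi> (snd y))"
      using y by (auto simp: KE_def)
    obtain g h where gh: "(g, snd y) \<in> KE \<phi>" "(h, snd y) \<in> KE \<psi>" using KE_lift[OF \<phi> y'(3)] KE_lift[OF \<psi> y'(3)] by blast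
    have gc: "g \<in> carrier Fn" "h \<in> carrier Fn" "\<rho> g = \<ominus>\<^bsub>N\<^esub> \<phi> (snd y)" "\<rho> h = \<ominus>\<^bsub>N\<^esub> \<psi> (snd y)" using gh by (auto simp: KE_def)
    have ag: "a \<odot>\<^bsub>Fn\<^esub> g \<in> carrier Fn" by (rule Fn.smult_closed[OF a gc(1)])
    have agh: "a \<odot>\<^bsub>Fn\<^esub> g \<oplus>\<^bsub>Fn\<^esub> h \<in> carrier Fn" by (rule Fn.M.a_closed[OF ag gc(2)])
    have "\<rho> (a \<odot>\<^bsub>Fn\<^esub> g \<oplus>\<^bsub>Fn\<^esub> h) = a \<odot>\<^bsub>N\<^esub> (\<ominus>\<^bsub>N\<^esub> \<phi> (snd y)) \<oplus>\<^bsub>N\<^esub> (\<ominus>\<^bsub>N\<^esub> \<psi> (snd y))"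
      unfolding linear_onD(2)[OF \<rho> ag gc(2)] linear_onD(3)[OF \<rho> a gc(1)] gc(3,4) ..
    also have "\<dots> = \<rho> (fst y)"
      using a H_closed[OF \<phi>] H_closed[OF \<psi>] by (simp add: y'(4) N.smult_r_minus N.M.minus_add)
    finally have "\<rho> (fst y \<ominus>\<^bsub>Fn\<^esub> (a \<odot>\<^bsub>Fn\<^esub> g \<oplus>\<^bsub>Fn\<^esub> h)) = \<zero>\<^bsub>N\<^esub>"
      using NN.lin_minus[OF Fn.carrier_is_submodule \<rho> y'(2) agh] linear_onD(1)[OF \<rho> y'(2)] N.minus_eq_zero_iff by simp
    then have kn: "fst y \<ominus>\<^bsub>Fn\<^esub> (a \<odot>\<^bsub>Fn\<^esub> g \<oplus>\<^bsub>Fn\<^esub> h) \<in> KN"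
      using Fn.M.minus_closed[OF y'(2) agh] by (simp add: KN_iff)
    have 1: "(b \<odot>\<^bsub>Fn\<^esub> g, b \<odot>\<^bsub>Fr\<^esub> snd y) \<in> sprod R G I (KE \<phi>)"
      using G.sprod_memI[OF b gh(1)] unfolding prod_module_sel fst_conv snd_conv .
    have 2: "(b \<odot>\<^bsub>Fn\<^esub> h, b \<odot>\<^bsub>Fr\<^esub> snd y) \<in> sprod R G I (KE \<psi>)"
      using G.sprod_memI[OF b gh(2)] unfolding prod_module_sel fst_conv snd_conv .
    have "b \<odot>\<^bsub>Fn\<^esub> (fst y \<ominus>\<^bsub>Fn\<^esub> (a \<odot>\<^bsub>Fn\<^esub> g \<oplus>\<^bsub>Fn\<^esub> h)) = b \<odot>\<^bsub>Fn\<^esub> fst y \<ominus>\<^bsub>Fn\<^esub> (a \<odot>\<^bsub>Fn\<^esub> (b \<odot>\<^bsub>Fn\<^esub> g) \<oplus>\<^bsub>Fn\<^esub> b \<odot>\<^bsub>Fn\<^esub> h)"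
      unfolding Fn.smult_minus_distr[OF bc y'(2) agh] Fn.smult_r_distr[OF bc ag gc(2)] Fn.smult_comm[OF bc a gc(1)] ..
    then have 3: "b \<odot>\<^bsub>Fn\<^esub> fst y \<ominus>\<^bsub>Fn\<^esub> (a \<odot>\<^bsub>Fn\<^esub> (b \<odot>\<^bsub>Fn\<^esub> g) \<oplus>\<^bsub>Fn\<^esub> b \<odot>\<^bsub>Fn\<^esub> h) \<in> sprod R Fn I KN"
      using Fn.sprod_memI[OF b kn] by simp
    show "b \<odot>\<^bsub>G\<^esub> y \<in> W"
      unfolding W_def using G.smult_closed[OF bc y'(1)] 1 2 3
      by (intro CollectI conjI exI[of _ "b \<odot>\<^bsub>Fn\<^esub> g"] exI[of _ "b \<odot>\<^bsub>Fn\<^esub> h"]) (simp_all only: prod_module_sel fst_conv snd_conv)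
  qed
  then show ?thesis using x unfolding W_def by blast
qed

lemma J_combination:
  assumes \<phi>: "\<phi> \<in> carrier H" and \<psi>: "\<psi> \<in> carrier H" and a: "a \<in> carrier R"
    and u: "u \<in> J (a \<odot>\<^bsub>H\<^esub> \<phi> \<oplus>\<^bsub>H\<^esub> \<psi>) I"
  shows "\<exists>g\<in>J \<phi> I. \<exists>h\<in>J \<psi> I. u \<ominus>\<^bsub>Fn\<^esub> (a \<odot>\<^bsub>Fn\<^esub> g \<oplus>\<^bsub>Fn\<^esub> h) \<in> sprod R Fn I KN"
proof -
  have "(u, \<zero>\<^bsub>Fr\<^esub>) \<in> sprod R G I (KE (a \<odot>\<^bsub>H\<^esub> \<phi> \<oplus>\<^bsub>H\<^esub> \<psi>))" using u by (simp add: J_def)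
  from IKE_combination[OF \<phi> \<psi> a this]
  obtain g h where gh: "(g, \<zero>\<^bsub>Fr\<^esub>) \<in> sprod R G I (KE \<phi>)" "(h, \<zero>\<^bsub>Fr\<^esub>) \<in> sprod R G I (KE \<psi>)"
    "u \<ominus>\<^bsub>Fn\<^esub> (a \<odot>\<^bsub>Fn\<^esub> g \<oplus>\<^bsub>Fn\<^esub> h) \<in> sprod R Fn I KN" unfolding fst_conv snd_conv by blast
  have "g \<in> carrier Fn" "h \<in> carrier Fn"
    using G.sub_carr[OF IKE[OF \<phi>] gh(1)] G.sub_carr[OF IKE[OF \<psi>] gh(2)] by auto
  then show ?thesis using gh unfolding J_def by blast
qed

lemma J_zero: "J \<zero>\<^bsub>H\<^esub> I \<subseteq> sprod R Fn I KN"
proof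
  fix g assume "g \<in> J \<zero>\<^bsub>H\<^esub> I"
  then have "(g, \<zero>\<^bsub>Fr\<^esub>) \<in> sprod R G I (KE \<zero>\<^bsub>H\<^esub>)" by (simp add: J_def)
  moreover have "fst ` sprod R G I (KE \<zero>\<^bsub>H\<^esub>) \<subseteq> sprod R Fn I KN"
    by (rule GN.sprod_image[OF I KE_submodule[OF H.M.zero_closed] FF.fst_linear KN])
       (auto simp: KE_def KN_iff neg_zero)
  ultimately show "g \<in> sprod R Fn I KN" by force
qed

lemma J_add:
  assumes \<phi>: "\<phi> \<in> carrier H" and \<psi>: "\<psi> \<in> carrier H"
  shows "J (\<phi> \<oplus>\<^bsub>H\<^esub> \<psi>) I \<subseteq> J \<phi> I <+>\<^bsub>Fn\<^esub> J \<psi> I"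
proof
  fix u assume u: "u \<in> J (\<phi> \<oplus>\<^bsub>H\<^esub> \<psi>) I"
  have "\<one>\<^bsub>R\<^esub> \<odot>\<^bsub>H\<^esub> \<phi> = \<phi>" by (rule H.smult_one[OF \<phi>])
  then obtain g h where gh: "g \<in> J \<phi> I" "h \<in> J \<psi> I" "u \<ominus>\<^bsub>Fn\<^esub> (\<one>\<^bsub>R\<^esub> \<odot>\<^bsub>Fn\<^esub> g \<oplus>\<^bsub>Fn\<^esub> h) \<in> sprod R Fn I KN"
    using J_combination[OF \<phi> \<psi> M.R.one_closed, of u] u by auto
  have S: "submodule (J \<phi> I <+>\<^bsub>Fn\<^esub> J \<psi> I) R Fn" by (rule Fn.sum_submodule[OF J_submodule[OF \<phi>] J_submodule[OF \<psi>]])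
  have d: "u \<ominus>\<^bsub>Fn\<^esub> (g \<oplus>\<^bsub>Fn\<^esub> h) \<in> J \<phi> I <+>\<^bsub>Fn\<^esub> J \<psi> I"
    using gh(3)[unfolded Fn.smult_one[OF Fn.sub_carr[OF J_submodule[OF \<phi>] gh(1)]]]
      IKN_J[OF \<phi>] Fn.sum_upper1[OF J_submodule[OF \<phi>] J_submodule[OF \<psi>]] by blast
  have "u \<in> carrier Fn" using u by (simp add: J_def)
  from Fn.sub_minus_cancel[OF S this Fn.sum_memI[OF gh(1,2)] d] show "u \<in> J \<phi> I <+>\<^bsub>Fn\<^esub> J \<psi> I" .
qed

lemma J_smult:
  assumes \<phi>: "\<phi> \<in> carrier H" and a: "a \<in> carrier R" and u: "u \<in> J (a \<odot>\<^bsub>H\<^esub> \<phi>) I"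
  shows "\<exists>g\<in>J \<phi> I. u \<ominus>\<^bsub>Fn\<^esub> a \<odot>\<^bsub>Fn\<^esub> g \<in> sprod R Fn I KN"
proof -
  have "a \<odot>\<^bsub>H\<^esub> \<phi> \<oplus>\<^bsub>H\<^esub> \<zero>\<^bsub>H\<^esub> = a \<odot>\<^bsub>H\<^esub> \<phi>" by (rule H.M.r_zero[OF H.smult_closed[OF a \<phi>]])
  then obtain g h where gh: "g \<in> J \<phi> I" "h \<in> J \<zero>\<^bsub>H\<^esub> I" "u \<ominus>\<^bsub>Fn\<^esub> (a \<odot>\<^bsub>Fn\<^esub> g \<oplus>\<^bsub>Fn\<^esub> h) \<in> sprod R Fn I KN"
    using J_combination[OF \<phi> H.M.zero_closed a, of u] u by metis
  have h: "h \<in> sprod R Fn I KN" using J_zero gh(2) by blast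
  have c: "u \<in> carrier Fn" "a \<odot>\<^bsub>Fn\<^esub> g \<in> carrier Fn" "h \<in> carrier Fn"
    using u Fn.sub_carr[OF J_submodule[OF \<phi>] gh(1)] Fn.sub_carr[OF IKN h] a Fn.smult_closed by (auto simp: J_def)
  have "(u \<ominus>\<^bsub>Fn\<^esub> (a \<odot>\<^bsub>Fn\<^esub> g \<oplus>\<^bsub>Fn\<^esub> h)) \<oplus>\<^bsub>Fn\<^esub> h = u \<ominus>\<^bsub>Fn\<^esub> a \<odot>\<^bsub>Fn\<^esub> g"
    using c by (simp add: a_minus_def Fn.M.minus_add Fn.M.a_assoc Fn.M.l_neg del: M.R.free_module_sel)
  then show ?thesis using gh(1) Fn.sub_add[OF IKN gh(3) h] by metis
qed

text \<open>The first summand of the defect grows with \<open>J\<close>, and \<open>J\<close> of a sum lies in the sum of the two; the second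
  decreases with \<open>Z\<close>, and \<open>Z\<close> of a sum contains the intersection of the two.\<close>

theorem defect_add:
  assumes \<phi>: "\<phi> \<in> carrier H" and \<psi>: "\<psi> \<in> carrier H"
  shows "defect (\<phi> \<oplus>\<^bsub>H\<^esub> \<psi>) I \<le> defect \<phi> I + defect \<psi> I"
proof -
  let ?A = "sprod R Fn I KN" and ?T = "K \<inter> sprod R Fr I (carrier Fr)"
  note \<phi>\<psi> = H.M.a_closed[OF \<phi> \<psi>]
  note J\<phi> = J_submodule[OF \<phi>] and J\<psi> = J_submodule[OF \<psi>] and J\<phi>\<psi> = J_submodule[OF \<phi>\<psi>]
  note Z\<phi> = Z_submodule[OF \<phi>] and Z\<psi> = Z_submodule[OF \<psi>] and Z\<phi>\<psi> = Z_submodule[OF \<phi>\<psi>]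
  have JJ: "submodule (J \<phi> I <+>\<^bsub>Fn\<^esub> J \<psi> I) R Fn" by (rule Fn.sum_submodule[OF J\<phi> J\<psi>])
  have comm: "J \<phi> I <+>\<^bsub>Fn\<^esub> J \<psi> I = J \<psi> I <+>\<^bsub>Fn\<^esub> J \<phi> I"
    using Fn.sum_least[OF Fn.sum_submodule[OF J\<psi> J\<phi>] Fn.sum_upper2[OF J\<psi> J\<phi>] Fn.sum_upper1[OF J\<psi> J\<phi>]]
      Fn.sum_least[OF Fn.sum_submodule[OF J\<phi> J\<psi>] Fn.sum_upper2[OF J\<phi> J\<psi>] Fn.sum_upper1[OF J\<phi> J\<psi>]] by (rule subset_antisym)
  have up: "J \<phi> I \<subseteq> J \<phi> I <+>\<^bsub>Fn\<^esub> J \<psi> I" by (rule Fn.sum_upper1[OF J\<phi> J\<psi>])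
  have "ilen R Fn ?A (J (\<phi> \<oplus>\<^bsub>H\<^esub> \<psi>) I) \<le> ilen R Fn ?A (J \<phi> I <+>\<^bsub>Fn\<^esub> J \<psi> I)"
    by (rule Fn.ilen_mono[OF IKN IKN JJ J\<phi>\<psi> order_refl IKN_J[OF \<phi>\<psi>] J_add[OF \<phi> \<psi>]])
  also have "\<dots> = ilen R Fn ?A (J \<phi> I) + ilen R Fn (J \<phi> I) (J \<phi> I <+>\<^bsub>Fn\<^esub> J \<psi> I)"
    by (rule Fn.ilen_add[OF IKN J\<phi> JJ IKN_J[OF \<phi>] up])
  also have "ilen R Fn (J \<phi> I) (J \<phi> I <+>\<^bsub>Fn\<^esub> J \<psi> I) = ilen R Fn (J \<psi> I \<inter> J \<phi> I) (J \<psi> I)"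
    unfolding comm by (rule Fn.ilen_second_iso[OF J\<psi> J\<phi>, symmetric])
  also have "\<dots> \<le> ilen R Fn ?A (J \<psi> I)"
    by (rule Fn.ilen_mono[OF IKN Fn.Int_submodule[OF J\<psi> J\<phi>] J\<psi> J\<psi> _ _ order_refl])
       (use IKN_J[OF \<phi>] IKN_J[OF \<psi>] in blast)+
  finally have 1: "ilen R Fn ?A (J (\<phi> \<oplus>\<^bsub>H\<^esub> \<psi>) I) \<le> ilen R Fn ?A (J \<phi> I) + ilen R Fn ?A (J \<psi> I)"
    by (simp add: add_left_mono)
  have ZZ: "submodule (Z \<phi> I \<inter> Z \<psi> I) R Fr" by (rule Fr.Int_submodule[OF Z\<phi> Z\<psi>])
  have Zs: "submodule (Z \<phi> I <+>\<^bsub>Fr\<^esub> Z \<psi> I) R Fr" by (rule Fr.sum_submodule[OF Z\<phi> Z\<psi>])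
  have sub: "Z \<phi> I \<inter> Z \<psi> I \<subseteq> Z (\<phi> \<oplus>\<^bsub>H\<^esub> \<psi>) I" using N.sub_add[OF IN] by (auto simp: Z_def)
  have ZsT: "Z \<phi> I <+>\<^bsub>Fr\<^esub> Z \<psi> I \<subseteq> ?T" by (rule Fr.sum_least[OF top_M Z_top Z_top])
  have "ilen R Fr (Z (\<phi> \<oplus>\<^bsub>H\<^esub> \<psi>) I) ?T \<le> ilen R Fr (Z \<phi> I \<inter> Z \<psi> I) ?T"
    by (rule Fr.ilen_mono[OF ZZ Z\<phi>\<psi> top_M top_M sub Z_top order_refl])
  also have "\<dots> = ilen R Fr (Z \<phi> I \<inter> Z \<psi> I) (Z \<phi> I) + ilen R Fr (Z \<phi> I) ?T"
    by (rule Fr.ilen_add[OF ZZ Z\<phi> top_M _ Z_top]) blast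
  also have "ilen R Fr (Z \<phi> I \<inter> Z \<psi> I) (Z \<phi> I) = ilen R Fr (Z \<psi> I) (Z \<phi> I <+>\<^bsub>Fr\<^esub> Z \<psi> I)"
    by (rule Fr.ilen_second_iso[OF Z\<phi> Z\<psi>])
  also have "\<dots> \<le> ilen R Fr (Z \<psi> I) ?T"
    by (rule Fr.ilen_mono[OF Z\<psi> Z\<psi> top_M Zs order_refl Fr.sum_upper2[OF Z\<phi> Z\<psi>] ZsT])
  finally have 2: "ilen R Fr (Z (\<phi> \<oplus>\<^bsub>H\<^esub> \<psi>) I) ?T \<le> ilen R Fr (Z \<psi> I) ?T + ilen R Fr (Z \<phi> I) ?T"
    by (simp add: add_right_mono)
  show ?thesis unfolding defect_def using add_mono[OF 1 2] by (simp add: ac_simps)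
qed

theorem defect_smult:
  assumes \<phi>: "\<phi> \<in> carrier H" and a: "a \<in> carrier R"
  shows "defect (a \<odot>\<^bsub>H\<^esub> \<phi>) I \<le> defect \<phi> I"
proof -
  note a\<phi> = H.smult_closed[OF a \<phi>]
  note J\<phi> = J_submodule[OF \<phi>] and Ja = J_submodule[OF a\<phi>]
  have "J (a \<odot>\<^bsub>H\<^esub> \<phi>) I \<subseteq> J \<phi> I"
  proof
    fix u assume u: "u \<in> J (a \<odot>\<^bsub>H\<^esub> \<phi>) I"
    then obtain g where g: "g \<in> J \<phi> I" "u \<ominus>\<^bsub>Fn\<^esub> a \<odot>\<^bsub>Fn\<^esub> g \<in> sprod R Fn I KN" using J_smult[OF \<phi> a] by blast
    show "u \<in> J \<phi> I"
      by (rule Fn.sub_minus_cancel[OF J\<phi> _ Fn.sub_smult[OF J\<phi> a g(1)]])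
         (use u g(2) IKN_J[OF \<phi>] in \<open>auto simp: J_def simp del: M.R.free_module_sel\<close>)
  qed
  then have 1: "ilen R Fn (sprod R Fn I KN) (J (a \<odot>\<^bsub>H\<^esub> \<phi>) I) \<le> ilen R Fn (sprod R Fn I KN) (J \<phi> I)"
    by (intro Fn.ilen_mono IKN J\<phi> Ja order_refl IKN_J a\<phi>)
  have "Z \<phi> I \<subseteq> Z (a \<odot>\<^bsub>H\<^esub> \<phi>) I" using N.sub_smult[OF IN a] by (auto simp: Z_def)
  then have 2: "ilen R Fr (Z (a \<odot>\<^bsub>H\<^esub> \<phi>) I) (K \<inter> sprod R Fr I (carrier Fr)) \<le>
      ilen R Fr (Z \<phi> I) (K \<inter> sprod R Fr I (carrier Fr))"
    by (intro Fr.ilen_mono Z_submodule \<phi> a\<phi> top_M Z_top order_refl)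
  show ?thesis unfolding defect_def using 1 2 by (rule add_mono)
qed

text \<open>A scalar that annihilates both Tor modules annihilates the connecting maps.\<close>

theorem defect_annihilated:
  assumes \<phi>: "\<phi> \<in> carrier H" and a: "a \<in> carrier R"
    and aM: "\<And>u. u \<in> K \<inter> sprod R Fr I (carrier Fr) \<Longrightarrow> a \<odot>\<^bsub>Fr\<^esub> u \<in> sprod R Fr I K"
    and aN: "\<And>u. u \<in> KN \<inter> sprod R Fn I (carrier Fn) \<Longrightarrow> a \<odot>\<^bsub>Fn\<^esub> u \<in> sprod R Fn I KN"
  shows "defect (a \<odot>\<^bsub>H\<^esub> \<phi>) I = 0"
proof -
  note a\<phi> = H.smult_closed[OF a \<phi>]
  have "J (a \<odot>\<^bsub>H\<^esub> \<phi>) I \<subseteq> sprod R Fn I KN"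
  proof
    fix u assume u: "u \<in> J (a \<odot>\<^bsub>H\<^esub> \<phi>) I"
    then obtain g where g: "g \<in> J \<phi> I" "u \<ominus>\<^bsub>Fn\<^esub> a \<odot>\<^bsub>Fn\<^esub> g \<in> sprod R Fn I KN" using J_smult[OF \<phi> a] by blast
    have ag: "a \<odot>\<^bsub>Fn\<^esub> g \<in> sprod R Fn I KN" using aN g(1) J_top[OF \<phi>] by blast
    have "u \<in> carrier Fn" using u by (simp add: J_def)
    from Fn.sub_minus_cancel[OF IKN this ag g(2)] show "u \<in> sprod R Fn I KN" .
  qed
  then have "J (a \<odot>\<^bsub>H\<^esub> \<phi>) I = sprod R Fn I KN" using IKN_J[OF a\<phi>] by blast
  moreover have "K \<inter> sprod R Fr I (carrier Fr) \<subseteq> Z (a \<odot>\<^bsub>H\<^esub> \<phi>) I"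
  proof
    fix u assume u: "u \<in> K \<inter> sprod R Fr I (carrier Fr)"
    have "a \<odot>\<^bsub>Fr\<^esub> u \<in> Z \<phi> I" using aM[OF u] IK_Z[OF \<phi>] by blast
    then have "a \<odot>\<^bsub>N\<^esub> \<phi> u \<in> sprod R N I (carrier N)"
      using linear_onD(3)[OF H_lin[OF \<phi>] a, of u] u by (simp add: Z_def)
    then show "u \<in> Z (a \<odot>\<^bsub>H\<^esub> \<phi>) I" using u by (simp add: Z_def)
  qed
  then have "Z (a \<odot>\<^bsub>H\<^esub> \<phi>) I = K \<inter> sprod R Fr I (carrier Fr)" using Z_top by blast
  ultimately show ?thesis unfolding defect_def by (simp add: Fn.ilen_self Fr.ilen_self)
qed

end

end

section \<open>T-split extensions over a Cohen--Macaulay local ring\<close>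

lemma (in cring) free_module_fin_gen:
  assumes "finite B" shows "fin_gen R (free_module R B)"
proof -
  interpret F: module R "free_module R B" by (rule free_module_module)
  have S: "basis_elt R ` B \<subseteq> carrier (free_module R B)" by (intro image_subsetI basis_elt_carrier)
  have g: "submodule (gen_submodule R (free_module R B) (basis_elt R ` B)) R (free_module R B)"
    by (rule F.gen_submodule_submodule[OF S])
  have "carrier (free_module R B) \<subseteq> gen_submodule R (free_module R B) (basis_elt R ` B)"
    by (rule free_span[OF g]) (rule F.gen_submodule_incl[THEN subsetD], rule imageI)
  then have "gen_submodule R (free_module R B) (basis_elt R ` B) = carrier (free_module R B)"
    using F.submoduleE(1)[OF g] by (rule subset_antisym[rotated])
  then show ?thesis unfolding fin_gen_def using S assms
    by (intro exI[of _ "basis_elt R ` B"]) simp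
qed

lemma (in module_pair) acc_prod:
  assumes "acc (subs R M {\<zero>\<^bsub>M\<^esub>} (carrier M))" "acc (subs R N {\<zero>\<^bsub>N\<^esub>} (carrier N))"
  shows "acc (subs R (prod_module M N) {\<zero>\<^bsub>prod_module M N\<^esub>} (carrier (prod_module M N)))"
proof -
  interpret P: module R "prod_module M N" by (rule prod_module_module)
  interpret PM: module_pair R "prod_module M N" M by (intro module_pairI prod_module_module M.module_axioms)
  interpret PN: module_pair R "prod_module M N" N by (intro module_pairI prod_module_module N.module_axioms)
  let ?L = "{x \<in> carrier (prod_module M N). snd x \<in> {\<zero>\<^bsub>N\<^esub>}}"
  have L: "submodule ?L R (prod_module M N)"
    by (rule PN.vimage_submodule[OF P.carrier_is_submodule snd_linear N.zero_submodule])
  have "acc (subs R (prod_module M N) {\<zero>\<^bsub>prod_module M N\<^esub>} ?L)"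
  proof (rule PM.acc_inj[OF L M.carrier_is_submodule M.zero_submodule _ _ _ _ assms(1)])
    show "linear_on R (prod_module M N) ?L M fst"
      by (rule linear_on_subset[OF fst_linear]) blast
    show "x \<in> {\<zero>\<^bsub>prod_module M N\<^esub>}" if "x \<in> ?L" "fst x \<in> {\<zero>\<^bsub>M\<^esub>}" for x
      using that by (cases x) auto
  qed auto
  moreover have "acc (subs R (prod_module M N) ?L (carrier (prod_module M N)))"
    by (rule PN.acc_inj[OF P.carrier_is_submodule N.carrier_is_submodule N.zero_submodule _ snd_linear _ _ assms(2)]) auto
  moreover have "{\<zero>\<^bsub>prod_module M N\<^esub>} \<subseteq> ?L" using P.sub_zero[OF L] by blast
  ultimately show ?thesis
    by (intro P.acc_add[OF P.zero_submodule L P.carrier_is_submodule]) auto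
qed

context cm_local
begin

definition scale :: "nat \<Rightarrow> real" where "scale n = fact (d - 1) / real n ^ (d - 1)"

text \<open>The presentation \<open>W/K\<close> of \<open>E\<close> is left open because \<open>E\<close> may be the middle term of an extension, which is
  presented by a product of free modules.\<close>

lemma eT_limit:
  assumes W: "module R W" and K: "submodule K R W" and noeth: "acc (subs R W {\<zero>\<^bsub>W\<^esub>} (carrier W))"
    and tor: "\<And>I. ideal I R \<Longrightarrow> mod_length R (Tor1 R E (quot_module (self_module R) I)) = tor_length R W K I"
  shows "tor_length R W K (\<mm> [^]\<^bsub>ideals_set R\<^esub> Suc n) < \<infinity>"
    and "(\<lambda>n. scale n * real (the_enat (tor_length R W K (\<mm> [^]\<^bsub>ideals_set R\<^esub> Suc n)))) \<longlonglongrightarrow> eT R \<mm> E"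
proof -
  interpret W: module R W by (rule W)
  interpret W: cm_local_module R \<mm> d W
    by (intro cm_local_module.intro local_module.intro local_module_axioms.intro
        cm_local_axioms noetherian_local_axioms W noeth)
  have eq: "tor_length R W K (\<mm> [^]\<^bsub>ideals_set R\<^esub> Suc n) =
      ilen R W (spow R W \<mm> (Suc n) K) (K \<inter> spow R W \<mm> (Suc n) (carrier W))" for n
    unfolding tor_length_def W.sprod_ideal_pow[OF m_ideal K] W.sprod_ideal_pow[OF m_ideal W.carrier_is_submodule] ..
  note lim = W.torsion_limit[OF K, folded eq]
  show "tor_length R W K (\<mm> [^]\<^bsub>ideals_set R\<^esub> Suc n) < \<infinity>" by (rule lim(1))
  let ?f = "\<lambda>n. scale n * real (the_enat (tor_length R W K (\<mm> [^]\<^bsub>ideals_set R\<^esub> Suc n)))"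
  have "convergent (\<lambda>n. fact (d - 1) * (real (the_enat (tor_length R W K (\<mm> [^]\<^bsub>ideals_set R\<^esub> Suc n))) / real n ^ (d - 1)))"
    by (intro convergent_mult convergent_const lim(2))
  then have "convergent ?f" by (simp add: scale_def)
  then have "?f \<longlonglongrightarrow> lim ?f" by (simp add: convergent_LIMSEQ_iff)
  moreover have "eT R \<mm> E = lim ?f"
    by (simp only: eT_def Let_def dim the_enat.simps scale_def Suc_eq_plus1
        tor[OF ideal_pow_ideal[OF m_ideal]])
  ultimately show "?f \<longlonglongrightarrow> eT R \<mm> E" by simp
qed

end

locale tsplit_cm = tsplit_setup R M N B \<pi> C \<rho> + cm_local R \<mm> d
  for R :: "('a, 'r) ring_scheme" (structure) and M :: "('a, 'c, 'm) module_scheme"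
    and N :: "('a, 'e, 'n) module_scheme" and B :: "'x set" and \<pi> :: "('x \<Rightarrow> 'a) \<Rightarrow> 'c"
    and C :: "'y set" and \<rho> :: "('y \<Rightarrow> 'a) \<Rightarrow> 'e" and \<mm> d +
  assumes finB: "finite B" and finC: "finite C"
    and noethN: "acc (subs R N {\<zero>\<^bsub>N\<^esub>} (carrier N))"
begin

abbreviation mpow :: "nat \<Rightarrow> 'a set" where "mpow n \<equiv> \<mm> [^]\<^bsub>ideals_set R\<^esub> Suc n"

lemma mpow_ideal: "ideal (mpow n) R" "mpow n \<subseteq> carrier R"
proof -
  show i: "ideal (mpow n) R" by (rule ideal_pow_ideal[OF m_ideal])
  show "mpow n \<subseteq> carrier R" by (rule subsetI) (rule ideal.Icarr[OF i])
qed

lemma acc_Fr: "acc (subs R Fr {\<zero>\<^bsub>Fr\<^esub>} (carrier Fr))"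
  by (rule Fr.acc_fin_gen[OF acc_self free_module_fin_gen[OF finB]])

lemma acc_Fn: "acc (subs R Fn {\<zero>\<^bsub>Fn\<^esub>} (carrier Fn))"
  by (rule Fn.acc_fin_gen[OF acc_self free_module_fin_gen[OF finC]])

lemma acc_G: "acc (subs R G {\<zero>\<^bsub>G\<^esub>} (carrier G))"
  by (rule FF.acc_prod[OF acc_Fn acc_Fr])

lemma tor_presentation:
  assumes E: "module R E" and p: "linear_on R (free_module R S) (carrier (free_module R S)) E p"
    and surj: "p ` carrier (free_module R S) = carrier E" and I: "ideal I R"
  shows "mod_length R (Tor1 R E (quot_module (self_module R) I)) =
    tor_length R (free_module R S) (a_kernel (free_module R S) E p) I"
proof -
  interpret E: module R E by (rule E)
  note F = free_module_module
  obtain a where a: "linear_on R E.free_cover (carrier E.free_cover) (free_module R S) a"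
    "\<And>u. u \<in> carrier E.free_cover \<Longrightarrow> p (a u) = free_lift R E id u"
    using free_projective[OF F E p surj E.free_cover_map] by blast
  obtain b where b: "linear_on R (free_module R S) (carrier (free_module R S)) E.free_cover b"
    "\<And>u. u \<in> carrier (free_module R S) \<Longrightarrow> free_lift R E id (b u) = p u"
    using free_projective[OF F E E.free_cover_map E.free_cover_surj p] by blast
  have "tor_length R E.free_cover (a_kernel E.free_cover E (free_lift R E id)) I =
      tor_length R (free_module R S) (a_kernel (free_module R S) E p) I"
    by (rule tor_length_eq[where a = a and b = b]; fact I F E E.free_cover_map p a b)
  then show ?thesis using E.mod_length_Tor1[OF I] by simp
qed

lemmas limM = eT_limit[OF Fr K acc_Fr tor_presentation[OF M.module_axioms \<pi> \<pi>_surj, folded K_def]]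
lemmas limN = eT_limit[OF Fn KN(1) acc_Fn tor_presentation[OF N.module_axioms \<rho> \<rho>_surj, folded KN_def]]

definition small :: "(('x \<Rightarrow> 'a) \<Rightarrow> 'e) \<Rightarrow> bool"
  where "small \<phi> \<longleftrightarrow> (\<lambda>n. scale n * real (the_enat (defect \<phi> (mpow n)))) \<longlonglongrightarrow> 0"

lemma defect_finite: "\<phi> \<in> carrier H \<Longrightarrow> defect \<phi> (mpow n) < \<infinity>"
  using defect_eq[OF mpow_ideal(2)[of n], of \<phi>] limM(1)[of n] limN(1)[of n]
  by (cases "defect \<phi> (mpow n)") auto

text \<open>The defect is the difference of the Tor lengths whose limits make up \<open>e\<^sup>T(s)\<close>.\<close>

lemma T_split_iff:
  assumes s: "extension R M N s" "classified \<phi> s" and \<phi>: "\<phi> \<in> carrier H"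
  shows "T_split R \<mm> M N s \<longleftrightarrow> small \<phi>"
proof -
  obtain i E p where s_eq: "s = (i, E, p)" by (cases s)
  note limE = eT_limit[OF G KE_submodule[OF \<phi>] acc_G tor_length_middle[OF s[unfolded s_eq] \<phi>]]
  let ?c = "\<lambda>n x. scale n * real (the_enat x)"
  have "(\<lambda>n. ?c n (tor_length R Fr K (mpow n)) + ?c n (tor_length R Fn KN (mpow n)) - ?c n (tor_length R G (KE \<phi>) (mpow n)))
      \<longlonglongrightarrow> eT R \<mm> M + eT R \<mm> N - eT R \<mm> E"
    by (intro tendsto_diff tendsto_add limM(2) limN(2) limE(2))
  moreover have "?c n (tor_length R Fr K (mpow n)) + ?c n (tor_length R Fn KN (mpow n)) - ?c n (tor_length R G (KE \<phi>) (mpow n)) =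
      ?c n (defect \<phi> (mpow n))" for n
  proof -
    obtain a where a: "tor_length R Fr K (mpow n) = enat a" using limM(1)[of n] by auto
    obtain b where b: "tor_length R Fn KN (mpow n) = enat b" using limN(1)[of n] by auto
    obtain c where c: "tor_length R G (KE \<phi>) (mpow n) = enat c" using limE(1)[of n] by auto
    obtain e where e: "defect \<phi> (mpow n) = enat e" using defect_finite[OF \<phi>, of n] by auto
    have "b + a = c + e" using defect_eq[OF mpow_ideal(2)[of n] \<phi>] unfolding a b c e by simp
    then have "real a + real b - real c = real e" by linarith
    then show ?thesis unfolding a b c e by (simp add: distrib_left[symmetric] right_diff_distrib[symmetric])
  qed
  ultimately have lim: "(\<lambda>n. ?c n (defect \<phi> (mpow n))) \<longlonglongrightarrow> eT R \<mm> M + eT R \<mm> N - eT R \<mm> E" by simp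
  have e: "eT_ext R \<mm> M N s = eT R \<mm> M + eT R \<mm> N - eT R \<mm> E" by (simp only: eT_ext_def s_eq prod.case)
  show ?thesis
  proof
    assume "T_split R \<mm> M N s"
    then have "eT R \<mm> M + eT R \<mm> N - eT R \<mm> E = 0" unfolding T_split_def e by (rule conjunct2)
    then show "small \<phi>" using lim unfolding small_def by (simp only:)
  next
    assume "small \<phi>"
    then have "eT R \<mm> M + eT R \<mm> N - eT R \<mm> E = 0" unfolding small_def by (rule LIMSEQ_unique[OF lim])
    then show "T_split R \<mm> M N s" unfolding T_split_def e using s(1) by (intro conjI)
  qed
qed

lemma scale_nonneg: "0 \<le> scale n" by (simp add: scale_def)

lemma small_mono:
  assumes "small \<phi>" "small \<psi>" "\<And>n. defect \<chi> (mpow n) \<le> defect \<phi> (mpow n) + defect \<psi> (mpow n)"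
    and "\<phi> \<in> carrier H" "\<psi> \<in> carrier H"
  shows "small \<chi>"
  unfolding small_def
proof (rule tendsto_sandwich[OF _ _ tendsto_const])
  show "(\<lambda>n. scale n * real (the_enat (defect \<phi> (mpow n))) + scale n * real (the_enat (defect \<psi> (mpow n)))) \<longlonglongrightarrow> 0"
    using tendsto_add[OF assms(1,2)[unfolded small_def]] by simp
  show "\<forall>\<^sub>F n in sequentially. 0 \<le> scale n * real (the_enat (defect \<chi> (mpow n)))" by (simp add: scale_nonneg)
  have "scale n * real (the_enat (defect \<chi> (mpow n))) \<le>
      scale n * real (the_enat (defect \<phi> (mpow n))) + scale n * real (the_enat (defect \<psi> (mpow n)))" for n
  proof -
    obtain a where a: "defect \<phi> (mpow n) = enat a" using defect_finite[OF assms(4), of n] by auto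
    obtain b where b: "defect \<psi> (mpow n) = enat b" using defect_finite[OF assms(5), of n] by auto
    obtain c where c: "defect \<chi> (mpow n) = enat c" "c \<le> a + b" using assms(3)[of n] unfolding a b by (cases "defect \<chi> (mpow n)") auto
    have "real c \<le> real a + real b" using c(2) by linarith
    from mult_left_mono[OF this scale_nonneg[of n]] show ?thesis unfolding a b c(1) by (simp add: distrib_left)
  qed
  then show "\<forall>\<^sub>F n in sequentially. scale n * real (the_enat (defect \<chi> (mpow n))) \<le>
      scale n * real (the_enat (defect \<phi> (mpow n))) + scale n * real (the_enat (defect \<psi> (mpow n)))" by simp
qed

lemma small_zero: "small \<zero>\<^bsub>H\<^esub>"
proof -
  have "defect \<zero>\<^bsub>H\<^esub> (mpow n) = 0" for n
  proof -
    have "\<zero>\<^bsub>R\<^esub> \<odot>\<^bsub>H\<^esub> \<zero>\<^bsub>H\<^esub> = \<zero>\<^bsub>H\<^esub>" by (rule H.smult_r_null) simp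
    moreover have "defect (\<zero>\<^bsub>R\<^esub> \<odot>\<^bsub>H\<^esub> \<zero>\<^bsub>H\<^esub>) (mpow n) = 0"
    proof (rule defect_annihilated[OF mpow_ideal(2) H.M.zero_closed])
      show "\<zero>\<^bsub>R\<^esub> \<odot>\<^bsub>Fr\<^esub> u \<in> sprod R Fr (mpow n) K" if "u \<in> K \<inter> sprod R Fr (mpow n) (carrier Fr)" for u
        using that K_carr[of u] Fr.smult_l_null[of u] Fr.sub_zero[OF IK[OF mpow_ideal(2)[of n]]] by (simp del: free_module_sel)
      show "\<zero>\<^bsub>R\<^esub> \<odot>\<^bsub>Fn\<^esub> u \<in> sprod R Fn (mpow n) KN" if "u \<in> KN \<inter> sprod R Fn (mpow n) (carrier Fn)" for u
        using that Fn.sub_carr[OF KN(1), of u] Fn.smult_l_null[of u] Fn.sub_zero[OF IKN[OF mpow_ideal(2)[of n]]] by (simp del: free_module_sel)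
    qed simp
    ultimately show ?thesis by metis
  qed
  then show ?thesis by (simp add: small_def zero_enat_def)
qed

text \<open>Hence the \<open>T\<close>-split classes form a submodule of the Ext module, as the image of this one.\<close>

lemma small_submodule: "submodule {\<phi> \<in> carrier H. small \<phi>} R H"
proof (rule H.submoduleI')
  show "\<zero>\<^bsub>H\<^esub> \<in> {\<phi> \<in> carrier H. small \<phi>}" using small_zero H.M.zero_closed by simp
next
  fix \<phi> \<psi> assume "\<phi> \<in> {\<phi> \<in> carrier H. small \<phi>}" "\<psi> \<in> {\<phi> \<in> carrier H. small \<phi>}"
  then have *: "\<phi> \<in> carrier H" "small \<phi>" "\<psi> \<in> carrier H" "small \<psi>" by auto
  have "small (\<phi> \<oplus>\<^bsub>H\<^esub> \<psi>)" by (rule small_mono[OF *(2,4) defect_add[OF mpow_ideal(2) *(1,3)] *(1,3)])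
  then show "\<phi> \<oplus>\<^bsub>H\<^esub> \<psi> \<in> {\<phi> \<in> carrier H. small \<phi>}" using H.M.a_closed[OF *(1,3)] by simp
next
  fix a \<phi> assume a: "a \<in> carrier R" and "\<phi> \<in> {\<phi> \<in> carrier H. small \<phi>}"
  then have *: "\<phi> \<in> carrier H" "small \<phi>" by auto
  have "defect (a \<odot>\<^bsub>H\<^esub> \<phi>) (mpow n) \<le> defect \<phi> (mpow n) + defect \<phi> (mpow n)" for n
    using defect_smult[OF mpow_ideal(2)[of n] *(1) a] by (rule order_trans) simp
  then have "small (a \<odot>\<^bsub>H\<^esub> \<phi>)" by (rule small_mono[OF *(2,2) _ *(1,1)])
  then show "a \<odot>\<^bsub>H\<^esub> \<phi> \<in> {\<phi> \<in> carrier H. small \<phi>}" using H.smult_closed[OF a *(1)] by simp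
qed auto

text \<open>Artin--Rees gives \<open>L \<inter> \<mm>\<^sup>nW \<subseteq> \<mm>\<^sup>n\<^sup>-\<^sup>cL\<close>, and multiplying by \<open>\<mm>\<^sup>c\<close> leads into \<open>\<mm>\<^sup>nL\<close>. All larger exponents
  are admitted as well, because one exponent has to serve for two modules.\<close>

lemma power_annihilates:
  assumes W: "module R W" and L: "submodule L R W" and noeth: "acc (subs R W {\<zero>\<^bsub>W\<^esub>} (carrier W))"
  shows "\<exists>c. \<forall>c'\<ge>c. \<forall>n\<ge>c'. \<forall>a\<in>\<mm> [^]\<^bsub>ideals_set R\<^esub> c'. \<forall>u\<in>L \<inter> sprod R W (mpow n) (carrier W).
    a \<odot>\<^bsub>W\<^esub> u \<in> sprod R W (mpow n) L"
proof -
  interpret W: module R W by (rule W)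
  interpret W: cm_local_module R \<mm> d W
    by (intro cm_local_module.intro local_module.intro local_module_axioms.intro
        cm_local_axioms noetherian_local_axioms W noeth)
  obtain c where c: "\<And>j. L \<inter> spow R W \<mm> (c + j) (carrier W) \<subseteq> spow R W \<mm> j L"
    using W.artin_rees_m[OF L] by blast
  have "a \<odot>\<^bsub>W\<^esub> u \<in> sprod R W (mpow n) L"
    if "c' \<ge> c" "n \<ge> c'" and a: "a \<in> \<mm> [^]\<^bsub>ideals_set R\<^esub> c'" and u: "u \<in> L \<inter> sprod R W (mpow n) (carrier W)" for c' n a u
  proof -
    define j where "j = Suc n - c'"
    have j: "Suc n = c' + j" "Suc n = c + (j + (c' - c))" using that(1,2) by (auto simp: j_def)
    have "u \<in> L \<inter> spow R W \<mm> (Suc n) (carrier W)"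
      using u unfolding W.sprod_ideal_pow[OF m_ideal W.carrier_is_submodule] .
    then have "u \<in> spow R W \<mm> (j + (c' - c)) L" using c[of "j + (c' - c)"] unfolding j(2)[symmetric] by blast
    then have "u \<in> spow R W \<mm> j L" using W.spow_decseq[OF m_sub L, of j "j + (c' - c)"] by auto
    then have "a \<odot>\<^bsub>W\<^esub> u \<in> sprod R W (\<mm> [^]\<^bsub>ideals_set R\<^esub> c') (spow R W \<mm> j L)" by (rule W.sprod_memI[OF a])
    also have "\<dots> = spow R W \<mm> (Suc n) L"
      unfolding W.sprod_ideal_pow[OF m_ideal W.spow_m_sub[OF L]] j(1) W.spow_add ..
    also have "\<dots> = sprod R W (mpow n) L" unfolding W.sprod_ideal_pow[OF m_ideal L] ..
    finally show ?thesis .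
  qed
  then show ?thesis by blast
qed

lemma power_small: "\<exists>c. spow R H \<mm> c (carrier H) \<subseteq> {\<phi> \<in> carrier H. small \<phi>}"
proof -
  obtain c1 where c1: "\<And>c n a u. c \<ge> c1 \<Longrightarrow> n \<ge> c \<Longrightarrow> a \<in> \<mm> [^]\<^bsub>ideals_set R\<^esub> c \<Longrightarrow>
      u \<in> K \<inter> sprod R Fr (mpow n) (carrier Fr) \<Longrightarrow> a \<odot>\<^bsub>Fr\<^esub> u \<in> sprod R Fr (mpow n) K"
    using power_annihilates[OF Fr K acc_Fr] by blast
  obtain c2 where c2: "\<And>c n a u. c \<ge> c2 \<Longrightarrow> n \<ge> c \<Longrightarrow> a \<in> \<mm> [^]\<^bsub>ideals_set R\<^esub> c \<Longrightarrow>
      u \<in> KN \<inter> sprod R Fn (mpow n) (carrier Fn) \<Longrightarrow> a \<odot>\<^bsub>Fn\<^esub> u \<in> sprod R Fn (mpow n) KN"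
    using power_annihilates[OF Fn KN(1) acc_Fn] by blast
  define c where "c = max c1 c2"
  have "sprod R H (\<mm> [^]\<^bsub>ideals_set R\<^esub> c) (carrier H) \<subseteq> {\<phi> \<in> carrier H. small \<phi>}"
  proof (rule H.sprod_least[OF small_submodule])
    fix a \<phi> assume a: "a \<in> \<mm> [^]\<^bsub>ideals_set R\<^esub> c" and \<phi>: "\<phi> \<in> carrier H"
    have ac: "a \<in> carrier R" by (rule ideal.Icarr[OF ideal_pow_ideal[OF m_ideal] a])
    have "defect (a \<odot>\<^bsub>H\<^esub> \<phi>) (mpow n) = 0" if "n \<ge> c" for n
      using that by (intro defect_annihilated[OF mpow_ideal(2) \<phi> ac] c1[of c] c2[of c] a) (simp_all add: c_def)
    then have "\<forall>\<^sub>F n in sequentially. scale n * real (the_enat (defect (a \<odot>\<^bsub>H\<^esub> \<phi>) (mpow n))) = 0"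
      unfolding eventually_sequentially by (intro exI[of _ c] allI impI) (simp add: zero_enat_def)
    then have "small (a \<odot>\<^bsub>H\<^esub> \<phi>)" unfolding small_def by (rule tendsto_eventually)
    then show "a \<odot>\<^bsub>H\<^esub> \<phi> \<in> {\<phi> \<in> carrier H. small \<phi>}" using H.smult_closed[OF ac \<phi>] by simp
  qed
  then show ?thesis unfolding H.sprod_ideal_pow[OF m_ideal H.carrier_is_submodule] by blast
qed

text \<open>A homomorphism from \<open>K\<close> is determined by its values on finitely many generators, so
  \<open>H\<close> is filtered by submodules whose successive quotients embed into \<open>N\<close>.\<close>

lemma acc_H: "acc (subs R H {\<zero>\<^bsub>H\<^esub>} (carrier H))"
proof -
  obtain S where S: "S \<subseteq> K" "finite S" "gen_submodule R Fr S = K"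
    using Fr.acc_imp_fin_gen[OF acc_Fr K] by blast
  interpret HN: module_pair R H N by (intro module_pairI H_module N.module_axioms)
  define A where "A T = {\<phi> \<in> carrier H. \<forall>x\<in>T. \<phi> x = \<zero>\<^bsub>N\<^esub>}" for T
  have A: "submodule (A T) R H" for T
  proof (rule H.submoduleI')
    show "\<zero>\<^bsub>H\<^esub> \<in> A T" unfolding A_def using H.M.zero_closed by simp
  qed (use H.M.a_closed H.smult_closed in \<open>auto simp: A_def simp del: H_sel\<close>, auto)
  have "acc (subs R H (A T) (carrier H))" if "finite T" for T
    using that
  proof (induction T rule: finite_induct)
    case empty
    have sub: "P = carrier H" if "P \<in> subs R H (A {}) (carrier H)" for P
      using that by (auto simp: subs_def A_def)
    show ?case
      unfolding acc_def
    proof (intro allI impI exI[of _ 0])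
      fix E :: "nat \<Rightarrow> (('x \<Rightarrow> 'a) \<Rightarrow> 'e) set" and i
      assume "\<forall>i. E i \<in> subs R H (A {}) (carrier H) \<and> E i \<subseteq> E (Suc i)"
      then have "E i = carrier H" "E 0 = carrier H" using sub by simp_all
      then show "E i = E 0" by simp
    qed
  next
    case (insert s T)
    have le: "A (insert s T) \<subseteq> A T" "A T \<subseteq> carrier H" by (auto simp: A_def)
    have ev: "linear_on R H (A T) N (\<lambda>\<phi>. \<phi> s)"
      by (rule linear_onI) (use le(2) H_closed in auto)
    have "acc (subs R H (A (insert s T)) (A T))"
      by (rule HN.acc_inj[OF A N.carrier_is_submodule N.zero_submodule _ ev _ _ noethN])
         (use le(2) H_closed in \<open>auto simp: A_def\<close>)
    then show ?case by (intro H.acc_add[OF A A H.carrier_is_submodule le] insert.IH)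
  qed
  moreover have "A S = {\<zero>\<^bsub>H\<^esub>}"
  proof
    show "A S \<subseteq> {\<zero>\<^bsub>H\<^esub>}"
    proof
      fix \<phi> assume "\<phi> \<in> A S"
      then have \<phi>: "\<phi> \<in> carrier H" "\<And>x. x \<in> S \<Longrightarrow> \<phi> x = \<zero>\<^bsub>N\<^esub>" by (auto simp: A_def)
      have "K \<subseteq> {x \<in> K. \<phi> x \<in> {\<zero>\<^bsub>N\<^esub>}}"
        unfolding S(3)[symmetric]
        by (rule Fr.gen_submodule_least, unfold S(3))
           (use FN.vimage_submodule[OF K H_lin[OF \<phi>(1)] N.zero_submodule] \<phi>(2) S(1) in auto)
      then have "\<phi> x = \<zero>\<^bsub>N\<^esub>" for x using \<phi>(1) by (cases "x \<in> K") (auto simp: H_iff)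
      then show "\<phi> \<in> {\<zero>\<^bsub>H\<^esub>}" by auto
    qed
  qed (use H.sub_zero[OF A] in simp)
  ultimately show ?thesis using S(2) by metis
qed

text \<open>The Ext module modulo the \<open>T\<close>-split classes is a quotient of \<open>Hom(K, N) / \<mm>\<^sup>c Hom(K, N)\<close>.\<close>

theorem finite_length_quotient:
  fixes T :: "('a, 'c, 'e, 'e \<times> 'c) extn set set"
  defines "T \<equiv> T_ext R \<mm> M N"
  shows "finite_length R (quot_module (Ext1 R M N) T)"
proof -
  interpret X: module R "Ext1 R M N" by (rule Ext1_module(1))
  interpret HX: module_pair R H "Ext1 R M N" by (intro module_pairI H_module Ext1_module(1))
  let ?S = "{\<phi> \<in> carrier H. small \<phi>}"
  have T: "T = \<Phi> ` ?S"
  proof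
    show "T \<subseteq> \<Phi> ` ?S"
      unfolding T_def T_ext_def
    proof (intro image_subsetI)
      fix s :: "('a, 'c, 'e, 'e \<times> 'c) extn" assume "s \<in> {s. T_split R \<mm> M N s}"
      then have s: "T_split R \<mm> M N s" "extension R M N s" by (auto simp: T_split_def)
      obtain \<phi> where \<phi>: "\<phi> \<in> carrier H" "classified \<phi> s" using classified_exists[OF s(2)] by blast
      have "small \<phi>" using T_split_iff[OF s(2) \<phi>(2,1)] s(1) by simp
      then show "ext_class R M N s \<in> \<Phi> ` ?S" using ext_class_eq[OF s(2) \<phi>(2,1)] \<phi>(1) by simp
    qed
    show "\<Phi> ` ?S \<subseteq> T"
    proof (intro image_subsetI)
      fix \<phi> assume "\<phi> \<in> ?S"
      then have \<phi>: "\<phi> \<in> carrier H" "small \<phi>" by auto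
      obtain s where "s \<in> \<Phi> \<phi>" using \<Phi>_elt[OF \<phi>(1)] by blast
      then have s: "extension R M N s" "classified \<phi> s" by (auto simp: \<Phi>_def)
      have "T_split R \<mm> M N s" using T_split_iff[OF s \<phi>(1)] \<phi>(2) by simp
      then show "\<Phi> \<phi> \<in> T" unfolding T_def T_ext_def ext_class_eq[OF s \<phi>(1), symmetric] by blast
    qed
  qed
  have sub: "submodule T R (Ext1 R M N)"
    unfolding T by (rule HX.image_submodule[OF H.carrier_is_submodule Ext1_module(2) small_submodule]) blast
  interpret HL: local_module R \<mm> H
    by (intro local_module.intro local_module_axioms.intro noetherian_local_axioms H_module acc_H)
  obtain c where c: "spow R H \<mm> c (carrier H) \<subseteq> ?S" using power_small by blast
  have "mod_length R (quot_module (Ext1 R M N) T) = ilen R (Ext1 R M N) T (carrier (Ext1 R M N))"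
    by (rule X.mod_length_quot[OF sub])
  also have "\<dots> \<le> ilen R H ?S (carrier H)"
  proof (rule HX.ilen_surj[OF H.carrier_is_submodule Ext1_module(2) _ _ sub])
    show "?S \<subseteq> carrier H" by blast
    show "\<Phi> ` ?S \<subseteq> T" unfolding T by blast
    have "submodule (\<Phi> ` carrier H) R (Ext1 R M N)" unfolding Ext1_module(3) by (rule X.carrier_is_submodule)
    then show "carrier (Ext1 R M N) \<subseteq> \<Phi> ` carrier H <+>\<^bsub>Ext1 R M N\<^esub> T"
      using X.sum_upper1[OF _ sub] Ext1_module(3) by blast
  qed
  also have "\<dots> \<le> ilen R H (spow R H \<mm> c (carrier H)) (carrier H)"
    by (rule H.ilen_mono[OF HL.spow_m_sub[OF H.carrier_is_submodule] small_submodule H.carrier_is_submodule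
        H.carrier_is_submodule c _ order_refl]) blast
  also have "\<dots> < \<infinity>" by (rule HL.finite_length_spow[OF H.carrier_is_submodule])
  finally show ?thesis unfolding finite_length_def using X.quot_module_module(1)[OF sub] by blast
qed

end

lemma (in module) finite_free_cover:
  assumes "fin_gen R M"
  shows "\<exists>S. finite S \<and> linear_on R (free_module R S) (carrier (free_module R S)) M (free_lift R M id) \<and>
    free_lift R M id ` carrier (free_module R S) = carrier M"
proof -
  obtain S where S: "S \<subseteq> carrier M" "finite S" "gen_submodule R M S = carrier M"
    using assms unfolding fin_gen_def by blast
  let ?F = "free_module R S"
  interpret FM: module_pair R ?F M by (intro module_pairI free_module_module module_axioms)
  have l: "linear_on R ?F (carrier ?F) M (free_lift R M id)"
    by (rule free_lift_linear) (use S(1) in auto)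
  have im: "submodule (free_lift R M id ` carrier ?F) R M"
    by (rule FM.image_submodule[OF FM.M.carrier_is_submodule l FM.M.carrier_is_submodule order_refl])
  have "S \<subseteq> free_lift R M id ` carrier ?F"
  proof
    fix x assume x: "x \<in> S"
    have "free_lift R M id (basis_elt R x) = id x" by (rule free_lift_basis[OF _ x]) (use S(1) in auto)
    then show "x \<in> free_lift R M id ` carrier ?F" using basis_elt_carrier[OF x] by (metis id_apply imageI)
  qed
  then have "carrier M \<subseteq> free_lift R M id ` carrier ?F" using gen_submodule_least[OF im] S(3) by metis
  then show ?thesis using S(2) l sub_carr[OF im] by blast
qed

theorem theorem1p5:
  fixes A :: "('a, 'r) ring_scheme" and \<mm> :: "'a set" and d :: nat
    and M :: "('a, 'b) module" and N :: "('a, 'c) module"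
  assumes "CM_local_ring A \<mm>"
    and "krull_dim A = enat d"
    and "d \<ge> 1"
    and "MCM A \<mm> M"
    and "MCM A \<mm> N"
  shows "finite_length A (quot_module (Ext1 A M N) (T_ext A \<mm> M N))"
proof -
  have cr: "cring A" using assms(1) by (simp add: CM_local_ring_def local_ring_def)
  have MN: "module A M" "fin_gen A M" "module A N" "fin_gen A N"
    using assms(4,5) by (auto simp: MCM_def)
  interpret cm_local A \<mm> d
    by (intro cm_local.intro cm_local_axioms.intro noetherian_local.intro noetherian_local_axioms.intro
        noetherian_cring.intro noetherian_cring_axioms.intro cr assms(1-3))
       (use assms(1) in \<open>simp_all add: CM_local_ring_def\<close>)
  interpret M: module A M by (rule MN(1))
  interpret N: module A N by (rule MN(3))
  obtain B where B: "finite B" "linear_on A (free_module A B) (carrier (free_module A B)) M (free_lift A M id)"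
    "free_lift A M id ` carrier (free_module A B) = carrier M"
    using M.finite_free_cover[OF MN(2)] by blast
  obtain C where C: "finite C" "linear_on A (free_module A C) (carrier (free_module A C)) N (free_lift A N id)"
    "free_lift A N id ` carrier (free_module A C) = carrier N"
    using N.finite_free_cover[OF MN(4)] by blast
  have "tsplit_cm A M N B (free_lift A M id) C (free_lift A N id) \<mm> d"
    by (intro tsplit_cm.intro tsplit_setup.intro tsplit_setup_axioms.intro ext_setup.intro ext_setup_axioms.intro
        module_pairI MN(1,3) B C cm_local_axioms tsplit_cm_axioms.intro N.acc_fin_gen[OF acc_self MN(4)])
  then show ?thesis by (rule tsplit_cm.finite_length_quotient)
qed

end
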